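(* Let $(\vec u,\vec v)$ be a basis of $\mathbb R^2$ such that the torus $\mathbb T_{(\vec u,\vec v)}=\mathbb R^2/(\mathbb Z\vec u+\mathbb Z\vec v)$ has volume $2\pi$, let $a_1,\dots,a_n$ be $n$ distinct points of $\mathbb T_{(\vec u,\vec v)}$, identified with a $(\vec u,\vec v)$-periodic discrete set $\Lambda\subset\mathbb R^2$, and let $j_{\{a_i\}}$ be the unique $(\vec u,\vec v)$-periodic vector field with mean zero satisfying $\operatorname{curl}j=2\pi\sum_{p\in\Lambda}\delta_p-n$, $\operatorname{div}j=0$ (so that $j_{\{a_i\}}\in\mathcal A_n$). Then $$W(j_{\{a_i\}})=\frac12\sum_{i\ne j}G(a_i-a_j)+n\,c_{(\vec u,\vec v)},$$ where $c_{(\vec u,\vec v)}$ is a constant depending only on $(\vec u,\vec v)$ and $G$ is the Green function of the torus, i.e. the (mean zero) solution of $-\Delta G=2\pi\delta_0-1$ in $\mathbb T_{(\vec u,\vec v)}$. Moreover, $j_{\{a_i\}}$ is the minimizer of $W(j)$ among all $\mathbb T_{(\vec u,\vec v)}$-periodic $j$'s satisfying $\operatorname{curl}j=2\pi\sum_{p\in\Lambda}\delta_p-n$, $\operatorname{div}j=0$.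
   Context: $B_R$ is the ball of center $0$ and radius $R$ in $\mathbb R^2$. For $m>0$, $\mathcal A_m$ is the set of vector fields $j$ on $\mathbb R^2$ such that $\operatorname{curl} j=\nu-m$ and $\operatorname{div} j=0$ in the sense of distributions, where $\nu=2\pi\sum_{p\in\Lambda}\delta_p$ for some discrete set $\Lambda\subset\mathbb R^2$ and $\nu(B_R)/|B_R|$ is bounded independently of $R>1$. For a function $\chi$, $W(j,\chi)=\lim_{\eta\to0}\big(\frac12\int_{\mathbb R^2\setminus\cup_{p\in\Lambda}B(p,\eta)}\chi|j|^2+\pi\log\eta\sum_{p\in\Lambda}\chi(p)\big)$, and for $j\in\mathcal A_m$, $W(j)=\limsup_{R\to\infty}W(j,\chi_{B_R})/|B_R|$, where $\chi_{B_R}$ are nonnegative cutoff functions with $|\nabla\chi_{B_R}|\le C$ ($C$ independent of $R$), $\operatorname{Supp}\chi_{B_R}\subset B_R$, $\chi_{B_R}=1$ at points at distance $\ge1$ from $B_R^c$ (the value does not depend on their choice). *)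

theory Defs
  imports "HOL-Analysis.Analysis"
begin

section \<open>Test functions and distributional equations in the plane\<close>

fun times_cont_differentiable :: "nat \<Rightarrow> (real^2 \<Rightarrow> real) \<Rightarrow> bool" where
  "times_cont_differentiable 0 f \<longleftrightarrow> continuous_on UNIV f"
| "times_cont_differentiable (Suc k) f \<longleftrightarrow>
     (\<forall>x. f differentiable (at x)) \<and>
     (\<forall>h. times_cont_differentiable k (\<lambda>x. frechet_derivative f (at x) h))"

definition test_function :: "(real^2 \<Rightarrow> real) \<Rightarrow> bool" where
  "test_function \<phi> \<longleftrightarrow> (\<forall>k. times_cont_differentiable k \<phi>) \<and> compact (closure {x. \<phi> x \<noteq> 0})"

definition partial :: "2 \<Rightarrow> (real^2 \<Rightarrow> real) \<Rightarrow> real^2 \<Rightarrow> real" where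
  "partial i f x = frechet_derivative f (at x) (axis i 1)"

definition locally_integrable :: "(real^2 \<Rightarrow> 'b::euclidean_space) \<Rightarrow> bool" where
  "locally_integrable f \<longleftrightarrow> (\<forall>K. compact K \<longrightarrow> f absolutely_integrable_on K)"

text \<open>Distributional curl \<open>\<partial>\<^sub>1 j\<^sub>2 - \<partial>\<^sub>2 j\<^sub>1\<close>, divergence and Laplacian, as functionals of the
  test function \<open>\<phi>\<close>.\<close>

definition distr_curl :: "(real^2 \<Rightarrow> real^2) \<Rightarrow> (real^2 \<Rightarrow> real) \<Rightarrow> real" where
  "distr_curl j \<phi> = (LINT x|lebesgue. j x $ 1 * partial 2 \<phi> x - j x $ 2 * partial 1 \<phi> x)"

definition distr_div :: "(real^2 \<Rightarrow> real^2) \<Rightarrow> (real^2 \<Rightarrow> real) \<Rightarrow> real" where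
  "distr_div j \<phi> = - (LINT x|lebesgue. j x $ 1 * partial 1 \<phi> x + j x $ 2 * partial 2 \<phi> x)"

definition distr_laplacian :: "(real^2 \<Rightarrow> real) \<Rightarrow> (real^2 \<Rightarrow> real) \<Rightarrow> real" where
  "distr_laplacian f \<phi> =
     (LINT x|lebesgue. f x * (partial 1 (partial 1 \<phi>) x + partial 2 (partial 2 \<phi>) x))"

text \<open>The distribution \<open>2\<pi> \<Sum>\<^bsub>p \<in> \<Lambda>\<^esub> \<delta>\<^sub>p - m\<close>. For locally finite \<open>\<Lambda>\<close> the sum has
  finitely many nonzero terms.\<close>

definition point_charges :: "(real^2) set \<Rightarrow> real \<Rightarrow> (real^2 \<Rightarrow> real) \<Rightarrow> real" where
  "point_charges \<Lambda> m \<phi> = 2 * pi * (\<Sum>\<^sub>\<infinity>p\<in>\<Lambda>. \<phi> p) - m * (LINT x|lebesgue. \<phi> x)"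

definition solves_curl_div :: "(real^2) set \<Rightarrow> real \<Rightarrow> (real^2 \<Rightarrow> real^2) \<Rightarrow> bool" where
  "solves_curl_div \<Lambda> m j \<longleftrightarrow> locally_integrable j \<and>
     (\<forall>\<phi>. test_function \<phi> \<longrightarrow> distr_curl j \<phi> = point_charges \<Lambda> m \<phi> \<and> distr_div j \<phi> = 0)"

section \<open>The admissible class and the renormalized energy\<close>

text \<open>Discreteness of \<open>\<Lambda>\<close> is local finiteness, so that \<open>\<nu> = 2\<pi> \<Sum>\<^bsub>p \<in> \<Lambda>\<^esub> \<delta>\<^sub>p\<close> is a
  locally finite measure; \<open>2\<pi> card (\<Lambda> \<inter> ball 0 R)\<close> is \<open>\<nu>(B\<^sub>R)\<close>.\<close>

definition admissible :: "real \<Rightarrow> (real^2 \<Rightarrow> real^2) set" where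
  "admissible m = {j. \<exists>\<Lambda>.
     (\<forall>K. compact K \<longrightarrow> finite (\<Lambda> \<inter> K)) \<and>
     (\<exists>C. \<forall>R>1. 2 * pi * real (card (\<Lambda> \<inter> ball 0 R)) / measure lebesgue (ball (0::real^2) R) \<le> C) \<and>
     solves_curl_div \<Lambda> m j}"

text \<open>In the two energies below, \<open>\<Lambda>\<close> is the point set with \<open>curl j = 2\<pi> \<Sum>\<^bsub>p \<in> \<Lambda>\<^esub> \<delta>\<^sub>p - m\<close>;
  it is determined by \<open>j\<close>, but is passed explicitly.\<close>

definition W_cutoff :: "(real^2) set \<Rightarrow> (real^2 \<Rightarrow> real^2) \<Rightarrow> (real^2 \<Rightarrow> real) \<Rightarrow> real" where
  "W_cutoff \<Lambda> j \<psi> = Lim (at_right 0) (\<lambda>\<eta>.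
     1/2 * (LINT x : (- (\<Union>p\<in>\<Lambda>. ball p \<eta>))|lebesgue. \<psi> x * (norm (j x))\<^sup>2)
     + pi * ln \<eta> * (\<Sum>\<^sub>\<infinity>p\<in>\<Lambda>. \<psi> p))"

text \<open>The bound \<open>|\<nabla>\<psi> R| \<le> C\<close> (with \<open>C\<close> independent of \<open>R\<close>) is rendered as a uniform Lipschitz
  bound, so that piecewise smooth cutoffs are allowed.\<close>

definition cutoff_family :: "(real \<Rightarrow> real^2 \<Rightarrow> real) \<Rightarrow> bool" where
  "cutoff_family \<psi> \<longleftrightarrow> (\<exists>C. \<forall>R>0.
     (\<forall>x. 0 \<le> \<psi> R x) \<and>
     C-lipschitz_on UNIV (\<psi> R) \<and>
     closure {x. \<psi> R x \<noteq> 0} \<subseteq> ball 0 R \<and>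
     (\<forall>x. infdist x (- ball 0 R) \<ge> 1 \<longrightarrow> \<psi> R x = 1))"

definition W :: "(real \<Rightarrow> real^2 \<Rightarrow> real) \<Rightarrow> (real^2) set \<Rightarrow> (real^2 \<Rightarrow> real^2) \<Rightarrow> ereal" where
  "W \<psi> \<Lambda> j =
     Limsup at_top (\<lambda>R. ereal (W_cutoff \<Lambda> j (\<psi> R) / measure lebesgue (ball (0::real^2) R)))"

section \<open>Functions and fields on the torus\<close>

text \<open>Objects on the torus \<open>\<real>\<^sup>2 / (\<int>u + \<int>v)\<close> are represented by their periodic lifts to the plane
  and points of the torus by representatives in the plane.\<close>

definition lattice :: "real^2 \<Rightarrow> real^2 \<Rightarrow> (real^2) set" where
  "lattice u v = {of_int k *\<^sub>R u + of_int l *\<^sub>R v | k l. True}"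

definition torus_cell :: "real^2 \<Rightarrow> real^2 \<Rightarrow> (real^2) set" where
  "torus_cell u v = {s *\<^sub>R u + t *\<^sub>R v | s t. 0 \<le> s \<and> s < 1 \<and> 0 \<le> t \<and> t < 1}"

definition torus_periodic :: "real^2 \<Rightarrow> real^2 \<Rightarrow> (real^2 \<Rightarrow> 'b) \<Rightarrow> bool" where
  "torus_periodic u v f \<longleftrightarrow> (AE x in lebesgue. f (x + u) = f x \<and> f (x + v) = f x)"

definition torus_mean_zero ::
    "real^2 \<Rightarrow> real^2 \<Rightarrow> (real^2 \<Rightarrow> 'b::euclidean_space) \<Rightarrow> bool" where
  "torus_mean_zero u v f \<longleftrightarrow> (LINT x : (torus_cell u v)|lebesgue. f x) = 0"

text \<open>Continuity off the lattice selects the representative of the Green function for which the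
  point values \<open>G x\<close>, \<open>x \<notin> lattice u v\<close>, are meaningful.\<close>

definition torus_green :: "real^2 \<Rightarrow> real^2 \<Rightarrow> (real^2 \<Rightarrow> real) \<Rightarrow> bool" where
  "torus_green u v G \<longleftrightarrow>
     locally_integrable G \<and> continuous_on (- lattice u v) G \<and>
     torus_periodic u v G \<and> torus_mean_zero u v G \<and>
     (\<forall>\<phi>. test_function \<phi> \<longrightarrow> - distr_laplacian G \<phi> = point_charges (lattice u v) 1 \<phi>)"

definition distinct_on_torus :: "real^2 \<Rightarrow> real^2 \<Rightarrow> nat \<Rightarrow> (nat \<Rightarrow> real^2) \<Rightarrow> bool" where
  "distinct_on_torus u v n a \<longleftrightarrow>
     (\<forall>i\<in>{1..n}. \<forall>k\<in>{1..n}. i \<noteq> k \<longrightarrow> a i - a k \<notin> lattice u v)"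

definition periodic_points :: "real^2 \<Rightarrow> real^2 \<Rightarrow> nat \<Rightarrow> (nat \<Rightarrow> real^2) \<Rightarrow> (real^2) set" where
  "periodic_points u v n a = {a i + w | i w. i \<in> {1..n} \<and> w \<in> lattice u v}"

definition torus_field ::
    "real^2 \<Rightarrow> real^2 \<Rightarrow> nat \<Rightarrow> (nat \<Rightarrow> real^2) \<Rightarrow> (real^2 \<Rightarrow> real^2) \<Rightarrow> bool" where
  "torus_field u v n a j \<longleftrightarrow>
     torus_periodic u v j \<and> solves_curl_div (periodic_points u v n a) (real n) j"

end

theory Submission
  imports Defs "HOL-Complex_Analysis.Complex_Analysis" "HOL-Real_Asymp.Real_Asymp"
begin

text \<open>
  A Jacobi theta function times a Gaussian factor gives an entire function \<open>P\<close> with simple zeros on the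
  lattice such that \<open>\<bar>P z\<bar> exp (-\<bar>z\<bar>\<^sup>2/4)\<close> is doubly periodic. Hence \<open>\<bar>z\<bar>\<^sup>2/4 - ln \<bar>P z\<bar>\<close> minus its mean
  is the Green function \<open>G\<close>, and the sum of the rotated gradients of its translates to the \<open>a\<^sub>i\<close> is
  a field \<open>j\<^sub>0\<close> as required. Two periodic solutions differ by a field with weakly harmonic periodic
  components, and such functions are constant: their means against rescaled bumps do not depend
  on the scale, and at large scale not on the center.

  For \<open>j = j\<^sub>0 + c\<close> write \<open>\<bar>j\<bar>\<^sup>2\<close> as a locally integrable periodic function \<open>g\<close> plus
  \<open>\<bar>x - p\<bar>\<^sup>-\<^sup>2\<close> on the unit ball around each point \<open>p\<close>. The integral of the latter over an annulus of radii
  \<open>\<eta>\<close> and \<open>1\<close> is \<open>-2\<pi> ln \<eta>\<close>, which cancels the counterterm of \<open>W\<close>, so \<open>W j\<close> is half the mean of \<open>g\<close>. The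
  mean of a product of the gradients of two distinct translates of \<open>G\<close> is a value of \<open>G\<close> by
  integration by parts, the diagonal terms give the constant, and \<open>c\<close> contributes \<open>\<bar>c\<bar>\<^sup>2/2\<close>.
\<close>

text \<open>No elliptic theory enters: every weak equation for \<open>G\<close> is reduced to the
  Cauchy kernel, and every statement about the torus is read off in the plane. A mean over the cell
  is the limit of integrals against cutoffs of radius R, divided by pi R^2; boundary terms live in
  shells of bounded width, which carry only o(R^2). This one device yields translation invariance of
  means, the density of lattice points, the interaction integrals and the value of \<open>W\<close>.
  The obstacle is that |j|^2 is not integrable near the points. Discs are removed only where the
  definition of \<open>W\<close> does so. In integrations by parts the potential is regularized
  instead, and products of fields with different poles are dominated through 1/(ab) <= (1/d)(1/a +
  1/b), so that only simple poles occur, which are integrable in the plane. The cell area 2 pi is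
  what makes one zero of \<open>P\<close> per cell compatible with the factor exp(-|z|^2/4): the
  Laplacian of |z|^2/4 is 1, so each cell is neutral. The constant of the theorem is half the mean
  of |grad G|^2 minus the inverse squares near the lattice points.\<close>

no_notation fps_nth (infixl "$" 75)

section \<open>Integration in the plane\<close>

lemma lebesgue_distr_plus: "distr lebesgue lebesgue ((+) c) = (lebesgue :: 'a::euclidean_space measure)"
proof -
  have "(lebesgue :: 'a measure) = density (distr lebesgue lebesgue (\<lambda>x. c + (\<Sum>j\<in>Basis. (1 * (x \<bullet> j)) *\<^sub>R j)))
     (\<lambda>x. ennreal (\<Prod>j\<in>(Basis::'a set). \<bar>1\<bar>))"
    by (rule lebesgue_affine_euclidean) auto
  also have "\<dots> = distr lebesgue lebesgue ((+) c)"
    by (simp add: euclidean_representation density_1)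
  finally show ?thesis by simp
qed

lemma lebesgue_measurable_shift [measurable]: "(\<lambda>x. x + c) \<in> lebesgue \<rightarrow>\<^sub>M (lebesgue :: 'a::euclidean_space measure)"
proof (rule measurableI)
  fix A :: "'a set" assume "A \<in> sets lebesgue"
  then have "(+) (- c) ` A \<in> sets lebesgue"
    by (rule lebesgue_sets_translation)
  moreover have "(\<lambda>x. x + c) -` A = (+) (- c) ` A"
    by (force simp: image_iff)
  ultimately show "(\<lambda>x. x + c) -` A \<inter> space lebesgue \<in> sets lebesgue" by simp
qed auto

lemma lebesgue_distr_shift: "distr lebesgue lebesgue (\<lambda>x. x + c) = (lebesgue :: 'a::euclidean_space measure)"
  using lebesgue_distr_plus[of c] by (simp add: add.commute[of _ c])

lemma borel_measurable_shift_iff: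
  fixes f :: "'a::euclidean_space \<Rightarrow> 'b::euclidean_space"
  shows "(\<lambda>x. f (x + c)) \<in> borel_measurable lebesgue \<longleftrightarrow> f \<in> borel_measurable lebesgue"
proof
  assume "(\<lambda>x. f (x + c)) \<in> borel_measurable lebesgue"
  then have "(\<lambda>x. f (x + c)) \<circ> (\<lambda>x. x + (- c)) \<in> borel_measurable lebesgue"
    by (rule measurable_comp[OF lebesgue_measurable_shift])
  then show "f \<in> borel_measurable lebesgue" by (simp add: o_def)
next
  assume "f \<in> borel_measurable lebesgue"
  then have "f \<circ> (\<lambda>x. x + c) \<in> borel_measurable lebesgue"
    by (rule measurable_comp[OF lebesgue_measurable_shift])
  then show "(\<lambda>x. f (x + c)) \<in> borel_measurable lebesgue" by (simp add: o_def)
qed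

lemma integrable_shift_iff:
  fixes f :: "'a::euclidean_space \<Rightarrow> 'b::euclidean_space"
  shows "integrable lebesgue (\<lambda>x. f (x + c)) \<longleftrightarrow> integrable lebesgue f"
proof (cases "f \<in> borel_measurable lebesgue")
  case True
  then show ?thesis
    using integrable_distr_eq[OF lebesgue_measurable_shift[of c] True] by (simp add: lebesgue_distr_shift)
next
  case False
  then show ?thesis
    using borel_measurable_shift_iff[of f c] by (auto dest: borel_measurable_integrable)
qed

lemma integral_shift:
  fixes f :: "'a::euclidean_space \<Rightarrow> 'b::euclidean_space"
  shows "(LINT x|lebesgue. f (x + c)) = (LINT x|lebesgue. f x)"
proof (cases "f \<in> borel_measurable lebesgue")
  case True
  then show ?thesis
    using integral_distr[OF lebesgue_measurable_shift[of c] True] by (simp add: lebesgue_distr_shift)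
next
  case False
  \<comment> \<open>No translate of a nonmeasurable function is measurable, so both integrals take
    the default value 0.\<close>
  then have "\<not> integrable lebesgue f" "\<not> integrable lebesgue (\<lambda>x. f (x + c))"
    using integrable_shift_iff[of f c] by (auto dest: borel_measurable_integrable)
  then show ?thesis by (simp add: not_integrable_integral_eq)
qed

lemma AE_shift:
  fixes c :: "'a::euclidean_space"
  assumes "AE x in lebesgue. P x"
  shows "AE x in lebesgue. P (x + c)"
proof -
  from assms obtain N where N: "N \<in> null_sets lebesgue" "{x. \<not> P x} \<subseteq> N"
    by (auto simp: eventually_ae_filter)
  have "(\<lambda>x. x + c) -` N \<inter> space lebesgue \<in> null_sets lebesgue"
  proof (rule null_setsI)
    show "(\<lambda>x. x + c) -` N \<inter> space lebesgue \<in> sets lebesgue"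
      using N by (intro measurable_sets[OF lebesgue_measurable_shift]) auto
    have "emeasure lebesgue ((\<lambda>x. x + c) -` N \<inter> space lebesgue) = emeasure (distr lebesgue lebesgue (\<lambda>x. x + c)) N"
      using N by (intro emeasure_distr[symmetric]) auto
    then show "emeasure lebesgue ((\<lambda>x. x + c) -` N \<inter> space lebesgue) = 0"
      using N by (auto simp: lebesgue_distr_shift)
  qed
  then show ?thesis
    by (rule AE_I') (use N in auto)
qed

text \<open>The substitution t -> 1/t reduces this to dominated convergence along a real parameter
  tending to infinity.\<close>

lemma dominated_convergence_at_right:
  fixes s :: "real \<Rightarrow> 'a \<Rightarrow> 'b::{banach, second_countable_topology}"
  assumes "f \<in> borel_measurable M" and "\<And>t. t > 0 \<Longrightarrow> s t \<in> borel_measurable M" and "integrable M w"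
    and lim: "AE x in M. ((\<lambda>t. s t x) \<longlongrightarrow> f x) (at_right 0)"
    and bound: "\<And>t. 0 < t \<Longrightarrow> t < d \<Longrightarrow> AE x in M. norm (s t x) \<le> w x" and "d > (0::real)"
  shows "((\<lambda>t. integral\<^sup>L M (s t)) \<longlongrightarrow> integral\<^sup>L M f) (at_right 0)"
proof -
  \<comment> \<open>The truncation keeps the parameter positive for every real t, because
    \<open>s t\<close> is assumed measurable only for positive t. For large t it changes
    nothing.\<close>
  define s' where "s' t = s (inverse (max t (1/2 / d)))" for t
  have "((\<lambda>t. integral\<^sup>L M (s' t)) \<longlongrightarrow> integral\<^sup>L M f) at_top"
  proof (rule integral_dominated_convergence_at_top[OF assms(1) _ assms(3)])
    have "inverse (max t (1/2 / d)) > 0" for t using \<open>d > 0\<close> by (auto simp: max_def not_le intro: less_le_trans[of _ "1/2/d"])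
    then show "s' t \<in> borel_measurable M" for t
      unfolding s'_def by (intro assms(2))
    show "AE x in M. ((\<lambda>i. s' i x) \<longlongrightarrow> f x) at_top"
      using lim
    proof eventually_elim
      case (elim x)
      then have "((\<lambda>t. s (inverse t) x) \<longlongrightarrow> f x) at_top"
        by (simp add: filterlim_at_right_to_top)
      then show ?case
        by (rule Lim_transform_eventually) (use eventually_ge_at_top[of "1/2/d"] in eventually_elim, auto simp: s'_def)
    qed
    show "\<forall>\<^sub>F i in at_top. AE x in M. norm (s' i x) \<le> w x"
      using eventually_gt_at_top[of "1/d"]
    proof eventually_elim
      case (elim t)
      have "t > 0" using elim \<open>d>0\<close> by (meson divide_pos_pos less_trans zero_less_one)
      moreover have "1/2/d \<le> 1/d" using \<open>d > 0\<close> by (simp add: field_simps)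
      then have "t > 1/2/d" using elim by linarith
      ultimately show ?case unfolding s'_def
        using elim \<open>d > 0\<close> by (intro bound) (auto simp: max_def field_simps)
    qed
  qed
  then have "((\<lambda>t. integral\<^sup>L M (s (inverse t))) \<longlongrightarrow> integral\<^sup>L M f) at_top"
    by (rule Lim_transform_eventually) (use eventually_ge_at_top[of "1/2/d"] in eventually_elim, auto simp: s'_def)
  then show ?thesis by (simp add: filterlim_at_right_to_top)
qed

text \<open>Polar coordinates for radial integrands. Both measures are compared on the half-lines
  \<open>{..a}\<close>, an intersection-stable generator, where the left one is the area of a
  disc.\<close>

lemma distr_norm_plane:
  "distr lborel borel (norm :: real^2 \<Rightarrow> real) = density lborel (\<lambda>r. ennreal (2 * pi * r) * indicator {0..} r)"
proof (rule measure_eqI_generator_eq[where \<Omega> = UNIV and E = "range atMost" and A = "\<lambda>i. {..real i}"])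
  show "Int_stable (range (atMost :: real \<Rightarrow> _))"
    by (auto simp: Int_stable_def)
  show "sets (distr lborel borel (norm :: real^2 \<Rightarrow> real)) = sigma_sets UNIV (range atMost)"
    by (simp add: borel_eq_atMost)
  show "sets (density lborel (\<lambda>r. ennreal (2 * pi * r) * indicator {0..} r)) = sigma_sets UNIV (range atMost)"
    by (simp add: borel_eq_atMost)
  have eq: "emeasure (distr lborel borel (norm :: real^2 \<Rightarrow> real)) {..a} = ennreal (pi * (max a 0)^2)" for a
  proof -
    have "emeasure (distr lborel borel (norm :: real^2 \<Rightarrow> real)) {..a} = emeasure lborel (norm -` {..a} :: (real^2) set)"
      by (subst emeasure_distr) auto
    also have "(norm -` {..a} :: (real^2) set) = cball 0 a"
      by auto
    also have "emeasure lborel \<dots> = ennreal (pi * (max a 0)^2)"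
    proof (cases "a \<ge> 0")
      case True
      then show ?thesis by (simp add: emeasure_cball unit_ball_vol_2)
    qed auto
    finally show ?thesis .
  qed
  fix X :: "real set" assume "X \<in> range atMost"
  then obtain a where X: "X = {..a}" by auto
  have "emeasure (density lborel (\<lambda>r. ennreal (2 * pi * r) * indicator {0..} r)) {..a}
     = (\<integral>\<^sup>+r. ennreal (2 * pi * r) * indicator {0..max a 0} r \<partial>lborel)"
  proof (subst emeasure_density)
    show "(\<integral>\<^sup>+ x. ennreal (2 * pi * x) * indicator {0..} x * indicator {..a} x \<partial>lborel) = (\<integral>\<^sup>+r. ennreal (2 * pi * r) * indicator {0..max a 0} r \<partial>lborel)"
    proof (rule nn_integral_cong)
      fix x :: real
      show "ennreal (2 * pi * x) * indicator {0..} x * indicator {..a} x = ennreal (2 * pi * x) * indicator {0..max a 0} x"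
        by (cases "x = 0") (auto simp: indicator_def max_def)
    qed
  qed auto
  also have "\<dots> = ennreal (pi * (max a 0)^2 - pi * 0^2)"
    by (rule nn_integral_FTC_Icc) (auto intro!: derivative_eq_intros)
  finally show "emeasure (distr lborel borel (norm :: real^2 \<Rightarrow> real)) X = emeasure (density lborel (\<lambda>r. ennreal (2 * pi * r) * indicator {0..} r)) X"
    using eq[of a] X by simp
next
  show "(\<Union>i. {..real i}) = UNIV"
    by (auto intro: real_arch_simple)
  have "emeasure (distr lborel borel (norm :: real^2 \<Rightarrow> real)) {..a} \<noteq> \<infinity>" for a
  proof -
    have "emeasure (distr lborel borel (norm :: real^2 \<Rightarrow> real)) {..a} = emeasure lborel (norm -` {..a} :: (real^2) set)"
      by (subst emeasure_distr) auto
    also have "(norm -` {..a} :: (real^2) set) = cball 0 a"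
      by auto
    finally show ?thesis
      using emeasure_bounded_finite[of "cball (0::real^2) a"] by auto
  qed
  then show "emeasure (distr lborel borel (norm :: real^2 \<Rightarrow> real)) {..real i} \<noteq> \<infinity>" for i by blast
qed auto

lemma nn_integral_radial:
  assumes [measurable]: "g \<in> borel_measurable borel"
  shows "(\<integral>\<^sup>+x. g (norm (x - p :: real^2)) \<partial>lebesgue) = (\<integral>\<^sup>+r. ennreal (2 * pi * r) * g r * indicator {0..} r \<partial>lborel)"
proof -
  have "(\<integral>\<^sup>+x. g (norm (x - p :: real^2)) \<partial>lebesgue) = (\<integral>\<^sup>+x. g (norm (x - p)) \<partial>lborel)"
    by (rule nn_integral_completion) 
  also have "\<dots> = (\<integral>\<^sup>+x. g (norm (x - p)) \<partial>(distr lborel borel ((+) p)))"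
    by (simp add: lborel_distr_plus)
  also have "\<dots> = (\<integral>\<^sup>+x. g (norm (x::real^2)) \<partial>lborel)"
    by (subst nn_integral_distr) auto
  also have "\<dots> = (\<integral>\<^sup>+r. g r \<partial>(distr lborel borel (norm :: real^2 \<Rightarrow> real)))"
    by (subst nn_integral_distr) auto
  also have "\<dots> = (\<integral>\<^sup>+r. ennreal (2 * pi * r) * g r * indicator {0..} r \<partial>lborel)"
    unfolding distr_norm_plane by (subst nn_integral_density) (auto simp: mult_ac)
  finally show ?thesis .
qed

text \<open>The density 2 pi r of the radius cancels the pole 1/r. Nearly every domination below
  rests on this.\<close>

lemma set_integrable_inverse_norm:
  "set_integrable lebesgue (cball q R) (\<lambda>x. 1 / norm (x - p :: real^2))"
proof -
  \<comment> \<open>A larger disc centered at the pole makes the integrand radial.\<close>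
  define R' where "R' = \<bar>R\<bar> + dist p q"
  have sub: "cball q R \<subseteq> cball p R'"
    unfolding R'_def using cball_subset_cball_iff[of q R p] 
    by (auto simp: dist_commute intro: order_trans)
  have "set_integrable lebesgue (cball p R') (\<lambda>x. 1 / norm (x - p :: real^2))"
    unfolding set_integrable_def
  proof (rule integrableI_bounded)
    show "(\<lambda>x. indicat_real (cball p R') x *\<^sub>R (1 / norm (x - p))) \<in> borel_measurable lebesgue"
      by (intro measurable_completion borel_measurable_scaleR borel_measurable_indicator borel_measurable_divide
          borel_measurable_norm borel_measurable_diff) auto
    have "(\<integral>\<^sup>+ x. ennreal (norm (indicat_real (cball p R') x *\<^sub>R (1 / norm (x - p)))) \<partial>lebesgue)
        = (\<integral>\<^sup>+ x. (\<lambda>r. ennreal (indicator {..R'} r * (1 / r))) (norm (x - p)) \<partial>lebesgue)"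
      by (intro nn_integral_cong) (auto simp: indicator_def dist_norm norm_minus_commute)
    also have "\<dots> = (\<integral>\<^sup>+r. ennreal (2 * pi * r) * ennreal (indicator {..R'} r * (1 / r)) * indicator {0..} r \<partial>lborel)"
      by (rule nn_integral_radial) auto
    also have "\<dots> \<le> (\<integral>\<^sup>+r. ennreal (2 * pi) * indicator {0..R'} r \<partial>lborel)"
      by (intro nn_integral_mono) (auto simp: indicator_def simp flip: ennreal_mult')
    also have "\<dots> < \<infinity>"
      by (subst nn_integral_cmult_indicator) (auto simp: ennreal_mult_less_top emeasure_lborel_Icc_eq)
    finally show "(\<integral>\<^sup>+ x. ennreal (norm (indicat_real (cball p R') x *\<^sub>R (1 / norm (x - p)))) \<partial>lebesgue) < \<infinity>" .
  qed
  then show ?thesis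
    by (rule set_integrable_subset) (use sub in auto)
qed

lemma annulus_integral:
  assumes "0 < \<eta>" "\<eta> \<le> r"
  shows "integrable lebesgue (\<lambda>x. indicator (cball p r - ball p \<eta>) x * (1 / (norm (x - p :: real^2))\<^sup>2))" (is ?A)
    and "(LINT x|lebesgue. indicator (cball p r - ball p \<eta>) x * (1 / (norm (x - p :: real^2))\<^sup>2)) = 2 * pi * ln (r / \<eta>)" (is ?B)
proof -
  have "(\<integral>\<^sup>+ x. ennreal (indicator (cball p r - ball p \<eta>) x * (1 / (norm (x - p :: real^2))\<^sup>2)) \<partial>lebesgue)
      = (\<integral>\<^sup>+ x. (\<lambda>s. ennreal (indicator {\<eta>..r} s * (1 / s\<^sup>2))) (norm (x - p)) \<partial>lebesgue)"
    by (intro nn_integral_cong) (auto simp: indicator_def dist_norm norm_minus_commute)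
  also have "\<dots> = (\<integral>\<^sup>+s. ennreal (2 * pi * s) * ennreal (indicator {\<eta>..r} s * (1 / s\<^sup>2)) * indicator {0..} s \<partial>lborel)"
    by (rule nn_integral_radial) auto
  also have "\<dots> = (\<integral>\<^sup>+s. ennreal (2 * pi / s) * indicator {\<eta>..r} s \<partial>lborel)"
    using assms by (intro nn_integral_cong) (auto simp: indicator_def power2_eq_square simp flip: ennreal_mult')
  also have "\<dots> = ennreal (2 * pi * ln r - 2 * pi * ln \<eta>)"
    using assms by (intro nn_integral_FTC_Icc) (auto intro!: derivative_eq_intros)
  also have "2 * pi * ln r - 2 * pi * ln \<eta> = 2 * pi * ln (r / \<eta>)"
    using assms by (simp add: ln_div algebra_simps)
  finally have *: "(\<integral>\<^sup>+ x. ennreal (indicator (cball p r - ball p \<eta>) x * (1 / (norm (x - p :: real^2))\<^sup>2)) \<partial>lebesgue) = ennreal (2 * pi * ln (r / \<eta>))" .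
  have m: "(\<lambda>x. indicator (cball p r - ball p \<eta>) x * (1 / (norm (x - p :: real^2))\<^sup>2)) \<in> borel_measurable lebesgue"
    by (intro measurable_completion borel_measurable_times borel_measurable_indicator borel_measurable_divide
        borel_measurable_power borel_measurable_norm borel_measurable_diff) auto
  have "2 * pi * ln (r / \<eta>) \<ge> 0" using assms by auto
  then show ?A ?B
    using nn_integral_eq_integrable[OF m, of "2 * pi * ln (r / \<eta>)"] * by auto
qed

text \<open>This profile is what d1 + i d2 produces from the Cauchy kernel regularized as cnj z /
  (|z|^2 + 1). In polar coordinates it has an explicit primitive.\<close>

lemma integral_approximate_identity:
  "integrable lebesgue (\<lambda>x::real^2. 2 / (1 + (norm x)\<^sup>2)\<^sup>2)" (is ?A)
  "(LINT x|lebesgue. 2 / (1 + (norm (x::real^2))\<^sup>2)\<^sup>2) = 2 * pi" (is ?B)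
proof -
  have "(\<integral>\<^sup>+ x. ennreal (2 / (1 + (norm (x::real^2))\<^sup>2)\<^sup>2) \<partial>lebesgue)
      = (\<integral>\<^sup>+ x. (\<lambda>s. ennreal (2 / (1 + s\<^sup>2)\<^sup>2)) (norm ((x::real^2) - 0)) \<partial>lebesgue)"
    by simp
  also have "\<dots> = (\<integral>\<^sup>+s. ennreal (2 * pi * s) * ennreal (2 / (1 + s\<^sup>2)\<^sup>2) * indicator {0..} s \<partial>lborel)"
    by (rule nn_integral_radial) auto
  also have "\<dots> = (\<integral>\<^sup>+s. ennreal (4 * pi * s / (1 + s\<^sup>2)\<^sup>2) * indicator {0..} s \<partial>lborel)"
    by (intro nn_integral_cong) (auto simp: indicator_def simp flip: ennreal_mult')
  also have "\<dots> = ennreal (0 - (- 2 * pi / (1 + 0\<^sup>2)))"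
  proof (rule nn_integral_FTC_atLeast)
    fix x :: real
    have "1 + x\<^sup>2 \<noteq> 0" by (metis add_pos_nonneg less_numeral_extra(1) less_numeral_extra(3) zero_le_power2)
    then show "((\<lambda>s. - 2 * pi / (1 + s\<^sup>2)) has_real_derivative 4 * pi * x / (1 + x\<^sup>2)\<^sup>2) (at x)"
      by (auto intro!: derivative_eq_intros simp: power2_eq_square)
    have "LIM x at_top. (1 + x\<^sup>2 :: real) :> at_top"
      by (intro filterlim_tendsto_add_at_top tendsto_const filterlim_pow_at_top filterlim_ident) auto
    then show "((\<lambda>s. - 2 * pi / (1 + s\<^sup>2)) \<longlongrightarrow> 0) at_top"
      by (intro tendsto_divide_0[OF tendsto_const] filterlim_at_top_imp_at_infinity)
  qed auto
  finally have *: "(\<integral>\<^sup>+ x. ennreal (2 / (1 + (norm (x::real^2))\<^sup>2)\<^sup>2) \<partial>lebesgue) = ennreal (2 * pi)" by simp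
  have m: "(\<lambda>x::real^2. 2 / (1 + (norm x)\<^sup>2)\<^sup>2) \<in> borel_measurable lebesgue"
    by (intro measurable_completion) auto
  show ?A ?B
    using nn_integral_eq_integrable[OF m, of "2 * pi"] * by auto
qed

section \<open>Lattices and averages of periodic functions\<close>

lemma locally_integrable_cball: "locally_integrable f \<Longrightarrow> set_integrable lebesgue (cball 0 R) f"
  by (auto simp: locally_integrable_def)

lemma locally_integrable_bounded:
  assumes "locally_integrable f" "bounded A" "A \<in> sets lebesgue"
  shows "set_integrable lebesgue A f"
proof -
  obtain R where "A \<subseteq> cball 0 R" using assms(2) by (meson bounded_subset_ballD ball_subset_cball order_trans)
  then show ?thesis
    using set_integrable_subset[OF locally_integrable_cball[OF assms(1)]] assms(3) by blast
qed

lemma locally_integrableI: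
  assumes "\<And>R. R > 0 \<Longrightarrow> set_integrable lebesgue (ball 0 R) f"
  shows "locally_integrable f"
  unfolding locally_integrable_def
proof safe
  fix K :: "(real^2) set" assume K: "compact K"
  then obtain R where "R > 0" "K \<subseteq> ball 0 R"
    using bounded_subset_ballD[OF compact_imp_bounded[OF K], of 0] by blast
  then show "f absolutely_integrable_on K"
    using set_integrable_subset[OF assms, of R K] lmeasurable_compact[OF K] by (simp add: fmeasurableD)
qed

lemma locally_integrable_measurable:
  fixes f :: "real^2 \<Rightarrow> 'b::euclidean_space"
  assumes "locally_integrable f"
  shows "f \<in> borel_measurable lebesgue"
proof (rule borel_measurable_LIMSEQ_metric)
  show "(\<lambda>x. indicator (cball 0 (real n)) x *\<^sub>R f x) \<in> borel_measurable lebesgue" for n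
    using locally_integrable_cball[OF assms, of "real n"] unfolding set_integrable_def by auto
  fix x :: "real^2"
  obtain N where N: "norm x \<le> real N" using real_arch_simple by blast
  have "eventually (\<lambda>n. f x = indicator (cball 0 (real n)) x *\<^sub>R f x) sequentially"
    using eventually_ge_at_top[of N] by eventually_elim (use N in auto)
  then show "(\<lambda>n. indicator (cball 0 (real n)) x *\<^sub>R f x) \<longlonglongrightarrow> f x"
    by (rule Lim_transform_eventually[OF tendsto_const])
qed

lemma locally_integrable_bounded_mult:
  fixes f :: "real^2 \<Rightarrow> real" and h :: "real^2 \<Rightarrow> real"
  assumes f: "locally_integrable f" and h: "h \<in> borel_measurable lebesgue"
    and bd: "\<And>x. \<bar>h x\<bar> \<le> C" and supp: "\<And>x. norm x > R \<Longrightarrow> h x = 0"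
  shows "integrable lebesgue (\<lambda>x. h x * f x)"
proof (rule Bochner_Integration.integrable_bound)
  show "integrable lebesgue (\<lambda>x. C * (indicator (cball 0 R) x *\<^sub>R f x))"
    using locally_integrable_cball[OF f, of R] unfolding set_integrable_def by (intro integrable_mult_right)
  show "(\<lambda>x. h x * f x) \<in> borel_measurable lebesgue"
    using h locally_integrable_measurable[OF f] by measurable
  have "norm (h x * f x) \<le> norm (C * (indicator (cball 0 R) x *\<^sub>R f x))" for x
  proof (cases "norm x > R")
    case False
    have "\<bar>h x\<bar> \<le> \<bar>C\<bar>" using bd[of x] by linarith
    then show ?thesis using False by (auto simp: abs_mult mult_right_mono)
  qed (use supp in auto)
  then show "AE x in lebesgue. norm (h x * f x) \<le> norm (C * (indicator (cball 0 R) x *\<^sub>R f x))" by simp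
qed

lemma locally_integrable_add:
  "locally_integrable f \<Longrightarrow> locally_integrable g \<Longrightarrow> locally_integrable (\<lambda>x. f x + g x)"
  unfolding locally_integrable_def by (auto intro: set_integral_add)

lemma locally_integrable_diff:
  "locally_integrable f \<Longrightarrow> locally_integrable g \<Longrightarrow> locally_integrable (\<lambda>x. f x - g x)"
  unfolding locally_integrable_def by (auto intro: set_integral_diff)

lemma locally_integrable_sum:
  assumes "finite I" "\<And>i. i \<in> I \<Longrightarrow> locally_integrable (f i)"
  shows "locally_integrable (\<lambda>x. \<Sum>i\<in>I. f i x)"
  using assms(2) unfolding locally_integrable_def set_integrable_def 
  by (auto simp: scaleR_sum_right)

lemma locally_integrable_shift:
  fixes f :: "real^2 \<Rightarrow> 'b::euclidean_space"
  assumes "locally_integrable f"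
  shows "locally_integrable (\<lambda>x. f (x + c))"
  unfolding locally_integrable_def
proof safe
  fix K :: "(real^2) set" assume K: "compact K"
  have "compact ((+) c ` K)" using K by (intro compact_translation)
  then have "integrable lebesgue (\<lambda>x. indicator ((+) c ` K) x *\<^sub>R f x)"
    using assms unfolding locally_integrable_def set_integrable_def by blast
  then have "integrable lebesgue (\<lambda>x. indicator ((+) c ` K) (x + c) *\<^sub>R f (x + c))"
    by (subst integrable_shift_iff)
  moreover have "x + c \<in> (+) c ` K \<longleftrightarrow> x \<in> K" for x by (auto simp: add.commute)
  ultimately show "(\<lambda>x. f (x + c)) absolutely_integrable_on K"
    unfolding set_integrable_def by (simp add: indicator_def)
qed

lemma locally_integrable_inner:
  assumes "locally_integrable f"
  shows "locally_integrable (\<lambda>x. c \<bullet> f x)"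
  unfolding locally_integrable_def set_integrable_def
proof safe
  fix K :: "(real^2) set" assume "compact K"
  then have "integrable lebesgue (\<lambda>x. c \<bullet> (indicat_real K x *\<^sub>R f x))"
    using assms unfolding locally_integrable_def set_integrable_def by (intro integrable_inner_right) auto
  then show "integrable lebesgue (\<lambda>x. indicat_real K x *\<^sub>R (c \<bullet> f x))" by simp
qed

lemma locally_integrable_const: "locally_integrable (\<lambda>x. c :: 'b::euclidean_space)"
proof (rule locally_integrableI)
  fix R :: real
  have "integrable lebesgue (indicat_real (ball (0::real^2) R))"
    using emeasure_lborel_ball_finite[of "0::real^2" R] by (intro integrable_real_indicator) auto
  then have "integrable lebesgue (\<lambda>x. indicat_real (ball (0::real^2) R) x *\<^sub>R c)"
    by (rule integrable_scaleR_left)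
  then show "set_integrable lebesgue (ball (0::real^2) R) (\<lambda>x. c)"
    unfolding set_integrable_def .
qed

section \<open>Coordinates, cells and points of the lattice\<close>

locale plane_lattice =
  fixes u v :: "real^2"
  assumes volume: "measure lebesgue (torus_cell u v) = 2 * pi"
begin

text \<open>Kept signed: the volume fixes only the absolute value of this determinant. The
  orientation matters once, for the theta function, and is repaired there by a sign in front of
  \<open>v\<close>.\<close>

definition "D = u$1 * v$2 - u$2 * v$1"

text \<open>The cell is the linear image of the half-open unit square, which differs from the closed
  one by a null set, so its area is the absolute determinant.\<close>

lemma abs_D: "\<bar>D\<bar> = 2 * pi"
proof -
  define lin where "lin = (\<lambda>x::real^2. (x$1) *\<^sub>R u + (x$2) *\<^sub>R v)"
  define S where "S = {x::real^2. 0 \<le> x$1 \<and> x$1 < 1 \<and> 0 \<le> x$2 \<and> x$2 < 1}"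
  have lin: "linear lin" unfolding lin_def by (auto intro!: linearI simp: algebra_simps)
  have T: "torus_cell u v = lin ` S"
  proof
    show "torus_cell u v \<subseteq> lin ` S"
    proof
      fix x assume "x \<in> torus_cell u v"
      then obtain s t where "x = s *\<^sub>R u + t *\<^sub>R v" "0 \<le> s" "s < 1" "0 \<le> t" "t < 1"
        by (auto simp: torus_cell_def)
      then show "x \<in> lin ` S" by (intro image_eqI[of _ _ "vector [s, t]"]) (auto simp: lin_def S_def)
    qed
  qed (auto simp: torus_cell_def lin_def S_def)
  have sub: "box 0 1 \<subseteq> S" "S \<subseteq> cbox 0 1"
    by (auto simp: S_def mem_box_cart forall_2)
  have "negligible (cbox 0 1 - box 0 (1::real^2))" by (rule negligible_frontier_interval)
  then have neg: "negligible ((S - cbox 0 1) \<union> (cbox 0 1 - S))"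
    by (rule negligible_subset) (use sub in auto)
  have "S \<in> lmeasurable"
    using lmeasurable_negligible_symdiff[OF lmeasurable_cbox] neg by (metis Un_commute)
  have "measure lebesgue S = measure lebesgue (cbox 0 (1::real^2))"
    by (rule measure_negligible_symdiff) (use neg in \<open>auto simp: Un_commute\<close>)
  also have "\<dots> = 1" by (simp add: content_cbox_cart interval_ne_empty_cart)
  finally have S1: "measure lebesgue S = 1" .
  have "matrix lin $ i $ j = (if j = 1 then u $ i else v $ i)" for i j :: 2
    by (cases j rule: exhaust_2[THEN disjE]) (auto simp: matrix_def lin_def axis_def)
  then have "det (matrix lin) = D"
    by (simp add: det_2 D_def mult.commute)
  then show ?thesis
    using measure_linear_image[OF lin \<open>S \<in> lmeasurable\<close>] volume by (simp add: T S1)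
qed

lemma D_nz: "D \<noteq> 0" using abs_D by auto

text \<open>Cramer's rule for the coordinates with respect to \<open>u\<close> and \<open>v\<close>;
  the second coordinate is \<open>ct\<close>.\<close>

definition "cs x = (x$1 * v$2 - x$2 * v$1) / D"
definition "ct x = (u$1 * x$2 - u$2 * x$1) / D"

lemma coords: "cs x *\<^sub>R u + ct x *\<^sub>R v = x"
proof -
  have "((x$1 * v$2 - x$2 * v$1) * u$1 + (u$1 * x$2 - u$2 * x$1) * v$1) = x$1 * D"
    "((x$1 * v$2 - x$2 * v$1) * u$2 + (u$1 * x$2 - u$2 * x$1) * v$2) = x$2 * D"
    by (auto simp: D_def algebra_simps)
  then have "((x$1 * v$2 - x$2 * v$1) * u$1 + (u$1 * x$2 - u$2 * x$1) * v$1) / D = x$1"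
    "((x$1 * v$2 - x$2 * v$1) * u$2 + (u$1 * x$2 - u$2 * x$1) * v$2) / D = x$2"
    using D_nz by simp_all
  then show ?thesis
    by (simp add: vec_eq_iff forall_2 cs_def ct_def add_divide_distrib)
qed

lemma cs_lin: "cs (s *\<^sub>R u + t *\<^sub>R v) = s" and ct_lin: "ct (s *\<^sub>R u + t *\<^sub>R v) = t"
proof -
  have "(s * u$1 + t * v$1) * v$2 - (s * u$2 + t * v$2) * v$1 = s * D"
    "u$1 * (s * u$2 + t * v$2) - u$2 * (s * u$1 + t * v$1) = t * D"
    by (auto simp: D_def algebra_simps)
  then show "cs (s *\<^sub>R u + t *\<^sub>R v) = s" "ct (s *\<^sub>R u + t *\<^sub>R v) = t"
    using D_nz by (auto simp: cs_def ct_def)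
qed

lemma cs_add: "cs (x + y) = cs x + cs y" and ct_add: "ct (x + y) = ct x + ct y"
  and cs_diff: "cs (x - y) = cs x - cs y" and ct_diff: "ct (x - y) = ct x - ct y"
  and cs_minus: "cs (- x) = - cs x" and ct_minus: "ct (- x) = - ct x"
  by (auto simp: cs_def ct_def field_simps add_divide_distrib diff_divide_distrib)

abbreviation "L \<equiv> lattice u v"
abbreviation "T \<equiv> torus_cell u v"

lemma L_iff: "x \<in> L \<longleftrightarrow> cs x \<in> \<int> \<and> ct x \<in> \<int>"
proof
  assume "x \<in> L" then show "cs x \<in> \<int> \<and> ct x \<in> \<int>" by (auto simp: lattice_def cs_lin ct_lin)
next
  assume "cs x \<in> \<int> \<and> ct x \<in> \<int>"
  then obtain k l where "cs x = of_int k" "ct x = of_int l" by (auto elim!: Ints_cases)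
  then have "x = of_int k *\<^sub>R u + of_int l *\<^sub>R v" using coords[of x] by simp
  then show "x \<in> L" unfolding lattice_def by blast
qed

lemma T_iff: "x \<in> T \<longleftrightarrow> 0 \<le> cs x \<and> cs x < 1 \<and> 0 \<le> ct x \<and> ct x < 1"
proof
  assume "x \<in> T" then show "0 \<le> cs x \<and> cs x < 1 \<and> 0 \<le> ct x \<and> ct x < 1"
    by (auto simp: torus_cell_def cs_lin ct_lin)
next
  assume "0 \<le> cs x \<and> cs x < 1 \<and> 0 \<le> ct x \<and> ct x < 1"
  then show "x \<in> T" unfolding torus_cell_def using coords[of x]
    by (intro CollectI exI[of _ "cs x"] exI[of _ "ct x"]) auto
qed

lemma L_add: "x \<in> L \<Longrightarrow> y \<in> L \<Longrightarrow> x + y \<in> L" by (auto simp: L_iff cs_add ct_add)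
lemma L_diff: "x \<in> L \<Longrightarrow> y \<in> L \<Longrightarrow> x - y \<in> L" by (auto simp: L_iff cs_diff ct_diff)
lemma L_minus: "x \<in> L \<Longrightarrow> - x \<in> L" by (auto simp: L_iff cs_minus ct_minus)
lemma L_add_iff: "w \<in> L \<Longrightarrow> x + w \<in> L \<longleftrightarrow> x \<in> L"
  using L_add[of x w] L_diff[of "x + w" w] by auto
lemma u_L: "u \<in> L" and v_L: "v \<in> L"
proof -
  have "u = of_int 1 *\<^sub>R u + of_int 0 *\<^sub>R v" "v = of_int 0 *\<^sub>R u + of_int 1 *\<^sub>R v" by auto
  then show "u \<in> L" "v \<in> L" unfolding lattice_def by blast+
qed

definition "fl x = of_int \<lfloor>cs x\<rfloor> *\<^sub>R u + of_int \<lfloor>ct x\<rfloor> *\<^sub>R v"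

lemma fl_L: "fl x \<in> L" unfolding fl_def lattice_def by blast

text \<open>The translates of the half-open cell tile the plane, and \<open>fl x\<close> selects the
  tile that contains \<open>x\<close>.\<close>

lemma diff_mem_T_iff: "w \<in> L \<Longrightarrow> x - w \<in> T \<longleftrightarrow> w = fl x"
proof
  assume w: "w \<in> L" "x - w \<in> T"
  then obtain k l where kl: "w = of_int k *\<^sub>R u + of_int l *\<^sub>R v" by (auto simp: lattice_def)
  have "\<lfloor>cs x\<rfloor> = k" "\<lfloor>ct x\<rfloor> = l"
    using w(2) unfolding T_iff cs_diff ct_diff kl cs_lin ct_lin by linarith+
  then show "w = fl x" by (simp add: fl_def kl)
next
  assume "w = fl x"
  then have w: "w = of_int \<lfloor>cs x\<rfloor> *\<^sub>R u + of_int \<lfloor>ct x\<rfloor> *\<^sub>R v" by (simp add: fl_def)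
  show "x - w \<in> T" unfolding T_iff cs_diff ct_diff w cs_lin ct_lin by (auto; linarith)
qed

lemma norm_ge_coords: "2 * pi * \<bar>cs x\<bar> \<le> norm x * norm v * 2" "2 * pi * \<bar>ct x\<bar> \<le> norm x * norm u * 2"
proof -
  have c: "\<bar>a * b - c * d\<bar> \<le> n * m * 2" if "\<bar>a\<bar> \<le> n" "\<bar>c\<bar> \<le> n" "\<bar>b\<bar> \<le> m" "\<bar>d\<bar> \<le> m" for a b c d n m :: real
  proof -
    have "\<bar>a * b\<bar> \<le> n * m" "\<bar>c * d\<bar> \<le> n * m" using that by (auto simp: abs_mult intro!: mult_mono)
    then show ?thesis by linarith
  qed
  have "\<bar>cs x\<bar> * \<bar>D\<bar> = \<bar>x$1 * v$2 - x$2 * v$1\<bar>" "\<bar>ct x\<bar> * \<bar>D\<bar> = \<bar>x$2 * u$1 - x$1 * u$2\<bar>"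
    using D_nz by (auto simp: cs_def ct_def mult.commute)
  moreover have "\<bar>x$1 * v$2 - x$2 * v$1\<bar> \<le> norm x * norm v * 2" "\<bar>x$2 * u$1 - x$1 * u$2\<bar> \<le> norm x * norm u * 2"
    by (intro c component_le_norm_cart)+
  ultimately show "2 * pi * \<bar>cs x\<bar> \<le> norm x * norm v * 2" "2 * pi * \<bar>ct x\<bar> \<le> norm x * norm u * 2"
    unfolding abs_D by (auto simp: mult_ac)
qed

lemma finite_L: "bounded K \<Longrightarrow> finite (L \<inter> K)"
proof -
  assume "bounded K"
  then obtain R where R: "\<And>x. x \<in> K \<Longrightarrow> norm x \<le> R" by (auto simp: bounded_iff)
  define N where "N = \<lceil>R * (norm u + norm v)\<rceil>"
  have "L \<inter> K \<subseteq> (\<lambda>(k, l). of_int k *\<^sub>R u + of_int l *\<^sub>R v) ` ({-N..N} \<times> {-N..N})"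
  proof
    fix x assume x: "x \<in> L \<inter> K"
    then obtain k l where kl: "x = of_int k *\<^sub>R u + of_int l *\<^sub>R v" by (auto simp: lattice_def)
    have n1: "norm x \<le> R" using R[of x] x by auto
    have n: "norm x \<le> R" "0 \<le> R" using n1 order_trans[OF norm_ge_zero n1] by auto
    have b: "norm x * norm v \<le> R * (norm u + norm v)" "norm x * norm u \<le> R * (norm u + norm v)"
      using n by (auto intro!: mult_mono)
    have "1 * \<bar>cs x\<bar> \<le> pi * \<bar>cs x\<bar>" "1 * \<bar>ct x\<bar> \<le> pi * \<bar>ct x\<bar>"
      using pi_gt3 by (intro mult_right_mono; linarith)+
    then have "\<bar>cs x\<bar> \<le> R * (norm u + norm v)" "\<bar>ct x\<bar> \<le> R * (norm u + norm v)"
      using norm_ge_coords[of x] b by auto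
    then have "\<bar>k\<bar> \<le> N" "\<bar>l\<bar> \<le> N" unfolding kl cs_lin ct_lin N_def by linarith+
    then show "x \<in> (\<lambda>(k, l). of_int k *\<^sub>R u + of_int l *\<^sub>R v) ` ({-N..N} \<times> {-N..N})"
      unfolding kl by (intro image_eqI[of _ _ "(k, l)"]) auto
  qed
  then show ?thesis by (rule finite_subset) auto
qed

lemma countable_L: "countable L"
proof -
  have "L = (\<lambda>(k, l). of_int k *\<^sub>R u + of_int l *\<^sub>R v) ` UNIV" by (auto simp: lattice_def)
  then show ?thesis by simp
qed

definition "dm = norm u + norm v + 1"

lemma dm_pos: "dm > 0" by (auto simp: dm_def intro: add_nonneg_pos)

lemma T_bound: "x \<in> T \<Longrightarrow> norm x < dm"
proof -
  assume "x \<in> T"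
  then obtain s t where st: "x = s *\<^sub>R u + t *\<^sub>R v" "0 \<le> s" "s < 1" "0 \<le> t" "t < 1"
    by (auto simp: torus_cell_def)
  have "norm x \<le> s * norm u + t * norm v" using norm_triangle_ineq[of "s *\<^sub>R u" "t *\<^sub>R v"] st by simp
  also have "\<dots> \<le> 1 * norm u + 1 * norm v" using st by (intro add_mono mult_right_mono) auto
  finally show ?thesis by (simp add: dm_def)
qed

lemma bounded_T: "bounded T" using T_bound by (auto simp: bounded_iff intro!: exI[of _ dm] less_imp_le)

lemma sets_T [measurable]: "T \<in> sets borel"
proof -
  have "T = {x. 0 \<le> cs x} \<inter> {x. cs x < 1} \<inter> {x. 0 \<le> ct x} \<inter> {x. ct x < 1}" by (auto simp: T_iff)
  moreover have "continuous_on UNIV cs" "continuous_on UNIV ct"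
    unfolding cs_def ct_def using D_nz by (auto intro!: continuous_intros)
  then have "closed {x. 0 \<le> cs x}" "closed {x. 0 \<le> ct x}" "open {x. cs x < 1}" "open {x. ct x < 1}"
    by (auto intro!: closed_Collect_le open_Collect_less continuous_intros)
  ultimately show ?thesis by (metis sets.Int borel_closed borel_open)
qed

lemma sets_T_lebesgue: "T \<in> sets lebesgue" using sets_T by auto

text \<open>Periodicity is given only almost everywhere and only for the two generators. The
  almost-everywhere periods form a group because translates of null sets are null.\<close>

lemma periodic_L:
  assumes "torus_periodic u v f" "w \<in> L"
  shows "AE x in lebesgue. f (x + w) = f x"
proof -
  define G where "G = {w. AE x in lebesgue. f (x + w) = f x}"
  have add: "a + b \<in> G" if ab: "a \<in> G" "b \<in> G" for a b
  proof -
    have 1: "AE x in lebesgue. f (x + b + a) = f (x + b)"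
      using AE_shift[of "\<lambda>x. f (x + a) = f x" b] ab by (simp add: G_def)
    have 2: "AE x in lebesgue. f (x + b) = f x" using ab by (simp add: G_def)
    have "AE x in lebesgue. f (x + (a + b)) = f x" using 1 2 by eventually_elim (simp add: ac_simps)
    then show ?thesis by (simp add: G_def)
  qed
  have neg: "- a \<in> G" if "a \<in> G" for a
  proof -
    have "AE x in lebesgue. f (x + - a + a) = f (x + - a)"
      using AE_shift[of "\<lambda>x. f (x + a) = f x" "- a"] that by (simp add: G_def)
    then show ?thesis by (simp add: G_def eq_commute)
  qed
  have zero: "0 \<in> G" by (simp add: G_def)
  have nat: "of_nat n *\<^sub>R a \<in> G" if "a \<in> G" for n a
    by (induction n) (auto simp: zero scaleR_add_left intro!: add that)
  have int: "of_int k *\<^sub>R a \<in> G" if "a \<in> G" for k a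
  proof (cases k rule: int_cases2)
    case (nonneg n) then show ?thesis using nat[OF that, of n] by simp
  next
    case (nonpos n) then show ?thesis using neg[OF nat[OF that, of n]] by simp
  qed
  have "u \<in> G" "v \<in> G" using assms(1) by (auto simp: torus_periodic_def G_def)
  then have "w \<in> G" using assms(2) by (auto simp: lattice_def intro!: add int)
  then show ?thesis by (simp add: G_def)
qed

lemma torus_periodicI: "(\<And>x w. w \<in> L \<Longrightarrow> f (x + w) = f x) \<Longrightarrow> torus_periodic u v f"
  by (simp add: torus_periodic_def u_L v_L)

lemma torus_periodic_shift: "torus_periodic u v f \<Longrightarrow> torus_periodic u v (\<lambda>x. f (x + c))"
  unfolding torus_periodic_def
  using AE_shift[of "\<lambda>x. f (x + u) = f x \<and> f (x + v) = f x" c]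
  by (simp add: add.assoc add.commute[of c])

lemma torus_periodic_comp: "torus_periodic u v f \<Longrightarrow> torus_periodic u v (\<lambda>x. g (f x))"
  unfolding torus_periodic_def by (auto elim: eventually_mono)

lemma torus_periodic_comp2:
  "torus_periodic u v f \<Longrightarrow> torus_periodic u v h \<Longrightarrow> torus_periodic u v (\<lambda>x. g (f x) (h x))"
  unfolding torus_periodic_def by (auto elim: eventually_elim2)

lemma torus_periodic_sum:
  "(\<And>i. i \<in> I \<Longrightarrow> torus_periodic u v (f i)) \<Longrightarrow> torus_periodic u v (\<lambda>x. \<Sum>i\<in>I. f i x)"
proof (induction I rule: infinite_finite_induct)
  case (insert i I)
  have "torus_periodic u v (\<lambda>x. f i x + (\<Sum>i\<in>I. f i x))"
    by (rule torus_periodic_comp2) (use insert in auto)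
  then show ?case using insert by simp
qed (auto simp: torus_periodic_def)

section \<open>Means of periodic functions as averages over large balls\<close>

definition mean :: "(real^2 \<Rightarrow> real) \<Rightarrow> real" where
  "mean f = (LINT x:T|lebesgue. f x) / (2 * pi)"

text \<open>The set where \<open>fl\<close> lies in \<open>F\<close> is a disjoint union of
  translated cells. Each contributes the same integral, by translation invariance and
  almost-everywhere periodicity.\<close>

lemma integral_cells:
  fixes f :: "real^2 \<Rightarrow> real"
  assumes f: "locally_integrable f" "torus_periodic u v f" and F: "finite F" "F \<subseteq> L"
  shows "integrable lebesgue (\<lambda>x. (if fl x \<in> F then 1 else 0) * f x)"
    "(LINT x|lebesgue. (if fl x \<in> F then 1 else 0) * f x) = card F * (LINT x:T|lebesgue. f x)"
proof -
  have eq: "(if fl x \<in> F then 1 else 0) * f x = (\<Sum>w\<in>F. indicator T (x - w) * f x)" for x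
  proof -
    have "(\<Sum>w\<in>F. indicator T (x - w) * f x) = (\<Sum>w\<in>F. if w = fl x then f x else 0)"
      using F(2) by (intro sum.cong) (auto simp: indicator_def diff_mem_T_iff)
    then show ?thesis using F(1) by simp
  qed
  have intT: "integrable lebesgue (\<lambda>x. indicator T x * f x)"
    using locally_integrable_bounded[OF f(1) bounded_T sets_T_lebesgue] by (simp add: set_integrable_def)
  have *: "integrable lebesgue (\<lambda>x. indicator T (x - w) * f x) \<and>
     (LINT x|lebesgue. indicator T (x - w) * f x) = (LINT x:T|lebesgue. f x)" if "w \<in> F" for w
  proof -
    have "AE x in lebesgue. f (x + - w) = f x" using F that by (intro periodic_L f(2) L_minus) auto
    then have ae: "AE x in lebesgue. indicator T (x - w) * f x = indicator T (x + - w) * f (x + - w)"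
      by eventually_elim simp
    have 1: "integrable lebesgue (\<lambda>x. indicator T (x + - w) * f (x + - w))"
      using integrable_shift_iff[of "\<lambda>x. indicator T x * f x" "- w"] intT by blast
    have m: "(\<lambda>x. indicator T (x - w) * f x) \<in> borel_measurable lebesgue"
    proof -
      have "(\<lambda>x. indicat_real T (x - w)) \<in> borel_measurable lebesgue"
        using borel_measurable_shift_iff[of "indicat_real T" "-w"] sets_T_lebesgue by auto
      then show ?thesis using locally_integrable_measurable[OF f(1)] by auto
    qed
    have "(LINT x|lebesgue. indicator T (x - w) * f x) = (LINT x|lebesgue. indicator T (x + - w) * f (x + - w))"
      by (rule integral_cong_AE) (use m ae 1 in auto)
    also have "\<dots> = (LINT x|lebesgue. indicator T x * f x)" by (rule integral_shift)
    finally show ?thesis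
      using integrable_cong_AE[OF m borel_measurable_integrable[OF 1] ae] 1 by (simp add: set_lebesgue_integral_def)
  qed
  show "integrable lebesgue (\<lambda>x. (if fl x \<in> F then 1 else 0) * f x)"
    unfolding eq using * by auto
  have "(LINT x|lebesgue. (if fl x \<in> F then 1 else 0) * f x) = (\<Sum>w\<in>F. LINT x|lebesgue. indicator T (x - w) * f x)"
    unfolding eq using * by (intro Bochner_Integration.integral_sum) auto
  also have "\<dots> = card F * (LINT x:T|lebesgue. f x)" using * by simp
  finally show "(LINT x|lebesgue. (if fl x \<in> F then 1 else 0) * f x) = card F * (LINT x:T|lebesgue. f x)" .
qed

lemma norm_fl: "norm (x - fl x) < dm"
  using T_bound diff_mem_T_iff[OF fl_L, of x x] by simp

text \<open>Every point has distance less than \<open>dm\<close> from the lattice point of its cell.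
  Hence cells meeting the ball belong to lattice points of norm below R + \<open>dm\<close>, and
  cells of lattice points of norm below R - \<open>dm\<close> lie inside it.\<close>

lemma ball_integral_bounds:
  fixes f :: "real^2 \<Rightarrow> real"
  assumes f: "locally_integrable f" "torus_periodic u v f" "\<And>x. f x \<ge> 0"
  shows "(LINT x:ball 0 R|lebesgue. f x) \<le> card (L \<inter> ball 0 (R + dm)) * (LINT x:T|lebesgue. f x)"
    "card (L \<inter> ball 0 (R - dm)) * (LINT x:T|lebesgue. f x) \<le> (LINT x:ball 0 R|lebesgue. f x)"
proof -
  have int: "integrable lebesgue (\<lambda>x. indicat_real (ball 0 R) x *\<^sub>R f x)"
    using locally_integrable_bounded[OF f(1), of "ball 0 R"] by (simp add: set_integrable_def)
  have fin: "finite (L \<inter> ball 0 r)" for r by (intro finite_L) auto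
  show "(LINT x:ball 0 R|lebesgue. f x) \<le> card (L \<inter> ball 0 (R + dm)) * (LINT x:T|lebesgue. f x)"
    unfolding integral_cells(2)[OF f(1,2) fin Int_lower1, symmetric]
    unfolding set_lebesgue_integral_def
  proof (rule integral_mono[OF int integral_cells(1)[OF f(1,2) fin Int_lower1]])
    fix x :: "real^2"
    have "norm (fl x) < R + dm" if "norm x < R"
      using norm_fl[of x] that norm_triangle_ineq3[of x "fl x"] by linarith
    then show "indicat_real (ball 0 R) x *\<^sub>R f x \<le> (if fl x \<in> L \<inter> ball 0 (R + dm) then 1 else 0) * f x"
      using f(3)[of x] by (auto simp: indicator_def fl_L)
  qed
  show "card (L \<inter> ball 0 (R - dm)) * (LINT x:T|lebesgue. f x) \<le> (LINT x:ball 0 R|lebesgue. f x)"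
    unfolding integral_cells(2)[OF f(1,2) fin Int_lower1, symmetric]
    unfolding set_lebesgue_integral_def
  proof (rule integral_mono[OF integral_cells(1)[OF f(1,2) fin Int_lower1] int])
    fix x :: "real^2"
    have "norm x < R" if "norm (fl x) < R - dm"
      using norm_fl[of x] that norm_triangle_ineq3[of x "fl x"] by linarith
    then show "(if fl x \<in> L \<inter> ball 0 (R - dm) then 1 else 0) * f x \<le> indicat_real (ball 0 R) x *\<^sub>R f x"
      using f(3)[of x] by (auto simp: indicator_def fl_L)
  qed
qed

lemma measure_ball_plane: "R \<ge> 0 \<Longrightarrow> measure lebesgue (ball (p::real^2) R) = pi * R\<^sup>2"
  using content_ball[of R p] by (simp add: unit_ball_vol_2)

text \<open>The previous bounds for the constant function 1: each lattice point owns the area 2 pi,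
  so a disc of area pi R^2 contains about R^2/2 of them.\<close>

lemma card_L_ball:
  assumes "R \<ge> dm"
  shows "card (L \<inter> ball 0 R) \<le> (R + dm)\<^sup>2 / 2" "card (L \<inter> ball 0 R) \<ge> (R - dm)\<^sup>2 / 2"
proof -
  have per: "torus_periodic u v (\<lambda>x. 1::real)" by (simp add: torus_periodic_def)
  have T1: "(LINT x:T|lebesgue. (1::real)) = 2 * pi"
    using volume by (simp add: set_lebesgue_integral_def)
  have B1: "(LINT x:ball (0::real^2) R'|lebesgue. (1::real)) = pi * R'\<^sup>2" if "R' \<ge> 0" for R'
    using measure_ball_plane[OF that] by (simp add: set_lebesgue_integral_def)
  have "card (L \<inter> ball 0 R) * (2 * pi) \<le> pi * (R + dm)\<^sup>2"
    using ball_integral_bounds(2)[OF locally_integrable_const per, of "R + dm"] assms dm_pos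
    by (simp add: T1 B1)
  also have "\<dots> = ((R + dm)\<^sup>2 / 2) * (2 * pi)" by simp
  finally show "card (L \<inter> ball 0 R) \<le> (R + dm)\<^sup>2 / 2"
    by (rule mult_right_le_imp_le) simp
  have "((R - dm)\<^sup>2 / 2) * (2 * pi) \<le> card (L \<inter> ball 0 R) * (2 * pi)"
    using ball_integral_bounds(1)[OF locally_integrable_const per, of "R - dm"] assms dm_pos
    by (simp add: T1 B1)
  then show "card (L \<inter> ball 0 R) \<ge> (R - dm)\<^sup>2 / 2"
    by (rule mult_right_le_imp_le) simp
qed

lemma average_ball_nonneg:
  fixes f :: "real^2 \<Rightarrow> real"
  assumes f: "locally_integrable f" "torus_periodic u v f" "\<And>x. f x \<ge> 0"
  shows "((\<lambda>R. (LINT x:ball 0 R|lebesgue. f x) / R\<^sup>2) \<longlongrightarrow> pi * mean f) at_top"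
proof -
  define I where "I = (LINT x:T|lebesgue. f x)"
  have I0: "I \<ge> 0" unfolding I_def set_lebesgue_integral_def using f(3) by (intro integral_nonneg_AE) auto
  have pm: "pi * mean f = I / 2" by (simp add: mean_def I_def)
  show ?thesis unfolding pm
  proof (rule tendsto_sandwich)
    show "\<forall>\<^sub>F R in at_top. ((R - 2 * dm)\<^sup>2 / 2) * I / R\<^sup>2 \<le> (LINT x:ball 0 R|lebesgue. f x) / R\<^sup>2"
      using eventually_ge_at_top[of "2 * dm"]
    proof eventually_elim
      case (elim R)
      have "((R - 2 * dm)\<^sup>2 / 2) * I \<le> card (L \<inter> ball 0 (R - dm)) * I"
        using card_L_ball(2)[of "R - dm"] elim I0 by (intro mult_right_mono) (auto simp: algebra_simps)
      also have "\<dots> \<le> (LINT x:ball 0 R|lebesgue. f x)"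
        using ball_integral_bounds(2)[OF f] by (simp add: I_def)
      finally show ?case by (rule divide_right_mono) simp
    qed
    show "\<forall>\<^sub>F R in at_top. (LINT x:ball 0 R|lebesgue. f x) / R\<^sup>2 \<le> ((R + 2 * dm)\<^sup>2 / 2) * I / R\<^sup>2"
      using eventually_ge_at_top[of "2 * dm"]
    proof eventually_elim
      case (elim R)
      have "(LINT x:ball 0 R|lebesgue. f x) \<le> card (L \<inter> ball 0 (R + dm)) * I"
        using ball_integral_bounds(1)[OF f] by (simp add: I_def)
      also have "\<dots> \<le> ((R + 2 * dm)\<^sup>2 / 2) * I"
        using card_L_ball(1)[of "R + dm"] elim I0 dm_pos by (intro mult_right_mono) (auto simp: algebra_simps)
      finally show ?case by (rule divide_right_mono) simp
    qed
    show "((\<lambda>R. ((R - 2 * dm)\<^sup>2 / 2) * I / R\<^sup>2) \<longlongrightarrow> I / 2) at_top"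
      "((\<lambda>R. ((R + 2 * dm)\<^sup>2 / 2) * I / R\<^sup>2) \<longlongrightarrow> I / 2) at_top"
      by real_asymp+
  qed
qed

text \<open>A shell is the difference of two balls whose averages have the same limit. No rate of
  convergence enters, only the order o(R^2).\<close>

lemma average_shell_nonneg:
  fixes f :: "real^2 \<Rightarrow> real"
  assumes f: "locally_integrable f" "torus_periodic u v f" "\<And>x. f x \<ge> 0"
  shows "((\<lambda>R. (LINT x:ball 0 (R + b) - ball 0 (R - b)|lebesgue. f x) / R\<^sup>2) \<longlongrightarrow> 0) at_top"
proof -
  let ?I = "\<lambda>R. LINT x:ball 0 R|lebesgue. f x"
  \<comment> \<open>Passing to the absolute value also covers negative \<open>b\<close>, where the
    shell is empty, and keeps the two balls nested.\<close>
  define b' where "b' = \<bar>b\<bar>"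
  have sh: "((\<lambda>R. ?I (R + c) / R\<^sup>2) \<longlongrightarrow> pi * mean f) at_top" for c
  proof -
    have "filterlim (\<lambda>R. R + c) at_top at_top" by real_asymp
    from filterlim_compose[OF average_ball_nonneg[OF f] this]
    have "((\<lambda>R. ?I (R + c) / (R + c)\<^sup>2 * ((R + c)\<^sup>2 / R\<^sup>2)) \<longlongrightarrow> pi * mean f * 1) at_top"
      by (rule tendsto_mult) real_asymp
    then show ?thesis
    proof (rule Lim_transform_eventually[OF tendsto_eq_rhs])
      show "\<forall>\<^sub>F R in at_top. ?I (R + c) / (R + c)\<^sup>2 * ((R + c)\<^sup>2 / R\<^sup>2) = ?I (R + c) / R\<^sup>2"
        using eventually_gt_at_top[of "- c"] by eventually_elim auto
    qed simp
  qed
  have "((\<lambda>R. ?I (R + b') / R\<^sup>2 - ?I (R + (- b')) / R\<^sup>2) \<longlongrightarrow> pi * mean f - pi * mean f) at_top"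
    by (intro tendsto_diff sh)
  then have *: "((\<lambda>R. ?I (R + b') / R\<^sup>2 - ?I (R + (- b')) / R\<^sup>2) \<longlongrightarrow> 0) at_top" by simp
  show ?thesis
  proof (rule tendsto_sandwich[OF _ _ tendsto_const *])
    have si: "set_integrable lebesgue A f" if "bounded A" "A \<in> sets borel" for A
      using locally_integrable_bounded[OF f(1)] that by auto
    show "\<forall>\<^sub>F R in at_top. 0 \<le> (LINT x:ball 0 (R + b) - ball 0 (R - b)|lebesgue. f x) / R\<^sup>2"
      using f(3) by (auto simp: set_lebesgue_integral_def intro!: always_eventually divide_nonneg_nonneg integral_nonneg_AE)
    show "\<forall>\<^sub>F R in at_top. (LINT x:ball 0 (R + b) - ball 0 (R - b)|lebesgue. f x) / R\<^sup>2 \<le> ?I (R + b') / R\<^sup>2 - ?I (R + (- b')) / R\<^sup>2"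
    proof (intro always_eventually allI)
      fix R
      have "(LINT x:ball 0 (R + b) - ball 0 (R - b)|lebesgue. f x) \<le> (LINT x:ball 0 (R + b') - ball 0 (R + (- b'))|lebesgue. f x)"
      proof -
        have "set_integrable lebesgue (ball 0 (R + b) - ball 0 (R - b)) f" "set_integrable lebesgue (ball 0 (R + b') - ball 0 (R + (- b'))) f"
          by (intro si bounded_diff bounded_ball; simp)+
        then show ?thesis unfolding set_lebesgue_integral_def set_integrable_def
          using f(3) by (intro integral_mono) (auto simp: indicator_def b'_def)
      qed
      also have "\<dots> = ?I (R + b') - ?I (R + (- b'))"
      proof -
        have "?I (R + b') = (LINT x:(ball 0 (R + b') - ball 0 (R + (- b'))) \<union> ball 0 (R + (- b'))|lebesgue. f x)"
          by (rule arg_cong2[where f="\<lambda>A f. set_lebesgue_integral lebesgue A f"]) (auto simp: b'_def)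
        also have "\<dots> = (LINT x:(ball 0 (R + b') - ball 0 (R + (- b')))|lebesgue. f x) + ?I (R + (- b'))"
          by (intro set_integral_Un si) (auto intro: bounded_diff)
        finally show ?thesis by simp
      qed
      finally show "(LINT x:ball 0 (R + b) - ball 0 (R - b)|lebesgue. f x) / R\<^sup>2 \<le> ?I (R + b') / R\<^sup>2 - ?I (R + (- b')) / R\<^sup>2"
        by (simp add: divide_right_mono flip: diff_divide_distrib)
    qed
  qed
qed

text \<open>Disposes of all boundary terms of the averaging arguments: gradients of cutoffs,
  differences of cutoffs, and displaced balls are bounded weights supported in such shells.\<close>

lemma average_shell:
  fixes f :: "real^2 \<Rightarrow> real"
  assumes f: "locally_integrable f" "torus_periodic u v f"
    and h: "\<And>R. R \<ge> Ra \<Longrightarrow> h R \<in> borel_measurable lebesgue"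
      "\<And>R x. R \<ge> Ra \<Longrightarrow> \<bar>h R x\<bar> \<le> C" 
      "\<And>R x. R \<ge> Ra \<Longrightarrow> norm x < R - b \<or> norm x \<ge> R + b \<Longrightarrow> h R x = 0"
  shows "((\<lambda>R. (LINT x|lebesgue. h R x * f x) / R\<^sup>2) \<longlongrightarrow> 0) at_top"
proof -
  have fa: "locally_integrable (\<lambda>x. \<bar>f x\<bar>)" "torus_periodic u v (\<lambda>x. \<bar>f x\<bar>)"
    using f by (auto simp: locally_integrable_def intro: set_integrable_abs torus_periodic_comp)
  have "((\<lambda>R. C * ((LINT x:ball 0 (R + b) - ball 0 (R - b)|lebesgue. \<bar>f x\<bar>) / R\<^sup>2)) \<longlongrightarrow> C * 0) at_top"
    by (intro tendsto_mult tendsto_const average_shell_nonneg fa) auto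
  then have *: "((\<lambda>R. C * ((LINT x:ball 0 (R + b) - ball 0 (R - b)|lebesgue. \<bar>f x\<bar>) / R\<^sup>2)) \<longlongrightarrow> 0) at_top" by simp
  show ?thesis
  proof (rule Lim_null_comparison[OF _ *])
    show "\<forall>\<^sub>F R in at_top. norm ((LINT x|lebesgue. h R x * f x) / R\<^sup>2) \<le> C * ((LINT x:ball 0 (R + b) - ball 0 (R - b)|lebesgue. \<bar>f x\<bar>) / R\<^sup>2)"
      using eventually_ge_at_top[of Ra]
    proof eventually_elim
      case (elim R)
      have "set_integrable lebesgue (ball 0 (R + b) - ball 0 (R - b)) (\<lambda>x. \<bar>f x\<bar>)"
        using locally_integrable_bounded[OF fa(1), of "ball 0 (R + b) - ball 0 (R - b)"]
        by (auto intro: bounded_diff)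
      then have i: "integrable lebesgue (\<lambda>x. C * (indicator (ball 0 (R + b) - ball 0 (R - b)) x *\<^sub>R \<bar>f x\<bar>))"
        unfolding set_integrable_def by (rule integrable_mult_right)
      have "\<bar>LINT x|lebesgue. h R x * f x\<bar> \<le> (LINT x|lebesgue. norm (h R x * f x))"
        using integral_norm_bound[of lebesgue "\<lambda>x. h R x * f x"] by simp
      also have "\<dots> \<le> (LINT x|lebesgue. C * (indicator (ball 0 (R + b) - ball 0 (R - b)) x *\<^sub>R \<bar>f x\<bar>))"
      proof (rule integral_mono)
        show "integrable lebesgue (\<lambda>x. norm (h R x * f x))"
          by (intro integrable_norm locally_integrable_bounded_mult[where R = "R + b" and C = C] f h elim) (use h[OF elim] in auto)
        fix x
        show "norm (h R x * f x) \<le> C * (indicator (ball 0 (R + b) - ball 0 (R - b)) x *\<^sub>R \<bar>f x\<bar>)"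
          using h(2,3)[OF elim, of x] by (auto simp: abs_mult indicator_def mult_right_mono not_less)
      qed (rule i)
      also have "\<dots> = C * (LINT x:ball 0 (R + b) - ball 0 (R - b)|lebesgue. \<bar>f x\<bar>)"
        by (simp add: set_lebesgue_integral_def)
      finally show ?case by (simp add: divide_right_mono)
    qed
  qed
qed

lemma average_ball:
  fixes f :: "real^2 \<Rightarrow> real"
  assumes f: "locally_integrable f" "torus_periodic u v f"
  shows "((\<lambda>R. (LINT x:ball 0 R|lebesgue. f x) / R\<^sup>2) \<longlongrightarrow> pi * mean f) at_top"
proof -
  have si: "set_integrable lebesgue A (\<lambda>x. max 0 (f x))" "set_integrable lebesgue A (\<lambda>x. max 0 (- f x))"
    if "set_integrable lebesgue A f" for A :: "(real^2) set"
  proof -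
    have "integrable lebesgue (\<lambda>x. max 0 (indicator A x *\<^sub>R f x))" "integrable lebesgue (\<lambda>x. max 0 (- (indicator A x *\<^sub>R f x)))"
      using that unfolding set_integrable_def by auto
    moreover have "max 0 (indicator A x *\<^sub>R f x) = indicator A x *\<^sub>R max 0 (f x)"
       "max 0 (- (indicator A x *\<^sub>R f x)) = indicator A x *\<^sub>R max 0 (- f x)" for x by (auto simp: indicator_def)
    ultimately show "set_integrable lebesgue A (\<lambda>x. max 0 (f x))" "set_integrable lebesgue A (\<lambda>x. max 0 (- f x))"
      unfolding set_integrable_def by auto
  qed
  have l: "locally_integrable (\<lambda>x. max 0 (f x))" "locally_integrable (\<lambda>x. max 0 (- f x))"
    using f(1) si by (auto simp: locally_integrable_def)
  have eq: "(LINT x:A|lebesgue. f x) = (LINT x:A|lebesgue. max 0 (f x)) - (LINT x:A|lebesgue. max 0 (- f x))"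
    if "bounded A" "A \<in> sets lebesgue" for A
  proof -
    have "(LINT x:A|lebesgue. f x) = (LINT x:A|lebesgue. max 0 (f x) - max 0 (- f x))"
      by (intro arg_cong2[where f="\<lambda>A f. set_lebesgue_integral lebesgue A f"]) auto
    also have "\<dots> = (LINT x:A|lebesgue. max 0 (f x)) - (LINT x:A|lebesgue. max 0 (- f x))"
      using locally_integrable_bounded[OF l(1) that] locally_integrable_bounded[OF l(2) that] by (rule set_integral_diff)
    finally show ?thesis .
  qed
  have "((\<lambda>R. (LINT x:ball 0 R|lebesgue. max 0 (f x)) / R\<^sup>2 - (LINT x:ball 0 R|lebesgue. max 0 (- f x)) / R\<^sup>2)
     \<longlongrightarrow> pi * mean (\<lambda>x. max 0 (f x)) - pi * mean (\<lambda>x. max 0 (- f x))) at_top"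
    by (intro tendsto_diff average_ball_nonneg l torus_periodic_comp[OF f(2)]) auto
  moreover have "mean f = mean (\<lambda>x. max 0 (f x)) - mean (\<lambda>x. max 0 (- f x))"
    unfolding mean_def eq[OF bounded_T sets_T_lebesgue] by (simp add: diff_divide_distrib)
  ultimately show ?thesis
    by (simp add: eq diff_divide_distrib right_diff_distrib)
qed

text \<open>The cutoff differs from the indicator of the ball only in a shell of bounded
  width.\<close>

lemma average_cutoff:
  fixes f :: "real^2 \<Rightarrow> real"
  assumes f: "locally_integrable f" "torus_periodic u v f"
    and h: "\<And>R. R \<ge> Ra \<Longrightarrow> h R \<in> borel_measurable lebesgue"
      "\<And>R x. R \<ge> Ra \<Longrightarrow> \<bar>h R x\<bar> \<le> C" 
      "\<And>R x. R \<ge> Ra \<Longrightarrow> norm x \<ge> R \<Longrightarrow> h R x = 0"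
      "\<And>R x. R \<ge> Ra \<Longrightarrow> norm x \<le> R - 1 \<Longrightarrow> h R x = 1"
  shows "((\<lambda>R. (LINT x|lebesgue. h R x * f x) / R\<^sup>2) \<longlongrightarrow> pi * mean f) at_top"
proof -
  have "((\<lambda>R. (LINT x:ball 0 R|lebesgue. f x) / R\<^sup>2 + (LINT x|lebesgue. (h R x - indicator (ball 0 R) x) * f x) / R\<^sup>2) \<longlongrightarrow> pi * mean f + 0) at_top"
  proof (intro tendsto_add average_ball f average_shell[where Ra = Ra and C = "\<bar>C\<bar> + 1" and b = 1])
    fix R x assume R: "R \<ge> Ra"
    show "(\<lambda>x. h R x - indicator (ball 0 R) x) \<in> borel_measurable lebesgue"
      using h(1)[OF R] by (intro borel_measurable_diff borel_measurable_indicator) auto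
    show "\<bar>h R x - indicator (ball 0 R) x\<bar> \<le> \<bar>C\<bar> + 1"
      using h(2)[OF R, of x] by (auto simp: indicator_def)
    show "norm x < R - 1 \<or> norm x \<ge> R + 1 \<Longrightarrow> h R x - indicator (ball 0 R) x = 0"
      using h(3,4)[OF R, of x] by (auto simp: indicator_def)
  qed
  then show ?thesis
  proof (rule Lim_transform_eventually[OF tendsto_eq_rhs])
    show "\<forall>\<^sub>F R in at_top. (LINT x:ball 0 R|lebesgue. f x) / R\<^sup>2 + (LINT x|lebesgue. (h R x - indicator (ball 0 R) x) * f x) / R\<^sup>2
        = (LINT x|lebesgue. h R x * f x) / R\<^sup>2"
      using eventually_ge_at_top[of Ra]
    proof eventually_elim
      case (elim R)
      have i1: "integrable lebesgue (\<lambda>x. indicator (ball 0 R) x * f x)"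
        by (rule locally_integrable_bounded_mult[where R = R and C = 1, OF f(1) borel_measurable_indicator]) (auto split: split_indicator)
      have i2: "integrable lebesgue (\<lambda>x. h R x * f x)"
        by (rule locally_integrable_bounded_mult[where R = R and C = C, OF f(1) h(1)]) (use h[OF elim] elim in auto)
      have "(LINT x|lebesgue. (h R x - indicator (ball 0 R) x) * f x) = (LINT x|lebesgue. h R x * f x - indicator (ball 0 R) x * f x)"
        by (simp add: algebra_simps)
      also have "\<dots> = (LINT x|lebesgue. h R x * f x) - (LINT x:ball 0 R|lebesgue. f x)"
        unfolding set_lebesgue_integral_def using i1 i2 by simp
      finally show ?case by (simp add: diff_divide_distrib)
    qed
  qed simp
qed

text \<open>The mean is read off from averages over large balls, and displacing a ball by
  \<open>c\<close> alters it only within a shell of bounded width.\<close>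

lemma mean_shift:
  fixes f :: "real^2 \<Rightarrow> real"
  assumes f: "locally_integrable f" "torus_periodic u v f"
  shows "mean (\<lambda>x. f (x + c)) = mean f"
proof -
  have "((\<lambda>R. (LINT x:ball 0 R|lebesgue. f x) / R\<^sup>2 + (LINT x|lebesgue. (indicator (ball 0 R) (x - c) - indicator (ball 0 R) x) * f x) / R\<^sup>2) \<longlongrightarrow> pi * mean f + 0) at_top"
  proof (intro tendsto_add average_ball f average_shell[where Ra = 0 and C = 1 and b = "norm c + 1"])
    fix R x
    show "(\<lambda>x. indicator (ball 0 R) (x - c) - indicat_real (ball 0 R) x) \<in> borel_measurable lebesgue"
    proof (rule borel_measurable_diff)
      show "(\<lambda>x. indicat_real (ball 0 R) (x - c)) \<in> borel_measurable lebesgue"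
        using borel_measurable_shift_iff[of "indicat_real (ball 0 R)" "-c"]
        by (simp add: borel_measurable_indicator)
    qed (intro borel_measurable_indicator; simp)
    show "\<bar>indicator (ball 0 R) (x - c) - indicat_real (ball 0 R) x\<bar> \<le> 1" by (auto simp: indicator_def)
    show "norm x < R - (norm c + 1) \<or> norm x \<ge> R + (norm c + 1) \<Longrightarrow> indicator (ball 0 R) (x - c) - indicat_real (ball 0 R) x = 0"
      using norm_triangle_ineq4[of x c] norm_triangle_ineq2[of x c] norm_ge_zero[of c]
      by (auto simp: indicator_def)
  qed
  moreover have "(LINT x:ball 0 R|lebesgue. f x) / R\<^sup>2 + (LINT x|lebesgue. (indicator (ball 0 R) (x - c) - indicator (ball 0 R) x) * f x) / R\<^sup>2
      = (LINT x:ball 0 R|lebesgue. f (x + c)) / R\<^sup>2" for R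
  proof -
    have i0: "integrable lebesgue (\<lambda>x. indicator (ball 0 R) x * f (x + c))"
      by (rule locally_integrable_bounded_mult[where R = R and C = 1, OF locally_integrable_shift[OF f(1)] borel_measurable_indicator]) (auto split: split_indicator)
    have i1: "integrable lebesgue (\<lambda>x. indicator (ball 0 R) x * f x)"
      by (rule locally_integrable_bounded_mult[where R = R and C = 1, OF f(1) borel_measurable_indicator]) (auto split: split_indicator)
    have i2: "integrable lebesgue (\<lambda>x. indicator (ball 0 R) (x - c) * f x)"
      using i0 integrable_shift_iff[of "\<lambda>x. indicator (ball 0 R) x * f (x + c)" "-c"] by simp
    have "(LINT x|lebesgue. (indicator (ball 0 R) (x - c) - indicator (ball 0 R) x) * f x) = (LINT x|lebesgue. indicator (ball 0 R) (x - c) * f x - indicator (ball 0 R) x * f x)"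
      by (simp add: algebra_simps)
    also have "\<dots> = (LINT x|lebesgue. indicator (ball 0 R) (x - c) * f x) - (LINT x:ball 0 R|lebesgue. f x)"
      unfolding set_lebesgue_integral_def using i1 i2 by simp
    also have "(LINT x|lebesgue. indicator (ball 0 R) (x - c) * f x) = (LINT x|lebesgue. indicator (ball 0 R) x * f (x + c))"
      using integral_shift[of "\<lambda>x. indicator (ball 0 R) (x - c) * f x" c] by simp
    finally show ?thesis by (simp add: set_lebesgue_integral_def diff_divide_distrib)
  qed
  ultimately have 1: "((\<lambda>R. (LINT x:ball 0 R|lebesgue. f (x + c)) / R\<^sup>2) \<longlongrightarrow> pi * mean f) at_top" by simp
  have 2: "((\<lambda>R. (LINT x:ball 0 R|lebesgue. f (x + c)) / R\<^sup>2) \<longlongrightarrow> pi * mean (\<lambda>x. f (x + c))) at_top"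
    by (intro average_ball locally_integrable_shift torus_periodic_shift f)
  show ?thesis using tendsto_unique[OF _ 1 2] by simp
qed

end

section \<open>Smooth bumps\<close>

lemma tcd_SucI:
  assumes "\<And>x. (f has_derivative f' x) (at x)" "\<And>h. times_cont_differentiable k (\<lambda>x. f' x h)"
  shows "times_cont_differentiable (Suc k) f"
proof -
  have "f' x = frechet_derivative f (at x)" for x by (rule frechet_derivative_at[OF assms(1)])
  then show ?thesis using assms by (auto simp: differentiable_def) 
qed

lemma tcd_Suc_has_derivative:
  assumes "times_cont_differentiable (Suc k) f"
  shows "(f has_derivative frechet_derivative f (at x)) (at x)"
    "times_cont_differentiable k (\<lambda>x. frechet_derivative f (at x) h)"
  using assms frechet_derivative_works by auto

lemma tcd_SucD: "times_cont_differentiable (Suc k) f \<Longrightarrow> times_cont_differentiable k f"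
proof (induction k arbitrary: f)
  case 0
  then have "continuous (at x) f" for x by (auto intro: differentiable_imp_continuous_within)
  then show ?case by (auto intro: continuous_at_imp_continuous_on)
next
  case (Suc k)
  show ?case
    by (rule tcd_SucI[OF tcd_Suc_has_derivative(1)[OF Suc.prems]])
       (rule Suc.IH[OF tcd_Suc_has_derivative(2)[OF Suc.prems]])
qed

lemma tcd_const: "times_cont_differentiable k (\<lambda>x. c)"
proof (induction k arbitrary: c)
  case (Suc k)
  show ?case by (rule tcd_SucI[where f' = "\<lambda>x h. 0"]) (auto intro: Suc)
qed auto

lemma tcd_linear:
  assumes "bounded_linear f"
  shows "times_cont_differentiable k f"
proof (cases k)
  case 0
  then show ?thesis using assms by (auto simp: linear_continuous_on)
next
  case (Suc k)
  show ?thesis unfolding Suc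
    by (rule tcd_SucI[where f' = "\<lambda>x. f"]) (auto intro: tcd_const bounded_linear_imp_has_derivative assms)
qed

lemma tcd_add:
  "times_cont_differentiable k f \<Longrightarrow> times_cont_differentiable k g \<Longrightarrow> times_cont_differentiable k (\<lambda>x. f x + g x)"
proof (induction k arbitrary: f g)
  case 0
  then show ?case by (auto intro: continuous_intros)
next
  case (Suc k)
  show ?case
    by (rule tcd_SucI[OF has_derivative_add[OF tcd_Suc_has_derivative(1)[OF Suc.prems(1)] tcd_Suc_has_derivative(1)[OF Suc.prems(2)]]])
       (intro Suc.IH tcd_Suc_has_derivative(2) Suc.prems)
qed

lemma tcd_mult:
  "times_cont_differentiable k f \<Longrightarrow> times_cont_differentiable k g \<Longrightarrow> times_cont_differentiable k (\<lambda>x. f x * g x)"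
proof (induction k arbitrary: f g)
  case 0
  then show ?case by (auto intro: continuous_intros)
next
  case (Suc k)
  show ?case
    by (rule tcd_SucI[OF has_derivative_mult[OF tcd_Suc_has_derivative(1)[OF Suc.prems(1)] tcd_Suc_has_derivative(1)[OF Suc.prems(2)]]])
       (intro tcd_add Suc.IH tcd_Suc_has_derivative(2) tcd_SucD[OF Suc.prems(1)] tcd_SucD[OF Suc.prems(2)] Suc.prems)
qed

text \<open>The polynomial in \<open>1/s\<close> makes the family closed under differentiation.\<close>

definition bump :: "real poly \<Rightarrow> real \<Rightarrow> real" where
  "bump p s = (if s > 0 then poly p (1 / s) * exp (- 1 / s) else 0)"

text \<open>The chain rule in the variable X = 1/s: the inner derivative contributes X^2 up to sign,
  and the exponential and the polynomial together give p - p'.\<close>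

definition bump_deriv :: "real poly \<Rightarrow> real poly" where
  "bump_deriv p = [:0, 0, 1:] * (p - pderiv p)"

lemma poly_div_exp_tendsto_0: "((\<lambda>x. poly p x / exp x) \<longlongrightarrow> 0) (at_top :: real filter)"
proof -
  have "((\<lambda>x. \<Sum>i\<le>degree p. coeff p i * (x ^ i / exp x)) \<longlongrightarrow> (\<Sum>i\<le>degree p. coeff p i * 0)) (at_top :: real filter)"
    by (intro tendsto_sum tendsto_mult tendsto_const tendsto_power_div_exp_0)
  then show ?thesis by (simp add: poly_altdef sum_divide_distrib)
qed

lemma bump_has_derivative: "(bump p has_real_derivative bump (bump_deriv p) s) (at s)"
proof -
  consider "s > 0" | "s < 0" | "s = 0" by linarith
  then show ?thesis
  proof cases
    case 1
    have "((\<lambda>s. poly p (1 / s) * exp (- 1 / s)) has_real_derivative bump (bump_deriv p) s) (at s)"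
      using 1 by (auto intro!: derivative_eq_intros simp: bump_def bump_deriv_def field_simps power2_eq_square)
    then show ?thesis
      by (rule has_field_derivative_transform_within_open[where S = "{0<..}"]) (use 1 in \<open>auto simp: bump_def\<close>)
  next
    case 2
    have "((\<lambda>s. 0) has_real_derivative bump (bump_deriv p) s) (at s)"
      using 2 by (auto simp: bump_def)
    then show ?thesis
      by (rule has_field_derivative_transform_within_open[where S = "{..<0}"]) (use 2 in \<open>auto simp: bump_def\<close>)
  next
    case 3
    \<comment> \<open>With x = 1/h the difference quotient from the right is a polynomial divided by
      exp x; the extra factor \<open>[:0,1:]\<close> comes from dividing by h.\<close>
    have "((\<lambda>h. bump p h / h) \<longlongrightarrow> 0) (at_right 0)"
    proof -
      have "((\<lambda>x. poly ([:0,1:] * p) x / exp x) \<longlongrightarrow> 0) at_top" by (rule poly_div_exp_tendsto_0)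
      moreover have "filterlim (\<lambda>h::real. inverse h) at_top (at_right 0)" by (rule filterlim_inverse_at_top_right)
      ultimately have "((\<lambda>h. poly ([:0,1:] * p) (inverse h) / exp (inverse h)) \<longlongrightarrow> 0) (at_right 0)"
        by (rule filterlim_compose)
      then show ?thesis
        by (rule Lim_transform_eventually)
           (auto simp: eventually_at_filter bump_def exp_minus field_simps)
    qed
    moreover have "((\<lambda>h. bump p h / h) \<longlongrightarrow> 0) (at_left 0)"
      by (rule Lim_transform_eventually[OF tendsto_const]) (auto simp: eventually_at_filter bump_def)
    ultimately have "((\<lambda>h. bump p h / h) \<longlongrightarrow> 0) (at 0)"
      by (simp add: filterlim_split_at)
    then show ?thesis unfolding 3 DERIV_def by (simp add: bump_def)
  qed
qed

lemma continuous_on_bump: "continuous_on A (bump p)"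
  by (rule DERIV_continuous_on[OF DERIV_subset[OF bump_has_derivative]]) auto

lemma tcd_bump:
  assumes "\<And>k. times_cont_differentiable k q"
  shows "times_cont_differentiable k (\<lambda>x. bump p (q x))"
proof (induction k arbitrary: p)
  case 0
  have "continuous_on UNIV q" using assms[of 0] by simp
  then show ?case
    by (auto intro: continuous_on_compose2[OF continuous_on_bump])
next
  case (Suc k)
  show ?case
  proof (rule tcd_SucI)
    show "((\<lambda>x. bump p (q x)) has_derivative (\<lambda>h. frechet_derivative q (at x) h * bump (bump_deriv p) (q x))) (at x)" for x
      by (rule DERIV_compose_FDERIV[OF bump_has_derivative tcd_Suc_has_derivative(1)[OF assms[of "Suc k"]]])
    show "times_cont_differentiable k (\<lambda>x. frechet_derivative q (at x) h * bump (bump_deriv p) (q x))" for h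
      by (intro tcd_mult Suc.IH tcd_Suc_has_derivative(2)[OF assms[of "Suc k"]])
  qed
qed

lemma tcd_norm_sq: "times_cont_differentiable k (\<lambda>x. 1 - t * (norm (x - y))\<^sup>2)"
proof -
  have "1 - t * (norm (x - y))\<^sup>2 = 1 + (- t) * ((x$1 + (- (y$1))) * (x$1 + (- (y$1))) + (x$2 + (- (y$2))) * (x$2 + (- (y$2))))" for x
    by (simp add: norm_eq_sqrt_inner inner_vec_def sum_2 power2_eq_square)
  then show ?thesis
    by (simp only:) (intro tcd_add tcd_mult tcd_const tcd_linear bounded_linear_vec_nth)
qed

text \<open>The parameter \<open>t\<close> is the inverse square of the radius of the supporting
  disc, which makes the dependence on it differentiable in closed form.\<close>

definition test_bump :: "real poly \<Rightarrow> real \<Rightarrow> real^2 \<Rightarrow> real^2 \<Rightarrow> real" where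
  "test_bump p t y x = bump p (1 - t * (norm (x - y))\<^sup>2)"

lemma test_bump_supp:
  assumes "t > 0" "test_bump p t y x \<noteq> 0"
  shows "x \<in> ball y (1 / sqrt t)"
proof -
  have "t * (norm (x - y))\<^sup>2 < 1" using assms(2) by (auto simp: test_bump_def bump_def split: if_splits)
  then have "(sqrt t * norm (x - y))\<^sup>2 < 1\<^sup>2" using assms(1) by (simp add: power_mult_distrib)
  then have "sqrt t * norm (x - y) < 1" by (rule power_less_imp_less_base) simp
  then show ?thesis using assms(1) by (simp add: dist_norm norm_minus_commute field_simps)
qed

lemma test_function_bump:
  assumes "t > 0" shows "test_function (test_bump p t y)"
  unfolding test_function_def
proof
  show "\<forall>k. times_cont_differentiable k (test_bump p t y)"
    unfolding test_bump_def by (intro allI tcd_bump tcd_norm_sq)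
  have "bounded {x. test_bump p t y x \<noteq> 0}"
    by (rule bounded_subset[OF bounded_ball[of y "1 / sqrt t"]]) (use test_bump_supp[OF assms] in auto)
  then show "compact (closure {x. test_bump p t y x \<noteq> 0})" by simp
qed

lemma test_bump_has_derivative:
  "(test_bump p t y has_derivative (\<lambda>h. - 2 * t * ((x - y) \<bullet> h) * test_bump (bump_deriv p) t y x)) (at x)"
proof -
  have "((\<lambda>x. 1 - t * (norm (x - y))\<^sup>2) has_derivative (\<lambda>h. - 2 * t * ((x - y) \<bullet> h))) (at x)"
    unfolding power2_norm_eq_inner by (auto intro!: derivative_eq_intros simp: inner_commute algebra_simps)
  from DERIV_compose_FDERIV[OF bump_has_derivative this]
  show ?thesis unfolding test_bump_def by (simp add: mult.commute)
qed

lemma partial_eqI: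
  assumes "(f has_derivative f') (at x)"
  shows "partial i f x = f' (axis i 1)"
  unfolding partial_def using frechet_derivative_at[OF assms] by simp

lemma partial_test_bump: "partial i (test_bump p t y) x = - 2 * t * (x - y)$i * test_bump (bump_deriv p) t y x"
  by (subst partial_eqI[OF test_bump_has_derivative]) (simp add: inner_axis)

lemma partial_partial_test_bump:
  "partial i (partial j (test_bump p t y)) x =
     - 2 * t * (if i = j then 1 else 0) * test_bump (bump_deriv p) t y x
     + 4 * t\<^sup>2 * (x - y)$i * (x - y)$j * test_bump (bump_deriv (bump_deriv p)) t y x"
proof -
  have "((\<lambda>x. - 2 * t * (x - y)$j * test_bump (bump_deriv p) t y x) has_derivative
    (\<lambda>h. - 2 * t * (x - y)$j * (- 2 * t * ((x - y) \<bullet> h) * test_bump (bump_deriv (bump_deriv p)) t y x)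
        + - 2 * t * h$j * test_bump (bump_deriv p) t y x)) (at x)"
    by (rule has_derivative_mult[OF _ test_bump_has_derivative])
       (auto intro!: derivative_eq_intros bounded_linear_imp_has_derivative[OF bounded_linear_vec_nth] )
  from partial_eqI[OF this, of i] 
  have "partial i (\<lambda>x. - 2 * t * (x - y)$j * test_bump (bump_deriv p) t y x) x = 
     - 2 * t * (x - y)$j * (- 2 * t * ((x - y) $ i) * test_bump (bump_deriv (bump_deriv p)) t y x)
        + - 2 * t * (if i = j then 1 else 0) * test_bump (bump_deriv p) t y x"
    by (simp add: inner_axis) (simp add: axis_def)
  moreover have "partial j (test_bump p t y) = (\<lambda>x. - 2 * t * (x - y)$j * test_bump (bump_deriv p) t y x)"
    using partial_test_bump by blast
  ultimately show ?thesis by (simp add: power2_eq_square algebra_simps)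
qed

lemma laplacian_test_bump:
  "partial 1 (partial 1 (test_bump p t y)) x + partial 2 (partial 2 (test_bump p t y)) x =
   - 4 * t * (test_bump (bump_deriv p) t y x - t * (norm (x - y))\<^sup>2 * test_bump (bump_deriv (bump_deriv p)) t y x)"
proof -
  have n2: "(norm (x - y))\<^sup>2 = (x - y)$1 * (x - y)$1 + (x - y)$2 * (x - y)$2"
    by (simp add: norm_eq_sqrt_inner inner_vec_def sum_2)
  then show ?thesis
    unfolding partial_partial_test_bump n2 unfolding power2_eq_square by (simp add: algebra_simps)
qed

text \<open>Since \<open>ennreal\<close> sends negative numbers to 0, \<open>ennreal (q x)\<close>
  and \<open>ennreal (- q x)\<close> are the positive and the negative part. As densities they agree
  on boxes, which generate the Borel sets, so they define the same measure and agree almost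
  everywhere.\<close>

lemma AE_zero_if_box_integrals_zero:
  fixes q :: "'a::euclidean_space \<Rightarrow> real"
  assumes q [measurable]: "q \<in> borel_measurable lborel"
    and int: "\<And>a b. integrable lborel (\<lambda>x. indicator (box a b) x * q x)"
    and zero: "\<And>a b. (LINT x|lborel. indicator (box a b) x * q x) = 0"
  shows "AE x in lborel. q x = 0"
proof -
  have pos: "(\<integral>\<^sup>+x. ennreal (q x) * indicator (box a b) x \<partial>lborel) = ennreal (LINT x|lborel. max 0 (indicator (box a b) x * q x))" for a b
  proof -
    have "(\<integral>\<^sup>+x. ennreal (q x) * indicator (box a b) x \<partial>lborel) = (\<integral>\<^sup>+x. ennreal (max 0 (indicator (box a b) x * q x)) \<partial>lborel)"
      by (intro nn_integral_cong) (auto simp: indicator_def max_def ennreal_neg)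
    also have "\<dots> = ennreal (LINT x|lborel. max 0 (indicator (box a b) x * q x))"
      by (rule nn_integral_eq_integral) (use int[of a b] in auto)
    finally show ?thesis .
  qed
  have neg: "(\<integral>\<^sup>+x. ennreal (- q x) * indicator (box a b) x \<partial>lborel) = ennreal (LINT x|lborel. max 0 (- (indicator (box a b) x * q x)))" for a b
  proof -
    have "(\<integral>\<^sup>+x. ennreal (- q x) * indicator (box a b) x \<partial>lborel) = (\<integral>\<^sup>+x. ennreal (max 0 (- (indicator (box a b) x * q x))) \<partial>lborel)"
      by (intro nn_integral_cong) (auto simp: indicator_def max_def ennreal_neg)
    also have "\<dots> = ennreal (LINT x|lborel. max 0 (- (indicator (box a b) x * q x)))"
      by (rule nn_integral_eq_integral) (use int[of a b] in auto)
    finally show ?thesis .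
  qed
  have eq: "(LINT x|lborel. max 0 (indicator (box a b) x * q x)) = (LINT x|lborel. max 0 (- (indicator (box a b) x * q x)))" for a b
  proof -
    have "(LINT x|lborel. max 0 (indicator (box a b) x * q x)) - (LINT x|lborel. max 0 (- (indicator (box a b) x * q x)))
      = (LINT x|lborel. max 0 (indicator (box a b) x * q x) - max 0 (- (indicator (box a b) x * q x)))"
      by (rule Bochner_Integration.integral_diff[symmetric]) (use int[of a b] in auto)
    also have "\<dots> = (LINT x|lborel. indicator (box a b) x * q x)"
      by (intro Bochner_Integration.integral_cong) auto
    finally show ?thesis using zero[of a b] by simp
  qed
  have "density lborel (\<lambda>x. ennreal (q x)) = density lborel (\<lambda>x. ennreal (- q x))"
  proof (rule measure_eqI_generator_eq)
    let ?E = "range (\<lambda>(a, b). box a b::'a set)"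
    let ?A = "\<lambda>n::nat. box (- (real n *\<^sub>R One)) (real n *\<^sub>R One) :: 'a set"
    show "Int_stable ?E"
      by (auto simp: Int_stable_def box_Int_box)
    show "?E \<subseteq> Pow UNIV" "sets (density lborel (\<lambda>x. ennreal (q x))) = sigma_sets UNIV ?E"
      "sets (density lborel (\<lambda>x. ennreal (- q x))) = sigma_sets UNIV ?E"
      by (simp_all add: borel_eq_box)
    show "range ?A \<subseteq> ?E" "(\<Union>i. ?A i) = UNIV"
      unfolding UN_box_eq_UNIV by auto
    show "emeasure (density lborel (\<lambda>x. ennreal (q x))) (?A i) \<noteq> \<infinity>" for i
      by (subst emeasure_density) (auto simp: pos)
    fix X assume "X \<in> ?E"
    then obtain a b where X: "X = box a b" by auto
    show "emeasure (density lborel (\<lambda>x. ennreal (q x))) X = emeasure (density lborel (\<lambda>x. ennreal (- q x))) X"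
      unfolding X by (subst (1 2) emeasure_density) (auto simp: pos neg eq)
  qed
  then have "AE x in lborel. ennreal (q x) = ennreal (- q x)"
    by (subst (asm) sigma_finite_measure.density_unique_iff[OF sigma_finite_lborel]) auto
  then show ?thesis
  proof eventually_elim
    case (elim x)
    then show ?case
      by (cases "q x \<ge> 0") (auto simp: ennreal_neg dest: sym)
  qed
qed

section \<open>Weakly harmonic periodic functions\<close>

lemma bump_bounded: "\<exists>C>0. \<forall>s\<le>1. \<bar>bump p s\<bar> \<le> C"
proof -
  have "bounded (bump p ` {0..1})"
    by (intro compact_imp_bounded compact_continuous_image continuous_on_bump) auto
  then obtain C where C: "C > 0" "\<And>s. s \<in> {0..1} \<Longrightarrow> \<bar>bump p s\<bar> \<le> C"
    unfolding bounded_pos by (auto simp: image_iff)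
  show ?thesis
  proof (intro exI[of _ C] conjI allI impI)
    fix s :: real assume "s \<le> 1"
    then show "\<bar>bump p s\<bar> \<le> C" using C by (cases "s \<ge> 0") (auto simp: bump_def)
  qed (fact C)
qed

lemma bump_measurable [measurable]: "bump p \<in> borel_measurable borel"
  by (intro borel_measurable_continuous_onI continuous_on_bump)

lemma test_bump_measurable: "test_bump p t y \<in> borel_measurable borel"
  unfolding test_bump_def by measurable

text \<open>Built from the derivative of the bump instead of the bump itself. This makes the radial
  integral an exact derivative, and the derivative in \<open>t\<close> a multiple of the Laplacian
  of a test function.\<close>

definition bump_kernel :: "real \<Rightarrow> real^2 \<Rightarrow> real^2 \<Rightarrow> real" where
  "bump_kernel t y x = t * test_bump (bump_deriv 1) t y x"

lemma bump_deriv_1: "bump (bump_deriv 1) s \<ge> 0"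
  by (auto simp: bump_deriv_def bump_def)

lemma bump_kernel_nonneg: "t > 0 \<Longrightarrow> bump_kernel t y x \<ge> 0"
  by (simp add: bump_kernel_def test_bump_def bump_deriv_1)

lemma bump_kernel_measurable: "bump_kernel t y \<in> borel_measurable borel"
  unfolding bump_kernel_def using test_bump_measurable by measurable

lemma bump_kernel_sym: "bump_kernel t y x = bump_kernel t x y"
  by (simp add: bump_kernel_def test_bump_def norm_minus_commute)

lemma bump_kernel_supp: "t > 0 \<Longrightarrow> bump_kernel t y x \<noteq> 0 \<Longrightarrow> dist x y < 1 / sqrt t"
  using test_bump_supp[of t "bump_deriv 1" y x] by (auto simp: bump_kernel_def dist_commute)

text \<open>In polar coordinates the integrand is the derivative of - pi \<open>bump 1\<close> (1 -
  t r^2), which gives the mass pi \<open>bump 1\<close> 1 = pi / e at every scale.\<close>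

lemma bump_kernel_integral:
  assumes t: "t > 0"
  shows "integrable lborel (bump_kernel t y)" "(LINT x|lborel. bump_kernel t y x) = pi * exp (- 1)"
proof -
  have "(\<integral>\<^sup>+ x. ennreal (bump_kernel t y x) \<partial>lborel) = (\<integral>\<^sup>+ x. ennreal (bump_kernel t y x) \<partial>lebesgue)"
    by (rule nn_integral_completion[symmetric])
  also have "\<dots> = (\<integral>\<^sup>+ x. (\<lambda>r. ennreal (t * bump (bump_deriv 1) (1 - t * r\<^sup>2))) (norm (x - y)) \<partial>lebesgue)"
    by (simp add: bump_kernel_def test_bump_def)
  also have "\<dots> = (\<integral>\<^sup>+r. ennreal (2 * pi * r) * ennreal (t * bump (bump_deriv 1) (1 - t * r\<^sup>2)) * indicator {0..} r \<partial>lborel)"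
    by (rule nn_integral_radial) measurable
  also have "\<dots> = (\<integral>\<^sup>+r. ennreal (2 * pi * r * (t * bump (bump_deriv 1) (1 - t * r\<^sup>2))) * indicator {0..} r \<partial>lborel)"
    by (intro nn_integral_cong) (auto simp: indicator_def simp flip: ennreal_mult')
  also have "\<dots> = ennreal (0 - (- pi * bump 1 (1 - t * 0\<^sup>2)))"
  proof (rule nn_integral_FTC_atLeast)
    fix r :: real
    show "((\<lambda>r. - pi * bump 1 (1 - t * r\<^sup>2)) has_real_derivative 2 * pi * r * (t * bump (bump_deriv 1) (1 - t * r\<^sup>2))) (at r)"
      by (auto intro!: derivative_eq_intros DERIV_chain2[OF bump_has_derivative])
    show "0 \<le> r \<Longrightarrow> 0 \<le> 2 * pi * r * (t * bump (bump_deriv 1) (1 - t * r\<^sup>2))"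
      using t bump_deriv_1 by auto
    have "eventually (\<lambda>r. - pi * bump 1 (1 - t * r\<^sup>2) = 0) at_top"
      using eventually_ge_at_top[of "1 / sqrt t"]
    proof eventually_elim
      case (elim r)
      then have "1 \<le> r * sqrt t" using t by (simp add: field_simps)
      then have "1\<^sup>2 \<le> (r * sqrt t)\<^sup>2" by (intro power_mono) auto
      then show ?case using t by (simp add: bump_def power_mult_distrib mult.commute)
    qed
    then show "((\<lambda>r. - pi * bump 1 (1 - t * r\<^sup>2)) \<longlongrightarrow> 0) at_top"
      by (rule tendsto_eventually)
  qed measurable
  also have "0 - (- pi * bump 1 (1 - t * 0\<^sup>2)) = pi * exp (- 1)" by (simp add: bump_def)
  finally have *: "(\<integral>\<^sup>+ x. ennreal (bump_kernel t y x) \<partial>lborel) = ennreal (pi * exp (- 1))" .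
  show "integrable lborel (bump_kernel t y)" "(LINT x|lborel. bump_kernel t y x) = pi * exp (- 1)"
    using nn_integral_eq_integrable[of "bump_kernel t y" lborel "pi * exp (- 1)"] * bump_kernel_measurable bump_kernel_nonneg[OF t] by auto
qed

text \<open>This is the derivative of \<^term>\<open>bump_kernel t y x\<close> with respect to \<open>t\<close>, and by
  \<open>laplacian_test_bump\<close> also \<open>- 1/(4t)\<close> times the Laplacian of \<^term>\<open>test_bump 1 t y\<close>.\<close>

definition bump_kernel_deriv :: "real \<Rightarrow> real^2 \<Rightarrow> real^2 \<Rightarrow> real" where
  "bump_kernel_deriv t y x = test_bump (bump_deriv 1) t y x - t * (norm (x - y))\<^sup>2 * test_bump (bump_deriv (bump_deriv 1)) t y x"

lemma bump_kernel_has_derivative: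
  "((\<lambda>t. bump_kernel t y x) has_real_derivative bump_kernel_deriv t y x) (at t)"
  unfolding bump_kernel_def bump_kernel_deriv_def test_bump_def
  by (auto intro!: derivative_eq_intros DERIV_chain2[OF bump_has_derivative])

text \<open>Uniform in \<open>t\<close>, in contrast to the kernel itself: where the second bump
  does not vanish, t |x - y|^2 is below 1.\<close>

lemma bump_kernel_deriv_bounded: "\<exists>C>0. \<forall>t>0. \<forall>y x. \<bar>bump_kernel_deriv t y x\<bar> \<le> C"
proof -
  obtain C1 where C1: "C1 > 0" "\<And>s. s \<le> 1 \<Longrightarrow> \<bar>bump (bump_deriv 1) s\<bar> \<le> C1"
    using bump_bounded by blast
  obtain C2 where C2: "C2 > 0" "\<And>s. s \<le> 1 \<Longrightarrow> \<bar>bump (bump_deriv (bump_deriv 1)) s\<bar> \<le> C2"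
    using bump_bounded by blast
  show ?thesis
  proof (intro exI[of _ "C1 + C2"] conjI allI impI)
    fix t :: real and y x :: "real^2" assume t: "t > 0"
    have "\<bar>t * (norm (x - y))\<^sup>2 * test_bump (bump_deriv (bump_deriv 1)) t y x\<bar> \<le> C2"
    proof (cases "t * (norm (x - y))\<^sup>2 < 1")
      case True
      then have "\<bar>t * (norm (x - y))\<^sup>2 * test_bump (bump_deriv (bump_deriv 1)) t y x\<bar> \<le> 1 * C2"
        unfolding abs_mult using t C2 by (intro mult_mono) (auto simp: test_bump_def abs_mult)
      then show ?thesis by simp
    next
      case False
      then show ?thesis using C2 by (simp add: test_bump_def bump_def)
    qed
    moreover have "\<bar>test_bump (bump_deriv 1) t y x\<bar> \<le> C1"
      unfolding test_bump_def using t by (intro C1) auto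
    ultimately show "\<bar>bump_kernel_deriv t y x\<bar> \<le> C1 + C2" unfolding bump_kernel_deriv_def by linarith
  qed (use C1 C2 in auto)
qed

lemma bump_kernel_bounded: "\<exists>C>0. \<forall>t>0. \<forall>y x. \<bar>bump_kernel t y x\<bar> \<le> t * C"
proof -
  obtain C1 where C1: "C1 > 0" "\<And>s. s \<le> 1 \<Longrightarrow> \<bar>bump (bump_deriv 1) s\<bar> \<le> C1"
    using bump_bounded by blast
  then show ?thesis unfolding bump_kernel_def test_bump_def by (intro exI[of _ C1]) (auto simp: abs_mult)
qed

lemma bump_kernel_mult_integrable:
  assumes f: "locally_integrable f" and t: "t > 0"
  shows "integrable lebesgue (\<lambda>x. bump_kernel t y x * f x)"
proof -
  obtain C where C: "\<And>t y x. t > 0 \<Longrightarrow> \<bar>bump_kernel t y x\<bar> \<le> t * C" using bump_kernel_bounded by blast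
  show ?thesis
  proof (rule locally_integrable_bounded_mult[OF f _ C[OF t]])
    show "bump_kernel t y \<in> borel_measurable lebesgue"
      using bump_kernel_measurable by (intro measurable_completion) auto
    show "bump_kernel t y x = 0" if "norm x > norm y + 1 / sqrt t" for x
      using bump_kernel_supp[OF t, of y x] that norm_triangle_ineq2[of x y] by (auto simp: dist_norm)
  qed
qed

text \<open>A weak mean value property. Differentiating under the integral, the derivative in the
  scale is the integral of \<open>f\<close> against a multiple of the Laplacian of a test bump,
  which vanishes.\<close>

lemma weakly_harmonic_kernel_mean_const:
  assumes f: "locally_integrable f" and harm: "\<And>t y. t > 0 \<Longrightarrow> distr_laplacian f (test_bump 1 t y) = 0"
  shows "\<exists>c. \<forall>t>0. (LINT x|lebesgue. bump_kernel t y x * f x) = c"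
proof -
  obtain C where C: "C > 0" "\<And>t y x. t > 0 \<Longrightarrow> \<bar>bump_kernel_deriv t y x\<bar> \<le> C" using bump_kernel_deriv_bounded by blast
  let ?M = "\<lambda>t. LINT x|lebesgue. bump_kernel t y x * f x"
  have orth: "(LINT x|lebesgue. bump_kernel_deriv t y x * f x) = 0" if t: "t > 0" for t
  proof -
    have "distr_laplacian f (test_bump 1 t y) = (LINT x|lebesgue. (- 4 * t) * (bump_kernel_deriv t y x * f x))"
      unfolding distr_laplacian_def laplacian_test_bump bump_kernel_deriv_def by (simp add: mult_ac)
    then have "(- 4 * t) * (LINT x|lebesgue. bump_kernel_deriv t y x * f x) = 0"
      using harm[OF t] by simp
    then show ?thesis using t by simp
  qed
  have fm: "f \<in> borel_measurable lebesgue" by (rule locally_integrable_measurable[OF f])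
  have km: "(\<lambda>x. bump_kernel t y x) \<in> borel_measurable lebesgue" for t
    using bump_kernel_measurable by (intro measurable_completion) auto
  have lip: "\<bar>bump_kernel s y x - bump_kernel t y x\<bar> \<le> C * \<bar>s - t\<bar>" if "s > 0" "t > 0" for s t x
    using field_differentiable_bound[of "{0<..}" "\<lambda>t. bump_kernel t y x" "\<lambda>t. bump_kernel_deriv t y x" C s t]
      that C(2) has_field_derivative_at_within[OF bump_kernel_has_derivative] by auto
  have deriv: "(?M has_real_derivative 0) (at t)" if t: "t > 0" for t
    unfolding DERIV_def
  proof (subst LIMSEQ_SEQ_conv[symmetric], safe)
    fix S :: "nat \<Rightarrow> real" assume S: "\<forall>n. S n \<noteq> 0" "S \<longlonglongrightarrow> 0"
    \<comment> \<open>The difference quotient, set to 0 for the indices with |S n| >= t/2, so that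
      one dominating function on one ball serves all n. The ball of radius \<open>B\<close> contains
      the supports of all kernels with parameter above t/2.\<close>
    define q where "q n x = (if \<bar>S n\<bar> < t / 2 then (bump_kernel (t + S n) y x - bump_kernel t y x) / S n * f x else 0)" for n x
    define B where "B = norm y + 1 / sqrt (t / 2)"
    have ev: "\<forall>\<^sub>F n in sequentially. \<bar>S n\<bar> < t / 2"
      using tendstoD[OF S(2), of "t / 2"] t by (simp add: dist_norm)
    have "(\<lambda>n. LINT x|lebesgue. q n x) \<longlonglongrightarrow> (LINT x|lebesgue. bump_kernel_deriv t y x * f x)"
    proof (rule integral_dominated_convergence)
      show "(\<lambda>x. bump_kernel_deriv t y x * f x) \<in> borel_measurable lebesgue"
      proof (intro borel_measurable_times fm measurable_completion)
        show "bump_kernel_deriv t y \<in> borel_measurable lborel"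
          unfolding bump_kernel_deriv_def using test_bump_measurable by measurable
      qed
      show "q n \<in> borel_measurable lebesgue" for n
        unfolding q_def using km fm by (cases "\<bar>S n\<bar> < t / 2") (simp_all, measurable)
      show "integrable lebesgue (\<lambda>x. C * (indicator (cball 0 B) x *\<^sub>R \<bar>f x\<bar>))"
        using set_integrable_abs[OF locally_integrable_cball[OF f, of B]] unfolding set_integrable_def
        by (intro integrable_mult_right)
      have "(\<lambda>n. q n x) \<longlonglongrightarrow> bump_kernel_deriv t y x * f x" for x
      proof -
        have "(\<lambda>n. (bump_kernel (t + S n) y x - bump_kernel t y x) / S n) \<longlonglongrightarrow> bump_kernel_deriv t y x"
          using bump_kernel_has_derivative[of y x t] S unfolding DERIV_def
          by (subst (asm) LIMSEQ_SEQ_conv[symmetric]) auto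
        then have "(\<lambda>n. (bump_kernel (t + S n) y x - bump_kernel t y x) / S n * f x) \<longlonglongrightarrow> bump_kernel_deriv t y x * f x"
          by (intro tendsto_mult tendsto_const)
        then show ?thesis
          by (rule Lim_transform_eventually) (use ev in eventually_elim, auto simp: q_def)
      qed
      then show "AE x in lebesgue. (\<lambda>n. q n x) \<longlonglongrightarrow> bump_kernel_deriv t y x * f x" by simp
      have "norm (q n x) \<le> C * (indicator (cball 0 B) x *\<^sub>R \<bar>f x\<bar>)" for n x
      proof (cases "\<bar>S n\<bar> < t / 2 \<and> q n x \<noteq> 0")
        case True
        then have Sn: "\<bar>S n\<bar> < t / 2" and nz: "bump_kernel (t + S n) y x \<noteq> 0 \<or> bump_kernel t y x \<noteq> 0"
          by (auto simp: q_def)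
        have "t + S n > t / 2" using Sn by linarith
        then have "1 / sqrt (t + S n) \<le> 1 / sqrt (t / 2)" "1 / sqrt t \<le> 1 / sqrt (t / 2)"
          using t by (auto intro!: divide_left_mono mult_pos_pos)
        then have "dist x y < 1 / sqrt (t / 2)"
          using nz bump_kernel_supp[of "t + S n" y x] bump_kernel_supp[of t y x] t \<open>t + S n > t / 2\<close> by fastforce
        then have x: "x \<in> cball 0 B"
          using norm_triangle_ineq2[of x y] by (simp add: B_def dist_norm)
        have "\<bar>bump_kernel (t + S n) y x - bump_kernel t y x\<bar> \<le> C * \<bar>S n\<bar>"
          using lip[of "t + S n" t x] t \<open>t + S n > t / 2\<close> by simp
        then have "\<bar>(bump_kernel (t + S n) y x - bump_kernel t y x) / S n\<bar> \<le> C"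
          using S(1) by (simp add: field_simps)
        then have "\<bar>(bump_kernel (t + S n) y x - bump_kernel t y x) / S n\<bar> * \<bar>f x\<bar> \<le> C * \<bar>f x\<bar>"
          by (rule mult_right_mono) simp
        then show ?thesis using x Sn by (simp add: q_def abs_mult)
      next
        case False
        then have "q n x = 0" by (auto simp: q_def)
        then show ?thesis using C(1) by simp
      qed
      then show "AE x in lebesgue. norm (q n x) \<le> C * (indicator (cball 0 B) x *\<^sub>R \<bar>f x\<bar>)" for n by simp
    qed
    then have "(\<lambda>n. LINT x|lebesgue. q n x) \<longlonglongrightarrow> 0" using orth[OF t] by simp
    then show "(\<lambda>n. (?M (t + S n) - ?M t) / S n) \<longlonglongrightarrow> 0"
    proof (rule Lim_transform_eventually)
      show "\<forall>\<^sub>F n in sequentially. (LINT x|lebesgue. q n x) = (?M (t + S n) - ?M t) / S n"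
        using ev
      proof eventually_elim
        case (elim n)
        then have "t + S n > 0" using t by linarith
        then have "?M (t + S n) - ?M t = (LINT x|lebesgue. bump_kernel (t + S n) y x * f x - bump_kernel t y x * f x)"
          by (intro Bochner_Integration.integral_diff[symmetric] bump_kernel_mult_integrable f t)
        moreover have "q n x = (bump_kernel (t + S n) y x * f x - bump_kernel t y x * f x) / S n" for x
          using elim by (simp add: q_def left_diff_distrib)
        ultimately show ?case by simp
      qed
    qed
  qed
  have "\<exists>c. \<forall>t\<in>{0<..}. ?M t = c"
    by (rule has_field_derivative_zero_constant) (use deriv in \<open>auto intro: has_field_derivative_at_within\<close>)
  then show ?thesis by auto
qed

context plane_lattice begin

text \<open>A Liouville estimate. At radius about r, moving the center by a fixed distance changes
  the kernel by O(r^-3), while |f| has mass O(r^2) on the ball of radius r by periodicity. The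
  difference of the two means is therefore O(1/r).\<close>

lemma periodic_kernel_mean_translation:
  assumes f: "locally_integrable f" "torus_periodic u v f"
    and const: "\<And>t. t > 0 \<Longrightarrow> (LINT x|lebesgue. bump_kernel t y x * f x) = a" "\<And>t. t > 0 \<Longrightarrow> (LINT x|lebesgue. bump_kernel t 0 x * f x) = b"
  shows "a = b"
proof -
  obtain C where C: "C > 0" "\<And>s. s \<le> 1 \<Longrightarrow> \<bar>bump (bump_deriv (bump_deriv 1)) s\<bar> \<le> C"
    using bump_bounded by blast
  have lip: "\<bar>bump (bump_deriv 1) s - bump (bump_deriv 1) s'\<bar> \<le> C * \<bar>s - s'\<bar>" if "s \<le> 1" "s' \<le> 1" for s s'
    using field_differentiable_bound[of "{..1}" "bump (bump_deriv 1)" "bump (bump_deriv (bump_deriv 1))" C s s']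
      that C(2) bump_has_derivative by (auto intro: has_field_derivative_at_within)
  have fa: "locally_integrable (\<lambda>x. \<bar>f x\<bar>)" "torus_periodic u v (\<lambda>x. \<bar>f x\<bar>)"
    using f by (auto simp: locally_integrable_def intro: set_integrable_abs torus_periodic_comp)
  define c where "c = norm y"
  have c0: "c \<ge> 0" by (simp add: c_def)
  define I where "I r = (LINT x:ball 0 r|lebesgue. \<bar>f x\<bar>)" for r
  have le: "\<bar>a - b\<bar> \<le> (C * c * (2 * r + c) / (r - c)^4) * I r" if r: "r > c" for r
  proof -
    \<comment> \<open>The kernel radius becomes r - c, so the kernels centered at \<open>y\<close>
      and at 0 both live in the ball of radius r.\<close>
    define t where "t = 1 / (r - c)\<^sup>2"
    have t: "t > 0" using r by (simp add: t_def)
    have st: "1 / sqrt t = r - c" using r by (simp add: t_def real_sqrt_divide)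
    have i: "integrable lebesgue (\<lambda>x. bump_kernel t y x * f x)" "integrable lebesgue (\<lambda>x. bump_kernel t 0 x * f x)"
      by (intro bump_kernel_mult_integrable f t)+
    have bd: "\<bar>(bump_kernel t y x - bump_kernel t 0 x) * f x\<bar> \<le> (C * c * (2 * r + c) / (r - c)^4) * (indicator (ball 0 r) x *\<^sub>R \<bar>f x\<bar>)" for x
    proof (cases "bump_kernel t y x = 0 \<and> bump_kernel t 0 x = 0")
      case True
      then show ?thesis using C(1) c0 r by auto
    next
      case False
      then have x: "norm x < r"
      proof -
        have "dist x y < r - c \<or> dist x 0 < r - c"
          using False bump_kernel_supp[OF t, of y x] bump_kernel_supp[OF t, of 0 x] unfolding st by blast
        then show ?thesis
        proof
          assume "dist x y < r - c"
          moreover have "norm x \<le> norm (x - y) + c" using norm_triangle_ineq2[of x y] unfolding c_def by linarith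
          ultimately show ?thesis unfolding dist_norm by linarith
        next
          assume "dist x 0 < r - c"
          then show ?thesis using c0 by simp
        qed
      qed
      have "\<bar>(norm (x - y))\<^sup>2 - (norm x)\<^sup>2\<bar> = \<bar>norm (x - y) - norm x\<bar> * (norm (x - y) + norm x)"
      proof -
        have "(norm (x - y))\<^sup>2 - (norm x)\<^sup>2 = (norm (x - y) - norm x) * (norm (x - y) + norm x)"
          by (simp add: power2_eq_square algebra_simps)
        then show ?thesis by (simp add: abs_mult)
      qed
      also have "\<dots> \<le> c * (2 * r + c)"
        using norm_triangle_ineq3[of "x - y" x] norm_triangle_ineq4[of x y] x c0
        by (intro mult_mono) (auto simp: c_def norm_minus_commute)
      finally have d: "\<bar>(norm (x - y))\<^sup>2 - (norm x)\<^sup>2\<bar> \<le> c * (2 * r + c)" .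
      have "\<bar>bump_kernel t y x - bump_kernel t 0 x\<bar> = t * \<bar>bump (bump_deriv 1) (1 - t * (norm (x - y))\<^sup>2) - bump (bump_deriv 1) (1 - t * (norm x)\<^sup>2)\<bar>"
        using t by (simp add: bump_kernel_def test_bump_def abs_mult flip: right_diff_distrib)
      also have "\<dots> \<le> t * (C * \<bar>(1 - t * (norm (x - y))\<^sup>2) - (1 - t * (norm x)\<^sup>2)\<bar>)"
        using t by (intro mult_left_mono lip) auto
      also have "(1 - t * (norm (x - y))\<^sup>2) - (1 - t * (norm x)\<^sup>2) = t * ((norm x)\<^sup>2 - (norm (x - y))\<^sup>2)"
        by (simp add: algebra_simps)
      also have "\<bar>t * ((norm x)\<^sup>2 - (norm (x - y))\<^sup>2)\<bar> = t * \<bar>(norm (x - y))\<^sup>2 - (norm x)\<^sup>2\<bar>"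
        using t by (simp add: abs_mult abs_minus_commute)
      also have "t * (C * (t * \<bar>(norm (x - y))\<^sup>2 - (norm x)\<^sup>2\<bar>)) \<le> t * (C * (t * (c * (2 * r + c))))"
        using t C(1) d by (intro mult_left_mono) auto
      also have "\<dots> = C * c * (2 * r + c) / (r - c)^4"
        by (simp add: t_def power2_eq_square power4_eq_xxxx mult.assoc)
      finally have "\<bar>bump_kernel t y x - bump_kernel t 0 x\<bar> * \<bar>f x\<bar> \<le> (C * c * (2 * r + c) / (r - c)^4) * \<bar>f x\<bar>"
        by (rule mult_right_mono) simp
      then show ?thesis using x by (simp add: abs_mult)
    qed
    have "\<bar>a - b\<bar> = \<bar>LINT x|lebesgue. (bump_kernel t y x - bump_kernel t 0 x) * f x\<bar>"
      using const[OF t] i by (simp add: left_diff_distrib)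
    also have "\<dots> \<le> (LINT x|lebesgue. \<bar>(bump_kernel t y x - bump_kernel t 0 x) * f x\<bar>)"
      by (rule integral_abs_bound)
    also have "\<dots> \<le> (LINT x|lebesgue. (C * c * (2 * r + c) / (r - c)^4) * (indicator (ball 0 r) x *\<^sub>R \<bar>f x\<bar>))"
    proof (rule integral_mono[OF _ _ bd])
      show "integrable lebesgue (\<lambda>x. \<bar>(bump_kernel t y x - bump_kernel t 0 x) * f x\<bar>)"
        using i by (simp add: left_diff_distrib)
      show "integrable lebesgue (\<lambda>x. (C * c * (2 * r + c) / (r - c)^4) * (indicator (ball 0 r) x *\<^sub>R \<bar>f x\<bar>))"
        using locally_integrable_bounded[OF fa(1), of "ball 0 r"] unfolding set_integrable_def
        by (intro integrable_mult_right) auto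
    qed
    also have "\<dots> = (C * c * (2 * r + c) / (r - c)^4) * I r"
      by (simp add: I_def set_lebesgue_integral_def)
    finally show ?thesis .
  qed
  have "((\<lambda>r. (C * c * (2 * r + c) * r\<^sup>2 / (r - c)^4) * (I r / r\<^sup>2)) \<longlongrightarrow> 0 * (pi * mean (\<lambda>x. \<bar>f x\<bar>))) at_top"
    unfolding I_def
  proof (intro tendsto_mult average_ball fa)
    show "((\<lambda>r. C * c * (2 * r + c) * r\<^sup>2 / (r - c)^4) \<longlongrightarrow> 0) at_top" by real_asymp
  qed
  then have "((\<lambda>r. (C * c * (2 * r + c) * r\<^sup>2 / (r - c)^4) * (I r / r\<^sup>2)) \<longlongrightarrow> 0) at_top" by simp
  moreover have "\<forall>\<^sub>F r in at_top. \<bar>a - b\<bar> \<le> (C * c * (2 * r + c) * r\<^sup>2 / (r - c)^4) * (I r / r\<^sup>2)"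
    using eventually_gt_at_top[of c] eventually_gt_at_top[of 0]
  proof eventually_elim
    case (elim r)
    then show ?case using le[OF elim(1)] by simp
  qed
  ultimately have "\<bar>a - b\<bar> \<le> 0"
    by (rule tendsto_lowerbound) simp
  then show ?thesis by simp
qed

end

text \<open>In place of a differentiation theorem the means are integrated over centers y in a box.
  By Fubini this is the integral of \<open>f\<close> against the smoothed indicator of the box, and
  as the kernels concentrate it yields c0 times the integral of \<open>f\<close> over the box, to be
  compared with m times its volume.\<close>

lemma AE_eq_const_if_bump_kernel_means_const:
  fixes f :: "real^2 \<Rightarrow> real"
  assumes f: "locally_integrable f"
    and const: "\<And>t y. t > 0 \<Longrightarrow> (LINT x|lebesgue. bump_kernel t y x * f x) = m"
  shows "AE x in lebesgue. f x = m / (pi * exp (- 1))"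
proof -
  define c0 where "c0 = pi * exp (- 1 :: real)"
  have c0: "c0 > 0" by (simp add: c0_def)
  \<comment> \<open>A Borel representative, so that Fubini can be applied on the product of Borel
    measures.\<close>
  obtain f0 where f0 [measurable]: "f0 \<in> borel_measurable lborel" and ae: "AE x in lborel. f x = f0 x"
    using completion_ex_borel_measurable_real[OF locally_integrable_measurable[OF f]] by blast
  have aeL: "AE x in lebesgue. f x = f0 x" using ae by (rule AE_completion)
  have sets_eq: "sets lebesgue = sets (completion lborel)" by simp
  have km [measurable]: "bump_kernel t y \<in> borel_measurable borel" for t y by (rule bump_kernel_measurable)
  have int_f0: "integrable lborel (\<lambda>x. h x * f0 x)"
    if [measurable]: "h \<in> borel_measurable borel" and "\<And>x. \<bar>h x\<bar> \<le> C" "\<And>x. norm x > R \<Longrightarrow> h x = 0" for h C R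
  proof -
    have "integrable lebesgue (\<lambda>x. h x * f x)"
      by (rule locally_integrable_bounded_mult[OF f _ that(2,3)]) (intro measurable_completion, auto)
    then have "integrable lebesgue (\<lambda>x. h x * f0 x)"
    proof (rule integrable_cong_AE_imp)
      show "(\<lambda>x. h x * f0 x) \<in> borel_measurable lebesgue" by (intro measurable_completion) measurable
      show "AE x in lebesgue. h x * f x = h x * f0 x" using aeL by eventually_elim simp
    qed
    then show ?thesis by (subst (asm) integrable_completion) auto
  qed
  have m: "(LINT x|lborel. bump_kernel t y x * f0 x) = m" if t: "t > 0" for t y
  proof -
    have "(LINT x|lborel. bump_kernel t y x * f0 x) = (LINT x|lebesgue. bump_kernel t y x * f0 x)"
      by (rule integral_completion[symmetric]) measurable
    also have "\<dots> = (LINT x|lebesgue. bump_kernel t y x * f x)"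
    proof (rule integral_cong_AE)
      show "(\<lambda>x. bump_kernel t y x * f0 x) \<in> borel_measurable lebesgue" by (intro measurable_completion) measurable
      show "(\<lambda>x. bump_kernel t y x * f x) \<in> borel_measurable lebesgue"
        using bump_kernel_mult_integrable[OF f t] by auto
      show "AE x in lebesgue. bump_kernel t y x * f0 x = bump_kernel t y x * f x" using aeL by eventually_elim simp
    qed
    finally show ?thesis using const[OF t] by simp
  qed
  have pairm [measurable]: "(\<lambda>p. bump_kernel t (snd p) (fst p)) \<in> borel_measurable (borel \<Otimes>\<^sub>M borel)" for t
    unfolding bump_kernel_def test_bump_def by measurable
  have box: "(LINT x|lborel. indicator (box a b) x * (c0 * f0 x - m)) = 0" for a b :: "real^2"
  proof -
    \<comment> \<open>The indicator of the box smoothed by the kernel: equal to \<open>c0\<close>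
      well inside, 0 well outside, and between these values in general.\<close>
    define w where "w t x = (LINT y|lborel. indicator (box a b) y * bump_kernel t y x)" for t x
    have ki: "integrable lborel (\<lambda>y. indicat_real (box a b) y * bump_kernel t y x)" if "t > 0" for t x
    proof (rule Bochner_Integration.integrable_bound)
      show "integrable lborel (bump_kernel t x)" by (rule bump_kernel_integral[OF that])
      show "(\<lambda>y. indicat_real (box a b) y * bump_kernel t y x) \<in> borel_measurable lborel"
        unfolding bump_kernel_sym[of t _ x] by measurable
      show "AE y in lborel. norm (indicat_real (box a b) y * bump_kernel t y x) \<le> norm (bump_kernel t x y)"
        unfolding bump_kernel_sym[of t _ x] by (auto simp: indicator_def)
    qed
    have w0: "0 \<le> w t x" "w t x \<le> c0" if t: "t > 0" for t x
    proof -
      show "0 \<le> w t x" unfolding w_def using bump_kernel_nonneg[OF t] by (intro integral_nonneg_AE) auto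
      have "w t x \<le> (LINT y|lborel. bump_kernel t x y)"
        unfolding w_def using bump_kernel_nonneg[OF t]
        by (intro integral_mono ki t bump_kernel_integral[OF t]) (auto simp: indicator_def bump_kernel_sym[of t x])
      then show "w t x \<le> c0" by (simp add: bump_kernel_integral[OF t] c0_def)
    qed
    have w_in: "w t x = c0" if t: "t > 0" and "ball x (1 / sqrt t) \<subseteq> box a b" for t x
    proof -
      have "indicator (box a b) y * bump_kernel t y x = bump_kernel t x y" for y
        using bump_kernel_supp[OF t, of y x] that(2) by (force simp: bump_kernel_sym[of t x] indicator_def subset_iff)
      then show ?thesis unfolding w_def by (simp add: bump_kernel_integral[OF t] c0_def)
    qed
    have w_out: "w t x = 0" if t: "t > 0" and "ball x (1 / sqrt t) \<inter> box a b = {}" for t x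
    proof -
      have *: "indicator (box a b) y * bump_kernel t y x = 0" for y
        using bump_kernel_supp[OF t, of y x] that(2) by (force simp: indicator_def)
      show ?thesis unfolding w_def * by simp
    qed
    have wm [measurable]: "w t \<in> borel_measurable borel" for t
    proof -
      have [measurable]: "(\<lambda>p. indicat_real (box a b) (snd p) * bump_kernel t (snd p) (fst p)) \<in> borel_measurable (borel \<Otimes>\<^sub>M lborel)"
        by (subst measurable_cong_sets[OF sets_pair_measure_cong[OF refl sets_lborel] refl]) measurable
      show ?thesis unfolding w_def
        by (rule lborel.borel_measurable_lebesgue_integral) (simp add: case_prod_beta)
    qed
    obtain R where R: "R > 0" "box a b \<subseteq> ball 0 R"
      using bounded_subset_ballD[OF bounded_box, of a b 0] by blast
    have w_far: "w t x = 0" if "t \<ge> 1" "norm x > R + 1" for t x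
    proof (rule w_out)
      have "1 / sqrt t \<le> 1" using that by simp
      show "ball x (1 / sqrt t) \<inter> box a b = {}"
      proof (rule equals0I)
        fix z assume "z \<in> ball x (1 / sqrt t) \<inter> box a b"
        then have "norm (x - z) < 1" "norm z < R" using \<open>1 / sqrt t \<le> 1\<close> R by (auto simp: dist_norm)
        then show False using that norm_triangle_ineq2[of x z] by linarith
      qed
    qed (use that in auto)
    \<comment> \<open>The scale (n + 1)^2 gives the kernel radius 1/(n + 1). Convergence can fail
      only on the boundary of the box, which is a null set.\<close>
    have lim: "AE x in lborel. (\<lambda>n. w ((real (Suc n))\<^sup>2) x * f0 x) \<longlonglongrightarrow> c0 * indicator (box a b) x * f0 x"
    proof -
      have "AE x in lborel. x \<notin> cbox a b - box a b"
      proof (rule AE_not_in)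
        have "negligible (cbox a b - box a b)" by (rule negligible_frontier_interval)
        then show "cbox a b - box a b \<in> null_sets lborel"
          by (auto simp: negligible_iff_null_sets null_sets_completion_iff)
      qed
      then show ?thesis
      proof eventually_elim
        case (elim x)
        have sq: "sqrt ((real (Suc n))\<^sup>2) = real (Suc n)" for n by simp
        have ev: "\<forall>\<^sub>F n in sequentially. 1 / real (Suc n) < e" if "e > 0" for e
          using LIMSEQ_inverse_real_of_nat[THEN tendstoD, OF that] by (simp add: inverse_eq_divide dist_norm)
        show ?case
        proof (cases "x \<in> box a b")
          case True
          obtain e where e: "e > 0" "ball x e \<subseteq> box a b" using open_box True open_contains_ball by blast
          have "\<forall>\<^sub>F n in sequentially. c0 * indicator (box a b) x * f0 x = w ((real (Suc n))\<^sup>2) x * f0 x"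
            using ev[OF e(1)]
          proof eventually_elim
            case (elim n)
            have "ball x (1 / sqrt ((real (Suc n))\<^sup>2)) \<subseteq> box a b" using e(2) elim unfolding sq by (meson order_trans subset_ball less_imp_le)
            then have "w ((real (Suc n))\<^sup>2) x = c0" by (intro w_in) auto
            then show ?case using True by simp
          qed
          then show ?thesis by (rule Lim_transform_eventually[OF tendsto_const])
        next
          case False
          then have "x \<in> - cbox a b" using elim by auto
          then obtain e where e: "e > 0" "ball x e \<subseteq> - cbox a b"
            using open_Compl[OF closed_cbox, of a b] open_contains_ball by blast
          have "\<forall>\<^sub>F n in sequentially. c0 * indicator (box a b) x * f0 x = w ((real (Suc n))\<^sup>2) x * f0 x"
            using ev[OF e(1)]
          proof eventually_elim
            case (elim n)
            have "ball x (1 / sqrt ((real (Suc n))\<^sup>2)) \<subseteq> - cbox a b" using e(2) elim unfolding sq by (meson order_trans subset_ball less_imp_le)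
            then have "w ((real (Suc n))\<^sup>2) x = 0" using box_subset_cbox[of a b] by (intro w_out) auto
            then show ?case using False by simp
          qed
          then show ?thesis by (rule Lim_transform_eventually[OF tendsto_const])
        qed
      qed
    qed
    have fub: "(LINT x|lborel. w t x * f0 x) = m * measure lborel (box a b)" if t1: "t \<ge> 1" for t
    proof -
      have t: "t > 0" using t1 by simp
      have int: "integrable (lborel \<Otimes>\<^sub>M lborel) (\<lambda>(x, y). indicat_real (box a b) y * bump_kernel t y x * f0 x)"
      proof (rule lborel_pair.Fubini_integrable)
        show "(\<lambda>(x, y). indicat_real (box a b) y * bump_kernel t y x * f0 x) \<in> borel_measurable (lborel \<Otimes>\<^sub>M lborel)"
          by (subst measurable_cong_sets[OF sets_pair_measure_cong[OF sets_lborel sets_lborel] refl])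
             (use f0 in \<open>simp add: case_prod_beta, measurable\<close>)
        have "(LINT y|lborel. norm (indicat_real (box a b) y * bump_kernel t y x * f0 x)) = w t x * \<bar>f0 x\<bar>" for x
        proof -
          have "norm (indicat_real (box a b) y * bump_kernel t y x * f0 x) = indicat_real (box a b) y * bump_kernel t y x * \<bar>f0 x\<bar>" for y
            using bump_kernel_nonneg[OF t] by (simp add: abs_mult)
          then show ?thesis unfolding w_def by simp
        qed
        moreover have "integrable lborel (\<lambda>x. \<bar>w t x * f0 x\<bar>)"
          by (rule integrable_abs, rule int_f0[of _ c0 "R + 1", OF wm]) (use w0[OF t] w_far t1 in \<open>auto simp: abs_of_nonneg\<close>)
        moreover have "\<bar>w t x * f0 x\<bar> = w t x * \<bar>f0 x\<bar>" for x using w0[OF t] by (simp add: abs_mult)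
        ultimately show "integrable lborel (\<lambda>x. LINT y|lborel. norm (case (x, y) of (x, y) \<Rightarrow> indicat_real (box a b) y * bump_kernel t y x * f0 x))"
          by simp
        show "AE x in lborel. integrable lborel (\<lambda>y. case (x, y) of (x, y) \<Rightarrow> indicat_real (box a b) y * bump_kernel t y x * f0 x)"
          using ki[OF t] by auto
      qed
      have "(LINT x|lborel. w t x * f0 x) = (LINT x|lborel. LINT y|lborel. indicat_real (box a b) y * bump_kernel t y x * f0 x)"
        unfolding w_def by simp
      also have "\<dots> = (LINT y|lborel. LINT x|lborel. indicat_real (box a b) y * bump_kernel t y x * f0 x)"
        using lborel_pair.Fubini_integral[of "\<lambda>x y. indicat_real (box a b) y * bump_kernel t y x * f0 x"] int by simp
      also have "\<dots> = (LINT y|lborel. indicat_real (box a b) y * m)"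
        using m[OF t] by (simp add: mult.assoc)
      also have "\<dots> = m * measure lborel (box a b)" by simp
      finally show ?thesis .
    qed
    have "(\<lambda>n. LINT x|lborel. w ((real (Suc n))\<^sup>2) x * f0 x) \<longlonglongrightarrow> (LINT x|lborel. c0 * indicator (box a b) x * f0 x)"
    proof (rule integral_dominated_convergence[OF _ _ _ lim])
      show "integrable lborel (\<lambda>x. \<bar>(c0 * indicator (cball 0 (R + 1)) x) * f0 x\<bar>)"
        by (intro integrable_abs int_f0[of _ c0 "R + 1"]) (use c0 in \<open>auto intro!: borel_measurable_times borel_measurable_const borel_measurable_indicator split: split_indicator\<close>)
      have "norm (w t x * f0 x) \<le> \<bar>(c0 * indicator (cball 0 (R + 1)) x) * f0 x\<bar>" if "t \<ge> 1" for t x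
        using w0[of t x] w_far[of t x] c0 that by (auto simp: abs_mult mult_right_mono indicator_def not_le)
      then show "AE x in lborel. norm (w ((real (Suc n))\<^sup>2) x * f0 x) \<le> \<bar>(c0 * indicator (cball 0 (R + 1)) x) * f0 x\<bar>" for n by simp
    qed measurable
    moreover have "(LINT x|lborel. w ((real (Suc n))\<^sup>2) x * f0 x) = m * measure lborel (box a b)" for n
      by (rule fub) simp
    ultimately have "m * measure lborel (box a b) = (LINT x|lborel. c0 * indicator (box a b) x * f0 x)"
      by (simp add: LIMSEQ_const_iff)
    moreover have i1: "integrable lborel (\<lambda>x. c0 * indicator (box a b) x * f0 x)"
      by (rule int_f0[of _ c0 R]) (use c0 R in \<open>auto intro!: borel_measurable_times borel_measurable_const borel_measurable_indicator split: split_indicator\<close>)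
    moreover have i2: "integrable lborel (\<lambda>x. indicat_real (box a b) x * m)"
      by (intro integrable_mult_left integrable_real_indicator) (auto simp: emeasure_lborel_box_eq)
    moreover have "(LINT x|lborel. indicator (box a b) x * (c0 * f0 x - m)) = (LINT x|lborel. c0 * indicator (box a b) x * f0 x - indicat_real (box a b) x * m)"
      by (simp add: algebra_simps)
    ultimately show ?thesis by (simp add: mult.commute[of m])
  qed
  have "AE x in lborel. c0 * f0 x - m = 0"
  proof (rule AE_zero_if_box_integrals_zero[OF _ _ box])
    fix a b :: "real^2"
    obtain R where R: "R > 0" "box a b \<subseteq> ball 0 R"
      using bounded_subset_ballD[OF bounded_box, of a b 0] by blast
    have i1: "integrable lborel (\<lambda>x. c0 * indicator (box a b) x * f0 x)"
      by (rule int_f0[of _ c0 R]) (use c0 R in \<open>auto intro!: borel_measurable_times borel_measurable_const borel_measurable_indicator split: split_indicator\<close>)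
    have i2: "integrable lborel (\<lambda>x. indicat_real (box a b) x * m)"
      by (intro integrable_mult_left integrable_real_indicator) (auto simp: emeasure_lborel_box_eq)
    have "integrable lborel (\<lambda>x. c0 * indicator (box a b) x * f0 x - indicat_real (box a b) x * m)"
      using i1 i2 by (rule Bochner_Integration.integrable_diff)
    then show "integrable lborel (\<lambda>x. indicator (box a b) x * (c0 * f0 x - m))"
      by (simp add: algebra_simps)
  qed measurable
  then have "AE x in lebesgue. c0 * f0 x - m = 0" by (rule AE_completion)
  with aeL show ?thesis
    by eventually_elim (use c0 in \<open>simp add: c0_def field_simps\<close>)
qed

text \<open>A Liouville theorem at the level of distributions. Regularity of \<open>f\<close> is
  never established on the way; only bumps of all scales and centers are tested.\<close>

theorem (in plane_lattice) periodic_weakly_harmonic_const: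
  fixes f :: "real^2 \<Rightarrow> real"
  assumes f: "locally_integrable f" "torus_periodic u v f"
    and harm: "\<And>t y. t > 0 \<Longrightarrow> distr_laplacian f (test_bump 1 t y) = 0"
  shows "\<exists>c. AE x in lebesgue. f x = c"
proof -
  have "\<forall>y. \<exists>c. \<forall>t>0. (LINT x|lebesgue. bump_kernel t y x * f x) = c"
    using weakly_harmonic_kernel_mean_const[OF f(1) harm] by blast
  then obtain c where c: "\<And>y t. t > 0 \<Longrightarrow> (LINT x|lebesgue. bump_kernel t y x * f x) = c y" by metis
  have "c y = c 0" for y
    by (rule periodic_kernel_mean_translation[OF f c c])
  then show ?thesis
    using AE_eq_const_if_bump_kernel_means_const[OF f(1), of "c 0"] c by auto
qed

section \<open>Integration by parts in complex notation\<close>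

lemma integrable_continuous_compact_support:
  fixes F :: "real^2 \<Rightarrow> 'b::euclidean_space"
  assumes "continuous_on UNIV F" and supp: "\<And>x. norm x > R \<Longrightarrow> F x = 0"
  shows "integrable lebesgue F"
proof -
  have "integrable lborel (\<lambda>x. indicator (cball 0 R) x *\<^sub>R F x)"
    by (rule borel_integrable_compact) (use assms in \<open>auto intro: continuous_on_subset\<close>)
  moreover have "indicator (cball 0 R) x *\<^sub>R F x = F x" for x
    using supp[of x] by (auto simp: indicator_def)
  ultimately have "integrable lborel F" by simp
  then show ?thesis
    by (subst integrable_completion) (auto intro: borel_measurable_continuous_onI assms)
qed

lemma continuous_compact_support_bounded:
  fixes F :: "real^2 \<Rightarrow> 'b::real_normed_vector"
  assumes "continuous_on UNIV F" and supp: "\<And>x. norm x > R \<Longrightarrow> F x = 0"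
  obtains C where "C > 0" "\<And>x. norm (F x) \<le> C"
proof -
  have "bounded (F ` cball 0 R)"
    by (intro compact_imp_bounded compact_continuous_image continuous_on_subset[OF assms(1)]) auto
  then obtain C where C: "C > 0" "\<And>x. x \<in> cball 0 R \<Longrightarrow> norm (F x) \<le> C"
    unfolding bounded_pos by (auto simp: image_iff)
  show ?thesis
  proof (rule that[OF C(1)])
    show "norm (F x) \<le> C" for x using C supp[of x] by (cases "norm x \<le> R") auto
  qed
qed

lemma derivative_zero_outside:
  assumes "(F has_derivative F') (at x)" and "\<And>x. norm x > R \<Longrightarrow> F x = 0" "norm (x::'a::real_normed_vector) > R"
  shows "F' = (\<lambda>h. 0)"
proof -
  have "open {x::'a. norm x > R}" by (intro open_Collect_less continuous_intros)
  then have "((\<lambda>x. 0) has_derivative F') (at x)"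
    using assms by (intro has_derivative_transform_within_open[OF assms(1)]) auto
  then show ?thesis using has_derivative_unique[OF _ has_derivative_const] by blast
qed

text \<open>The integral of a difference quotient vanishes by translation invariance.\<close>

lemma integral_derivative_eq_0:
  fixes F :: "real^2 \<Rightarrow> 'b::euclidean_space"
  assumes der: "\<And>x. (F has_derivative F' x) (at x)" and cont: "continuous_on UNIV (\<lambda>x. F' x h)"
    and supp: "\<And>x. norm x > R \<Longrightarrow> F x = 0"
  shows "(LINT x|lebesgue. F' x h) = 0"
proof -
  have F: "continuous_on UNIV F"
    by (rule has_derivative_continuous_on) (rule has_derivative_at_withinI[OF der])
  have int: "integrable lebesgue F" by (rule integrable_continuous_compact_support[OF F supp])
  have supp': "F' x h = 0" if "norm x > R" for x
    using derivative_zero_outside[OF der supp that] by simp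
  obtain C where C: "C > 0" "\<And>x. norm (F' x h) \<le> C"
    using continuous_compact_support_bounded[OF cont supp'] by metis
  define q where "q n x = (F (x + (1 / real (Suc n)) *\<^sub>R h) - F x) /\<^sub>R (1 / real (Suc n))" for n x
  \<comment> \<open>The steps in direction \<open>h\<close> have length at most |h|, so all
    difference quotients vanish outside this radius.\<close>
  define B where "B = R + norm h"
  have "(\<lambda>n. LINT x|lebesgue. q n x) \<longlonglongrightarrow> (LINT x|lebesgue. F' x h)"
  proof (rule integral_dominated_convergence)
    show "(\<lambda>x. F' x h) \<in> borel_measurable lebesgue"
      using integrable_continuous_compact_support[OF cont supp'] by auto
    show "q n \<in> borel_measurable lebesgue" for n
    proof -
      have "(\<lambda>x. F (x + (1 / real (Suc n)) *\<^sub>R h)) \<in> borel_measurable lebesgue"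
        using int by (subst borel_measurable_shift_iff) auto
      then show ?thesis unfolding q_def using int by measurable
    qed
    have "integrable lborel (indicat_real (cball (0::real^2) B))"
      using emeasure_bounded_finite[of "cball (0::real^2) B"] by (intro integrable_real_indicator) auto
    then have "integrable lebesgue (indicat_real (cball (0::real^2) B))"
      by (subst integrable_completion) auto
    then show "integrable lebesgue (\<lambda>x. C * indicat_real (cball (0::real^2) B) x)"
      by (rule integrable_mult_right)
    have "(\<lambda>n. q n x) \<longlonglongrightarrow> F' x h" for x
    proof -
      have g: "((\<lambda>s. F (x + s *\<^sub>R h)) has_vector_derivative F' x h) (at 0)"
      proof -
        have "((\<lambda>s. F (x + s *\<^sub>R h)) has_derivative (\<lambda>s. F' (x + 0 *\<^sub>R h) (s *\<^sub>R h))) (at 0)"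
          by (rule has_derivative_compose[of "\<lambda>s. x + s *\<^sub>R h" _ _ _ F, OF _ der])
             (auto intro!: derivative_eq_intros)
        moreover have "F' x (s *\<^sub>R h) = s *\<^sub>R F' x h" for s
          using linear_scale[OF has_derivative_linear[OF der]] by simp
        ultimately show ?thesis by (simp add: has_vector_derivative_def)
      qed
      then have "((\<lambda>s. norm ((1 / \<bar>s\<bar>) *\<^sub>R (F (x + s *\<^sub>R h) - (F x + s *\<^sub>R F' x h)))) \<longlongrightarrow> 0) (at 0)"
        by (intro tendsto_norm_zero) (simp add: has_vector_derivative_def has_derivative_at2)
      then have "((\<lambda>s. norm ((F (x + s *\<^sub>R h) - F x) /\<^sub>R s - F' x h)) \<longlongrightarrow> 0) (at 0)"
      proof (rule Lim_transform_eventually)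
        have "norm ((1 / \<bar>s\<bar>) *\<^sub>R (F (x + s *\<^sub>R h) - (F x + s *\<^sub>R F' x h))) = norm ((F (x + s *\<^sub>R h) - F x) /\<^sub>R s - F' x h)"
          if "s \<noteq> 0" for s
        proof -
          have "(F (x + s *\<^sub>R h) - F x) /\<^sub>R s - F' x h = (1 / s) *\<^sub>R (F (x + s *\<^sub>R h) - (F x + s *\<^sub>R F' x h))"
            using that by (simp add: algebra_simps divide_inverse)
          then show ?thesis by simp
        qed
        then show "\<forall>\<^sub>F s in at 0. norm ((1 / \<bar>s\<bar>) *\<^sub>R (F (x + s *\<^sub>R h) - (F x + s *\<^sub>R F' x h))) = norm ((F (x + s *\<^sub>R h) - F x) /\<^sub>R s - F' x h)"
          by (simp add: eventually_at_filter)
      qed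
      then have "((\<lambda>s. (F (x + s *\<^sub>R h) - F x) /\<^sub>R s) \<longlongrightarrow> F' x h) (at 0)"
        by (subst Lim_null) (rule tendsto_norm_zero_cancel)
      moreover have "filterlim (\<lambda>n. 1 / real (Suc n)) (at 0) sequentially"
        unfolding filterlim_at using LIMSEQ_inverse_real_of_nat by (auto simp: inverse_eq_divide)
      ultimately show ?thesis unfolding q_def by (rule filterlim_compose)
    qed
    then show "AE x in lebesgue. (\<lambda>n. q n x) \<longlonglongrightarrow> F' x h" by simp
    have "norm (q n x) \<le> C * indicat_real (cball (0::real^2) B) x" for n x
    proof (cases "norm x > B")
      case True
      have "norm ((1 / real (Suc n)) *\<^sub>R h) \<le> norm h" by (simp add: field_simps mult_left_le)
      then have "norm (x + (1 / real (Suc n)) *\<^sub>R h) > R"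
        using True norm_triangle_ineq2[of x "- (1 / real (Suc n)) *\<^sub>R h"] by (simp add: B_def)
      moreover have "norm x > R" using True by (simp add: B_def) (use norm_ge_zero[of h] in linarith)
      ultimately have "q n x = 0" unfolding q_def by (simp only: supp) simp
      then show ?thesis using C(1) by simp
    next
      case False
      define s where "s = 1 / real (Suc n)"
      have s: "s > 0" by (simp add: s_def)
      have der_line: "((\<lambda>s. F (x + s *\<^sub>R h)) has_derivative (\<lambda>s'. F' (x + s *\<^sub>R h) (s' *\<^sub>R h))) (at s)" for s
        by (rule has_derivative_compose[of "\<lambda>s. x + s *\<^sub>R h" _ _ _ F, OF _ der])
           (auto intro!: derivative_eq_intros)
      \<comment> \<open>The mean value inequality along the segment bounds all difference quotients
        by the same constant, which is the domination.\<close>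
      have "\<exists>t\<in>{0<..<s}. norm (F (x + s *\<^sub>R h) - F (x + 0 *\<^sub>R h)) \<le> norm (F' (x + t *\<^sub>R h) ((s - 0) *\<^sub>R h))"
      proof (rule mvt_general[OF s _ der_line])
        show "continuous_on {0..s} (\<lambda>s. F (x + s *\<^sub>R h))"
          by (intro continuous_on_compose2[OF F] continuous_intros) auto
      qed
      then obtain t where t: "norm (F (x + s *\<^sub>R h) - F x) \<le> norm (F' (x + t *\<^sub>R h) (s *\<^sub>R h))" by auto
      also have "F' (x + t *\<^sub>R h) (s *\<^sub>R h) = s *\<^sub>R F' (x + t *\<^sub>R h) h"
        using linear_scale[OF has_derivative_linear[OF der]] by simp
      also have "norm \<dots> \<le> s * C" using s C(2)[of "x + t *\<^sub>R h"] by simp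
      finally have "norm (q n x) \<le> C"
        using s unfolding q_def s_def[symmetric] by (simp add: divide_inverse_commute[symmetric] pos_divide_le_eq mult.commute)
      then show ?thesis using False by simp
    qed
    then show "AE x in lebesgue. norm (q n x) \<le> C * indicat_real (cball (0::real^2) B) x" for n by simp
  qed
  moreover have "(LINT x|lebesgue. q n x) = 0" for n
  proof -
    have "integrable lebesgue (\<lambda>x. F (x + (1 / real (Suc n)) *\<^sub>R h))" using int by (subst integrable_shift_iff)
    then have "(LINT x|lebesgue. F (x + (1 / real (Suc n)) *\<^sub>R h) - F x) = 0"
      using int by (simp add: integral_shift)
    then show ?thesis unfolding q_def by (simp only: integral_scaleR_right) simp
  qed
  ultimately show ?thesis by (simp add: LIMSEQ_const_iff)
qed

text \<open>Compactly supported C^1 functions with an explicit radius. The weak identities are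
  proved for this class rather than for smooth functions, since they are later applied to products
  of a cutoff with a regularized potential.\<close>

definition C1c :: "real \<Rightarrow> (real^2 \<Rightarrow> real) \<Rightarrow> bool" where
  "C1c R \<phi> \<longleftrightarrow> (\<forall>x. \<phi> differentiable (at x)) \<and>
     (\<forall>h. continuous_on UNIV (\<lambda>x. frechet_derivative \<phi> (at x) h)) \<and> (\<forall>x. norm x > R \<longrightarrow> \<phi> x = 0)"

lemma C1cD:
  assumes "C1c R \<phi>"
  shows "(\<phi> has_derivative frechet_derivative \<phi> (at x)) (at x)" "continuous_on UNIV \<phi>"
    "continuous_on UNIV (partial i \<phi>)" "norm x > R \<Longrightarrow> \<phi> x = 0" "norm x > R \<Longrightarrow> partial i \<phi> x = 0"
proof -
  show *: "(\<phi> has_derivative frechet_derivative \<phi> (at x)) (at x)" for x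
    using assms frechet_derivative_works by (auto simp: C1c_def)
  show "continuous_on UNIV \<phi>"
    by (rule has_derivative_continuous_on) (rule has_derivative_at_withinI[OF *])
  show "continuous_on UNIV (partial i \<phi>)" using assms by (auto simp: C1c_def partial_def[abs_def])
  show z: "norm x > R \<Longrightarrow> \<phi> x = 0" for x using assms by (auto simp: C1c_def)
  show "norm x > R \<Longrightarrow> partial i \<phi> x = 0"
    using derivative_zero_outside[OF * z] by (simp add: partial_def)
qed

lemma C1cI:
  assumes "\<And>x. (\<phi> has_derivative \<phi>' x) (at x)" "\<And>h. continuous_on UNIV (\<lambda>x. \<phi>' x h)"
    "\<And>x. norm x > R \<Longrightarrow> \<phi> x = 0"
  shows "C1c R \<phi>"
  unfolding C1c_def using assms frechet_derivative_at[OF assms(1)] by (auto simp: differentiable_def)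

lemma test_function_C1c:
  assumes "test_function \<phi>"
  obtains R where "R > 0" "C1c R \<phi>"
proof -
  have "bounded {x. \<phi> x \<noteq> 0}"
    using assms bounded_subset[OF compact_imp_bounded closure_subset] by (auto simp: test_function_def)
  then obtain R where R: "R > 0" "\<And>x. \<phi> x \<noteq> 0 \<Longrightarrow> norm x \<le> R" by (auto simp: bounded_pos)
  have "times_cont_differentiable (Suc 0) \<phi>" using assms by (simp add: test_function_def)
  then have "C1c R \<phi>" using R unfolding C1c_def by (fastforce simp: not_le[symmetric])
  then show ?thesis using R that by blast
qed

lemma tcd_partial: "times_cont_differentiable (Suc k) \<phi> \<Longrightarrow> times_cont_differentiable k (partial i \<phi>)"
  using tcd_Suc_has_derivative(2)[of k \<phi>] by (simp add: partial_def[abs_def])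

lemma test_function_partial:
  assumes "test_function \<phi>"
  shows "test_function (partial i \<phi>)"
proof -
  obtain R where R: "R > 0" "C1c R \<phi>" using test_function_C1c[OF assms] .
  have "{x. partial i \<phi> x \<noteq> 0} \<subseteq> cball 0 R" using C1cD(5)[OF R(2)] by (force simp: not_le[symmetric])
  then have "bounded {x. partial i \<phi> x \<noteq> 0}" by (rule bounded_subset[OF bounded_cball])
  then show ?thesis using assms tcd_partial unfolding test_function_def compact_closure by blast
qed

lemma continuous_on_glue_zero:
  fixes g :: "real^2 \<Rightarrow> 'b::real_normed_vector"
  assumes g: "continuous_on (ball 0 R') g" and "R < R'" and "\<And>x. norm x > R \<Longrightarrow> norm x < R' \<Longrightarrow> g x = 0"
  shows "continuous_on UNIV (\<lambda>x. if norm x < R' then g x else 0)"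
proof -
  let ?G = "\<lambda>x. if norm x < R' then g x else 0"
  have 1: "continuous_on (ball 0 R') ?G"
    using g by (rule continuous_on_eq) auto
  have 2: "continuous_on (- cball 0 R) ?G"
    by (rule continuous_on_eq[OF continuous_on_const[of _ 0]]) (use assms(3) in auto)
  have "continuous_on (ball 0 R' \<union> - cball 0 R) ?G"
    by (rule continuous_on_open_Un[OF _ _ 1 2]) auto
  moreover have "ball 0 R' \<union> - cball (0::real^2) R = UNIV" using \<open>R < R'\<close> by auto
  ultimately show ?thesis by simp
qed

text \<open>The factor \<open>k\<close> is regular only on a ball somewhat larger than the support
  of \<open>\<phi>\<close>. Outside the support the product vanishes, so it is C^1 on the whole
  plane and the integral of its derivative is 0.\<close>

lemma integral_by_parts:
  fixes k :: "real^2 \<Rightarrow> 'b::euclidean_space"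
  assumes \<phi>: "C1c R \<phi>" and "R < R'"
    and k: "\<And>x. norm x < R' \<Longrightarrow> (k has_derivative k' x) (at x)" "\<And>h. continuous_on (ball 0 R') (\<lambda>x. k' x h)"
  shows "integrable lebesgue (\<lambda>x. partial i \<phi> x *\<^sub>R k x)"
    "integrable lebesgue (\<lambda>x. \<phi> x *\<^sub>R k' x (axis i 1))"
    "(LINT x|lebesgue. partial i \<phi> x *\<^sub>R k x) = - (LINT x|lebesgue. \<phi> x *\<^sub>R k' x (axis i 1))"
proof -
  let ?D = "\<lambda>x. frechet_derivative \<phi> (at x)"
  have kc: "continuous_on (ball 0 R') k"
    by (rule has_derivative_continuous_on) (rule has_derivative_at_withinI[OF k(1)], auto)
  note c = continuous_on_subset[OF C1cD(2)[OF \<phi>]] continuous_on_subset[OF C1cD(3)[OF \<phi>]]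
  have c1: "continuous_on UNIV (\<lambda>x. if norm x < R' then partial i \<phi> x *\<^sub>R k x else 0)"
    by (rule continuous_on_glue_zero[OF _ \<open>R < R'\<close>]) (auto intro!: continuous_intros c kc simp: C1cD[OF \<phi>])
  have c2: "continuous_on UNIV (\<lambda>x. if norm x < R' then \<phi> x *\<^sub>R k' x (axis i 1) else 0)"
    by (rule continuous_on_glue_zero[OF _ \<open>R < R'\<close>]) (auto intro!: continuous_intros c k(2) simp: C1cD[OF \<phi>])
  have e1: "(\<lambda>x. if norm x < R' then partial i \<phi> x *\<^sub>R k x else 0) = (\<lambda>x. partial i \<phi> x *\<^sub>R k x)"
    using C1cD(5)[OF \<phi>] \<open>R < R'\<close> by fastforce
  have e2: "(\<lambda>x. if norm x < R' then \<phi> x *\<^sub>R k' x (axis i 1) else 0) = (\<lambda>x. \<phi> x *\<^sub>R k' x (axis i 1))"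
    using C1cD(4)[OF \<phi>] \<open>R < R'\<close> by fastforce
  show i1: "integrable lebesgue (\<lambda>x. partial i \<phi> x *\<^sub>R k x)"
    using integrable_continuous_compact_support[OF c1[unfolded e1], of R] C1cD(5)[OF \<phi>] by auto
  show i2: "integrable lebesgue (\<lambda>x. \<phi> x *\<^sub>R k' x (axis i 1))"
    using integrable_continuous_compact_support[OF c2[unfolded e2], of R] C1cD(4)[OF \<phi>] by auto
  define F' where "F' x h = (if norm x < R' then \<phi> x *\<^sub>R k' x h + ?D x h *\<^sub>R k x else 0)" for x h
  have "(LINT x|lebesgue. F' x (axis i 1)) = 0"
  proof (rule integral_derivative_eq_0)
    show "((\<lambda>x. \<phi> x *\<^sub>R k x) has_derivative F' x) (at x)" for x
    proof (cases "norm x < R'")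
      case True
      have "((\<lambda>x. \<phi> x *\<^sub>R k x) has_derivative (\<lambda>h. \<phi> x *\<^sub>R k' x h + ?D x h *\<^sub>R k x)) (at x)"
        by (rule has_derivative_scaleR[OF C1cD(1)[OF \<phi>] k(1)[OF True]])
      then show ?thesis using True by (simp add: F'_def[abs_def])
    next
      case False
      then have x: "x \<in> - cball 0 R" using \<open>R < R'\<close> by auto
      have "((\<lambda>x. 0) has_derivative (\<lambda>h. 0)) (at x)" by simp
      then have "((\<lambda>x. \<phi> x *\<^sub>R k x) has_derivative (\<lambda>h. 0)) (at x)"
        by (rule has_derivative_transform_within_open[OF _ _ x]) (auto simp: C1cD(4)[OF \<phi>])
      then show ?thesis using False by (simp add: F'_def[abs_def])
    qed
    have "continuous_on UNIV (\<lambda>x. (if norm x < R' then \<phi> x *\<^sub>R k' x (axis i 1) else 0) + (if norm x < R' then partial i \<phi> x *\<^sub>R k x else 0))"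
      by (rule continuous_on_add[OF c2 c1])
    then show "continuous_on UNIV (\<lambda>x. F' x (axis i 1))"
      by (rule continuous_on_eq) (auto simp: F'_def partial_def)
    show "norm x > R \<Longrightarrow> \<phi> x *\<^sub>R k x = 0" for x using C1cD(4)[OF \<phi>] by simp
  qed
  moreover have "F' x (axis i 1) = \<phi> x *\<^sub>R k' x (axis i 1) + partial i \<phi> x *\<^sub>R k x" for x
    using fun_cong[OF e1, of x] fun_cong[OF e2, of x] by (auto simp: F'_def partial_def split: if_splits)
  ultimately show "(LINT x|lebesgue. partial i \<phi> x *\<^sub>R k x) = - (LINT x|lebesgue. \<phi> x *\<^sub>R k' x (axis i 1))"
    using i1 i2 by (simp add: eq_neg_iff_add_eq_0 add.commute)
qed

section \<open>The plane as the complex numbers\<close>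

definition to_complex :: "real^2 \<Rightarrow> complex" where "to_complex x = Complex (x$1) (x$2)"

text \<open>The operator d1 + i d2, twice the Wirtinger derivative in the conjugate variable,
  applied to a real function.\<close>

definition dbar :: "(real^2 \<Rightarrow> real) \<Rightarrow> real^2 \<Rightarrow> complex" where
  "dbar \<phi> x = Complex (partial 1 \<phi> x) (partial 2 \<phi> x)"

lemma bounded_linear_to_complex: "bounded_linear to_complex"
proof
  show "\<exists>K. \<forall>x. norm (to_complex x) \<le> norm x * K"
    by (intro exI[of _ 1]) (simp add: to_complex_def cmod_def norm_vec_def L2_set_def sum_2)
qed (auto simp: to_complex_def complex_eq_iff)

lemma cmod_to_complex [simp]: "cmod (to_complex x) = norm x"
  by (simp add: to_complex_def cmod_def norm_vec_def L2_set_def sum_2)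

lemma to_complex_add: "to_complex (x + y) = to_complex x + to_complex y"
  and to_complex_diff: "to_complex (x - y) = to_complex x - to_complex y"
  and to_complex_scaleR: "to_complex (c *\<^sub>R x) = of_real c * to_complex x"
  and to_complex_0 [simp]: "to_complex 0 = 0"
  by (auto simp: to_complex_def complex_eq_iff)

lemma to_complex_eq_iff [simp]: "to_complex x = to_complex y \<longleftrightarrow> x = y"
  by (auto simp: to_complex_def complex_eq_iff vec_eq_iff forall_2)

lemma to_complex_axis [simp]: "to_complex (axis 1 1) = 1" "to_complex (axis 2 1) = \<i>"
  by (auto simp: to_complex_def complex_eq_iff axis_def)

lemma continuous_on_to_complex [continuous_intros]: "continuous_on A f \<Longrightarrow> continuous_on A (\<lambda>x. to_complex (f x))"
  by (rule bounded_linear.continuous_on[OF bounded_linear_to_complex])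

lemma to_complex_measurable [measurable]: "to_complex \<in> borel_measurable borel"
  by (intro borel_measurable_continuous_onI continuous_intros)

text \<open>In complex notation \<open>\<partial>\<^sub>1 k + \<i> \<partial>\<^sub>2 k = b\<close> contains divergence and curl of the
  real field \<open>(Re k, - Im k)\<close> as real and imaginary part.\<close>

lemma dbar_by_parts:
  fixes k :: "real^2 \<Rightarrow> complex"
  assumes \<phi>: "C1c R \<phi>" and "R < R'"
    and k: "\<And>x. norm x < R' \<Longrightarrow> (k has_derivative k' x) (at x)" "\<And>h. continuous_on (ball 0 R') (\<lambda>x. k' x h)"
    and b: "\<And>x. norm x < R' \<Longrightarrow> k' x (axis 1 1) + \<i> * k' x (axis 2 1) = b x"
  shows "integrable lebesgue (\<lambda>x. dbar \<phi> x * k x)" "integrable lebesgue (\<lambda>x. of_real (\<phi> x) * b x)"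
    "(LINT x|lebesgue. dbar \<phi> x * k x) = - (LINT x|lebesgue. of_real (\<phi> x) * b x)"
proof -
  have p: "integrable lebesgue (\<lambda>x. partial i \<phi> x *\<^sub>R k x)"
    "integrable lebesgue (\<lambda>x. \<phi> x *\<^sub>R k' x (axis i 1))"
    "(LINT x|lebesgue. partial i \<phi> x *\<^sub>R k x) = - (LINT x|lebesgue. \<phi> x *\<^sub>R k' x (axis i 1))" for i
    by (rule integral_by_parts[OF \<phi> \<open>R < R'\<close> k(1) k(2)]; assumption)+
  have e1: "dbar \<phi> x * k x = partial 1 \<phi> x *\<^sub>R k x + \<i> * (partial 2 \<phi> x *\<^sub>R k x)" for x
    by (simp add: dbar_def complex_eq_iff)
  have e2: "of_real (\<phi> x) * b x = \<phi> x *\<^sub>R k' x (axis 1 1) + \<i> * (\<phi> x *\<^sub>R k' x (axis 2 1))" for x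
  proof (cases "norm x < R'")
    case True
    then show ?thesis by (simp add: b[symmetric] scaleR_conv_of_real algebra_simps)
  next
    case False
    then show ?thesis using C1cD(4)[OF \<phi>, of x] \<open>R < R'\<close> by simp
  qed
  show "integrable lebesgue (\<lambda>x. dbar \<phi> x * k x)"
    unfolding e1 by (intro Bochner_Integration.integrable_add integrable_mult_right p)
  show "integrable lebesgue (\<lambda>x. of_real (\<phi> x) * b x)"
    unfolding e2 by (intro Bochner_Integration.integrable_add integrable_mult_right p)
  have "(LINT x|lebesgue. dbar \<phi> x * k x) = (LINT x|lebesgue. partial 1 \<phi> x *\<^sub>R k x) + \<i> * (LINT x|lebesgue. partial 2 \<phi> x *\<^sub>R k x)"
    unfolding e1 integral_mult_right_zero[symmetric]
    by (intro Bochner_Integration.integral_add integrable_mult_right p)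
  also have "\<dots> = - ((LINT x|lebesgue. \<phi> x *\<^sub>R k' x (axis 1 1)) + \<i> * (LINT x|lebesgue. \<phi> x *\<^sub>R k' x (axis 2 1)))"
    unfolding p(3) by simp
  also have "(LINT x|lebesgue. \<phi> x *\<^sub>R k' x (axis 1 1)) + \<i> * (LINT x|lebesgue. \<phi> x *\<^sub>R k' x (axis 2 1)) = (LINT x|lebesgue. of_real (\<phi> x) * b x)"
    unfolding e2 integral_mult_right_zero[symmetric]
    by (intro Bochner_Integration.integral_add[symmetric] integrable_mult_right p)
  finally show "(LINT x|lebesgue. dbar \<phi> x * k x) = - (LINT x|lebesgue. of_real (\<phi> x) * b x)" .
qed

section \<open>The Cauchy kernel as fundamental solution\<close>

lemma lborel_integral_affine:
  fixes g :: "real^2 \<Rightarrow> real"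
  assumes [measurable]: "g \<in> borel_measurable borel" and c: "c > 0"
  shows "(LINT x|lborel. g x) = c\<^sup>2 * (LINT y|lborel. g (p + c *\<^sub>R y))"
proof -
  have "(LINT x|lborel. g x) = (LINT x|density (distr lborel borel (\<lambda>y. p + c *\<^sub>R y)) (\<lambda>_. ennreal (\<bar>c\<bar> ^ DIM(real^2))). g x)"
    using lborel_affine[of c p] c by simp
  also have "\<dots> = (LINT x|distr lborel borel (\<lambda>y. p + c *\<^sub>R y). (\<bar>c\<bar> ^ DIM(real^2)) *\<^sub>R g x)"
    by (rule integral_density) auto
  also have "\<dots> = (LINT y|lborel. (\<bar>c\<bar> ^ DIM(real^2)) *\<^sub>R g (p + c *\<^sub>R y))"
    by (rule integral_distr) auto
  finally show ?thesis using c by (simp add: power2_eq_square)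
qed

lemma dbar_continuous: "C1c R \<phi> \<Longrightarrow> continuous_on UNIV (dbar \<phi>)"
  unfolding dbar_def[abs_def] Complex_eq
  by (intro continuous_intros C1cD(3))

lemma dbar_bounded:
  assumes "C1c R \<phi>"
  obtains C where "C > 0" "\<And>x. cmod (dbar \<phi> x) \<le> C * indicator (cball 0 R) x"
proof -
  have z: "norm x > R \<Longrightarrow> dbar \<phi> x = 0" for x using C1cD(5)[OF assms] by (simp add: dbar_def complex_eq_iff)
  obtain C where C: "C > 0" "\<And>x. cmod (dbar \<phi> x) \<le> C"
    using continuous_compact_support_bounded[OF dbar_continuous[OF assms] z] by metis
  show ?thesis
  proof (rule that[OF C(1)])
    show "cmod (dbar \<phi> x) \<le> C * indicator (cball 0 R) x" for x
      using C(2)[of x] z[of x] by (cases "norm x \<le> R") auto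
  qed
qed

lemma C1c_bounded:
  assumes "C1c R \<phi>"
  obtains C where "C > 0" "\<And>x. \<bar>\<phi> x\<bar> \<le> C * indicator (cball 0 R) x"
proof -
  obtain C where C: "C > 0" "\<And>x. norm (\<phi> x) \<le> C"
    using continuous_compact_support_bounded[OF C1cD(2)[OF assms] C1cD(4)[OF assms]] by metis
  show ?thesis
  proof (rule that[OF C(1)])
    show "\<bar>\<phi> x\<bar> \<le> C * indicator (cball 0 R) x" for x
      using C(2)[of x] C1cD(4)[OF assms, of x] by (cases "norm x \<le> R") auto
  qed
qed

lemma tendsto_0_inverse_Suc: "(\<lambda>n. 1 / real (Suc n)) \<longlonglongrightarrow> 0"
  using LIMSEQ_inverse_real_of_nat by (simp add: inverse_eq_divide)

text \<open>The Cauchy kernel is a fundamental solution; it is regularized as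
  \<open>cnj z / (\<bar>z\<bar>\<^sup>2 + \<epsilon>\<^sup>2)\<close>.\<close>

lemma dbar_cauchy_kernel:
  assumes \<phi>: "C1c R \<phi>"
  shows "integrable lebesgue (\<lambda>x. dbar \<phi> x * (1 / to_complex (x - p)))"
    "(LINT x|lebesgue. dbar \<phi> x * (1 / to_complex (x - p))) = of_real (- 2 * pi * \<phi> p)"
proof -
  obtain C where C: "C > 0" "\<And>x. cmod (dbar \<phi> x) \<le> C * indicator (cball 0 R) x" using dbar_bounded[OF \<phi>] by metis
  obtain M where M: "M > 0" "\<And>x. \<bar>\<phi> x\<bar> \<le> M * indicator (cball 0 R) x" using C1c_bounded[OF \<phi>] by metis
  define e where "e n = 1 / real (Suc n)" for n
  have e: "e n > 0" for n by (simp add: e_def)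
  have e0: "e \<longlonglongrightarrow> 0" unfolding e_def[abs_def] by (rule tendsto_0_inverse_Suc)
  define N where "N n x = (norm (x - p))\<^sup>2 + (e n)\<^sup>2" for n x
  have N: "N n x > 0" for n x unfolding N_def using e[of n] by (intro add_nonneg_pos) auto
  define k where "k n x = (1 / N n x) *\<^sub>R cnj (to_complex (x - p))" for n x
  define k' where "k' n x h = (1 / N n x) *\<^sub>R cnj (to_complex h) + (- (2 * ((x - p) \<bullet> h)) / (N n x)\<^sup>2) *\<^sub>R cnj (to_complex (x - p))" for n x h
  have dm: "dbar \<phi> \<in> borel_measurable borel"
    by (rule borel_measurable_continuous_onI[OF dbar_continuous[OF \<phi>]])
  have der: "(k n has_derivative k' n x) (at x)" for n x
  proof -
    have 1: "((\<lambda>x. 1 / N n x) has_derivative (\<lambda>h. - (2 * ((x - p) \<bullet> h)) / (N n x)\<^sup>2)) (at x)"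
      using N[of n x] unfolding N_def power2_norm_eq_inner
      by (auto intro!: derivative_eq_intros simp: power2_eq_square inner_commute field_simps)
    have "bounded_linear (\<lambda>x. cnj (to_complex x))"
      by (rule bounded_linear_compose[OF bounded_linear_cnj bounded_linear_to_complex])
    then have 2: "((\<lambda>x. cnj (to_complex (x - p))) has_derivative (\<lambda>h. cnj (to_complex h))) (at x)"
      by (rule bounded_linear.has_derivative) (auto intro!: derivative_eq_intros)
    show ?thesis unfolding k_def[abs_def] k'_def[abs_def]
      by (rule has_derivative_scaleR[OF 1 2])
  qed
  have cont: "continuous_on A (\<lambda>x. k' n x h)" for n h A
  proof -
    have "N n x \<noteq> 0" for x using N[of n x] by simp
    then show ?thesis unfolding k'_def unfolding N_def
      by (auto intro!: continuous_intros)
  qed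
  \<comment> \<open>Applied to the regularized kernel, d1 + i d2 leaves an approximate identity of
    mass 2 pi in place of the point mass.\<close>
  have b: "k' n x (axis 1 1) + \<i> * k' n x (axis 2 1) = of_real (2 * (e n)\<^sup>2 / (N n x)\<^sup>2)" for n x
  proof -
    define z where "z = to_complex (x - p)"
    have i: "(x - p) \<bullet> axis 1 1 = Re z" "(x - p) \<bullet> axis 2 1 = Im z"
      by (auto simp: inner_axis z_def to_complex_def)
    have zz: "cnj z * z = of_real ((norm (x - p))\<^sup>2)"
      by (simp only: complex_norm_square[symmetric] mult.commute[of "cnj z"]) (simp add: z_def)
    have "k' n x (axis 1 1) + \<i> * k' n x (axis 2 1) = of_real (2 / N n x) - of_real (2 / (N n x)\<^sup>2) * (cnj z * (of_real (Re z) + \<i> * of_real (Im z)))"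
      unfolding k'_def i z_def[symmetric] by (simp add: scaleR_conv_of_real algebra_simps)
    also have "of_real (Re z) + \<i> * of_real (Im z) = z" by (simp add: complex_eq_iff)
    also have "of_real (2 / N n x) - of_real (2 / (N n x)\<^sup>2) * (cnj z * z) = of_real (2 / N n x - 2 / (N n x)\<^sup>2 * (norm (x - p))\<^sup>2)"
      unfolding zz by simp
    also have "2 / N n x - 2 / (N n x)\<^sup>2 * (norm (x - p))\<^sup>2 = 2 * (e n)\<^sup>2 / (N n x)\<^sup>2"
    proof -
      have "2 / N n x = 2 * N n x / (N n x)\<^sup>2" using N[of n x] by (simp add: power2_eq_square)
      then show ?thesis by (simp add: N_def diff_divide_distrib[symmetric])
    qed
    finally show ?thesis .
  qed
  have parts: "(LINT x|lebesgue. dbar \<phi> x * k n x) = - (LINT x|lebesgue. of_real (\<phi> x) * of_real (2 * (e n)\<^sup>2 / (N n x)\<^sup>2))" for n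
    by (rule dbar_by_parts[OF \<phi>, of "R + 1" "k n" "k' n"]) (use der cont b in auto)
  have km: "k n \<in> borel_measurable borel" for n
    by (rule borel_measurable_continuous_onI) (rule has_derivative_continuous_on[OF has_derivative_at_withinI[OF der]])
  have dom: "integrable lebesgue (\<lambda>x. C * (indicator (cball 0 R) x *\<^sub>R (1 / norm (x - p))))"
    using set_integrable_inverse_norm[of 0 R p] unfolding set_integrable_def by (rule integrable_mult_right)
  have im: "(\<lambda>x. dbar \<phi> x * (1 / to_complex (x - p))) \<in> borel_measurable lebesgue"
    by (intro measurable_completion borel_measurable_times borel_measurable_divide) (use dm in \<open>auto intro: borel_measurable_continuous_onI continuous_intros\<close>)
  have kb: "cmod (k n x) \<le> 1 / norm (x - p)" for n x
  proof (cases "x = p")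
    case False
    have "norm (x - p) * norm (x - p) \<le> N n x" by (simp add: N_def power2_eq_square)
    then have "norm (x - p) / N n x \<le> 1 / norm (x - p)" using N[of n x] False by (simp add: field_simps)
    then show ?thesis using N[of n x] by (simp add: k_def)
  qed (simp add: k_def)
  show "integrable lebesgue (\<lambda>x. dbar \<phi> x * (1 / to_complex (x - p)))"
  proof (rule Bochner_Integration.integrable_bound[OF dom im])
    have "cmod (dbar \<phi> x * (1 / to_complex (x - p))) \<le> (C * indicator (cball 0 R) x) * (1 / norm (x - p))" for x
      unfolding norm_mult by (intro mult_mono C) (auto simp: norm_divide C(1) less_imp_le)
    then show "AE x in lebesgue. norm (dbar \<phi> x * (1 / to_complex (x - p))) \<le> norm (C * (indicator (cball 0 R) x *\<^sub>R (1 / norm (x - p))))"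
      using C(1) by (simp add: abs_mult)
  qed
  have "(\<lambda>n. LINT x|lebesgue. dbar \<phi> x * k n x) \<longlonglongrightarrow> (LINT x|lebesgue. dbar \<phi> x * (1 / to_complex (x - p)))"
  proof (rule integral_dominated_convergence[OF im _ dom])
    show "(\<lambda>x. dbar \<phi> x * k n x) \<in> borel_measurable lebesgue" for n
      by (intro measurable_completion borel_measurable_times) (use dm km in auto)
    have "(\<lambda>n. dbar \<phi> x * k n x) \<longlonglongrightarrow> dbar \<phi> x * (1 / to_complex (x - p))" for x
    proof (cases "x = p")
      case True
      then show ?thesis by (simp add: k_def)
    next
      case False
      have "(\<lambda>n. k n x) \<longlonglongrightarrow> (1 / ((norm (x - p))\<^sup>2 + 0\<^sup>2)) *\<^sub>R cnj (to_complex (x - p))"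
        unfolding k_def N_def using False by (intro tendsto_intros e0) auto
      moreover have "(1 / ((norm (x - p))\<^sup>2 + 0\<^sup>2)) *\<^sub>R cnj (to_complex (x - p)) = 1 / to_complex (x - p)"
      proof -
        have "1 / to_complex (x - p) = cnj (to_complex (x - p)) / of_real ((norm (x - p))\<^sup>2)"
          using complex_div_cnj[of 1 "to_complex (x - p)"] by simp
        then show ?thesis by (simp add: scaleR_conv_of_real)
      qed
      ultimately show ?thesis by (intro tendsto_mult tendsto_const) simp
    qed
    then show "AE x in lebesgue. (\<lambda>n. dbar \<phi> x * k n x) \<longlonglongrightarrow> dbar \<phi> x * (1 / to_complex (x - p))" by simp
    have "cmod (dbar \<phi> x * k n x) \<le> (C * indicator (cball 0 R) x) * (1 / norm (x - p))" for n x
      unfolding norm_mult by (intro mult_mono C kb) (auto simp: C(1) less_imp_le)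
    then show "AE x in lebesgue. norm (dbar \<phi> x * k n x) \<le> C * (indicator (cball 0 R) x *\<^sub>R (1 / norm (x - p)))" for n
      by (simp add: mult.assoc)
  qed
  moreover have "(\<lambda>n. LINT x|lebesgue. dbar \<phi> x * k n x) \<longlonglongrightarrow> of_real (- 2 * pi * \<phi> p)"
  proof -
    have \<phi>m [measurable]: "\<phi> \<in> borel_measurable borel"
      by (rule borel_measurable_continuous_onI[OF C1cD(2)[OF \<phi>]])
    have Nm [measurable]: "N n \<in> borel_measurable borel" for n unfolding N_def[abs_def] by measurable
    \<comment> \<open>The substitution x = p + e y turns the approximate identity into the fixed
      profile 2/(1 + |y|^2)^2, so that only the argument of \<open>\<phi>\<close> still depends on
      n.\<close>
    have "(LINT x|lebesgue. dbar \<phi> x * k n x) = of_real (- (LINT y|lborel. \<phi> (p + e n *\<^sub>R y) * (2 / (1 + (norm y)\<^sup>2)\<^sup>2)))" for n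
    proof -
      have "(LINT x|lebesgue. dbar \<phi> x * k n x) = - (LINT x|lebesgue. complex_of_real (\<phi> x * (2 * (e n)\<^sup>2 / (N n x)\<^sup>2)))"
        unfolding parts by simp
      also have "\<dots> = of_real (- (LINT x|lebesgue. \<phi> x * (2 * (e n)\<^sup>2 / (N n x)\<^sup>2)))"
        by (simp only: integral_complex_of_real of_real_minus)
      also have "(LINT x|lebesgue. \<phi> x * (2 * (e n)\<^sup>2 / (N n x)\<^sup>2)) = (LINT x|lborel. \<phi> x * (2 * (e n)\<^sup>2 / (N n x)\<^sup>2))"
        by (rule integral_completion) measurable
      also have "\<dots> = (e n)\<^sup>2 * (LINT y|lborel. \<phi> (p + e n *\<^sub>R y) * (2 * (e n)\<^sup>2 / (N n (p + e n *\<^sub>R y))\<^sup>2))"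
        by (rule lborel_integral_affine[OF _ e]) measurable
      also have "\<dots> = (LINT y|lborel. (e n)\<^sup>2 * (\<phi> (p + e n *\<^sub>R y) * (2 * (e n)\<^sup>2 / (N n (p + e n *\<^sub>R y))\<^sup>2)))"
        by (rule integral_mult_right_zero[symmetric])
      also have "(\<lambda>y. (e n)\<^sup>2 * (\<phi> (p + e n *\<^sub>R y) * (2 * (e n)\<^sup>2 / (N n (p + e n *\<^sub>R y))\<^sup>2))) = (\<lambda>y. \<phi> (p + e n *\<^sub>R y) * (2 / (1 + (norm y)\<^sup>2)\<^sup>2))"
      proof
        fix y
        have "N n (p + e n *\<^sub>R y) = (e n)\<^sup>2 * (1 + (norm y)\<^sup>2)"
          by (simp add: N_def power_mult_distrib algebra_simps)
        then show "(e n)\<^sup>2 * (\<phi> (p + e n *\<^sub>R y) * (2 * (e n)\<^sup>2 / (N n (p + e n *\<^sub>R y))\<^sup>2)) = \<phi> (p + e n *\<^sub>R y) * (2 / (1 + (norm y)\<^sup>2)\<^sup>2)"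
          using e[of n] by (simp add: power2_eq_square)
      qed
      finally show ?thesis .
    qed
    moreover have "(\<lambda>n. LINT y|lborel. \<phi> (p + e n *\<^sub>R y) * (2 / (1 + (norm y)\<^sup>2)\<^sup>2)) \<longlonglongrightarrow> (LINT y|lborel. \<phi> p * (2 / (1 + (norm (y::real^2))\<^sup>2)\<^sup>2))"
    proof (rule integral_dominated_convergence)
      have "integrable lborel (\<lambda>y::real^2. 2 / (1 + (norm y)\<^sup>2)\<^sup>2)"
        using integral_approximate_identity(1) by (subst (asm) integrable_completion) auto
      then show "integrable lborel (\<lambda>y::real^2. M * (2 / (1 + (norm y)\<^sup>2)\<^sup>2))"
        by (rule integrable_mult_right)
      have "(\<lambda>n. \<phi> (p + e n *\<^sub>R y)) \<longlonglongrightarrow> \<phi> (p + 0 *\<^sub>R y)" for y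
      proof (rule continuous_on_tendsto_compose[OF C1cD(2)[OF \<phi>]])
        show "(\<lambda>n. p + e n *\<^sub>R y) \<longlonglongrightarrow> p + 0 *\<^sub>R y" by (intro tendsto_intros e0)
      qed auto
      then show "AE y in lborel. (\<lambda>n. \<phi> (p + e n *\<^sub>R y) * (2 / (1 + (norm y)\<^sup>2)\<^sup>2)) \<longlonglongrightarrow> \<phi> p * (2 / (1 + (norm y)\<^sup>2)\<^sup>2)"
        by (intro AE_I2 tendsto_mult tendsto_const) simp
      have "\<bar>\<phi> y\<bar> \<le> M" for y using M(2)[of y] M(1) by (cases "norm y \<le> R") auto
      then show "AE y in lborel. norm (\<phi> (p + e n *\<^sub>R y) * (2 / (1 + (norm y)\<^sup>2)\<^sup>2)) \<le> M * (2 / (1 + (norm y)\<^sup>2)\<^sup>2)" for n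
        by (auto simp: abs_mult intro!: mult_right_mono divide_right_mono)
    qed measurable
    moreover have "(LINT y|lborel. \<phi> p * (2 / (1 + (norm (y::real^2))\<^sup>2)\<^sup>2)) = 2 * pi * \<phi> p"
    proof -
      have "(LINT y|lborel. 2 / (1 + (norm (y::real^2))\<^sup>2)\<^sup>2) = 2 * pi"
        using integral_approximate_identity(2) by (subst (asm) integral_completion) auto
      then show ?thesis by (simp only: integral_mult_right_zero mult.commute)
    qed
    ultimately have "(\<lambda>n. LINT y|lborel. \<phi> (p + e n *\<^sub>R y) * (2 / (1 + (norm y)\<^sup>2)\<^sup>2)) \<longlonglongrightarrow> 2 * pi * \<phi> p"
      and eq: "\<And>n. (LINT x|lebesgue. dbar \<phi> x * k n x) = of_real (- (LINT y|lborel. \<phi> (p + e n *\<^sub>R y) * (2 / (1 + (norm y)\<^sup>2)\<^sup>2)))"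
      by simp_all
    then have "(\<lambda>n. complex_of_real (- (LINT y|lborel. \<phi> (p + e n *\<^sub>R y) * (2 / (1 + (norm y)\<^sup>2)\<^sup>2)))) \<longlonglongrightarrow> of_real (- (2 * pi * \<phi> p))"
      by (intro tendsto_of_real tendsto_minus)
    then show ?thesis unfolding eq by simp
  qed
  ultimately show "(LINT x|lebesgue. dbar \<phi> x * (1 / to_complex (x - p))) = of_real (- 2 * pi * \<phi> p)"
    by (rule LIMSEQ_unique)
qed

section \<open>A theta function\<close>

locale q_product =
  fixes q :: complex
  assumes q: "q \<noteq> 0" "cmod q < 1"
begin

text \<open>The product of the factors 1 - q^n z over n >= 0, that is, the q-Pochhammer symbol. It
  is a Weierstrass product of genus 0 with zeros q^(-n), convergent by comparison with a geometric
  series.\<close>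

sublocale weierstrass_product "\<lambda>n. inverse (q ^ n)" "\<lambda>n. 0"
proof
  show "inverse (q ^ n) \<noteq> 0" for n using q by simp
  have "(\<lambda>n. q ^ n) \<longlonglongrightarrow> 0" using q by (rule_tac LIMSEQ_power_zero) simp
  then have "filterlim (\<lambda>n. q ^ n) (at 0) sequentially"
    using q by (auto simp: filterlim_at)
  then show "filterlim (\<lambda>n. inverse (q ^ n)) at_infinity sequentially"
    by (rule filterlim_compose[OF filterlim_inverse_at_infinity])
  have "r / cmod (inverse (q ^ n)) = r * cmod q ^ n" for r n
    by (simp add: norm_inverse norm_power divide_inverse)
  then show "summable (\<lambda>n. (r / cmod (inverse (q ^ n))) ^ Suc 0)" for r
    using q summable_mult[OF summable_geometric[of "cmod q"], of r] by simp
qed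

lemma factor: "weierstrass_factor 0 (z / inverse (q ^ n)) = 1 - q ^ n * z"
  by (simp add: weierstrass_factor_def field_simps)

lemma f_rec: "f z = (1 - z) * f (q * z)"
proof (rule has_prod_unique2)
  show "(\<lambda>n. 1 - q ^ n * z) has_prod f z" using has_prod[of z] unfolding factor .
  have "(\<lambda>n. 1 - q ^ Suc n * z) has_prod f (q * z)"
    using has_prod[of "q * z"] unfolding factor by (simp add: mult_ac)
  from has_prod_Suc_imp[of "\<lambda>n. 1 - q ^ n * z", OF this]
  show "(\<lambda>n. 1 - q ^ n * z) has_prod ((1 - z) * f (q * z))" by (simp add: mult.commute)
qed

lemma f_eq_0_iff: "f z = 0 \<longleftrightarrow> (\<exists>n. z * q ^ n = 1)"
  using zero[of z] q by (auto simp: image_iff field_simps)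

end

locale theta =
  fixes U V :: complex
  assumes orientation: "Im (cnj U * V) = 2 * pi"
begin

lemma U_nz: "U \<noteq> 0" using orientation by auto

definition "\<tau> = V / U"

lemma Im_tau: "Im \<tau> * (cmod U)\<^sup>2 = 2 * pi"
proof -
  have "\<tau> * of_real ((cmod U)\<^sup>2) = cnj U * V"
    using U_nz unfolding \<tau>_def complex_norm_square by (simp add: mult.commute)
  then have "Im (\<tau> * of_real ((cmod U)\<^sup>2)) = 2 * pi" using orientation by simp
  then show ?thesis by simp
qed

lemma Im_tau_pos: "Im \<tau> > 0"
proof -
  have "Im \<tau> * (cmod U)\<^sup>2 > 0" using Im_tau by simp
  then show ?thesis by (simp add: zero_less_mult_iff)
qed

definition "q = exp (2 * of_real pi * \<i> * \<tau>)"

sublocale q_product q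
proof
  show "q \<noteq> 0" by (simp add: q_def)
  show "cmod q < 1" using Im_tau_pos by (simp add: q_def)
qed

text \<open>By the Jacobi triple product \<open>\<theta>\<close> is, up to a constant, a theta series in \<open>w\<close>; the quadratic
  exponential turns its quasi-periodicity into periodicity of \<open>\<Phi>\<close>.\<close>

definition "w z = exp (2 * of_real pi * \<i> * (z / U))"
definition "\<theta> z = f (w z) * f (q / w z)"
definition "P z = \<theta> z * exp (of_real ((cmod U)\<^sup>2) / (4 * U\<^sup>2) * z\<^sup>2 - \<i> * of_real pi / U * z)"
definition "\<Phi> z = cmod (P z) * exp (- (cmod z)\<^sup>2 / 4)"

lemma w_nz: "w z \<noteq> 0" by (simp add: w_def)

lemma norm_w: "cmod (w z) = exp (- 2 * pi * Im (z / U))"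
proof -
  have "Re (2 * of_real pi * \<i> * \<zeta>) = - 2 * pi * Im \<zeta>" for \<zeta> by simp
  then show ?thesis unfolding w_def norm_exp_eq_Re by (simp only:)
qed

lemma P_holomorphic: "P holomorphic_on A"
proof -
  have w: "w holomorphic_on A" unfolding w_def[abs_def] using U_nz by (intro holomorphic_intros) auto
  have "(f \<circ> w) holomorphic_on A" by (rule holomorphic_on_compose_gen[OF w holomorphic[of UNIV]]) auto
  moreover have "(f \<circ> (\<lambda>z. q / w z)) holomorphic_on A"
    by (rule holomorphic_on_compose_gen[OF _ holomorphic[of UNIV]]) (use w w_nz in \<open>auto intro!: holomorphic_intros\<close>)
  ultimately show ?thesis
    unfolding P_def[abs_def] \<theta>_def[abs_def] o_def using U_nz by (intro holomorphic_intros) auto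
qed

text \<open>The quadratic coefficient in \<open>P\<close> is chosen so that its real part and
  -|z|^2/4 combine to an expression in Im (z/U) alone. Translation by \<open>U\<close> then leaves
  everything fixed, and translation by \<open>V\<close> has to be balanced only against the
  multiplier of \<open>\<theta>\<close>.\<close>

lemma Phi_theta: "\<Phi> z = cmod (\<theta> z) * exp (- ((cmod U)\<^sup>2 / 2 * (Im (z / U))\<^sup>2 - pi * Im (z / U)))"
proof -
  define \<zeta> where "\<zeta> = z / U"
  have z: "z = U * \<zeta>" using U_nz by (simp add: \<zeta>_def)
  have "cmod (P z) = cmod (\<theta> z) * exp (Re (of_real ((cmod U)\<^sup>2) / (4 * U\<^sup>2) * z\<^sup>2 - \<i> * of_real pi / U * z))"
    by (simp add: P_def norm_mult)
  also have "of_real ((cmod U)\<^sup>2) / (4 * U\<^sup>2) * z\<^sup>2 = of_real ((cmod U)\<^sup>2 / 4) * \<zeta>\<^sup>2"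
    using U_nz by (simp add: z power_mult_distrib)
  also have "\<i> * of_real pi / U * z = \<i> * of_real pi * \<zeta>" using U_nz by (simp add: z)
  also have "Re (of_real ((cmod U)\<^sup>2 / 4) * \<zeta>\<^sup>2 - \<i> * of_real pi * \<zeta>) = (cmod U)\<^sup>2 / 4 * ((Re \<zeta>)\<^sup>2 - (Im \<zeta>)\<^sup>2) + pi * Im \<zeta>"
    by (simp add: power2_eq_square)
  finally have 1: "cmod (P z) = cmod (\<theta> z) * exp ((cmod U)\<^sup>2 / 4 * ((Re \<zeta>)\<^sup>2 - (Im \<zeta>)\<^sup>2) + pi * Im \<zeta>)" .
  have "(cmod z)\<^sup>2 = (cmod U)\<^sup>2 * ((Re \<zeta>)\<^sup>2 + (Im \<zeta>)\<^sup>2)"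
    by (simp add: z norm_mult power_mult_distrib cmod_power2[of \<zeta>])
  then have "(cmod U)\<^sup>2 / 4 * ((Re \<zeta>)\<^sup>2 - (Im \<zeta>)\<^sup>2) + pi * Im \<zeta> + (- (cmod z)\<^sup>2 / 4) = - ((cmod U)\<^sup>2 / 2 * (Im \<zeta>)\<^sup>2 - pi * Im \<zeta>)"
    by (simp add: field_simps)
  then show ?thesis unfolding \<Phi>_def 1 \<zeta>_def[symmetric] by (simp only: mult.assoc exp_add[symmetric])
qed

lemma Phi_U: "\<Phi> (z + U) = \<Phi> z"
proof -
  have d: "(z + U) / U = z / U + 1" using U_nz by (simp add: field_simps)
  have "w (z + U) = w z" unfolding w_def d by (simp add: distrib_left exp_add)
  then have "\<theta> (z + U) = \<theta> z" by (simp add: \<theta>_def)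
  then show ?thesis by (simp add: Phi_theta d)
qed

lemma w_V: "w (z + V) = q * w z"
  unfolding w_def q_def \<tau>_def by (simp add: exp_add[symmetric] add_divide_distrib distrib_left add.commute)

text \<open>The recursion \<open>f_rec\<close>, used once for each factor, produces the quotient (1
  - 1/w)/(1 - w) = -1/w. The case w = 1, where one may not divide, is treated apart; both sides
  vanish there because f 1 = 0.\<close>

lemma theta_V: "cmod (\<theta> (z + V)) = cmod (\<theta> z) / cmod (w z)"
proof (cases "w z = 1")
  case True
  have "f 1 = 0" using f_rec[of 1] by simp
  then show ?thesis using q(1) by (simp add: \<theta>_def w_V True)
next
  case False
  have 1: "f (w z) = (1 - w z) * f (q * w z)" by (rule f_rec)
  have 2: "f (1 / w z) = (1 - 1 / w z) * f (q / w z)" using f_rec[of "1 / w z"] by simp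
  have "(1 - w z) * \<theta> (z + V) = (1 - w z) * f (q * w z) * f (1 / w z)"
    using q(1) by (simp add: \<theta>_def w_V)
  also have "\<dots> = (1 - w z) * (- \<theta> z / w z)"
    unfolding 1[symmetric] 2 \<theta>_def using w_nz[of z] by (simp add: field_simps)
  finally have "(1 - w z) * \<theta> (z + V) = (1 - w z) * (- \<theta> z / w z)" .
  moreover have "1 - w z \<noteq> 0" using False by simp
  ultimately have "\<theta> (z + V) = - \<theta> z / w z" by (metis mult_left_cancel)
  then show ?thesis by (simp add: norm_divide)
qed

text \<open>Shifting y by t = Im \<open>\<tau>\<close> in the exponent creates the additional term 2
  pi y, which cancels 1/|w z|, and two terms pi t that cancel each other. The area 2 pi enters as
  |U|^2 t / 2 = pi.\<close>

lemma Phi_V: "\<Phi> (z + V) = \<Phi> z"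
proof -
  define y where "y = Im (z / U)"
  define t where "t = Im \<tau>"
  have y: "Im ((z + V) / U) = y + t" by (simp add: y_def t_def \<tau>_def add_divide_distrib)
  have t: "(cmod U)\<^sup>2 / 2 * t = pi" using Im_tau by (simp add: t_def mult.commute)
  have "(cmod U)\<^sup>2 / 2 * (y + t)\<^sup>2 - pi * (y + t) = (cmod U)\<^sup>2 / 2 * y\<^sup>2 + 2 * y * ((cmod U)\<^sup>2 / 2 * t) + t * ((cmod U)\<^sup>2 / 2 * t) - pi * (y + t)"
    by (simp add: power2_eq_square algebra_simps)
  also have "\<dots> = ((cmod U)\<^sup>2 / 2 * y\<^sup>2 - pi * y) + 2 * pi * y"
    unfolding t by (simp add: algebra_simps)
  finally have e: "(cmod U)\<^sup>2 / 2 * (y + t)\<^sup>2 - pi * (y + t) = ((cmod U)\<^sup>2 / 2 * y\<^sup>2 - pi * y) + 2 * pi * y" .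
  show ?thesis unfolding Phi_theta theta_V y e norm_w y_def[symmetric]
    by (simp add: field_simps flip: exp_add)
qed

lemma Phi_lattice: "\<Phi> (z + of_int k * U + of_int l * V) = \<Phi> z"
proof -
  have nat: "\<Phi> (z + of_nat n * X) = \<Phi> z" if "\<And>z. \<Phi> (z + X) = \<Phi> z" for n X z
  proof (induction n)
    case (Suc n)
    have e: "z + of_nat (Suc n) * X = (z + of_nat n * X) + X" by (simp add: algebra_simps)
    show ?case unfolding e that by (rule Suc)
  qed simp
  have int: "\<Phi> (z + of_int k * X) = \<Phi> z" if X: "\<And>z. \<Phi> (z + X) = \<Phi> z" for k X z
  proof (cases k rule: int_cases2)
    case (nonneg n) then show ?thesis using nat[OF X] by simp
  next
    case (nonpos n) then show ?thesis using nat[OF X, of "z - of_nat n * X" n] by simp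
  qed
  show ?thesis using int[OF Phi_V] int[OF Phi_U] by simp
qed

text \<open>The first factor of \<open>\<theta>\<close> vanishes where \<open>w z\<close> is q^(-n),
  the second where it is q^(n+1), with n >= 0; together these are all integer powers of q. Comparing
  exponents modulo 2 pi i turns \<open>w z\<close> = q^k into membership in the lattice.\<close>

lemma P_eq_0_iff: "P z = 0 \<longleftrightarrow> (\<exists>k l. z = of_int k * U + of_int l * V)"
proof -
  have "P z = 0 \<longleftrightarrow> (\<exists>n. w z * q ^ n = 1) \<or> (\<exists>n. q / w z * q ^ n = 1)"
    by (simp add: P_def \<theta>_def f_eq_0_iff)
  also have "\<dots> \<longleftrightarrow> (\<exists>k. w z = q powi k)"
  proof safe
    fix n assume "w z * q ^ n = 1"
    then have "w z = q powi (- int n)" using q(1) by (simp add: power_int_minus field_simps)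
    then show "\<exists>k. w z = q powi k" by blast
  next
    fix n assume "q / w z * q ^ n = 1"
    then have "w z = q powi (int (Suc n))" using q(1) w_nz[of z] by (simp add: power_int_def field_simps nat_add_distrib)
    then show "\<exists>k. w z = q powi k" by blast
  next
    fix k assume k: "w z = q powi k" "\<nexists>n. q / w z * q ^ n = 1"
    show "\<exists>n. w z * q ^ n = 1"
    proof (cases k rule: int_cases3)
      case (pos n)
      then obtain m where "n = Suc m" by (cases n) auto
      then have "q / w z * q ^ m = 1" using k(1) pos q(1) by (simp add: power_int_def field_simps nat_add_distrib)
      then show ?thesis using k(2) by blast
    next
      case (neg n)
      then have "w z * q ^ n = 1" using k(1) q(1) by (simp add: power_int_minus)
      then show ?thesis by blast
    next
      case zero
      then have "w z * q ^ 0 = 1" using k(1) by simp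
      then show ?thesis by blast
    qed
  qed
  also have "\<dots> \<longleftrightarrow> (\<exists>k l. z = of_int k * U + of_int l * V)"
  proof -
    have "w z = q powi k \<longleftrightarrow> (\<exists>m. z = of_int m * U + of_int k * V)" for k
    proof -
      have "q powi k = exp (2 * of_real pi * \<i> * (of_int k * \<tau>))"
        unfolding q_def exp_power_int by (simp add: mult_ac)
      then have "w z = q powi k \<longleftrightarrow> (\<exists>m::int. 2 * of_real pi * \<i> * (z / U) = 2 * of_real pi * \<i> * (of_int k * \<tau>) + of_int (2 * m) * pi * \<i>)"
        unfolding w_def by (simp only: exp_eq)
      also have "\<dots> \<longleftrightarrow> (\<exists>m::int. z / U = of_int k * \<tau> + of_int m)"
      proof -
        have "2 * of_real pi * \<i> * (of_int k * \<tau>) + of_int (2 * m) * pi * \<i> = 2 * of_real pi * \<i> * (of_int k * \<tau> + of_int m)" for m :: int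
          by (simp add: algebra_simps)
        moreover have "2 * of_real pi * \<i> \<noteq> 0" by simp
        ultimately have "2 * of_real pi * \<i> * (z / U) = 2 * of_real pi * \<i> * (of_int k * \<tau>) + of_int (2 * m) * pi * \<i> \<longleftrightarrow> z / U = of_int k * \<tau> + of_int m" for m :: int
          by (metis mult_left_cancel)
        then show ?thesis by (simp only:)
      qed
      also have "\<dots> \<longleftrightarrow> (\<exists>m. z = of_int m * U + of_int k * V)"
      proof -
        have "z / U = of_int k * \<tau> + of_int m \<longleftrightarrow> z = (of_int k * \<tau> + of_int m) * U" for m
          using U_nz by (rule nonzero_divide_eq_eq)
        moreover have "(of_int k * \<tau> + of_int m) * U = of_int m * U + of_int k * V" for m
          using U_nz by (simp add: \<tau>_def distrib_right)
        ultimately show ?thesis by simp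
      qed
      finally show ?thesis .
    qed
    then show ?thesis by blast
  qed
  finally show ?thesis .
qed

text \<open>Among the factors of the product only 1 - \<open>w z\<close> vanishes at 0, and to first
  order. The remaining factor is nonzero there because no positive power of q equals 1.\<close>

lemma deriv_P_0: "deriv P 0 \<noteq> 0"
proof -
  have fq: "f q \<noteq> 0"
  proof
    assume "f q = 0"
    then obtain n where "q * q ^ n = 1" by (auto simp: f_eq_0_iff)
    then have "q ^ Suc n = 1" by simp
    then have "cmod q ^ Suc n = 1" by (metis norm_one norm_power)
    moreover have "cmod q ^ Suc n < 1" by (rule power_Suc_less_one) (use q in auto)
    ultimately show False by linarith
  qed
  define h where "h z = f (q * w z) * f (q / w z) * exp (of_real ((cmod U)\<^sup>2) / (4 * U\<^sup>2) * z\<^sup>2 - \<i> * of_real pi / U * z)" for z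
  have P: "P z = (1 - w z) * h z" for z
    unfolding P_def \<theta>_def h_def f_rec[of "w z"] by (simp add: mult_ac)
  have wh: "w holomorphic_on UNIV" unfolding w_def[abs_def] using U_nz by (intro holomorphic_intros) auto
  have "(f \<circ> (\<lambda>z. q * w z)) holomorphic_on UNIV"
    by (rule holomorphic_on_compose_gen[OF _ holomorphic[of UNIV]]) (use wh in \<open>auto intro!: holomorphic_intros\<close>)
  moreover have "(f \<circ> (\<lambda>z. q / w z)) holomorphic_on UNIV"
    by (rule holomorphic_on_compose_gen[OF _ holomorphic[of UNIV]]) (use wh w_nz in \<open>auto intro!: holomorphic_intros\<close>)
  ultimately have "h holomorphic_on UNIV"
    unfolding h_def[abs_def] o_def using U_nz by (intro holomorphic_intros) auto
  then obtain h' where h': "(h has_field_derivative h') (at 0)"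
    unfolding holomorphic_on_def field_differentiable_def by auto
  have w': "(w has_field_derivative (2 * of_real pi * \<i> / U)) (at 0)"
    unfolding w_def[abs_def] using U_nz by (auto intro!: derivative_eq_intros)
  have "(P has_field_derivative ((1 - w 0) * h' + (0 - 2 * of_real pi * \<i> / U) * h 0)) (at 0)"
    unfolding P[abs_def] by (intro DERIV_mult' DERIV_diff DERIV_const w' h')
  then have "deriv P 0 = - (2 * of_real pi * \<i> / U) * h 0"
    by (simp add: w_def DERIV_imp_deriv)
  moreover have "h 0 \<noteq> 0" using fq by (simp add: h_def w_def)
  ultimately show ?thesis using U_nz by simp
qed

text \<open>Quasi-periodicity is available only for the modulus of \<open>P\<close>, so simplicity
  of the zero is carried from 0 to \<open>p\<close> through the modulus of the difference
  quotients.\<close>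

lemma deriv_P_lattice:
  assumes p: "p = of_int k * U + of_int l * V"
  shows "deriv P p \<noteq> 0"
proof -
  have z: "P 0 = 0" "P p = 0" unfolding P_eq_0_iff using p by (auto intro: exI[of _ 0])
  have d: "(P has_field_derivative deriv P a) (at a)" for a
    by (rule holomorphic_derivI[OF P_holomorphic[of UNIV]]) auto
  have "((\<lambda>h. (P (0 + h) - P 0) / h) \<longlongrightarrow> deriv P 0) (at 0)" using d[of 0] by (simp add: DERIV_def)
  then have "((\<lambda>h. cmod (P h / h) * exp (((cmod (p + h))\<^sup>2 - (cmod h)\<^sup>2) / 4)) \<longlongrightarrow> cmod (deriv P 0) * exp (((cmod (p + 0))\<^sup>2 - (cmod 0)\<^sup>2) / 4)) (at 0)"
    using z by (intro tendsto_intros) auto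
  then have A: "((\<lambda>h. cmod (P h / h) * exp (((cmod (p + h))\<^sup>2 - (cmod h)\<^sup>2) / 4)) \<longlongrightarrow> cmod (deriv P 0) * exp (((cmod (p + 0))\<^sup>2 - (cmod 0)\<^sup>2) / 4)) (at 0)" .
  have "cmod (P h) * exp (((cmod (p + h))\<^sup>2 - (cmod h)\<^sup>2) / 4) = cmod (P (p + h))" for h
  proof -
    have "\<Phi> (p + h) = \<Phi> h" using Phi_lattice[of h k l] by (simp add: p add_ac)
    then have "cmod (P (p + h)) * exp (- (cmod (p + h))\<^sup>2 / 4) * exp ((cmod (p + h))\<^sup>2 / 4) = cmod (P h) * exp (- (cmod h)\<^sup>2 / 4) * exp ((cmod (p + h))\<^sup>2 / 4)"
      by (simp add: \<Phi>_def)
    then show ?thesis by (simp add: mult.assoc diff_divide_distrib flip: exp_add)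
  qed
  then have e: "cmod (P h / h) * exp (((cmod (p + h))\<^sup>2 - (cmod h)\<^sup>2) / 4) = cmod ((P (p + h) - P p) / h)" for h
    using z by (simp add: norm_divide)
  have B: "((\<lambda>h. cmod ((P (p + h) - P p) / h)) \<longlongrightarrow> cmod (deriv P p)) (at 0)"
    using d[of p] by (intro tendsto_norm) (simp add: DERIV_def)
  have "cmod (deriv P p) = cmod (deriv P 0) * exp (((cmod (p + 0))\<^sup>2 - (cmod 0)\<^sup>2) / 4)"
    by (rule tendsto_unique[OF at_neq_bot B A[unfolded e]])
  then show ?thesis using deriv_P_0 by auto
qed

end

lemma (in plane_lattice) exists_quasiperiodic_entire:
  obtains P where "P holomorphic_on UNIV" "\<And>x. P (to_complex x) = 0 \<longleftrightarrow> x \<in> L"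
    "\<And>x. x \<in> L \<Longrightarrow> deriv P (to_complex x) \<noteq> 0"
    "\<And>x w. w \<in> L \<Longrightarrow> cmod (P (to_complex (x + w))) * exp (- (norm (x + w))\<^sup>2 / 4) = cmod (P (to_complex x)) * exp (- (norm x)\<^sup>2 / 4)"
proof -
  \<comment> \<open>The pair \<open>u\<close>, \<open>v\<close> may be negatively oriented.
    Replacing \<open>v\<close> by its negative repairs this and generates the same lattice.\<close>
  define e :: real where "e = (if D > 0 then 1 else -1)"
  have "Im (cnj (to_complex u) * (of_real e * to_complex v)) = e * D"
    by (simp add: to_complex_def D_def algebra_simps)
  also have "\<dots> = 2 * pi" using abs_D by (auto simp: e_def)
  finally interpret theta "to_complex u" "of_real e * to_complex v" by unfold_locales
  have e: "e = 1 \<or> e = -1" by (simp add: e_def)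
  have Lc: "x \<in> L \<longleftrightarrow> (\<exists>k l. to_complex x = of_int k * to_complex u + of_int l * (of_real e * to_complex v))" for x
  proof -
    have "x \<in> L \<longleftrightarrow> (\<exists>k l. to_complex x = to_complex (of_int k *\<^sub>R u + of_int l *\<^sub>R v))"
      by (auto simp: lattice_def)
    also have "\<dots> \<longleftrightarrow> (\<exists>k l. to_complex x = of_int k * to_complex u + of_int l * to_complex v)"
      by (simp add: to_complex_add to_complex_scaleR)
    also have "\<dots> \<longleftrightarrow> (\<exists>k l. to_complex x = of_int k * to_complex u + of_int l * (of_real e * to_complex v))"
    proof (cases "e = 1")
      case False
      then have "e = -1" using e by simp
      then have "of_int l * to_complex v = of_int (- l) * (of_real e * to_complex v)" for l by simp
      then show ?thesis by (metis minus_minus)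
    qed simp
    finally show ?thesis .
  qed
  show ?thesis
  proof (rule that[of P])
    show "P holomorphic_on UNIV" by (rule P_holomorphic)
    show "P (to_complex x) = 0 \<longleftrightarrow> x \<in> L" for x unfolding P_eq_0_iff Lc ..
    show "x \<in> L \<Longrightarrow> deriv P (to_complex x) \<noteq> 0" for x unfolding Lc using deriv_P_lattice by blast
    fix x w assume "w \<in> L"
    then obtain k l where kl: "to_complex w = of_int k * to_complex u + of_int l * (of_real e * to_complex v)" unfolding Lc by blast
    show "cmod (P (to_complex (x + w))) * exp (- (norm (x + w))\<^sup>2 / 4) = cmod (P (to_complex x)) * exp (- (norm x)\<^sup>2 / 4)"
      using Phi_lattice[of "to_complex x" k l] unfolding \<Phi>_def add.assoc kl[symmetric] to_complex_add[symmetric] cmod_to_complex .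
  qed
qed

section \<open>The Green function and its gradient\<close>

text \<open>The zeros are divided out one at a time, each quotient being entire by the removable
  singularity theorem. The logarithmic derivative is carried along because its partial fractions
  supply the Cauchy kernels of the gradient field.\<close>

lemma split_off_simple_zeros:
  assumes P: "P holomorphic_on UNIV" and "finite F" and F: "\<And>p. p \<in> F \<Longrightarrow> P p = 0 \<and> deriv P p \<noteq> 0"
  shows "\<exists>h. h holomorphic_on UNIV \<and> (\<forall>z. P z = h z * (\<Prod>p\<in>F. z - p)) \<and> (\<forall>p\<in>F. h p \<noteq> 0) \<and>
    (\<forall>z. P z \<noteq> 0 \<longrightarrow> deriv P z / P z = deriv h z / h z + (\<Sum>p\<in>F. 1 / (z - p)))"
  using assms(2) F
proof (induction F rule: finite_induct)
  case empty
  then show ?case using P by (intro exI[of _ P]) auto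
next
  case (insert p F)
  then obtain h where h: "h holomorphic_on UNIV" "\<And>z. P z = h z * (\<Prod>p\<in>F. z - p)" "\<And>p. p \<in> F \<Longrightarrow> h p \<noteq> 0"
    "\<And>z. P z \<noteq> 0 \<Longrightarrow> deriv P z / P z = deriv h z / h z + (\<Sum>p\<in>F. 1 / (z - p))"
    by auto
  have prod_nz: "(\<Prod>q\<in>F. p - q) \<noteq> 0" using insert.hyps by (auto simp: prod_zero_iff)
  have hp: "h p = 0" using h(2)[of p] prod_nz insert.prems[of p] by auto
  define g where "g z = (if z = p then deriv h p else (h z - h p) / (z - p))" for z
  have g: "g holomorphic_on UNIV" unfolding g_def[abs_def] by (rule pole_lemma[OF h(1)]) auto
  have hg: "h z = (z - p) * g z" for z by (simp add: g_def hp)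
  have dg: "(g has_field_derivative deriv g z) (at z)" for z using holomorphic_derivI[OF g] by auto
  have dh: "deriv h z = g z + (z - p) * deriv g z" for z
  proof -
    have "(h has_field_derivative ((z - p) * deriv g z + (1 - 0) * g z)) (at z)"
      unfolding hg[abs_def] by (intro DERIV_mult' DERIV_diff DERIV_ident DERIV_const dg)
    then show ?thesis by (simp add: DERIV_imp_deriv)
  qed
  show ?case
  proof (intro exI[of _ g] conjI allI ballI impI)
    show "g holomorphic_on UNIV" by (fact g)
    show "P z = g z * (\<Prod>p\<in>insert p F. z - p)" for z
      using insert.hyps by (simp add: h(2)[of z] hg mult_ac)
    show "g q \<noteq> 0" if "q \<in> insert p F" for q
    proof (cases "q = p")
      case True
      have "((\<lambda>z. \<Prod>p\<in>F. z - p) has_field_derivative deriv (\<lambda>z. \<Prod>p\<in>F. z - p) p) (at p)"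
        by (rule holomorphic_derivI[of _ UNIV]) (auto intro!: holomorphic_intros)
      then have "(P has_field_derivative (h p * deriv (\<lambda>z. \<Prod>p\<in>F. z - p) p + deriv h p * (\<Prod>q\<in>F. p - q))) (at p)"
        unfolding h(2)[abs_def] using holomorphic_derivI[OF h(1)] by (intro DERIV_mult') auto
      then have "deriv P p = g p * (\<Prod>q\<in>F. p - q)" by (simp add: DERIV_imp_deriv hp dh)
      then show ?thesis using insert.prems[of p] True by auto
    next
      case False
      then show ?thesis using that h(3)[of q] hg[of q] by auto
    qed
    fix z assume z: "P z \<noteq> 0"
    then have nz: "g z \<noteq> 0" "z - p \<noteq> 0" by (auto simp: h(2) hg)
    have "deriv P z / P z = deriv h z / h z + (\<Sum>p\<in>F. 1 / (z - p))" by (rule h(4)[OF z])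
    also have "deriv h z / h z = deriv g z / g z + 1 / (z - p)"
      unfolding dh hg using nz by (simp add: add_divide_distrib)
    finally show "deriv P z / P z = deriv g z / g z + (\<Sum>p\<in>insert p F. 1 / (z - p))"
      using insert.hyps by simp
  qed
qed

text \<open>From here on the theta function is known only through these four properties.\<close>

locale quasiperiodic = plane_lattice +
  fixes P :: "complex \<Rightarrow> complex"
  assumes P_holo: "P holomorphic_on UNIV"
    and P_zero: "P (to_complex x) = 0 \<longleftrightarrow> x \<in> lattice u v"
    and P_simple: "x \<in> lattice u v \<Longrightarrow> deriv P (to_complex x) \<noteq> 0"
    and P_quasi: "w \<in> lattice u v \<Longrightarrow> cmod (P (to_complex (x + w))) * exp (- (norm (x + w))\<^sup>2 / 4) = cmod (P (to_complex x)) * exp (- (norm x)\<^sup>2 / 4)"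
begin

text \<open>\<open>pot\<close> is the Green function up to an additive constant, and \<open>fld = \<partial>\<^sub>1 pot - \<i> \<partial>\<^sub>2 pot\<close>.\<close>

definition "pot x = (norm x)\<^sup>2 / 4 - ln (cmod (P (to_complex x)))"
definition "fld x = cnj (to_complex x) / 2 - deriv P (to_complex x) / P (to_complex x)"

lemma P_deriv: "(P has_field_derivative deriv P z) (at z)"
  using holomorphic_derivI[OF P_holo] by auto

lemma P_cont: "continuous_on A P" by (rule holomorphic_on_imp_continuous_on[OF holomorphic_on_subset[OF P_holo]]) auto
lemma dP_cont: "continuous_on A (deriv P)"
  using holomorphic_on_imp_continuous_on[OF holomorphic_deriv[OF P_holo open_UNIV]] continuous_on_subset by blast

lemma pot_measurable [measurable]: "pot \<in> borel_measurable borel"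
proof -
  have [measurable]: "P \<in> borel_measurable borel" by (rule borel_measurable_continuous_onI[OF P_cont])
  show ?thesis unfolding pot_def[abs_def] by measurable
qed

lemma fld_measurable [measurable]: "fld \<in> borel_measurable borel"
proof -
  have [measurable]: "P \<in> borel_measurable borel" "deriv P \<in> borel_measurable borel"
    by (intro borel_measurable_continuous_onI P_cont dP_cont)+
  have [measurable]: "cnj \<in> borel_measurable borel" by (intro borel_measurable_continuous_onI continuous_intros)
  show ?thesis unfolding fld_def[abs_def] by measurable
qed

text \<open>After the zeros in a ball are divided out, a holomorphic factor without zeros there
  remains, so \<open>fld\<close> is a smooth field minus Cauchy kernels. Its smooth part satisfies
  (d1 + i d2) m = 1, contributed entirely by cnj z / 2; this is the uniform background
  charge.\<close>

lemma local_structure: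
  fixes R :: real
  defines "F \<equiv> L \<inter> cball 0 R"
  obtains m m' h C where
    "\<And>x. norm x \<le> R \<Longrightarrow> x \<notin> L \<Longrightarrow> fld x = m x - (\<Sum>p\<in>F. 1 / to_complex (x - p))"
    "\<And>x. norm x < R \<Longrightarrow> (m has_derivative m' x) (at x)"
    "\<And>h. continuous_on (ball 0 R) (\<lambda>x. m' x h)"
    "\<And>x. norm x < R \<Longrightarrow> m' x (axis 1 1) + \<i> * m' x (axis 2 1) = 1"
    "\<And>x. norm x \<le> R \<Longrightarrow> x \<notin> L \<Longrightarrow> pot x = h x - (\<Sum>p\<in>F. ln (norm (x - p)))"
    "C > 0" "\<And>x. norm x \<le> R \<Longrightarrow> cmod (m x) \<le> C" "\<And>x. norm x \<le> R \<Longrightarrow> \<bar>h x\<bar> \<le> C"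
proof -
  have finF: "finite F" unfolding F_def by (intro finite_L) auto
  define Fc where "Fc = to_complex ` F"
  have inj: "inj_on to_complex F" by (auto simp: inj_on_def)
  have "\<exists>h. h holomorphic_on UNIV \<and> (\<forall>z. P z = h z * (\<Prod>p\<in>Fc. z - p)) \<and> (\<forall>p\<in>Fc. h p \<noteq> 0) \<and>
    (\<forall>z. P z \<noteq> 0 \<longrightarrow> deriv P z / P z = deriv h z / h z + (\<Sum>p\<in>Fc. 1 / (z - p)))"
    by (rule split_off_simple_zeros[OF P_holo]) (use finF P_zero P_simple in \<open>auto simp: Fc_def F_def\<close>)
  then obtain h where h: "h holomorphic_on UNIV" "\<And>z. P z = h z * (\<Prod>p\<in>Fc. z - p)" "\<And>p. p \<in> Fc \<Longrightarrow> h p \<noteq> 0"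
    "\<And>z. P z \<noteq> 0 \<Longrightarrow> deriv P z / P z = deriv h z / h z + (\<Sum>p\<in>Fc. 1 / (z - p))"
    by blast
  have hnz: "h (to_complex x) \<noteq> 0" if "norm x \<le> R" for x
  proof (cases "x \<in> L")
    case True
    then show ?thesis using that by (intro h(3)) (auto simp: Fc_def F_def)
  next
    case False
    then show ?thesis using P_zero[of x] h(2)[of "to_complex x"] by auto
  qed
  have hd: "(h has_field_derivative deriv h z) (at z)" for z using holomorphic_derivI[OF h(1)] by auto
  have hc: "continuous_on A h" for A by (rule holomorphic_on_imp_continuous_on[OF holomorphic_on_subset[OF h(1)]]) auto
  have h2: "deriv h holomorphic_on UNIV" by (rule holomorphic_deriv[OF h(1)]) auto
  have hd2: "(deriv h has_field_derivative deriv (deriv h) z) (at z)" for z using holomorphic_derivI[OF h2] by auto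
  have hc1: "continuous_on A (deriv h)" for A by (rule holomorphic_on_imp_continuous_on[OF holomorphic_on_subset[OF h2]]) auto
  have hc2: "continuous_on A (deriv (deriv h))" for A
    using holomorphic_on_imp_continuous_on[OF holomorphic_deriv[OF h2 open_UNIV]] continuous_on_subset by blast
  define g where "g z = deriv h z / h z" for z
  define g' where "g' z = (deriv (deriv h) z * h z - deriv h z * deriv h z) / (h z)\<^sup>2" for z
  define m where "m x = cnj (to_complex x) / 2 - g (to_complex x)" for x
  define m' where "m' x h = cnj (to_complex h) / 2 - g' (to_complex x) * to_complex h" for x h
  define H where "H x = (norm x)\<^sup>2 / 4 - ln (cmod (h (to_complex x)))" for x
  have cc: "continuous_on (cball 0 R) (\<lambda>x. h (to_complex x))" "continuous_on (cball 0 R) (\<lambda>x. deriv h (to_complex x))"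
    "continuous_on (cball 0 R) (\<lambda>x. deriv (deriv h) (to_complex x))"
    by (intro continuous_on_compose2[OF hc[of UNIV]] continuous_on_compose2[OF hc1[of UNIV]] continuous_on_compose2[OF hc2[of UNIV]] continuous_intros; simp)+
  have mc: "continuous_on (cball 0 R) m"
    unfolding m_def[abs_def] g_def using cc hnz by (intro continuous_intros) auto
  have Hc: "continuous_on (cball 0 R) H"
    unfolding H_def[abs_def] using cc hnz by (intro continuous_intros) auto
  have "bounded (m ` cball 0 R)" "bounded (H ` cball 0 R)"
    by (intro compact_imp_bounded compact_continuous_image mc Hc; simp)+
  then obtain C1 C2 where C: "C1 > 0" "\<And>x. x \<in> cball 0 R \<Longrightarrow> cmod (m x) \<le> C1" "C2 > 0" "\<And>x. x \<in> cball 0 R \<Longrightarrow> \<bar>H x\<bar> \<le> C2"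
    unfolding bounded_pos by (force simp: image_iff)
  show ?thesis
  proof (rule that[of m m' H "C1 + C2"])
    fix x assume x: "norm x \<le> R" "x \<notin> L"
    have nz: "P (to_complex x) \<noteq> 0" using x P_zero by simp
    have s: "(\<Sum>p\<in>Fc. 1 / (to_complex x - p)) = (\<Sum>p\<in>F. 1 / to_complex (x - p))"
      unfolding Fc_def by (subst sum.reindex[OF inj]) (simp add: to_complex_diff)
    show "fld x = m x - (\<Sum>p\<in>F. 1 / to_complex (x - p))"
      unfolding fld_def h(4)[OF nz] m_def g_def s by simp
    have "cmod (P (to_complex x)) = cmod (h (to_complex x)) * (\<Prod>p\<in>F. norm (x - p))"
      unfolding h(2)[of "to_complex x"] norm_mult Fc_def
      by (subst prod.reindex[OF inj]) (simp add: prod_norm[symmetric] flip: to_complex_diff)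
    moreover have "x - p \<noteq> 0" if "p \<in> F" for p using that x by (auto simp: F_def)
    ultimately have "ln (cmod (P (to_complex x))) = ln (cmod (h (to_complex x))) + (\<Sum>p\<in>F. ln (norm (x - p)))"
      using hnz[OF x(1)] finF by (simp add: ln_mult prod_pos ln_prod)
    then show "pot x = H x - (\<Sum>p\<in>F. ln (norm (x - p)))" by (simp add: pot_def H_def)
  next
    fix x :: "real^2" assume x: "norm x < R"
    have g: "(g has_field_derivative g' (to_complex x)) (at (to_complex x))"
      unfolding g_def[abs_def] g'_def power2_eq_square using hnz[of x] x by (intro DERIV_divide hd hd2) auto
    have Z: "(to_complex has_derivative to_complex) (at x)"
      by (rule bounded_linear_imp_has_derivative[OF bounded_linear_to_complex])
    have 1: "((\<lambda>x. g (to_complex x)) has_derivative (\<lambda>h. g' (to_complex x) * to_complex h)) (at x)"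
      using has_derivative_compose[OF Z g[unfolded has_field_derivative_def]] by simp
    have "bounded_linear (\<lambda>x. cnj (to_complex x))"
      by (rule bounded_linear_compose[OF bounded_linear_cnj bounded_linear_to_complex])
    then have 2: "((\<lambda>x. cnj (to_complex x) / 2) has_derivative (\<lambda>h. cnj (to_complex h) / 2)) (at x)"
      by (intro bounded_linear_imp_has_derivative bounded_linear_divide[THEN bounded_linear_compose])
    show "(m has_derivative m' x) (at x)"
      unfolding m_def[abs_def] m'_def[abs_def] by (rule has_derivative_diff[OF 2 1])
    show "m' x (axis 1 1) + \<i> * m' x (axis 2 1) = 1"
      by (simp add: m'_def algebra_simps)
  next
    fix ha :: "real^2"
    have "continuous_on (cball 0 R) (\<lambda>x. m' x ha)"
      unfolding m'_def[abs_def] g'_def using cc hnz by (intro continuous_intros) auto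
    then show "continuous_on (ball 0 R) (\<lambda>x. m' x ha)"
      by (rule continuous_on_subset) auto
  qed (use C in \<open>auto intro: add_pos_pos order_trans\<close>, (force+)?)
qed

end

section \<open>Majorants with finitely many simple poles\<close>

lemma majorant_integrable:
  assumes "finite F"
  shows "set_integrable lebesgue (cball q R) (\<lambda>x. C + D * (\<Sum>p\<in>F. 1 / norm (x - p :: real^2)))"
proof -
  have c: "set_integrable lebesgue (cball q R) (\<lambda>x. C)"
    using locally_integrable_const[of C] by (auto simp: locally_integrable_def)
  have "integrable lebesgue (\<lambda>x. D * (\<Sum>p\<in>F. indicator (cball q R) x *\<^sub>R (1 / norm (x - p))))"
    using set_integrable_inverse_norm[of q R] unfolding set_integrable_def
    by (intro integrable_mult_right Bochner_Integration.integrable_sum) auto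
  moreover have "D * (\<Sum>p\<in>F. indicator (cball q R) x *\<^sub>R (1 / norm (x - p))) = indicator (cball q R) x *\<^sub>R (D * (\<Sum>p\<in>F. 1 / norm (x - p)))" for x
    by (simp add: sum_distrib_left mult_ac)
  ultimately have "set_integrable lebesgue (cball q R) (\<lambda>x. D * (\<Sum>p\<in>F. 1 / norm (x - p)))"
    unfolding set_integrable_def by (simp only:)
  with c show ?thesis by (rule set_integral_add)
qed

text \<open>The common criterion for \<open>pot\<close>, \<open>fld\<close>, the mixed products and
  the self energy: on each ball a constant plus finitely many simple poles suffices as a bound. The
  exceptional set \<open>N\<close> contains the poles themselves.\<close>

lemma locally_integrable_majorant:
  fixes f :: "real^2 \<Rightarrow> 'b::euclidean_space"
  assumes f: "f \<in> borel_measurable lebesgue" and N: "N \<in> null_sets lebesgue"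
    and bd: "\<And>R. R > 0 \<Longrightarrow> \<exists>C D F. finite F \<and> (\<forall>x. norm x \<le> R \<longrightarrow> x \<notin> N \<longrightarrow> norm (f x) \<le> C + D * (\<Sum>p\<in>F. 1 / norm (x - p)))"
  shows "locally_integrable f"
proof (rule locally_integrableI)
  fix R :: real assume "R > 0"
  then obtain C D F where F: "finite F" "\<And>x. norm x \<le> R \<Longrightarrow> x \<notin> N \<Longrightarrow> norm (f x) \<le> C + D * (\<Sum>p\<in>F. 1 / norm (x - p))"
    using bd by metis
  have "set_integrable lebesgue (cball 0 R) f"
    unfolding set_integrable_def
  proof (rule Bochner_Integration.integrable_bound)
    show "integrable lebesgue (\<lambda>x. indicator (cball 0 R) x *\<^sub>R (C + D * (\<Sum>p\<in>F. 1 / norm (x - p))))"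
      using majorant_integrable[OF F(1)] unfolding set_integrable_def .
    show "(\<lambda>x. indicat_real (cball 0 R) x *\<^sub>R f x) \<in> borel_measurable lebesgue"
      using f by (intro borel_measurable_scaleR borel_measurable_indicator) auto
    have "AE x in lebesgue. x \<notin> N" by (rule AE_not_in[OF N])
    then show "AE x in lebesgue. norm (indicat_real (cball 0 R) x *\<^sub>R f x) \<le> norm (indicator (cball 0 R) x *\<^sub>R (C + D * (\<Sum>p\<in>F. 1 / norm (x - p))))"
      by eventually_elim (use F(2) in \<open>force simp: indicator_def\<close>)
  qed
  then show "set_integrable lebesgue (ball 0 R) f"
    by (rule set_integrable_subset) auto
qed

lemma infsum_finite_support:
  fixes f :: "'a \<Rightarrow> real"
  assumes "finite F" "F \<subseteq> A" "\<And>x. x \<in> A - F \<Longrightarrow> f x = 0"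
  shows "infsum f A = sum f F"
proof -
  have "infsum f A = infsum f F" by (rule infsum_cong_neutral) (use assms in auto)
  then show ?thesis using assms by simp
qed

context quasiperiodic begin

lemma null_L: "L \<in> null_sets lebesgue"
  using countable_imp_null_set_lborel[OF countable_L] by (auto intro: null_sets_completionI)

lemma AE_not_L: "AE x in lebesgue. x \<notin> L" by (rule AE_not_in[OF null_L])

lemma fld_bound:
  "\<exists>C. C > 0 \<and> (\<forall>x. norm x \<le> R \<longrightarrow> x \<notin> L \<longrightarrow> cmod (fld x) \<le> C + (\<Sum>p\<in>L \<inter> cball 0 R. 1 / norm (x - p)))"
proof -
  obtain m m' h C where *: "\<And>x. norm x \<le> R \<Longrightarrow> x \<notin> L \<Longrightarrow> fld x = m x - (\<Sum>p\<in>L \<inter> cball 0 R. 1 / to_complex (x - p))"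
    "C > 0" "\<And>x. norm x \<le> R \<Longrightarrow> cmod (m x) \<le> C"
    using local_structure[of R] by metis
  have "cmod (fld x) \<le> C + (\<Sum>p\<in>L \<inter> cball 0 R. 1 / norm (x - p))" if "norm x \<le> R" "x \<notin> L" for x
  proof -
    have "cmod (fld x) \<le> cmod (m x) + cmod (\<Sum>p\<in>L \<inter> cball 0 R. 1 / to_complex (x - p))"
      unfolding *(1)[OF that] by (rule norm_triangle_ineq4)
    also have "cmod (\<Sum>p\<in>L \<inter> cball 0 R. 1 / to_complex (x - p)) \<le> (\<Sum>p\<in>L \<inter> cball 0 R. cmod (1 / to_complex (x - p)))"
      by (rule norm_sum)
    also have "\<dots> = (\<Sum>p\<in>L \<inter> cball 0 R. 1 / norm (x - p))" by (simp add: norm_divide)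
    finally show ?thesis using *(3)[OF that(1)] by linarith
  qed
  then show ?thesis using *(2) by blast
qed

lemma pot_bound:
  "\<exists>C. C > 0 \<and> (\<forall>x. norm x \<le> R \<longrightarrow> x \<notin> L \<longrightarrow> \<bar>pot x\<bar> \<le> C + (\<Sum>p\<in>L \<inter> cball 0 R. 1 / norm (x - p)))"
proof -
  obtain m m' h C where *: "\<And>x. norm x \<le> R \<Longrightarrow> x \<notin> L \<Longrightarrow> pot x = h x - (\<Sum>p\<in>L \<inter> cball 0 R. ln (norm (x - p)))"
    "C > 0" "\<And>x. norm x \<le> R \<Longrightarrow> \<bar>h x\<bar> \<le> C"
    using local_structure[of R] by metis
  \<comment> \<open>Brings logarithmic poles under the same majorant as simple ones.\<close>
  have lnb: "\<bar>ln r\<bar> \<le> r + 1 / r" if "r > 0" for r :: real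
  proof -
    have "ln r \<le> r" using ln_le_minus_one[OF that] by linarith
    moreover have "- ln r \<le> 1 / r" using ln_le_minus_one[of "1 / r"] that by (simp add: ln_div)
    ultimately show ?thesis using that by (auto simp: abs_le_iff intro: add_increasing add_increasing2)
  qed
  define K where "K = (\<Sum>p\<in>L \<inter> cball 0 R. R + norm p)"
  have "\<bar>pot x\<bar> \<le> (C + K) + (\<Sum>p\<in>L \<inter> cball 0 R. 1 / norm (x - p))" if x: "norm x \<le> R" "x \<notin> L" for x
  proof -
    have "\<bar>pot x\<bar> \<le> \<bar>h x\<bar> + \<bar>\<Sum>p\<in>L \<inter> cball 0 R. ln (norm (x - p))\<bar>"
      unfolding *(1)[OF x] by linarith
    also have "\<bar>\<Sum>p\<in>L \<inter> cball 0 R. ln (norm (x - p))\<bar> \<le> (\<Sum>p\<in>L \<inter> cball 0 R. \<bar>ln (norm (x - p))\<bar>)"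
      by (rule sum_abs)
    also have "\<dots> \<le> (\<Sum>p\<in>L \<inter> cball 0 R. (R + norm p) + 1 / norm (x - p))"
    proof (rule sum_mono)
      fix p assume p: "p \<in> L \<inter> cball 0 R"
      then have "norm (x - p) > 0" using x by auto
      then have "\<bar>ln (norm (x - p))\<bar> \<le> norm (x - p) + 1 / norm (x - p)" by (rule lnb)
      then show "\<bar>ln (norm (x - p))\<bar> \<le> (R + norm p) + 1 / norm (x - p)"
        using norm_triangle_ineq4[of x p] x(1) by linarith
    qed
    also have "\<dots> = K + (\<Sum>p\<in>L \<inter> cball 0 R. 1 / norm (x - p))" by (simp add: sum.distrib K_def)
    finally show ?thesis using *(3)[OF x(1)] by linarith
  qed
  moreover have "C + K > 0"
  proof -
    have "R + norm p \<ge> 0" if "p \<in> L \<inter> cball 0 R" for p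
    proof -
      have "norm p \<le> R" using that by simp
      then show ?thesis using norm_ge_zero[of p] by linarith
    qed
    then have "K \<ge> 0" unfolding K_def by (intro sum_nonneg) auto
    then show ?thesis using *(2) by simp
  qed
  ultimately show ?thesis by blast
qed

lemma fld_locally_integrable: "locally_integrable fld"
proof (rule locally_integrable_majorant[OF _ null_L])
  show "fld \<in> borel_measurable lebesgue" by (intro measurable_completion) measurable
  fix R :: real
  obtain C where C: "\<And>x. norm x \<le> R \<Longrightarrow> x \<notin> L \<Longrightarrow> cmod (fld x) \<le> C + (\<Sum>p\<in>L \<inter> cball 0 R. 1 / norm (x - p))"
    using fld_bound by blast
  show "\<exists>C D F. finite F \<and> (\<forall>x. norm x \<le> R \<longrightarrow> x \<notin> L \<longrightarrow> cmod (fld x) \<le> C + D * (\<Sum>p\<in>F. 1 / norm (x - p)))"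
    by (intro exI[of _ C] exI[of _ 1] exI[of _ "L \<inter> cball 0 R"]) (use C finite_L in auto)
qed

lemma pot_locally_integrable: "locally_integrable pot"
proof (rule locally_integrable_majorant[OF _ null_L])
  show "pot \<in> borel_measurable lebesgue" by (intro measurable_completion) measurable
  fix R :: real
  obtain C where C: "\<And>x. norm x \<le> R \<Longrightarrow> x \<notin> L \<Longrightarrow> \<bar>pot x\<bar> \<le> C + (\<Sum>p\<in>L \<inter> cball 0 R. 1 / norm (x - p))"
    using pot_bound by blast
  show "\<exists>C D F. finite F \<and> (\<forall>x. norm x \<le> R \<longrightarrow> x \<notin> L \<longrightarrow> norm (pot x) \<le> C + D * (\<Sum>p\<in>F. 1 / norm (x - p)))"
    by (intro exI[of _ C] exI[of _ 1] exI[of _ "L \<inter> cball 0 R"]) (use C finite_L in auto)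
qed

text \<open>The weak form of (d1 + i d2) \<open>fld\<close> = 1 - 2 pi times the point masses on the
  lattice. On the support of \<open>\<phi>\<close> the smooth part is integrated by parts, and each
  pole is an instance of \<open>dbar_cauchy_kernel\<close>.\<close>

lemma dbar_fld:
  assumes \<phi>: "C1c R \<phi>"
  shows "integrable lebesgue (\<lambda>x. dbar \<phi> x * fld x)"
    "(LINT x|lebesgue. dbar \<phi> x * fld x) = of_real (2 * pi * (\<Sum>\<^sub>\<infinity>p\<in>L. \<phi> p) - (LINT x|lebesgue. \<phi> x))"
proof -
  define F where "F = L \<inter> cball 0 (R + 1)"
  have finF: "finite F" unfolding F_def by (intro finite_L) auto
  obtain m m' h C where *: "\<And>x. norm x \<le> R + 1 \<Longrightarrow> x \<notin> L \<Longrightarrow> fld x = m x - (\<Sum>p\<in>F. 1 / to_complex (x - p))"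
    "\<And>x. norm x < R + 1 \<Longrightarrow> (m has_derivative m' x) (at x)"
    "\<And>h. continuous_on (ball 0 (R + 1)) (\<lambda>x. m' x h)"
    "\<And>x. norm x < R + 1 \<Longrightarrow> m' x (axis 1 1) + \<i> * m' x (axis 2 1) = 1"
    using local_structure[of "R + 1"] unfolding F_def by metis
  note mp = dbar_by_parts[OF \<phi>, of "R + 1" m m' "\<lambda>x. 1", OF _ *(2,3,4), simplified]
  have eq: "dbar \<phi> x * fld x = dbar \<phi> x * m x - (\<Sum>p\<in>F. dbar \<phi> x * (1 / to_complex (x - p)))" if "x \<notin> L" for x
  proof (cases "norm x \<le> R + 1")
    case True
    show ?thesis unfolding *(1)[OF True that] by (simp only: right_diff_distrib sum_distrib_left)
  next
    case False
    then have "dbar \<phi> x = 0" using C1cD(5)[OF \<phi>] by (simp add: dbar_def complex_eq_iff)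
    then show ?thesis by simp
  qed
  have ae: "AE x in lebesgue. dbar \<phi> x * m x - (\<Sum>p\<in>F. dbar \<phi> x * (1 / to_complex (x - p))) = dbar \<phi> x * fld x"
    using AE_not_L by eventually_elim (rule eq[symmetric])
  have i: "integrable lebesgue (\<lambda>x. dbar \<phi> x * m x - (\<Sum>p\<in>F. dbar \<phi> x * (1 / to_complex (x - p))))"
    by (intro Bochner_Integration.integrable_diff Bochner_Integration.integrable_sum dbar_cauchy_kernel(1)[OF \<phi>] mp(1)) 
  have dm: "dbar \<phi> \<in> borel_measurable borel"
    by (rule borel_measurable_continuous_onI[OF dbar_continuous[OF \<phi>]])
  have me: "(\<lambda>x. dbar \<phi> x * fld x) \<in> borel_measurable lebesgue"
    using dm fld_measurable by (intro measurable_completion borel_measurable_times) auto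
  show "integrable lebesgue (\<lambda>x. dbar \<phi> x * fld x)"
    by (rule integrable_cong_AE_imp[OF i me ae])
  have "(LINT x|lebesgue. dbar \<phi> x * fld x) = (LINT x|lebesgue. dbar \<phi> x * m x - (\<Sum>p\<in>F. dbar \<phi> x * (1 / to_complex (x - p))))"
    by (rule integral_cong_AE[OF me]) (use i ae in \<open>auto elim: eventually_mono\<close>)
  also have "\<dots> = (LINT x|lebesgue. dbar \<phi> x * m x) - (LINT x|lebesgue. (\<Sum>p\<in>F. dbar \<phi> x * (1 / to_complex (x - p))))"
    by (intro Bochner_Integration.integral_diff Bochner_Integration.integrable_sum dbar_cauchy_kernel(1)[OF \<phi>] mp(1))
  also have "(LINT x|lebesgue. (\<Sum>p\<in>F. dbar \<phi> x * (1 / to_complex (x - p)))) = (\<Sum>p\<in>F. of_real (- 2 * pi * \<phi> p))"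
    unfolding dbar_cauchy_kernel(2)[OF \<phi>, symmetric]
    by (intro Bochner_Integration.integral_sum dbar_cauchy_kernel(1)[OF \<phi>])
  also have "(LINT x|lebesgue. dbar \<phi> x * m x) = - of_real (LINT x|lebesgue. \<phi> x)"
    unfolding mp(3) by simp
  also have "(\<Sum>p\<in>F. complex_of_real (- 2 * pi * \<phi> p)) = - of_real (2 * pi * (\<Sum>p\<in>F. \<phi> p))"
    by (simp add: sum_distrib_left sum_negf)
  also have "(\<Sum>p\<in>F. \<phi> p) = (\<Sum>\<^sub>\<infinity>p\<in>L. \<phi> p)"
    by (rule infsum_finite_support[symmetric, OF finF]) (use C1cD(4)[OF \<phi>] in \<open>auto simp: F_def\<close>)
  finally show "(LINT x|lebesgue. dbar \<phi> x * fld x) = of_real (2 * pi * (\<Sum>\<^sub>\<infinity>p\<in>L. \<phi> p) - (LINT x|lebesgue. \<phi> x))"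
    by simp
qed

text \<open>Replacing \<open>\<bar>P\<bar>\<^sup>2\<close> by \<open>\<bar>P\<bar>\<^sup>2 + \<epsilon>\<^sup>2\<close> removes the singularities, so that one can integrate by parts
  across the lattice before letting \<open>\<epsilon> \<rightarrow> 0\<close>.\<close>

definition "rpot \<epsilon> x = (norm x)\<^sup>2 / 4 - ln ((cmod (P (to_complex x)))\<^sup>2 + \<epsilon>\<^sup>2) / 2"
definition "rfld \<epsilon> x = cnj (to_complex x) / 2 - cnj (P (to_complex x)) * deriv P (to_complex x) / of_real ((cmod (P (to_complex x)))\<^sup>2 + \<epsilon>\<^sup>2)"

lemma rpot_0: "rpot 0 x = pot x"
  \<comment> \<open>At a zero of \<open>P\<close> both sides agree through the default value
    \<open>ln 0 = 0\<close>.\<close>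
  by (cases "P (to_complex x) = 0") (auto simp: rpot_def pot_def ln_realpow)

lemma rfld_0: "rfld 0 x = fld x"
proof (cases "P (to_complex x) = 0")
  case False
  have "complex_of_real ((cmod (P (to_complex x)))\<^sup>2 + 0\<^sup>2) = P (to_complex x) * cnj (P (to_complex x))"
    using complex_norm_square[of "P (to_complex x)"] by simp
  then show ?thesis unfolding rfld_def fld_def using False by simp
qed (simp add: rfld_def fld_def)

lemma rpot_has_derivative:
  assumes "(cmod (P (to_complex x)))\<^sup>2 + \<epsilon>\<^sup>2 > 0"
  shows "(rpot \<epsilon> has_derivative (\<lambda>h. Re (rfld \<epsilon> x * to_complex h))) (at x)"
proof -
  have Z: "(to_complex has_derivative to_complex) (at x)"
    by (rule bounded_linear_imp_has_derivative[OF bounded_linear_to_complex])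
  have Pd: "((\<lambda>x. P (to_complex x)) has_derivative (\<lambda>h. deriv P (to_complex x) * to_complex h)) (at x)"
    using has_derivative_compose[OF Z P_deriv[of "to_complex x", unfolded has_field_derivative_def]] by simp
  define N where "N = (cmod (P (to_complex x)))\<^sup>2 + \<epsilon>\<^sup>2"
  have 1: "((\<lambda>x. (cmod (P (to_complex x)))\<^sup>2 + \<epsilon>\<^sup>2) has_derivative (\<lambda>h. 2 * (P (to_complex x) \<bullet> (deriv P (to_complex x) * to_complex h)))) (at x)"
    unfolding power2_norm_eq_inner by (auto intro!: derivative_eq_intros Pd simp: inner_commute)
  have 2: "((\<lambda>x. ln ((cmod (P (to_complex x)))\<^sup>2 + \<epsilon>\<^sup>2)) has_derivative (\<lambda>h. 2 * (P (to_complex x) \<bullet> (deriv P (to_complex x) * to_complex h)) / N)) (at x)"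
    using has_derivative_ln[OF assms 1] by (simp add: N_def divide_inverse)
  have 3: "((\<lambda>x. (norm x)\<^sup>2 / 4) has_derivative (\<lambda>h. (x \<bullet> h) / 2)) (at x)"
    unfolding power2_norm_eq_inner by (auto intro!: derivative_eq_intros simp: inner_commute)
  have i1: "z \<bullet> y = Re (cnj z * y)" for z y :: complex by (simp add: inner_complex_def)
  have i2: "x \<bullet> h = Re (cnj (to_complex x) * to_complex h)" for h by (simp add: to_complex_def inner_vec_def sum_2)
  have "((\<lambda>x. (norm x)\<^sup>2 / 4 - ln ((cmod (P (to_complex x)))\<^sup>2 + \<epsilon>\<^sup>2) / 2) has_derivative
     (\<lambda>h. (x \<bullet> h) / 2 - 2 * (P (to_complex x) \<bullet> (deriv P (to_complex x) * to_complex h)) / N / 2)) (at x)"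
    by (intro has_derivative_diff 3 bounded_linear.has_derivative[OF bounded_linear_divide 2])
  moreover have "(x \<bullet> h) / 2 - 2 * (P (to_complex x) \<bullet> (deriv P (to_complex x) * to_complex h)) / N / 2 = Re (rfld \<epsilon> x * to_complex h)" for h
  proof -
    have "rfld \<epsilon> x * to_complex h = cnj (to_complex x) * to_complex h / 2 - cnj (P (to_complex x)) * (deriv P (to_complex x) * to_complex h) / of_real N"
      unfolding rfld_def N_def[symmetric] by (simp add: left_diff_distrib)
    moreover have "2 * a / N / 2 = a / N" for a :: real by simp
    ultimately show ?thesis unfolding i1 i2 by (simp only: minus_complex.sel Re_divide_numeral Re_divide_of_real)
  qed
  ultimately show ?thesis unfolding rpot_def[abs_def] by simp
qed

lemma pot_has_derivative: "x \<notin> L \<Longrightarrow> (pot has_derivative (\<lambda>h. Re (fld x * to_complex h))) (at x)"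
  using rpot_has_derivative[of x 0] P_zero[of x] by (simp add: rpot_0 rfld_0 rpot_0[abs_def])

lemma rfld_continuous: "\<epsilon> > 0 \<Longrightarrow> continuous_on A (rfld \<epsilon>)"
proof -
  assume e: "\<epsilon> > 0"
  have n: "(cmod z)\<^sup>2 + \<epsilon>\<^sup>2 > 0" for z using e by (intro add_nonneg_pos) auto
  then have "complex_of_real ((cmod z)\<^sup>2 + \<epsilon>\<^sup>2) \<noteq> 0" for z by (metis less_irrefl of_real_eq_0_iff)
  then show ?thesis unfolding rfld_def[abs_def]
    by (intro continuous_intros continuous_on_compose2[OF P_cont[of UNIV]] continuous_on_compose2[OF dP_cont[of UNIV]]) auto
qed

text \<open>A domination uniform in \<open>\<epsilon>\<close>: enlarging the denominator |P|^2 can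
  only decrease the modulus of the logarithmic derivative.\<close>

lemma rfld_bound:
  assumes "x \<notin> L"
  shows "cmod (rfld \<epsilon> x) \<le> cmod (fld x) + norm x"
proof -
  define p where "p = P (to_complex x)"
  define d where "d = deriv P (to_complex x)"
  have p: "p \<noteq> 0" using assms P_zero by (simp add: p_def)
  have N: "(cmod p)\<^sup>2 + \<epsilon>\<^sup>2 > 0" using p by (intro add_pos_nonneg) auto
  have "cmod (cnj p * d / of_real ((cmod p)\<^sup>2 + \<epsilon>\<^sup>2)) = cmod p * cmod d / ((cmod p)\<^sup>2 + \<epsilon>\<^sup>2)"
    using N by (simp only: norm_divide norm_mult complex_mod_cnj norm_of_real abs_of_pos)
  also have "\<dots> \<le> cmod p * cmod d / (cmod p)\<^sup>2"
    using p N by (intro divide_left_mono) (auto intro!: mult_pos_pos)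
  also have "\<dots> = cmod (d / p)" using p by (simp add: norm_divide power2_eq_square)
  finally have 1: "cmod (cnj p * d / of_real ((cmod p)\<^sup>2 + \<epsilon>\<^sup>2)) \<le> cmod (d / p)" .
  have "cmod (d / p) \<le> cmod (fld x) + norm x / 2"
  proof -
    have "d / p = cnj (to_complex x) / 2 - fld x" by (simp add: fld_def p_def d_def)
    then have "cmod (d / p) \<le> cmod (cnj (to_complex x) / 2) + cmod (fld x)" by (simp only: norm_triangle_ineq4)
    then show ?thesis by (simp add: norm_divide)
  qed
  moreover have "cmod (rfld \<epsilon> x) \<le> cmod (cnj (to_complex x) / 2) + cmod (cnj p * d / of_real ((cmod p)\<^sup>2 + \<epsilon>\<^sup>2))"
    unfolding rfld_def p_def d_def by (rule norm_triangle_ineq4)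
  ultimately show ?thesis using 1 by (simp add: norm_divide)
qed

lemma rpot_bound:
  assumes "x \<notin> L" "0 \<le> \<epsilon>" "\<epsilon> \<le> 1"
  shows "\<bar>rpot \<epsilon> x\<bar> \<le> \<bar>pot x\<bar> + (norm x)\<^sup>2 + (cmod (P (to_complex x)))\<^sup>2"
proof -
  define p where "p = cmod (P (to_complex x))"
  have p: "p > 0" using assms P_zero by (simp add: p_def)
  have e: "\<epsilon>\<^sup>2 \<le> 1" using assms by (simp add: power_le_one)
  have "p\<^sup>2 + \<epsilon>\<^sup>2 > 0" using p by (intro add_pos_nonneg) auto
  then have "ln (p\<^sup>2 + \<epsilon>\<^sup>2) \<le> p\<^sup>2 + \<epsilon>\<^sup>2 - 1" by (rule ln_le_minus_one)
  then have 1: "ln (p\<^sup>2 + \<epsilon>\<^sup>2) \<le> p\<^sup>2" using e by linarith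
  have "ln (p\<^sup>2) \<le> ln (p\<^sup>2 + \<epsilon>\<^sup>2)" using p by (intro ln_mono) auto
  moreover have "ln (p\<^sup>2) = 2 * ln p" using p by (simp add: ln_realpow)
  ultimately have 2: "2 * ln p \<le> ln (p\<^sup>2 + \<epsilon>\<^sup>2)" by simp
  have "0 \<le> p\<^sup>2" "0 \<le> (norm x)\<^sup>2" by auto
  then show ?thesis using 1 2 unfolding rpot_def pot_def p_def[symmetric] by linarith
qed

lemma rpot_tendsto:
  assumes "x \<notin> L" "e \<longlonglongrightarrow> 0"
  shows "(\<lambda>n. rpot (e n) x) \<longlonglongrightarrow> pot x" "(\<lambda>n. rfld (e n) x) \<longlonglongrightarrow> fld x"
proof -
  have p: "P (to_complex x) \<noteq> 0" using assms P_zero by simp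
  then have n: "(cmod (P (to_complex x)))\<^sup>2 + 0\<^sup>2 \<noteq> 0" by simp
  then have n': "complex_of_real ((cmod (P (to_complex x)))\<^sup>2 + 0\<^sup>2) \<noteq> 0" by (metis of_real_eq_0_iff)
  show "(\<lambda>n. rpot (e n) x) \<longlonglongrightarrow> pot x"
    unfolding rpot_0[symmetric] rpot_def by (intro tendsto_intros assms n) simp
  show "(\<lambda>n. rfld (e n) x) \<longlonglongrightarrow> fld x"
    unfolding rfld_0[symmetric] rfld_def by (intro tendsto_intros assms n') simp
qed

end

text \<open>Products of simple poles at distinct points are again controlled by simple poles. With
  a, b the distances of x to p, q and d = |p - q| <= a + b, one has 1/(ab) <= (1/d)(1/a + 1/b); the
  finitely many 1/d are bounded by their sum \<open>M\<close>.\<close>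

lemma product_majorant:
  fixes A B :: "(real^2) set"
  assumes fin: "finite A" "finite B" and disj: "A \<inter> B = {}" and C: "C1 \<ge> 0" "C2 \<ge> 0"
  shows "\<exists>D. \<forall>x. x \<notin> A \<union> B \<longrightarrow> (C1 + (\<Sum>p\<in>A. 1 / norm (x - p))) * (C2 + (\<Sum>q\<in>B. 1 / norm (x - q)))
     \<le> C1 * C2 + D * (\<Sum>p\<in>A \<union> B. 1 / norm (x - p))"
proof -
  define M where "M = (\<Sum>p\<in>A. \<Sum>q\<in>B. 1 / norm (p - q))"
  have M0: "M \<ge> 0" unfolding M_def by (intro sum_nonneg) auto
  have M: "1 / norm (p - q) \<le> M" if "p \<in> A" "q \<in> B" for p q
  proof -
    have "1 / norm (p - q) \<le> (\<Sum>q\<in>B. 1 / norm (p - q))"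
      by (rule member_le_sum[OF that(2)]) (use fin in auto)
    also have "\<dots> \<le> M" unfolding M_def
      by (rule member_le_sum[OF that(1), where f = "\<lambda>p. \<Sum>q\<in>B. 1 / norm (p - q)"]) (use fin in \<open>auto intro: sum_nonneg\<close>)
    finally show ?thesis .
  qed
  define D where "D = C1 + C2 + M * (card A + card B)"
  show ?thesis
  proof (intro exI[of _ D] allI impI)
    fix x assume x: "x \<notin> A \<union> B"
    define SA where "SA = (\<Sum>p\<in>A. 1 / norm (x - p))"
    define SB where "SB = (\<Sum>p\<in>B. 1 / norm (x - p))"
    define S where "S = (\<Sum>p\<in>A \<union> B. 1 / norm (x - p))"
    have S: "0 \<le> SA" "0 \<le> SB" "SA \<le> S" "SB \<le> S"
      unfolding SA_def SB_def S_def using fin by (auto intro!: sum_nonneg sum_mono2)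
    have "SA * SB = (\<Sum>p\<in>A. \<Sum>q\<in>B. 1 / norm (x - p) * (1 / norm (x - q)))"
      unfolding SA_def SB_def by (rule sum_product)
    also have "\<dots> \<le> (\<Sum>p\<in>A. \<Sum>q\<in>B. M * (1 / norm (x - p) + 1 / norm (x - q)))"
    proof (intro sum_mono)
      fix p q assume pq: "p \<in> A" "q \<in> B"
      define a b d where "a = norm (x - p)" and "b = norm (x - q)" and "d = norm (p - q)"
      have pos: "a > 0" "b > 0" "d > 0" using x pq disj by (auto simp: a_def b_def d_def)
      have "d \<le> b + a" using norm_triangle_ineq4[of "x - q" "x - p"] by (simp add: a_def b_def d_def)
      then have "1 / a * (1 / b) \<le> (1 / d) * (1 / a + 1 / b)"
        using pos by (simp add: field_simps)
      also have "\<dots> \<le> M * (1 / a + 1 / b)"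
        using M[OF pq] pos unfolding d_def by (intro mult_right_mono) auto
      finally show "1 / norm (x - p) * (1 / norm (x - q)) \<le> M * (1 / norm (x - p) + 1 / norm (x - q))"
        by (simp add: a_def b_def)
    qed
    also have "\<dots> = M * (card B * SA + card A * SB)"
      by (simp only: SA_def SB_def sum.distrib sum_distrib_left[symmetric] sum_constant)
    also have "\<dots> \<le> M * (card B * S + card A * S)"
      using S M0 by (intro mult_left_mono add_mono) auto
    finally have 1: "SA * SB \<le> M * (card A + card B) * S" by (simp add: algebra_simps)
    have "C1 * SB \<le> C1 * S" "C2 * SA \<le> C2 * S" using S C by (auto intro: mult_left_mono)
    then show "(C1 + SA) * (C2 + SB) \<le> C1 * C2 + D * S"
      using 1 by (simp add: D_def algebra_simps)
  qed
qed

context quasiperiodic begin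

lemma pot_periodic: assumes "x \<notin> L" "w \<in> L" shows "pot (x + w) = pot x"
proof -
  have nz: "P (to_complex x) \<noteq> 0" "P (to_complex (x + w)) \<noteq> 0"
    using assms L_add_iff P_zero by auto
  have "ln (cmod (P (to_complex (x + w))) * exp (- (norm (x + w))\<^sup>2 / 4)) = ln (cmod (P (to_complex x)) * exp (- (norm x)\<^sup>2 / 4))"
    using P_quasi[OF assms(2)] by simp
  then show ?thesis using nz by (simp add: ln_mult pot_def)
qed

lemma open_compl_L: "open (- L)"
proof -
  have "\<not> x islimpt L" for x
  proof
    assume "x islimpt L"
    then have "infinite (L \<inter> cball x 1)" by (simp add: islimpt_eq_infinite_cball)
    then show False using finite_L[of "cball x 1"] by simp
  qed
  then have "closed L" by (simp add: closed_limpt)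
  then show ?thesis by auto
qed

text \<open>Only the modulus of \<open>P\<close> is quasi-periodic, so periodicity of the gradient
  is obtained by differentiating that of \<open>pot\<close> off the lattice.\<close>

lemma fld_periodic: assumes x: "x \<notin> L" and w: "w \<in> L" shows "fld (x + w) = fld x"
proof -
  have xw: "x + w \<notin> L" using x w L_add_iff by blast
  have 1: "((\<lambda>y. pot (y + w)) has_derivative (\<lambda>h. Re (fld (x + w) * to_complex h))) (at x)"
    by (rule has_derivative_compose[of "\<lambda>y. y + w" "\<lambda>h. h" x UNIV pot, OF _ pot_has_derivative[OF xw]])
       (auto intro!: derivative_eq_intros)
  have "(pot has_derivative (\<lambda>h. Re (fld (x + w) * to_complex h))) (at x)"
    by (rule has_derivative_transform_within_open[OF 1 open_compl_L]) (use x w pot_periodic in auto)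
  then have "(\<lambda>h. Re (fld (x + w) * to_complex h)) = (\<lambda>h. Re (fld x * to_complex h))"
    using pot_has_derivative[OF x] by (rule has_derivative_unique)
  then have "Re (fld (x + w) * to_complex (axis 1 1)) = Re (fld x * to_complex (axis 1 1))"
    "Re (fld (x + w) * to_complex (axis 2 1)) = Re (fld x * to_complex (axis 2 1))"
    by metis+
  then show ?thesis by (simp add: complex_eq_iff)
qed

lemma torus_periodic_pot: "torus_periodic u v pot"
  unfolding torus_periodic_def using AE_not_L by eventually_elim (simp add: pot_periodic u_L v_L)

lemma torus_periodic_fld: "torus_periodic u v fld"
  unfolding torus_periodic_def using AE_not_L by eventually_elim (simp add: fld_periodic u_L v_L)

lemma pot_continuous: "continuous_on (- L) pot"
  by (rule has_derivative_continuous_on) (rule has_derivative_at_withinI[OF pot_has_derivative], simp)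

lemma P_bounded: "\<exists>K>0. \<forall>x. norm x \<le> R \<longrightarrow> (norm x)\<^sup>2 + (cmod (P (to_complex x)))\<^sup>2 \<le> K"
proof -
  have "continuous_on (cball 0 R) (\<lambda>x. (norm x)\<^sup>2 + (cmod (P (to_complex x)))\<^sup>2)"
    by (intro continuous_intros continuous_on_compose2[OF P_cont[of UNIV]]) auto
  then have "bounded ((\<lambda>x. (norm x)\<^sup>2 + (cmod (P (to_complex x)))\<^sup>2) ` cball 0 R)"
    by (intro compact_imp_bounded compact_continuous_image) auto
  then obtain K where "K > 0" "\<And>x. x \<in> cball 0 R \<Longrightarrow> \<bar>(norm x)\<^sup>2 + (cmod (P (to_complex x)))\<^sup>2\<bar> \<le> K"
    unfolding bounded_pos by (auto simp: image_iff)
  then show ?thesis by (intro exI[of _ K]) auto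
qed

lemma rpot_measurable: "rpot \<epsilon> \<in> borel_measurable borel" and rfld_measurable: "rfld \<epsilon> \<in> borel_measurable borel"
proof -
  have [measurable]: "P \<in> borel_measurable borel" "deriv P \<in> borel_measurable borel"
    by (intro borel_measurable_continuous_onI P_cont dP_cont)+
  have [measurable]: "cnj \<in> borel_measurable borel" by (intro borel_measurable_continuous_onI continuous_intros)
  show "rpot \<epsilon> \<in> borel_measurable borel" unfolding rpot_def[abs_def] by measurable
  show "rfld \<epsilon> \<in> borel_measurable borel" unfolding rfld_def[abs_def] by measurable
qed

lemma reg_pos: "\<epsilon> > 0 \<Longrightarrow> (cmod z)\<^sup>2 + \<epsilon>\<^sup>2 > 0"
  by (intro add_nonneg_pos) auto

text \<open>The field \<open>fld\<close> is the gradient of \<open>pot\<close> also in the weak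
  sense: the logarithmic poles contribute no extra term. The dominations come from
  \<open>rpot_bound\<close> and \<open>rfld_bound\<close>.\<close>

lemma pot_by_parts:
  assumes \<phi>: "C1c R \<phi>"
  shows "(LINT x|lebesgue. partial i \<phi> x * pot x) = - (LINT x|lebesgue. \<phi> x * Re (fld x * to_complex (axis i 1)))"
proof -
  define e where "e n = 1 / real (Suc n)" for n
  have e: "e n > 0" "e n \<le> 1" for n by (auto simp: e_def field_simps)
  have e0: "e \<longlonglongrightarrow> 0" unfolding e_def[abs_def] by (rule tendsto_0_inverse_Suc)
  obtain C where C: "C > 0" "\<And>x. \<bar>\<phi> x\<bar> \<le> C * indicator (cball 0 R) x" using C1c_bounded[OF \<phi>] by metis
  obtain C' where C': "C' > 0" "\<And>x. cmod (dbar \<phi> x) \<le> C' * indicator (cball 0 R) x" using dbar_bounded[OF \<phi>] by metis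
  have pb: "\<bar>partial i \<phi> x\<bar> \<le> C' * indicator (cball 0 R) x" for x
    using C'(2)[of x] abs_Re_le_cmod[of "dbar \<phi> x"] abs_Im_le_cmod[of "dbar \<phi> x"] exhaust_2[of i]
    by (auto simp: dbar_def)
  obtain K where K: "K > 0" "\<And>x. norm x \<le> R \<Longrightarrow> (norm x)\<^sup>2 + (cmod (P (to_complex x)))\<^sup>2 \<le> K"
    using P_bounded by blast
  have pm: "partial i \<phi> \<in> borel_measurable borel" by (rule borel_measurable_continuous_onI[OF C1cD(3)[OF \<phi>]])
  have \<phi>m: "\<phi> \<in> borel_measurable borel" by (rule borel_measurable_continuous_onI[OF C1cD(2)[OF \<phi>]])
  have parts: "(LINT x|lebesgue. partial i \<phi> x * rpot (e n) x) = - (LINT x|lebesgue. \<phi> x * Re (rfld (e n) x * to_complex (axis i 1)))" for n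
  proof -
    have "(LINT x|lebesgue. partial i \<phi> x *\<^sub>R rpot (e n) x) = - (LINT x|lebesgue. \<phi> x *\<^sub>R Re (rfld (e n) x * to_complex (axis i 1)))"
    proof (rule integral_by_parts(3)[OF \<phi>, of "R + 1"])
      show "(rpot (e n) has_derivative (\<lambda>h. Re (rfld (e n) x * to_complex h))) (at x)" for x
        by (rule rpot_has_derivative[OF reg_pos[OF e(1)]])
      show "continuous_on (ball 0 (R + 1)) (\<lambda>x. Re (rfld (e n) x * to_complex h))" for h
        by (intro continuous_intros rfld_continuous e)
    qed simp
    then show ?thesis by simp
  qed
  have int1: "integrable lebesgue (\<lambda>x. C' * (indicator (cball 0 R) x * (\<bar>pot x\<bar> + K)))"
  proof -
    have "locally_integrable (\<lambda>x. \<bar>pot x\<bar> + K)"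
      using pot_locally_integrable by (intro locally_integrable_add locally_integrable_const) (auto simp: locally_integrable_def intro: set_integrable_abs)
    from locally_integrable_cball[OF this, of R] show ?thesis unfolding set_integrable_def by (intro integrable_mult_right) simp
  qed
  have int2: "integrable lebesgue (\<lambda>x. C * (indicator (cball 0 R) x * (cmod (fld x) + R)))"
  proof -
    have "locally_integrable (\<lambda>x. cmod (fld x) + R)"
      using fld_locally_integrable by (intro locally_integrable_add locally_integrable_const) (auto simp: locally_integrable_def intro: set_integrable_norm)
    from locally_integrable_cball[OF this, of R] show ?thesis unfolding set_integrable_def by (intro integrable_mult_right) simp
  qed
  have cm: "(\<lambda>x. Re (f x * to_complex (axis i 1))) \<in> borel_measurable borel" if "f \<in> borel_measurable borel" for f :: "real^2 \<Rightarrow> complex"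
    using that by measurable
  have "(\<lambda>n. LINT x|lebesgue. partial i \<phi> x * rpot (e n) x) \<longlonglongrightarrow> (LINT x|lebesgue. partial i \<phi> x * pot x)"
  proof (rule integral_dominated_convergence[OF _ _ int1])
    show "AE x in lebesgue. (\<lambda>n. partial i \<phi> x * rpot (e n) x) \<longlonglongrightarrow> partial i \<phi> x * pot x"
      using AE_not_L by eventually_elim (intro tendsto_mult tendsto_const rpot_tendsto e0)
    show "AE x in lebesgue. norm (partial i \<phi> x * rpot (e n) x) \<le> C' * (indicator (cball 0 R) x * (\<bar>pot x\<bar> + K))" for n
      using AE_not_L
    proof eventually_elim
      case (elim x)
      show ?case
      proof (cases "norm x \<le> R")
        case True
        have "\<bar>rpot (e n) x\<bar> \<le> \<bar>pot x\<bar> + K" using rpot_bound[OF elim, of "e n"] e[of n] K(2)[OF True] by simp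
        then have "\<bar>partial i \<phi> x\<bar> * \<bar>rpot (e n) x\<bar> \<le> C' * (\<bar>pot x\<bar> + K)"
          using pb[of x] True C'(1) by (intro mult_mono) auto
        then show ?thesis using True by (simp add: abs_mult)
      next
        case False
        then show ?thesis using C1cD(5)[OF \<phi>, of x] by simp
      qed
    qed
  qed (use pm pot_measurable rpot_measurable in \<open>intro measurable_completion borel_measurable_times, auto\<close>)+
  moreover have "(\<lambda>n. LINT x|lebesgue. \<phi> x * Re (rfld (e n) x * to_complex (axis i 1))) \<longlonglongrightarrow> (LINT x|lebesgue. \<phi> x * Re (fld x * to_complex (axis i 1)))"
  proof (rule integral_dominated_convergence[OF _ _ int2])
    show "AE x in lebesgue. (\<lambda>n. \<phi> x * Re (rfld (e n) x * to_complex (axis i 1))) \<longlonglongrightarrow> \<phi> x * Re (fld x * to_complex (axis i 1))"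
      using AE_not_L by eventually_elim (intro tendsto_mult tendsto_const tendsto_Re rpot_tendsto e0)
    show "AE x in lebesgue. norm (\<phi> x * Re (rfld (e n) x * to_complex (axis i 1))) \<le> C * (indicator (cball 0 R) x * (cmod (fld x) + R))" for n
      using AE_not_L
    proof eventually_elim
      case (elim x)
      show ?case
      proof (cases "norm x \<le> R")
        case True
        have "cmod (to_complex (axis i 1)) = 1" by (simp add: norm_axis_1)
        then have "\<bar>Re (rfld (e n) x * to_complex (axis i 1))\<bar> \<le> cmod (rfld (e n) x)"
          using abs_Re_le_cmod[of "rfld (e n) x * to_complex (axis i 1)"] by (simp add: norm_mult)
        also have "\<dots> \<le> cmod (fld x) + R" using rfld_bound[OF elim, of "e n"] True by simp
        finally have "\<bar>\<phi> x\<bar> * \<bar>Re (rfld (e n) x * to_complex (axis i 1))\<bar> \<le> C * (cmod (fld x) + R)"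
          using C(2)[of x] True C(1) by (intro mult_mono) auto
        then show ?thesis using True by (simp only: real_norm_def abs_mult) simp
      next
        case False
        then show ?thesis using C1cD(4)[OF \<phi>, of x] by simp
      qed
    qed
  qed (use \<phi>m cm[OF fld_measurable] cm[OF rfld_measurable] in \<open>intro measurable_completion borel_measurable_times, auto\<close>)+
  then have "(\<lambda>n. - (LINT x|lebesgue. \<phi> x * Re (rfld (e n) x * to_complex (axis i 1)))) \<longlonglongrightarrow> - (LINT x|lebesgue. \<phi> x * Re (fld x * to_complex (axis i 1)))"
    by (rule tendsto_minus)
  ultimately show ?thesis unfolding parts by (rule LIMSEQ_unique)
qed

end

section \<open>Interaction of two point charges\<close>

definition smooth_step :: "real \<Rightarrow> real" where
  "smooth_step t = bump 1 t / (bump 1 t + bump 1 (1 - t))"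

definition smooth_step' :: "real \<Rightarrow> real" where
  "smooth_step' t = (bump (bump_deriv 1) t * (bump 1 t + bump 1 (1 - t)) -
     bump 1 t * (bump (bump_deriv 1) t - bump (bump_deriv 1) (1 - t))) / (bump 1 t + bump 1 (1 - t))\<^sup>2"

lemma smooth_step_denom: "bump 1 t + bump 1 (1 - t) > 0"
  by (auto simp: bump_def intro: add_pos_pos)

lemma smooth_step_has_derivative: "(smooth_step has_real_derivative smooth_step' t) (at t)"
proof -
  have "((\<lambda>t. bump 1 (1 - t)) has_real_derivative bump (bump_deriv 1) (1 - t) * (0 - 1)) (at t)"
    by (rule DERIV_chain2[where f = "bump 1" and g = "\<lambda>t. 1 - t", OF bump_has_derivative])
       (intro DERIV_diff DERIV_const DERIV_ident)
  then have "((\<lambda>t. bump 1 t + bump 1 (1 - t)) has_real_derivative (bump (bump_deriv 1) t + bump (bump_deriv 1) (1 - t) * (0 - 1))) (at t)"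
    by (intro DERIV_add bump_has_derivative)
  from DERIV_divide[OF bump_has_derivative this] smooth_step_denom[of t]
  show ?thesis unfolding smooth_step_def[abs_def] smooth_step'_def by (simp add: power2_eq_square)
qed

lemma smooth_step_0: "t \<le> 0 \<Longrightarrow> smooth_step t = 0"
  by (simp add: smooth_step_def bump_def)

lemma smooth_step_1: "t \<ge> 1 \<Longrightarrow> smooth_step t = 1"
  by (simp add: smooth_step_def bump_def)

lemma smooth_step_bounds: "0 \<le> smooth_step t" "smooth_step t \<le> 1"
proof -
  have "bump 1 s \<ge> 0" for s by (simp add: bump_def)
  then show "0 \<le> smooth_step t" "smooth_step t \<le> 1"
    unfolding smooth_step_def using smooth_step_denom[of t] by (auto simp: divide_simps)
qed

lemma smooth_step'_continuous: "continuous_on A smooth_step'"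
proof -
  have "bump 1 t + bump 1 (1 - t) \<noteq> 0" for t using smooth_step_denom[of t] by linarith
  then show ?thesis unfolding smooth_step'_def[abs_def]
    by (intro continuous_intros continuous_on_compose2[OF continuous_on_bump[of UNIV]]) auto
qed

lemma smooth_step'_0: "t \<le> 0 \<or> t \<ge> 1 \<Longrightarrow> smooth_step' t = 0"
  by (auto simp: smooth_step'_def bump_def bump_deriv_def)

lemma smooth_step'_bounded: "\<exists>C>0. \<forall>t. \<bar>smooth_step' t\<bar> \<le> C"
proof -
  have "bounded (smooth_step' ` {0..1})"
    by (intro compact_imp_bounded compact_continuous_image smooth_step'_continuous) auto
  then obtain C where C: "C > 0" "\<And>t. t \<in> {0..1} \<Longrightarrow> \<bar>smooth_step' t\<bar> \<le> C"
    unfolding bounded_pos by (auto simp: image_iff)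
  have "\<bar>smooth_step' t\<bar> \<le> C" for t
    using C smooth_step'_0[of t] by (cases "t \<in> {0..1}") auto
  then show ?thesis using C(1) by blast
qed

text \<open>The denominator 2R - 1 equals R^2 - (R - 1)^2, so the step runs from 1 at radius R - 1
  to 0 at radius R. The squared norm avoids a singularity at the origin.\<close>

definition cutoff :: "real \<Rightarrow> real^2 \<Rightarrow> real" where
  "cutoff R x = smooth_step ((R\<^sup>2 - (norm x)\<^sup>2) / (2 * R - 1))"

lemma cutoff_0: "R \<ge> 1 \<Longrightarrow> norm x \<ge> R \<Longrightarrow> cutoff R x = 0"
  unfolding cutoff_def by (intro smooth_step_0 divide_nonpos_pos) (auto intro: power_mono)

lemma cutoff_1: "R \<ge> 1 \<Longrightarrow> norm x \<le> R - 1 \<Longrightarrow> cutoff R x = 1"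
proof -
  assume R: "R \<ge> 1" and x: "norm x \<le> R - 1"
  have "(norm x)\<^sup>2 \<le> (R - 1)\<^sup>2" using x by (intro power_mono) auto
  then have "2 * R - 1 \<le> R\<^sup>2 - (norm x)\<^sup>2" by (simp add: power2_eq_square algebra_simps)
  then show ?thesis unfolding cutoff_def using R by (intro smooth_step_1) (simp add: field_simps)
qed

lemma cutoff_bounds: "\<bar>cutoff R x\<bar> \<le> 1"
  using smooth_step_bounds by (simp add: cutoff_def)

lemma cutoff_has_derivative:
  "(cutoff R has_derivative (\<lambda>h. (- 2 * (x \<bullet> h) / (2 * R - 1)) * smooth_step' ((R\<^sup>2 - (norm x)\<^sup>2) / (2 * R - 1)))) (at x)"
proof -
  have "((\<lambda>x. (R\<^sup>2 - (norm x)\<^sup>2) / (2 * R - 1)) has_derivative (\<lambda>h. - 2 * (x \<bullet> h) / (2 * R - 1))) (at x)"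
    unfolding power2_norm_eq_inner divide_inverse by (auto intro!: derivative_eq_intros simp: inner_commute)
  from DERIV_compose_FDERIV[OF smooth_step_has_derivative this] show ?thesis unfolding cutoff_def[abs_def] .
qed

lemma cutoff_C1c: "R \<ge> 1 \<Longrightarrow> C1c R (cutoff R)"
proof (rule C1cI[OF cutoff_has_derivative])
  assume R: "R \<ge> 1"
  show "continuous_on UNIV (\<lambda>x. (- 2 * (x \<bullet> h) / (2 * R - 1)) * smooth_step' ((R\<^sup>2 - (norm x)\<^sup>2) / (2 * R - 1)))" for h
    using R by (intro continuous_intros continuous_on_compose2[OF smooth_step'_continuous[of UNIV]]) auto
  show "norm x > R \<Longrightarrow> cutoff R x = 0" for x using cutoff_0[OF R] by simp
qed

lemma partial_cutoff:
  "partial i (cutoff R) x = (- 2 * x $ i / (2 * R - 1)) * smooth_step' ((R\<^sup>2 - (norm x)\<^sup>2) / (2 * R - 1))"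
  by (subst partial_eqI[OF cutoff_has_derivative]) (simp add: inner_axis)

lemma partial_cutoff_shell:
  assumes "R \<ge> 1" "norm x < R - 1 \<or> norm x \<ge> R + 1"
  shows "partial i (cutoff R) x = 0"
proof -
  have "(R\<^sup>2 - (norm x)\<^sup>2) / (2 * R - 1) \<le> 0 \<or> (R\<^sup>2 - (norm x)\<^sup>2) / (2 * R - 1) \<ge> 1"
  proof (cases "norm x < R - 1")
    case True
    then have "(norm x)\<^sup>2 \<le> (R - 1)\<^sup>2" by (intro power_mono) auto
    then have "2 * R - 1 \<le> R\<^sup>2 - (norm x)\<^sup>2" by (simp add: power2_eq_square algebra_simps)
    then show ?thesis using assms by (simp add: field_simps)
  next
    case False
    then have "R\<^sup>2 \<le> (norm x)\<^sup>2" using assms by (intro power_mono) auto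
    then show ?thesis using assms by (auto intro!: disjI1 divide_nonpos_pos)
  qed
  then show ?thesis unfolding partial_cutoff using smooth_step'_0 by simp
qed

text \<open>Where the gradient lives, |x| and 2R - 1 are comparable, so the quotient stays bounded
  independently of R.\<close>

lemma partial_cutoff_bounded: "\<exists>C>0. \<forall>R\<ge>1. \<forall>x i. \<bar>partial i (cutoff R) x\<bar> \<le> C"
proof -
  obtain C where C: "C > 0" "\<And>t. \<bar>smooth_step' t\<bar> \<le> C" using smooth_step'_bounded by blast
  have "\<bar>partial i (cutoff R) x\<bar> \<le> 4 * C" if R: "R \<ge> 1" for R x i
  proof (cases "norm x < R + 1")
    case True
    have "norm x \<le> 2 * (2 * R - 1)" using R True by simp
    then have "\<bar>x $ i\<bar> \<le> 2 * (2 * R - 1)" by (rule order_trans[OF component_le_norm_cart])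
    then have "\<bar>- 2 * x $ i / (2 * R - 1)\<bar> \<le> 4" using R by (simp add: abs_mult field_simps)
    then have "\<bar>- 2 * x $ i / (2 * R - 1)\<bar> * \<bar>smooth_step' ((R\<^sup>2 - (norm x)\<^sup>2) / (2 * R - 1))\<bar> \<le> 4 * C"
      by (intro mult_mono C) auto
    then show ?thesis unfolding partial_cutoff by (simp only: abs_mult)
  next
    case False
    then show ?thesis using partial_cutoff_shell[OF R] C by simp
  qed
  then show ?thesis using C(1) by (intro exI[of _ "4 * C"]) auto
qed

lemma Re_dbar_mult: "Re (dbar \<phi> x * z) = partial 1 \<phi> x * Re z - partial 2 \<phi> x * Im z"
  by (simp add: dbar_def)

context quasiperiodic begin

section \<open>The mixed product of two translates of the gradient field\<close>

lemma shift_bound: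
  assumes "\<And>x. norm x \<le> R + norm s \<Longrightarrow> x \<notin> L \<Longrightarrow> f x \<le> C + (\<Sum>p\<in>L \<inter> cball 0 (R + norm s). 1 / norm (x - p))"
    and "norm x \<le> R" "x - s \<notin> L"
  shows "f (x - s) \<le> C + (\<Sum>p\<in>(+) s ` (L \<inter> cball 0 (R + norm s)). 1 / norm (x - p))"
proof -
  have "norm (x - s) \<le> R + norm s" using norm_triangle_ineq4[of x s] assms(2) by linarith
  then have "f (x - s) \<le> C + (\<Sum>p\<in>L \<inter> cball 0 (R + norm s). 1 / norm (x - s - p))"
    using assms(1)[of "x - s"] assms(3) by blast
  also have "(\<Sum>p\<in>L \<inter> cball 0 (R + norm s). 1 / norm (x - s - p)) = (\<Sum>p\<in>(+) s ` (L \<inter> cball 0 (R + norm s)). 1 / norm (x - p))"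
    by (subst sum.reindex) (auto simp: algebra_simps)
  finally show ?thesis .
qed

lemma null_shift_L: "(+) s ` L \<in> null_sets lebesgue"
  using countable_imp_null_set_lborel[of "(+) s ` L"] countable_L by (auto intro: null_sets_completionI)

lemma AE_not_shift_L: "AE x in lebesgue. x - s \<notin> L"
  using AE_shift[OF AE_not_L, of "- s"] by simp

text \<open>The poles of the two factors lie in the disjoint cosets of \<open>s\<close> and 0, so
  \<open>product_majorant\<close> applies. One statement serves all mixed products below;
  \<open>K\<close> leaves room for the constants in the bounds of the regularized functions.\<close>

lemma cross_locally_integrable:
  assumes s: "s \<notin> L"
  shows "locally_integrable (\<lambda>x. (\<bar>pot (x - s)\<bar> + cmod (fld (x - s)) + K) * (cmod (fld x) + K'))"
proof (rule locally_integrable_majorant)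
  show "L \<union> (+) s ` L \<in> null_sets lebesgue" using null_L null_shift_L by auto
  show "(\<lambda>x. (\<bar>pot (x - s)\<bar> + cmod (fld (x - s)) + K) * (cmod (fld x) + K')) \<in> borel_measurable lebesgue"
    by (intro measurable_completion) measurable
  fix R :: real assume R: "R > 0"
  define A where "A = L \<inter> cball 0 R"
  define B where "B = (+) s ` (L \<inter> cball 0 (R + norm s))"
  have fin: "finite A" "finite B" unfolding A_def B_def using finite_L by auto
  have disj: "B \<inter> A = {}" using s L_diff by (force simp: A_def B_def)
  obtain C1 where C1: "C1 > 0" "\<And>x. norm x \<le> R \<Longrightarrow> x \<notin> L \<Longrightarrow> cmod (fld x) \<le> C1 + (\<Sum>p\<in>A. 1 / norm (x - p))"
    using fld_bound[of R] unfolding A_def by blast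
  obtain C2 where C2: "C2 > 0" "\<And>x. norm x \<le> R + norm s \<Longrightarrow> x \<notin> L \<Longrightarrow> cmod (fld x) \<le> C2 + (\<Sum>p\<in>L \<inter> cball 0 (R + norm s). 1 / norm (x - p))"
    using fld_bound by blast
  obtain C3 where C3: "C3 > 0" "\<And>x. norm x \<le> R + norm s \<Longrightarrow> x \<notin> L \<Longrightarrow> \<bar>pot x\<bar> \<le> C3 + (\<Sum>p\<in>L \<inter> cball 0 (R + norm s). 1 / norm (x - p))"
    using pot_bound by blast
  define E where "E = C2 + C3 + \<bar>K\<bar>"
  define E' where "E' = C1 + \<bar>K'\<bar>"
  \<comment> \<open>The sum over \<open>B\<close> occurs twice, once for \<open>pot\<close> and once
    for \<open>fld\<close>. Pulling out a factor 2 leaves half of the constant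
    \<open>E\<close>.\<close>
  obtain D where D: "\<And>x. x \<notin> B \<union> A \<Longrightarrow> (E / 2 + (\<Sum>p\<in>B. 1 / norm (x - p))) * (E' + (\<Sum>q\<in>A. 1 / norm (x - q)))
     \<le> (E / 2) * E' + D * (\<Sum>p\<in>B \<union> A. 1 / norm (x - p))"
    using product_majorant[OF fin(2,1) disj, of "E / 2" E'] C1(1) C2(1) C3(1) by (auto simp: E_def E'_def)
  have "norm ((\<bar>pot (x - s)\<bar> + cmod (fld (x - s)) + K) * (cmod (fld x) + K')) \<le> E * E' + (2 * D) * (\<Sum>p\<in>B \<union> A. 1 / norm (x - p))"
    if x: "norm x \<le> R" "x \<notin> L \<union> (+) s ` L" for x
  proof -
    have xs: "x - s \<notin> L" using x(2) by (metis UnI2 add.commute diff_add_cancel image_eqI)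
    have xn: "x \<notin> B \<union> A" using x(2) by (auto simp: A_def B_def)
    have 1: "\<bar>pot (x - s)\<bar> \<le> C3 + (\<Sum>p\<in>B. 1 / norm (x - p))" unfolding B_def by (rule shift_bound[OF C3(2) x(1) xs])
    have 2: "cmod (fld (x - s)) \<le> C2 + (\<Sum>p\<in>B. 1 / norm (x - p))" unfolding B_def by (rule shift_bound[OF C2(2) x(1) xs])
    have a3: "\<bar>\<bar>a\<bar> + b + K\<bar> \<le> \<bar>a\<bar> + b + \<bar>K\<bar>" if "b \<ge> 0" for a b :: real using that by arith
    have a4: "\<bar>b + K'\<bar> \<le> b + \<bar>K'\<bar>" if "b \<ge> 0" for b :: real using that by arith
    have e2: "2 * (E / 2 + S) = C2 + C3 + \<bar>K\<bar> + 2 * S" for S by (simp add: E_def)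
    have 3: "\<bar>\<bar>pot (x - s)\<bar> + cmod (fld (x - s)) + K\<bar> \<le> 2 * (E / 2 + (\<Sum>p\<in>B. 1 / norm (x - p)))"
      using 1 2 a3[OF norm_ge_zero[of "fld (x - s)"], of "pot (x - s)"] unfolding e2 by linarith
    have 4: "\<bar>cmod (fld x) + K'\<bar> \<le> E' + (\<Sum>p\<in>A. 1 / norm (x - p))"
      using C1(2)[OF x(1)] x(2) a4[OF norm_ge_zero[of "fld x"]] unfolding E'_def by (auto; linarith)
    have "norm ((\<bar>pot (x - s)\<bar> + cmod (fld (x - s)) + K) * (cmod (fld x) + K')) \<le> (2 * (E / 2 + (\<Sum>p\<in>B. 1 / norm (x - p)))) * (E' + (\<Sum>p\<in>A. 1 / norm (x - p)))"
      unfolding real_norm_def abs_mult by (rule mult_mono[OF 3 4]) (use 3 in linarith, simp)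
    also have "\<dots> \<le> 2 * ((E / 2) * E' + D * (\<Sum>p\<in>B \<union> A. 1 / norm (x - p)))"
      unfolding mult.assoc[of 2] by (rule mult_left_mono[OF D[OF xn]]) simp
    finally show ?thesis by (simp add: algebra_simps)
  qed
  then show "\<exists>C D F. finite F \<and> (\<forall>x. norm x \<le> R \<longrightarrow> x \<notin> L \<union> (+) s ` L \<longrightarrow> norm ((\<bar>pot (x - s)\<bar> + cmod (fld (x - s)) + K) * (cmod (fld x) + K')) \<le> C + D * (\<Sum>p\<in>F. 1 / norm (x - p)))"
    using fin by (intro exI[of _ "E * E'"] exI[of _ "2 * D"] exI[of _ "B \<union> A"]) blast
qed

end

lemma locally_integrable_dominated:
  fixes f :: "real^2 \<Rightarrow> 'b::euclidean_space" and g :: "real^2 \<Rightarrow> real"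
  assumes g: "locally_integrable g" and f: "f \<in> borel_measurable lebesgue" and le: "\<And>x. norm (f x) \<le> \<bar>g x\<bar>"
  shows "locally_integrable f"
  unfolding locally_integrable_def set_integrable_def
proof safe
  fix K :: "(real^2) set" assume K: "compact K"
  show "integrable lebesgue (\<lambda>x. indicat_real K x *\<^sub>R f x)"
  proof (rule Bochner_Integration.integrable_bound)
    show "integrable lebesgue (\<lambda>x. indicat_real K x *\<^sub>R g x)"
      using g K unfolding locally_integrable_def set_integrable_def by blast
    show "(\<lambda>x. indicat_real K x *\<^sub>R f x) \<in> borel_measurable lebesgue"
      using f lmeasurable_compact[OF K] by (intro borel_measurable_scaleR borel_measurable_indicator) (auto dest: fmeasurableD)
    show "AE x in lebesgue. norm (indicat_real K x *\<^sub>R f x) \<le> norm (indicat_real K x *\<^sub>R g x)"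
      using le by (auto simp: indicator_def)
  qed
qed

lemma C1c_mult:
  assumes \<phi>: "C1c R \<phi>" and g: "\<And>x. (g has_derivative g' x) (at x)" "\<And>h. continuous_on UNIV (\<lambda>x. g' x h)"
  shows "C1c R (\<lambda>x. \<phi> x * g x)" "partial i (\<lambda>x. \<phi> x * g x) x = \<phi> x * g' x (axis i 1) + partial i \<phi> x * g x"
proof -
  have d: "((\<lambda>x. \<phi> x * g x) has_derivative (\<lambda>h. \<phi> x * g' x h + frechet_derivative \<phi> (at x) h * g x)) (at x)" for x
    by (rule has_derivative_mult[OF C1cD(1)[OF \<phi>] g(1)])
  show "partial i (\<lambda>x. \<phi> x * g x) x = \<phi> x * g' x (axis i 1) + partial i \<phi> x * g x"
    by (subst partial_eqI[OF d]) (simp add: partial_def)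
  have gc: "continuous_on UNIV g" by (rule has_derivative_continuous_on[OF has_derivative_at_withinI[OF g(1)]])
  show "C1c R (\<lambda>x. \<phi> x * g x)"
  proof (rule C1cI[OF d])
    show "continuous_on UNIV (\<lambda>x. \<phi> x * g' x h + frechet_derivative \<phi> (at x) h * g x)" for h
      using \<phi> by (intro continuous_intros C1cD(2)[OF \<phi>] g gc) (auto simp: C1c_def)
    show "norm x > R \<Longrightarrow> \<phi> x * g x = 0" for x using C1cD(4)[OF \<phi>] by simp
  qed
qed

context quasiperiodic begin

text \<open>The weak equation \<open>dbar_fld\<close> is tested with \<open>\<phi>\<close> times the
  potential centered at \<open>s\<close>, regularized to be C^1. The poles of the two factors are
  separated because \<open>s\<close> is not in the lattice, which makes the values at lattice points
  converge and the products integrable.\<close>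

lemma cross_by_parts:
  assumes \<phi>: "C1c R \<phi>" and s: "s \<notin> L"
  shows "(LINT x|lebesgue. pot (x - s) * Re (dbar \<phi> x * fld x) + \<phi> x * (fld (x - s) \<bullet> fld x)) =
    2 * pi * (\<Sum>\<^sub>\<infinity>p\<in>L. \<phi> p * pot (p - s)) - (LINT x|lebesgue. \<phi> x * pot (x - s))"
proof -
  define e where "e n = 1 / real (Suc n)" for n
  have e: "e n > 0" "e n \<le> 1" for n by (auto simp: e_def field_simps)
  have e0: "e \<longlonglongrightarrow> 0" unfolding e_def[abs_def] by (rule tendsto_0_inverse_Suc)
  obtain C where C: "C > 0" "\<And>x. \<bar>\<phi> x\<bar> \<le> C * indicator (cball 0 R) x" using C1c_bounded[OF \<phi>] by metis
  obtain C' where C': "C' > 0" "\<And>x. cmod (dbar \<phi> x) \<le> C' * indicator (cball 0 R) x" using dbar_bounded[OF \<phi>] by metis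
  obtain K where K: "K > 0" "\<And>x. norm x \<le> R + norm s \<Longrightarrow> (norm x)\<^sup>2 + (cmod (P (to_complex x)))\<^sup>2 \<le> K"
    using P_bounded by blast
  have dm: "dbar \<phi> \<in> borel_measurable borel" by (rule borel_measurable_continuous_onI[OF dbar_continuous[OF \<phi>]])
  have \<phi>m: "\<phi> \<in> borel_measurable borel" by (rule borel_measurable_continuous_onI[OF C1cD(2)[OF \<phi>]])
  note [measurable] = dm \<phi>m rpot_measurable rfld_measurable
  have xs: "norm (x - s) \<le> R + norm s" if "norm x \<le> R" for x
    using norm_triangle_ineq4[of x s] that by linarith
  define \<psi> where "\<psi> n x = \<phi> x * rpot (e n) (x - s)" for n x
  have gd: "((\<lambda>x. rpot (e n) (x - s)) has_derivative (\<lambda>h. Re (rfld (e n) (x - s) * to_complex h))) (at x)" for n x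
    by (rule has_derivative_compose[of "\<lambda>x. x - s" "\<lambda>h. h" x UNIV "rpot (e n)", OF _ rpot_has_derivative[OF reg_pos[OF e(1)]]])
       (auto intro!: derivative_eq_intros)
  have gc: "continuous_on UNIV (\<lambda>x. Re (rfld (e n) (x - s) * to_complex h))" for n h
    by (intro continuous_intros continuous_on_compose2[OF rfld_continuous[OF e(1), of UNIV]]) auto
  have \<psi>: "C1c R (\<psi> n)" for n unfolding \<psi>_def[abs_def] by (rule C1c_mult(1)[OF \<phi> gd gc])
  \<comment> \<open>By the chain rule d1 + i d2 of the regularized potential is the conjugate of
    \<open>rfld\<close>, and the real part of conjugate times \<open>fld\<close> is the inner
    product of the gradients.\<close>
  have dbar\<psi>: "Re (dbar (\<psi> n) x * fld x) = rpot (e n) (x - s) * Re (dbar \<phi> x * fld x) + \<phi> x * (rfld (e n) (x - s) \<bullet> fld x)" for n x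
  proof -
    have p: "partial i (\<psi> n) x = \<phi> x * Re (rfld (e n) (x - s) * to_complex (axis i 1)) + partial i \<phi> x * rpot (e n) (x - s)" for i
      unfolding \<psi>_def[abs_def] by (rule C1c_mult(2)[OF \<phi> gd gc])
    show ?thesis unfolding Re_dbar_mult p by (simp add: inner_complex_def algebra_simps)
  qed
  have eq: "(LINT x|lebesgue. rpot (e n) (x - s) * Re (dbar \<phi> x * fld x) + \<phi> x * (rfld (e n) (x - s) \<bullet> fld x)) =
     2 * pi * (\<Sum>\<^sub>\<infinity>p\<in>L. \<psi> n p) - (LINT x|lebesgue. \<psi> n x)" for n
  proof -
    have "(LINT x|lebesgue. Re (dbar (\<psi> n) x * fld x)) = Re (LINT x|lebesgue. dbar (\<psi> n) x * fld x)"
      by (rule integral_Re[OF dbar_fld(1)[OF \<psi>]])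
    also have "\<dots> = 2 * pi * (\<Sum>\<^sub>\<infinity>p\<in>L. \<psi> n p) - (LINT x|lebesgue. \<psi> n x)"
      unfolding dbar_fld(2)[OF \<psi>] by simp
    finally show ?thesis unfolding dbar\<psi> .
  qed
  \<comment> \<open>Covers both dominations at once: \<open>K\<close> is the excess in
    \<open>rpot_bound\<close>, and R + |s| bounds the norm of x - s appearing in
    \<open>rfld_bound\<close>.\<close>
  define K2 where "K2 = K + R + norm s"
  define w where "w x = (C + C') * (indicator (cball 0 R) x * ((\<bar>pot (x - s)\<bar> + cmod (fld (x - s)) + K2) * (cmod (fld x) + 0)))" for x
  have wint: "integrable lebesgue w"
    using locally_integrable_cball[OF cross_locally_integrable[OF s, of K2 0], of R]
    unfolding set_integrable_def w_def[abs_def] real_scaleR_def by (intro integrable_mult_right)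
  have meas: "(\<lambda>x. g (x - s) * Re (dbar \<phi> x * fld x) + \<phi> x * (h (x - s) \<bullet> fld x)) \<in> borel_measurable lebesgue"
    if [measurable]: "g \<in> borel_measurable borel" "h \<in> borel_measurable borel" for g h
    by (intro measurable_completion) measurable
  have 1: "(\<lambda>n. LINT x|lebesgue. rpot (e n) (x - s) * Re (dbar \<phi> x * fld x) + \<phi> x * (rfld (e n) (x - s) \<bullet> fld x))
    \<longlonglongrightarrow> (LINT x|lebesgue. pot (x - s) * Re (dbar \<phi> x * fld x) + \<phi> x * (fld (x - s) \<bullet> fld x))"
  proof (rule integral_dominated_convergence[OF _ _ wint])
    show "AE x in lebesgue. (\<lambda>n. rpot (e n) (x - s) * Re (dbar \<phi> x * fld x) + \<phi> x * (rfld (e n) (x - s) \<bullet> fld x))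
      \<longlonglongrightarrow> pot (x - s) * Re (dbar \<phi> x * fld x) + \<phi> x * (fld (x - s) \<bullet> fld x)"
      using AE_not_shift_L[of s] by eventually_elim (intro tendsto_intros rpot_tendsto e0)
    show "AE x in lebesgue. norm (rpot (e n) (x - s) * Re (dbar \<phi> x * fld x) + \<phi> x * (rfld (e n) (x - s) \<bullet> fld x)) \<le> w x" for n
      using AE_not_shift_L[of s]
    proof eventually_elim
      case (elim x)
      show ?case
      proof (cases "norm x \<le> R")
        case True
        define A where "A = \<bar>pot (x - s)\<bar> + cmod (fld (x - s)) + K2"
        have R0: "R \<ge> 0" using True norm_ge_zero[of x] by linarith
        have b1: "\<bar>rpot (e n) (x - s)\<bar> \<le> A"
          using rpot_bound[OF elim less_imp_le[OF e(1)] e(2), of n] K(2)[OF xs[OF True]] R0 norm_ge_zero[of "fld (x - s)"] norm_ge_zero[of s]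
          unfolding A_def K2_def by linarith
        have b2: "cmod (rfld (e n) (x - s)) \<le> A"
          using rfld_bound[OF elim, of "e n"] xs[OF True] K(1) abs_ge_zero[of "pot (x - s)"]
          unfolding A_def K2_def by linarith
        have A0: "A \<ge> 0" using b2 norm_ge_zero[of "rfld (e n) (x - s)"] by linarith
        have b3: "\<bar>Re (dbar \<phi> x * fld x)\<bar> \<le> C' * cmod (fld x)"
        proof -
          have "\<bar>Re (dbar \<phi> x * fld x)\<bar> \<le> cmod (dbar \<phi> x) * cmod (fld x)"
            using abs_Re_le_cmod[of "dbar \<phi> x * fld x"] unfolding norm_mult .
          also have "\<dots> \<le> C' * cmod (fld x)" using C'(2)[of x] True by (intro mult_right_mono) auto
          finally show ?thesis .
        qed
        have b4: "\<bar>rfld (e n) (x - s) \<bullet> fld x\<bar> \<le> A * cmod (fld x)"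
          using Cauchy_Schwarz_ineq2[of "rfld (e n) (x - s)" "fld x"] b2 by (meson mult_right_mono norm_ge_zero order_trans)
        have "\<bar>rpot (e n) (x - s) * Re (dbar \<phi> x * fld x)\<bar> \<le> A * (C' * cmod (fld x))"
          unfolding abs_mult[of "rpot (e n) (x - s)"] by (rule mult_mono[OF b1 b3 A0]) simp
        moreover have "\<bar>\<phi> x * (rfld (e n) (x - s) \<bullet> fld x)\<bar> \<le> C * (A * cmod (fld x))"
          unfolding abs_mult[of "\<phi> x"] by (rule mult_mono[OF _ b4]) (use C(2)[of x] C(1) True in auto)
        ultimately have "\<bar>rpot (e n) (x - s) * Re (dbar \<phi> x * fld x) + \<phi> x * (rfld (e n) (x - s) \<bullet> fld x)\<bar> \<le> A * (C' * cmod (fld x)) + C * (A * cmod (fld x))"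
          by linarith
        also have "\<dots> = w x" using True by (simp add: w_def A_def algebra_simps)
        finally show ?thesis by simp
      next
        case False
        then have "dbar \<phi> x = 0" "\<phi> x = 0" using C1cD(4,5)[OF \<phi>, of x] by (auto simp: dbar_def complex_eq_iff)
        then show ?thesis using False by (simp add: w_def)
      qed
    qed
  qed (intro meas rpot_measurable rfld_measurable pot_measurable fld_measurable)+
  have pot_s: "locally_integrable (\<lambda>x. pot (x - s))"
    using locally_integrable_shift[OF pot_locally_integrable, of "- s"] by simp
  have 2: "(\<lambda>n. LINT x|lebesgue. \<psi> n x) \<longlonglongrightarrow> (LINT x|lebesgue. \<phi> x * pot (x - s))"
  proof (rule integral_dominated_convergence)
    have "locally_integrable (\<lambda>x. \<bar>pot (x - s)\<bar> + K)"
      using pot_s by (intro locally_integrable_add locally_integrable_const) (auto simp: locally_integrable_def intro: set_integrable_abs)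
    from locally_integrable_cball[OF this, of R]
    show "integrable lebesgue (\<lambda>x. C * (indicator (cball 0 R) x * (\<bar>pot (x - s)\<bar> + K)))" 
      unfolding set_integrable_def by (intro integrable_mult_right) simp
    show "AE x in lebesgue. (\<lambda>n. \<psi> n x) \<longlonglongrightarrow> \<phi> x * pot (x - s)"
      using AE_not_shift_L[of s] unfolding \<psi>_def by eventually_elim (intro tendsto_intros rpot_tendsto e0)
    show "AE x in lebesgue. norm (\<psi> n x) \<le> C * (indicator (cball 0 R) x * (\<bar>pot (x - s)\<bar> + K))" for n
      using AE_not_shift_L[of s]
    proof eventually_elim
      case (elim x)
      show ?case
      proof (cases "norm x \<le> R")
        case True
        have "\<bar>rpot (e n) (x - s)\<bar> \<le> \<bar>pot (x - s)\<bar> + K"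
          using rpot_bound[OF elim, of "e n"] e[of n] K(2)[OF xs[OF True]] by simp
        then have "\<bar>\<phi> x\<bar> * \<bar>rpot (e n) (x - s)\<bar> \<le> C * (\<bar>pot (x - s)\<bar> + K)"
          using C(2)[of x] True C(1) by (intro mult_mono) auto
        then show ?thesis using True by (simp add: abs_mult \<psi>_def)
      next
        case False
        then show ?thesis using C1cD(4)[OF \<phi>, of x] by (simp add: \<psi>_def)
      qed
    qed
    show "(\<lambda>x. \<phi> x * pot (x - s)) \<in> borel_measurable lebesgue"
      by (intro measurable_completion) measurable
    show "\<psi> n \<in> borel_measurable lebesgue" for n
      unfolding \<psi>_def[abs_def] by (intro measurable_completion) measurable
  qed
  have fin: "finite (L \<inter> cball 0 R)" by (intro finite_L) auto
  have inf: "(\<Sum>\<^sub>\<infinity>p\<in>L. \<phi> p * g p) = (\<Sum>p\<in>L \<inter> cball 0 R. \<phi> p * g p)" for g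
    by (rule infsum_finite_support[OF fin]) (use C1cD(4)[OF \<phi>] in auto)
  have 3: "(\<lambda>n. \<Sum>\<^sub>\<infinity>p\<in>L. \<psi> n p) \<longlonglongrightarrow> (\<Sum>\<^sub>\<infinity>p\<in>L. \<phi> p * pot (p - s))"
    unfolding \<psi>_def inf
  proof (intro tendsto_intros rpot_tendsto e0)
    fix p assume "p \<in> L \<inter> cball 0 R"
    then show "p - s \<notin> L" using s L_diff[of p "p - s"] by auto
  qed
  have "(\<lambda>n. 2 * pi * (\<Sum>\<^sub>\<infinity>p\<in>L. \<psi> n p) - (LINT x|lebesgue. \<psi> n x)) \<longlonglongrightarrow> 2 * pi * (\<Sum>\<^sub>\<infinity>p\<in>L. \<phi> p * pot (p - s)) - (LINT x|lebesgue. \<phi> x * pot (x - s))"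
    by (intro tendsto_intros 2 3)
  from LIMSEQ_unique[OF 1[unfolded eq] this] show ?thesis .
qed

lemma cutoff_shell_vanishes:
  assumes "locally_integrable f" "torus_periodic u v f" "locally_integrable g" "torus_periodic u v g"
  shows "((\<lambda>R. (LINT x|lebesgue. partial 1 (cutoff R) x * f x - partial 2 (cutoff R) x * g x) / R\<^sup>2) \<longlongrightarrow> 0) at_top"
proof -
  obtain C where C: "C > 0" "\<And>R x i. R \<ge> 1 \<Longrightarrow> \<bar>partial i (cutoff R) x\<bar> \<le> C"
    using partial_cutoff_bounded by blast
  have m: "partial i (cutoff R) \<in> borel_measurable lebesgue" if "R \<ge> 1" for i R
    by (intro measurable_completion) (use borel_measurable_continuous_onI[OF C1cD(3)[OF cutoff_C1c[OF that]]] in simp)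
  have "((\<lambda>R. (LINT x|lebesgue. partial 1 (cutoff R) x * f x) / R\<^sup>2 - (LINT x|lebesgue. partial 2 (cutoff R) x * g x) / R\<^sup>2) \<longlongrightarrow> 0 - 0) at_top"
    by (intro tendsto_diff average_shell[where Ra = 1 and C = C and b = 1] assms m C partial_cutoff_shell)
  then show ?thesis
  proof (rule Lim_transform_eventually[OF tendsto_eq_rhs])
    show "\<forall>\<^sub>F R in at_top. (LINT x|lebesgue. partial 1 (cutoff R) x * f x) / R\<^sup>2 - (LINT x|lebesgue. partial 2 (cutoff R) x * g x) / R\<^sup>2
       = (LINT x|lebesgue. partial 1 (cutoff R) x * f x - partial 2 (cutoff R) x * g x) / R\<^sup>2"
      using eventually_ge_at_top[of 1]
    proof eventually_elim
      case (elim R)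
      have "integrable lebesgue (\<lambda>x. partial i (cutoff R) x * h x)" if "locally_integrable h" for h i
        by (rule locally_integrable_bounded_mult[OF that m[OF elim] C(2)[OF elim], of R]) (rule C1cD(5)[OF cutoff_C1c[OF elim]])
      then show ?case using assms by (simp add: diff_divide_distrib)
    qed
  qed simp
qed

text \<open>\<open>cross_by_parts\<close> averaged over large cutoffs. By periodicity the sum over
  lattice points is \<open>pot (- s)\<close> times their weighted number, and the terms with the
  gradient of the cutoff live in a shell.\<close>

lemma cross_mean:
  assumes s: "s \<notin> L"
  shows "locally_integrable (\<lambda>x. fld (x - s) \<bullet> fld x)" "torus_periodic u v (\<lambda>x. fld (x - s) \<bullet> fld x)"
    "mean (\<lambda>x. fld (x - s) \<bullet> fld x) = pot (- s) - mean pot"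
proof -
  have X: "locally_integrable (\<lambda>x. (\<bar>pot (x - s)\<bar> + cmod (fld (x - s)) + 0) * (cmod (fld x) + 0))"
    by (rule cross_locally_integrable[OF s])
  have per: "torus_periodic u v (\<lambda>x. pot (x - s))" "torus_periodic u v (\<lambda>x. fld (x - s))"
    using torus_periodic_shift[OF torus_periodic_pot, of "- s"] torus_periodic_shift[OF torus_periodic_fld, of "- s"] by simp_all
  have pot_s: "locally_integrable (\<lambda>x. pot (x - s))"
    using locally_integrable_shift[OF pot_locally_integrable, of "- s"] by simp
  show cl: "locally_integrable (\<lambda>x. fld (x - s) \<bullet> fld x)"
  proof (rule locally_integrable_dominated[OF X])
    show "(\<lambda>x. fld (x - s) \<bullet> fld x) \<in> borel_measurable lebesgue" by (intro measurable_completion) measurable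
    show "norm (fld (x - s) \<bullet> fld x) \<le> \<bar>(\<bar>pot (x - s)\<bar> + cmod (fld (x - s)) + 0) * (cmod (fld x) + 0)\<bar>" for x
      using Cauchy_Schwarz_ineq2[of "fld (x - s)" "fld x"] by (simp add: abs_mult distrib_right add_increasing)
  qed
  show cp: "torus_periodic u v (\<lambda>x. fld (x - s) \<bullet> fld x)"
    by (rule torus_periodic_comp2[OF per(2) torus_periodic_fld])
  have re: "locally_integrable (\<lambda>x. Re (fld x))" "locally_integrable (\<lambda>x. Im (fld x))"
    using locally_integrable_inner[OF fld_locally_integrable, of 1] locally_integrable_inner[OF fld_locally_integrable, of \<i>]
    by (simp_all add: inner_complex_def)
  have rep: "torus_periodic u v (\<lambda>x. Re (fld x))" "torus_periodic u v (\<lambda>x. Im (fld x))"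
    by (rule torus_periodic_comp[OF torus_periodic_fld])+
  have pre: "locally_integrable (\<lambda>x. pot (x - s) * Re (fld x))" "locally_integrable (\<lambda>x. pot (x - s) * Im (fld x))"
  proof -
    have b: "norm (pot (x - s) * r) \<le> \<bar>(\<bar>pot (x - s)\<bar> + cmod (fld (x - s)) + 0) * (cmod (fld x) + 0)\<bar>" if "\<bar>r\<bar> \<le> cmod (fld x)" for r x
    proof -
      have "\<bar>pot (x - s)\<bar> * \<bar>r\<bar> \<le> (\<bar>pot (x - s)\<bar> + cmod (fld (x - s)) + 0) * (cmod (fld x) + 0)"
        using that by (intro mult_mono) auto
      then show ?thesis by (simp add: abs_mult)
    qed
    show "locally_integrable (\<lambda>x. pot (x - s) * Re (fld x))"
      by (rule locally_integrable_dominated[OF X _ b[OF abs_Re_le_cmod]]) (intro measurable_completion, measurable)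
    show "locally_integrable (\<lambda>x. pot (x - s) * Im (fld x))"
      by (rule locally_integrable_dominated[OF X _ b[OF abs_Im_le_cmod]]) (intro measurable_completion, measurable)
  qed
  have prep: "torus_periodic u v (\<lambda>x. pot (x - s) * Re (fld x))" "torus_periodic u v (\<lambda>x. pot (x - s) * Im (fld x))"
    by (rule torus_periodic_comp2[OF per(1) rep(1)], rule torus_periodic_comp2[OF per(1) rep(2)])
  have cm: "cutoff R \<in> borel_measurable lebesgue" if "R \<ge> 1" for R
    by (intro measurable_completion) (use borel_measurable_continuous_onI[OF C1cD(2)[OF cutoff_C1c[OF that]]] in simp)
  have avg: "((\<lambda>R. (LINT x|lebesgue. cutoff R x * f x) / R\<^sup>2) \<longlongrightarrow> pi * mean f) at_top"
    if "locally_integrable f" "torus_periodic u v f" for f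
    by (rule average_cutoff[OF that, where Ra = 1 and C = 1]) (auto intro: cm cutoff_bounds cutoff_0 cutoff_1)
  define S where "S R = (\<Sum>\<^sub>\<infinity>p\<in>L. cutoff R p)" for R
  \<comment> \<open>The weighted number of lattice points comes from the weak equation for
    \<open>fld\<close>, tested with the cutoff alone. After division by R^2 it gives the density
    needed below.\<close>
  have A: "2 * pi * S R = (LINT x|lebesgue. partial 1 (cutoff R) x * Re (fld x) - partial 2 (cutoff R) x * Im (fld x)) + (LINT x|lebesgue. cutoff R x * 1)"
    if R: "R \<ge> 1" for R
  proof -
    have "(LINT x|lebesgue. Re (dbar (cutoff R) x * fld x)) = Re (LINT x|lebesgue. dbar (cutoff R) x * fld x)"
      by (rule integral_Re[OF dbar_fld(1)[OF cutoff_C1c[OF R]]])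
    then show ?thesis unfolding dbar_fld(2)[OF cutoff_C1c[OF R]] Re_dbar_mult by (simp add: S_def)
  qed
  have "((\<lambda>R. (LINT x|lebesgue. partial 1 (cutoff R) x * Re (fld x) - partial 2 (cutoff R) x * Im (fld x)) / R\<^sup>2 + (LINT x|lebesgue. cutoff R x * 1) / R\<^sup>2) \<longlongrightarrow> 0 + pi * mean (\<lambda>x. 1)) at_top"
    by (intro tendsto_add cutoff_shell_vanishes avg re rep locally_integrable_const) (simp add: torus_periodic_def)
  moreover have "mean (\<lambda>x. 1) = 1"
    using volume by (simp add: mean_def set_lebesgue_integral_def)
  moreover have "\<forall>\<^sub>F R in at_top. (LINT x|lebesgue. partial 1 (cutoff R) x * Re (fld x) - partial 2 (cutoff R) x * Im (fld x)) / R\<^sup>2 + (LINT x|lebesgue. cutoff R x * 1) / R\<^sup>2 = 2 * pi * S R / R\<^sup>2"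
    using eventually_ge_at_top[of 1] by eventually_elim (simp only: A add_divide_distrib)
  ultimately have limS: "((\<lambda>R. 2 * pi * S R / R\<^sup>2) \<longlongrightarrow> pi) at_top"
    using Lim_transform_eventually by fastforce
  have B: "(LINT x|lebesgue. cutoff R x * (fld (x - s) \<bullet> fld x)) =
      pot (- s) * (2 * pi * S R) - (LINT x|lebesgue. cutoff R x * pot (x - s))
      - (LINT x|lebesgue. partial 1 (cutoff R) x * (pot (x - s) * Re (fld x)) - partial 2 (cutoff R) x * (pot (x - s) * Im (fld x)))"
    if R: "R \<ge> 1" for R
  proof -
    obtain C where C: "C > 0" "\<And>R x i. R \<ge> 1 \<Longrightarrow> \<bar>partial i (cutoff R) x\<bar> \<le> C"
      using partial_cutoff_bounded by blast
    have m: "partial i (cutoff R) \<in> borel_measurable lebesgue" for i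
      by (intro measurable_completion) (use borel_measurable_continuous_onI[OF C1cD(3)[OF cutoff_C1c[OF R]]] in simp)
    have pi: "integrable lebesgue (\<lambda>x. partial i (cutoff R) x * h x)" if "locally_integrable h" for h i
      by (rule locally_integrable_bounded_mult[OF that m C(2)[OF R], of R]) (rule C1cD(5)[OF cutoff_C1c[OF R]])
    have ci: "integrable lebesgue (\<lambda>x. cutoff R x * (fld (x - s) \<bullet> fld x))"
      by (rule locally_integrable_bounded_mult[OF cl cm[OF R] cutoff_bounds, of R]) (use cutoff_0[OF R] in auto)
    have "(\<Sum>\<^sub>\<infinity>p\<in>L. cutoff R p * pot (p - s)) = (\<Sum>\<^sub>\<infinity>p\<in>L. cutoff R p * pot (- s))"
    proof (rule infsum_cong)
      fix p assume "p \<in> L"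
      moreover have "- s \<notin> L" using s L_minus[of "- s"] by auto
      ultimately show "cutoff R p * pot (p - s) = cutoff R p * pot (- s)"
        using pot_periodic[of "- s" p] by simp
    qed
    also have "\<dots> = S R * pot (- s)" unfolding S_def by (rule infsum_cmult_left')
    finally have 1: "(LINT x|lebesgue. pot (x - s) * Re (dbar (cutoff R) x * fld x) + cutoff R x * (fld (x - s) \<bullet> fld x)) =
      pot (- s) * (2 * pi * S R) - (LINT x|lebesgue. cutoff R x * pot (x - s))"
      unfolding cross_by_parts[OF cutoff_C1c[OF R] s] by simp
    have "(LINT x|lebesgue. pot (x - s) * Re (dbar (cutoff R) x * fld x) + cutoff R x * (fld (x - s) \<bullet> fld x)) =
      (LINT x|lebesgue. (partial 1 (cutoff R) x * (pot (x - s) * Re (fld x)) - partial 2 (cutoff R) x * (pot (x - s) * Im (fld x))) + cutoff R x * (fld (x - s) \<bullet> fld x))"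
      unfolding Re_dbar_mult by (simp add: algebra_simps)
    also have "\<dots> = (LINT x|lebesgue. partial 1 (cutoff R) x * (pot (x - s) * Re (fld x)) - partial 2 (cutoff R) x * (pot (x - s) * Im (fld x))) + (LINT x|lebesgue. cutoff R x * (fld (x - s) \<bullet> fld x))"
      by (intro Bochner_Integration.integral_add Bochner_Integration.integrable_diff pi pre ci)
    finally show ?thesis using 1 by simp
  qed
  have "((\<lambda>R. pot (- s) * (2 * pi * S R / R\<^sup>2) - (LINT x|lebesgue. cutoff R x * pot (x - s)) / R\<^sup>2
      - (LINT x|lebesgue. partial 1 (cutoff R) x * (pot (x - s) * Re (fld x)) - partial 2 (cutoff R) x * (pot (x - s) * Im (fld x))) / R\<^sup>2)
     \<longlongrightarrow> pot (- s) * pi - pi * mean (\<lambda>x. pot (x - s)) - 0) at_top"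
    by (intro tendsto_diff tendsto_mult tendsto_const limS avg cutoff_shell_vanishes pot_s per pre prep)
  then have "((\<lambda>R. (LINT x|lebesgue. cutoff R x * (fld (x - s) \<bullet> fld x)) / R\<^sup>2) \<longlongrightarrow> pot (- s) * pi - pi * mean (\<lambda>x. pot (x - s)) - 0) at_top"
  proof (rule Lim_transform_eventually)
    show "\<forall>\<^sub>F R in at_top. pot (- s) * (2 * pi * S R / R\<^sup>2) - (LINT x|lebesgue. cutoff R x * pot (x - s)) / R\<^sup>2
      - (LINT x|lebesgue. partial 1 (cutoff R) x * (pot (x - s) * Re (fld x)) - partial 2 (cutoff R) x * (pot (x - s) * Im (fld x))) / R\<^sup>2
      = (LINT x|lebesgue. cutoff R x * (fld (x - s) \<bullet> fld x)) / R\<^sup>2"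
      using eventually_ge_at_top[of 1] by eventually_elim (simp only: B diff_divide_distrib times_divide_eq_right)
  qed
  from tendsto_unique[OF _ avg[OF cl cp] this]
  have "pi * mean (\<lambda>x. fld (x - s) \<bullet> fld x) = pi * (pot (- s) - mean (\<lambda>x. pot (x - s)))"
    by (simp add: algebra_simps)
  then have "mean (\<lambda>x. fld (x - s) \<bullet> fld x) = pot (- s) - mean (\<lambda>x. pot (x - s))" by simp
  also have "mean (\<lambda>x. pot (x - s)) = mean pot"
    using mean_shift[OF pot_locally_integrable torus_periodic_pot, of "- s"] by simp
  finally show "mean (\<lambda>x. fld (x - s) \<bullet> fld x) = pot (- s) - mean pot" .
qed

end

section \<open>Averaging the renormalized energy\<close>

definition locally_finite_set :: "(real^2) set \<Rightarrow> bool" where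
  "locally_finite_set \<Lambda> \<longleftrightarrow> (\<forall>R. finite (\<Lambda> \<inter> cball 0 R))"

lemma locally_finite_setD: "locally_finite_set \<Lambda> \<Longrightarrow> bounded K \<Longrightarrow> finite (\<Lambda> \<inter> K)"
proof -
  assume a: "locally_finite_set \<Lambda>" "bounded K"
  then obtain R where "K \<subseteq> cball 0 R" by (meson bounded_subset_ballD ball_subset_cball order_trans)
  then show ?thesis using a(1) by (auto simp: locally_finite_set_def intro: finite_subset[of _ "\<Lambda> \<inter> cball 0 R"])
qed

lemma locally_finite_set_null:
  assumes "locally_finite_set \<Lambda>"
  shows "\<Lambda> \<in> null_sets lebesgue"
proof -
  have "\<Lambda> = (\<Union>n. \<Lambda> \<inter> cball 0 (real n))" by (auto intro: real_arch_simple)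
  moreover have "countable (\<Union>n. \<Lambda> \<inter> cball 0 (real n))"
    using assms by (intro countable_UN) (auto simp: locally_finite_set_def intro: countable_finite)
  ultimately have "countable \<Lambda>" by metis
  then show ?thesis using countable_imp_null_set_lborel by (auto intro: null_sets_completionI)
qed

lemma locally_finite_set_separated:
  assumes "locally_finite_set \<Lambda>"
  obtains d where "d > 0" "\<And>q. q \<in> \<Lambda> \<Longrightarrow> q \<noteq> p \<Longrightarrow> dist p q \<ge> d"
proof -
  have fin: "finite (\<Lambda> \<inter> cball p 1 - {p})" using locally_finite_setD[OF assms, of "cball p 1"] by auto
  obtain d where d: "d > 0" "\<And>q. q \<in> \<Lambda> \<inter> cball p 1 - {p} \<Longrightarrow> q \<noteq> p \<Longrightarrow> d \<le> dist p q"
    using finite_set_avoid[OF fin, of p] by auto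
  show ?thesis
  proof (rule that[of "min d 1"])
    show "dist p q \<ge> min d 1" if "q \<in> \<Lambda>" "q \<noteq> p" for q
      using d(2)[of q] that by (cases "dist p q \<le> 1") auto
  qed (use d in auto)
qed

definition inv_sq :: "real \<Rightarrow> real^2 \<Rightarrow> real^2 \<Rightarrow> real" where
  "inv_sq r p x = indicator (cball p r) x * (1 / (norm (x - p))\<^sup>2)"

text \<open>The part of the energy density that is not integrable at the points, cut off at distance
  r so that the sum is finite and inherits periodicity from \<open>\<Lambda>\<close>.\<close>

definition sing_part :: "(real^2) set \<Rightarrow> real \<Rightarrow> real^2 \<Rightarrow> real" where
  "sing_part \<Lambda> r x = (\<Sum>p\<in>\<Lambda> \<inter> cball x r. 1 / (norm (x - p))\<^sup>2)"

text \<open>A locally integrable stand-in for the counting measure. Integrating it against a weight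
  gives pi r^2 times the sum of the weight over the points, up to the variation of the weight over
  discs of radius r.\<close>

definition near_count :: "(real^2) set \<Rightarrow> real \<Rightarrow> real^2 \<Rightarrow> real" where
  "near_count \<Lambda> r x = real (card (\<Lambda> \<inter> cball x r))"

lemma local_sum_eq:
  assumes "locally_finite_set \<Lambda>" "norm x \<le> R"
  shows "(\<Sum>p\<in>\<Lambda> \<inter> cball x r. f p) = (\<Sum>p\<in>\<Lambda> \<inter> cball 0 (R + r). indicator (cball p r) x * f p :: real)"
proof -
  have "norm p \<le> R + r" if "dist x p \<le> r" for p
    using norm_triangle_ineq2[of p x] assms(2) that by (simp add: dist_norm norm_minus_commute)
  then have "\<Lambda> \<inter> cball x r \<subseteq> \<Lambda> \<inter> cball 0 (R + r)" by auto
  then show ?thesis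
    using assms(1) by (intro sum.mono_neutral_cong_left) (auto simp: locally_finite_set_def dist_commute indicator_def)
qed

lemma sing_part_eq:
  assumes "locally_finite_set \<Lambda>" "norm x \<le> R"
  shows "sing_part \<Lambda> r x = (\<Sum>p\<in>\<Lambda> \<inter> cball 0 (R + r). inv_sq r p x)"
  unfolding sing_part_def inv_sq_def by (rule local_sum_eq[OF assms])

lemma near_count_eq:
  assumes "locally_finite_set \<Lambda>" "norm x \<le> R"
  shows "near_count \<Lambda> r x = (\<Sum>p\<in>\<Lambda> \<inter> cball 0 (R + r). indicator (cball p r) x)"
  using local_sum_eq[OF assms, of "\<lambda>p. 1" r] by (simp add: near_count_def)

lemma inv_sq_measurable: "inv_sq r p \<in> borel_measurable lebesgue"
  unfolding inv_sq_def[abs_def]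
  by (intro measurable_completion borel_measurable_times borel_measurable_indicator borel_measurable_divide
      borel_measurable_power borel_measurable_norm borel_measurable_diff) auto

lemma integrable_indicator_bounded:
  "A \<in> sets lebesgue \<Longrightarrow> bounded A \<Longrightarrow> integrable lebesgue (indicat_real (A :: (real^2) set))"
  using locally_integrable_bounded[OF locally_integrable_const[of "1::real"], of A]
  by (simp add: set_integrable_def)

text \<open>Subtracting the value at the point gains one power of |x - p|, which turns the inverse
  square into an integrable simple pole.\<close>

lemma lipschitz_inv_sq:
  assumes \<psi>: "C-lipschitz_on UNIV \<psi>" and r: "r > 0"
  shows "\<bar>(\<psi> x - \<psi> p) * inv_sq r p x\<bar> \<le> C * (indicator (cball p r) x *\<^sub>R (1 / norm (x - p :: real^2)))"
    "integrable lebesgue (\<lambda>x. C * (indicator (cball p r) x *\<^sub>R (1 / norm (x - p))))"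
    "integrable lebesgue (\<lambda>x. (\<psi> x - \<psi> p) * inv_sq r p x)"
    "\<bar>LINT x|lebesgue. (\<psi> x - \<psi> p) * inv_sq r p x\<bar> \<le> (LINT x|lebesgue. C * (indicator (cball p r) x *\<^sub>R (1 / norm (x - p))))"
proof -
  show b: "\<bar>(\<psi> x - \<psi> p) * inv_sq r p x\<bar> \<le> C * (indicator (cball p r) x *\<^sub>R (1 / norm (x - p)))" for x
  proof (cases "x = p")
    case False
    have "\<bar>\<psi> x - \<psi> p\<bar> \<le> C * norm (x - p)"
      using lipschitz_onD[OF \<psi>, of x p] by (simp add: dist_norm)
    then have "\<bar>\<psi> x - \<psi> p\<bar> * (1 / (norm (x - p))\<^sup>2) \<le> C * norm (x - p) * (1 / (norm (x - p))\<^sup>2)"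
      by (rule mult_right_mono) simp
    also have "\<dots> = C * (1 / norm (x - p))" using False by (simp add: power2_eq_square)
    finally show ?thesis by (simp add: inv_sq_def abs_mult indicator_def)
  qed (simp add: inv_sq_def)
  show i: "integrable lebesgue (\<lambda>x. C * (indicator (cball p r) x *\<^sub>R (1 / norm (x - p))))"
    using set_integrable_inverse_norm[of p r p] unfolding set_integrable_def by (rule integrable_mult_right)
  have c: "continuous_on UNIV \<psi>" by (rule lipschitz_on_continuous_on[OF \<psi>])
  have m: "(\<lambda>x. (\<psi> x - \<psi> p) * inv_sq r p x) \<in> borel_measurable lebesgue"
    by (intro borel_measurable_times borel_measurable_diff inv_sq_measurable borel_measurable_const measurable_completion)
       (use borel_measurable_continuous_onI[OF c] in simp)
  show i2: "integrable lebesgue (\<lambda>x. (\<psi> x - \<psi> p) * inv_sq r p x)"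
  proof (rule Bochner_Integration.integrable_bound[OF i m], rule AE_I2)
    show "norm ((\<psi> x - \<psi> p) * inv_sq r p x) \<le> norm (C * (indicator (cball p r) x *\<^sub>R (1 / norm (x - p))))" for x
      unfolding real_norm_def by (rule order_trans[OF b abs_ge_self])
  qed
  have "\<bar>LINT x|lebesgue. (\<psi> x - \<psi> p) * inv_sq r p x\<bar> \<le> (LINT x|lebesgue. \<bar>(\<psi> x - \<psi> p) * inv_sq r p x\<bar>)"
    by (rule integral_abs_bound)
  also have "\<dots> \<le> (LINT x|lebesgue. C * (indicator (cball p r) x *\<^sub>R (1 / norm (x - p))))"
    by (intro integral_mono integrable_abs i i2 b)
  finally show "\<bar>LINT x|lebesgue. (\<psi> x - \<psi> p) * inv_sq r p x\<bar> \<le> (LINT x|lebesgue. C * (indicator (cball p r) x *\<^sub>R (1 / norm (x - p))))" .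
qed

text \<open>Near each point the weight is split into \<psi> x - \<psi> p, which tames the inverse
  square, and the constant \<psi> p, for which the integral diverges like the logarithm in the
  counterterm. The three limits are \<open>T1\<close> for the regular part, \<open>T2\<close> for
  the tamed part and \<open>T3\<close> for the divergent one.\<close>

lemma W_cutoff_eq:
  fixes j :: "real^2 \<Rightarrow> real^2"
  assumes \<Lambda>: "locally_finite_set \<Lambda>" and r: "r > 0" and g: "locally_integrable g"
    and j: "AE x in lebesgue. (norm (j x))\<^sup>2 = g x + sing_part \<Lambda> r x" and jm: "j \<in> borel_measurable lebesgue"
    and \<psi>: "C-lipschitz_on UNIV \<psi>" "\<And>x. norm x \<ge> R \<Longrightarrow> \<psi> x = 0"
  shows "W_cutoff \<Lambda> j \<psi> = 1/2 * (LINT x|lebesgue. \<psi> x * g x) +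
     (\<Sum>p\<in>\<Lambda> \<inter> cball 0 (R + r). pi * ln r * \<psi> p + 1/2 * (LINT x|lebesgue. (\<psi> x - \<psi> p) * inv_sq r p x))"
proof -
  define F where "F = \<Lambda> \<inter> cball 0 (R + r)"
  have finF: "finite F" using \<Lambda> by (auto simp: F_def locally_finite_set_def)
  define A where "A \<eta> = - (\<Union>p\<in>\<Lambda>. ball p \<eta>)" for \<eta>
  have "open (\<Union>p\<in>\<Lambda>. ball p \<eta>)" for \<eta> by auto
  then have Ac: "closed (A \<eta>)" for \<eta> unfolding A_def by (rule closed_Compl)
  then have As: "A \<eta> \<in> sets lebesgue" for \<eta> by auto
  have im: "indicat_real (A \<eta>) \<in> borel_measurable lebesgue" for \<eta> using As by (rule borel_measurable_indicator)
  have \<psi>c: "continuous_on UNIV \<psi>" by (rule lipschitz_on_continuous_on[OF \<psi>(1)])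
  have \<psi>m: "\<psi> \<in> borel_measurable lebesgue"
    by (intro measurable_completion) (use borel_measurable_continuous_onI[OF \<psi>c] in simp)
  obtain M where M: "M > 0" "\<And>x. norm (\<psi> x) \<le> M"
    using continuous_compact_support_bounded[OF \<psi>c, of R] \<psi>(2) by (metis less_imp_le)
  have gi: "integrable lebesgue (\<lambda>x. \<psi> x * g x)"
    by (rule locally_integrable_bounded_mult[OF g \<psi>m, of M R]) (use M \<psi>(2) in auto)
  have aeL: "AE x in lebesgue. x \<notin> \<Lambda>" by (rule AE_not_in[OF locally_finite_set_null[OF \<Lambda>]])
  have ind_lim: "((\<lambda>\<eta>. indicat_real (A \<eta>) x) \<longlongrightarrow> 1) (at_right 0)" if "x \<notin> \<Lambda>" for x
  proof -
    obtain d where d: "d > 0" "\<And>q. q \<in> \<Lambda> \<Longrightarrow> q \<noteq> x \<Longrightarrow> dist x q \<ge> d"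
      using locally_finite_set_separated[OF \<Lambda>] by metis
    have "\<forall>\<^sub>F \<eta> in at_right 0. 1 = indicat_real (A \<eta>) x"
      using eventually_at_right_real[OF d(1)]
    proof eventually_elim
      case (elim \<eta>)
      have "x \<in> A \<eta>" using d(2) elim that unfolding A_def by (force simp: dist_commute)
      then show ?case by simp
    qed
    then show ?thesis by (rule Lim_transform_eventually[OF tendsto_const])
  qed
  define ann where "ann p \<eta> x = indicator (cball p r - ball p \<eta>) x * (1 / (norm (x - p))\<^sup>2)" for p \<eta> and x :: "real^2"
  have ann: "integrable lebesgue (ann p \<eta>)" "(LINT x|lebesgue. ann p \<eta> x) = 2 * pi * ln (r / \<eta>)" if "0 < \<eta>" "\<eta> \<le> r" for p \<eta>
    using annulus_integral[OF that, of p] unfolding ann_def[abs_def] by auto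
  have A_inv: "indicator (A \<eta>) x * inv_sq r p x = indicator (A \<eta>) x * ann p \<eta> x" if "p \<in> \<Lambda>" for p \<eta> x
    using that by (auto simp: A_def inv_sq_def ann_def indicator_def)
  have T1: "((\<lambda>\<eta>. LINT x|lebesgue. indicator (A \<eta>) x * (\<psi> x * g x)) \<longlongrightarrow> (LINT x|lebesgue. \<psi> x * g x)) (at_right 0)"
  proof (rule dominated_convergence_at_right[where w = "\<lambda>x. \<bar>\<psi> x * g x\<bar>" and d = 1])
    show "AE x in lebesgue. ((\<lambda>\<eta>. indicator (A \<eta>) x * (\<psi> x * g x)) \<longlongrightarrow> \<psi> x * g x) (at_right 0)"
      using aeL
    proof eventually_elim
      case (elim x)
      show ?case using tendsto_mult[OF ind_lim[OF elim] tendsto_const[of "\<psi> x * g x"]] by simp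
    qed
    show "(\<lambda>x. indicator (A t) x * (\<psi> x * g x)) \<in> borel_measurable lebesgue" for t
      by (rule borel_measurable_times[OF im borel_measurable_integrable[OF gi]])
  qed (use gi in \<open>auto simp: indicator_def\<close>)
  have T2: "((\<lambda>\<eta>. LINT x|lebesgue. indicator (A \<eta>) x * ((\<psi> x - \<psi> p) * inv_sq r p x)) \<longlongrightarrow> (LINT x|lebesgue. (\<psi> x - \<psi> p) * inv_sq r p x)) (at_right 0)" for p
  proof (rule dominated_convergence_at_right[where w = "\<lambda>x. \<bar>(\<psi> x - \<psi> p) * inv_sq r p x\<bar>" and d = 1])
    show "AE x in lebesgue. ((\<lambda>\<eta>. indicator (A \<eta>) x * ((\<psi> x - \<psi> p) * inv_sq r p x)) \<longlongrightarrow> (\<psi> x - \<psi> p) * inv_sq r p x) (at_right 0)"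
      using aeL
    proof eventually_elim
      case (elim x)
      show ?case using tendsto_mult[OF ind_lim[OF elim] tendsto_const[of "(\<psi> x - \<psi> p) * inv_sq r p x"]] by simp
    qed
    show "(\<lambda>x. indicator (A t) x * ((\<psi> x - \<psi> p) * inv_sq r p x)) \<in> borel_measurable lebesgue" for t
      by (rule borel_measurable_times[OF im borel_measurable_integrable[OF lipschitz_inv_sq(3)[OF \<psi>(1) r]]])
  qed (use lipschitz_inv_sq(3)[OF \<psi>(1) r] in \<open>auto simp: indicator_def\<close>)
  have Ai: "integrable lebesgue (\<lambda>x. indicator (A \<eta>) x * inv_sq r p x)" if "0 < \<eta>" "\<eta> \<le> r" "p \<in> \<Lambda>" for \<eta> p
    unfolding A_inv[OF that(3)]
    using integrable_mult_indicator[OF As ann(1)[OF that(1,2), of p], of \<eta>] unfolding real_scaleR_def .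
  \<comment> \<open>The domain excludes discs around all points, not only around \<open>p\<close>,
    so the integral is not exactly the annulus integral. The discrepancy comes from discs around
    other points and tends to 0.\<close>
  have T3: "((\<lambda>\<eta>. (LINT x|lebesgue. indicator (A \<eta>) x * inv_sq r p x) + 2 * pi * ln \<eta>) \<longlongrightarrow> 2 * pi * ln r) (at_right 0)" if p: "p \<in> \<Lambda>" for p
  proof -
    obtain d where d: "d > 0" "\<And>q. q \<in> \<Lambda> \<Longrightarrow> q \<noteq> p \<Longrightarrow> dist p q \<ge> d"
      using locally_finite_set_separated[OF \<Lambda>] by metis
    \<comment> \<open>For radii below d/2 the discs around other points stay at distance more than
      d/2 from \<open>p\<close>, so the discrepancy is dominated by the bounded function 1/(d/2)^2
      on a disc.\<close>
    define d' where "d' = min (d / 2) r"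
    have d': "d' > 0" using d(1) r by (simp add: d'_def)
    have "((\<lambda>\<eta>. LINT x|lebesgue. (1 - indicator (A \<eta>) x) * ann p \<eta> x) \<longlongrightarrow> (LINT x|(lebesgue :: (real^2) measure). (0::real))) (at_right 0)"
    proof (rule dominated_convergence_at_right[where w = "\<lambda>x. (1 / (d/2)\<^sup>2) * indicator (cball p r) x" and d = d'])
      show "(\<lambda>x. (1 - indicator (A t) x) * ann p t x) \<in> borel_measurable lebesgue" if "t > 0" for t
      proof -
        have "ann p t \<in> borel_measurable lebesgue" unfolding ann_def[abs_def]
          by (intro measurable_completion borel_measurable_times borel_measurable_indicator borel_measurable_divide
              borel_measurable_power borel_measurable_norm borel_measurable_diff) auto
        then show ?thesis using im by (intro borel_measurable_times borel_measurable_diff) auto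
      qed
      show "integrable lebesgue (\<lambda>x. (1 / (d/2)\<^sup>2) * indicat_real (cball p r) x)"
        by (intro integrable_mult_right integrable_indicator_bounded) auto
      show "AE x in lebesgue. ((\<lambda>\<eta>. (1 - indicator (A \<eta>) x) * ann p \<eta> x) \<longlongrightarrow> 0) (at_right 0)"
        using aeL
      proof eventually_elim
        case (elim x)
        show ?case
        proof (rule Lim_null_comparison)
          show "\<forall>\<^sub>F \<eta> in at_right 0. norm ((1 - indicator (A \<eta>) x) * ann p \<eta> x) \<le> (1 - indicator (A \<eta>) x) * (1 / (norm (x - p))\<^sup>2)"
            by (intro always_eventually allI) (auto simp: ann_def indicator_def)
          show "((\<lambda>\<eta>. (1 - indicator (A \<eta>) x) * (1 / (norm (x - p))\<^sup>2)) \<longlongrightarrow> 0) (at_right 0)"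
            using tendsto_mult[OF tendsto_diff[OF tendsto_const[of "1::real"] ind_lim[OF elim]] tendsto_const[of "1 / (norm (x - p))\<^sup>2"]] by simp
        qed
      qed
      fix t assume t: "0 < t" "t < d'"
      have "norm ((1 - indicator (A t) x) * ann p t x) \<le> (1 / (d/2)\<^sup>2) * indicator (cball p r) x" for x
      proof (cases "norm (x - p) < d / 2")
        case True
        have "x \<in> A t" if "norm (x - p) \<ge> t"
        proof -
          have "dist q x \<ge> t" if q: "q \<in> \<Lambda>" for q
          proof (cases "q = p")
            case True
            then show ?thesis using \<open>norm (x - p) \<ge> t\<close> by (simp add: dist_norm norm_minus_commute)
          next
            case False
            have "dist p q \<le> dist p x + dist x q" by (rule dist_triangle)
            moreover have "dist p x < d / 2" using True by (simp add: dist_norm norm_minus_commute)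
            ultimately have "dist x q > d / 2" using d(2)[OF q False] by linarith
            then show ?thesis using t by (simp add: d'_def dist_commute)
          qed
          then show ?thesis by (auto simp: A_def not_less)
        qed
        then have z: "(1 - indicator (A t) x) * ann p t x = 0"
          by (cases "norm (x - p) < t") (auto simp: ann_def dist_norm norm_minus_commute)
        show ?thesis unfolding z by simp
      next
        case False
        have "(d/2)\<^sup>2 \<le> (norm (x - p))\<^sup>2" using False d(1) by (intro power_mono) auto
        then have "1 / (norm (x - p))\<^sup>2 \<le> 1 / (d/2)\<^sup>2" using d(1) by (intro frac_le) auto
        then show ?thesis by (auto simp: ann_def indicator_def)
      qed
      then show "AE x in lebesgue. norm ((1 - indicator (A t) x) * ann p t x) \<le> (1 / (d/2)\<^sup>2) * indicator (cball p r) x" by simp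
    qed (use d' in auto)
    then have "((\<lambda>\<eta>. 2 * pi * ln r - (LINT x|lebesgue. (1 - indicator (A \<eta>) x) * ann p \<eta> x)) \<longlongrightarrow> 2 * pi * ln r - 0) (at_right 0)"
      by (intro tendsto_diff tendsto_const) simp
    then show ?thesis
    proof (rule Lim_transform_eventually[OF tendsto_eq_rhs])
      show "\<forall>\<^sub>F \<eta> in at_right 0. 2 * pi * ln r - (LINT x|lebesgue. (1 - indicator (A \<eta>) x) * ann p \<eta> x) =
        (LINT x|lebesgue. indicator (A \<eta>) x * inv_sq r p x) + 2 * pi * ln \<eta>"
        using eventually_at_right_real[OF r]
      proof eventually_elim
        case (elim \<eta>)
        then have \<eta>: "0 < \<eta>" "\<eta> \<le> r" by auto
        have "(LINT x|lebesgue. (1 - indicator (A \<eta>) x) * ann p \<eta> x) = (LINT x|lebesgue. ann p \<eta> x - indicator (A \<eta>) x * inv_sq r p x)"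
          unfolding A_inv[OF p] by (simp add: left_diff_distrib)
        also have "\<dots> = 2 * pi * ln (r / \<eta>) - (LINT x|lebesgue. indicator (A \<eta>) x * inv_sq r p x)"
          using ann[OF \<eta>, of p] Ai[OF \<eta> p] by simp
        finally show ?case using \<eta> r by (simp add: ln_div algebra_simps)
      qed
    qed simp
  qed
  have split: "(LINT x:A \<eta>|lebesgue. \<psi> x * (norm (j x))\<^sup>2) = (LINT x|lebesgue. indicator (A \<eta>) x * (\<psi> x * g x)) +
      (\<Sum>p\<in>F. (LINT x|lebesgue. indicator (A \<eta>) x * ((\<psi> x - \<psi> p) * inv_sq r p x)) + \<psi> p * (LINT x|lebesgue. indicator (A \<eta>) x * inv_sq r p x))"
    if \<eta>: "0 < \<eta>" "\<eta> \<le> r" for \<eta>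
  proof -
    have i1: "integrable lebesgue (\<lambda>x. indicator (A \<eta>) x * (\<psi> x * g x))"
      using integrable_mult_indicator[OF As gi] by simp
    have i2: "integrable lebesgue (\<lambda>x. indicator (A \<eta>) x * ((\<psi> x - \<psi> p) * inv_sq r p x))" for p
      using integrable_mult_indicator[OF As lipschitz_inv_sq(3)[OF \<psi>(1) r]] by simp
    have i3: "integrable lebesgue (\<lambda>x. \<psi> p * (indicator (A \<eta>) x * inv_sq r p x))" if "p \<in> F" for p
      using Ai[OF \<eta>] that by (intro integrable_mult_right) (auto simp: F_def)
    have rhs_i: "integrable lebesgue (\<lambda>x. indicator (A \<eta>) x * (\<psi> x * g x) +
       (\<Sum>p\<in>F. indicator (A \<eta>) x * ((\<psi> x - \<psi> p) * inv_sq r p x) + \<psi> p * (indicator (A \<eta>) x * inv_sq r p x)))"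
      by (intro Bochner_Integration.integrable_add Bochner_Integration.integrable_sum i1 i2 i3)
    have "AE x in lebesgue. indicator (A \<eta>) x *\<^sub>R (\<psi> x * (norm (j x))\<^sup>2) = indicator (A \<eta>) x * (\<psi> x * g x) +
       (\<Sum>p\<in>F. indicator (A \<eta>) x * ((\<psi> x - \<psi> p) * inv_sq r p x) + \<psi> p * (indicator (A \<eta>) x * inv_sq r p x))"
      using j
    proof eventually_elim
      case (elim x)
      have s: "(\<Sum>p\<in>F. indicator (A \<eta>) x * ((\<psi> x - \<psi> p) * inv_sq r p x) + \<psi> p * (indicator (A \<eta>) x * inv_sq r p x)) =
         indicator (A \<eta>) x * \<psi> x * (\<Sum>p\<in>F. inv_sq r p x)"
        unfolding sum_distrib_left by (intro sum.cong) (auto simp: algebra_simps)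
      show ?case
      proof (cases "norm x \<le> R")
        case True
        show ?thesis unfolding s unfolding elim sing_part_eq[OF \<Lambda> True] F_def real_scaleR_def by (simp only: distrib_left mult.assoc)
      next
        case False
        then show ?thesis unfolding s using \<psi>(2)[of x] by simp
      qed
    qed
    then have "(LINT x:A \<eta>|lebesgue. \<psi> x * (norm (j x))\<^sup>2) = (LINT x|lebesgue. indicator (A \<eta>) x * (\<psi> x * g x) +
       (\<Sum>p\<in>F. indicator (A \<eta>) x * ((\<psi> x - \<psi> p) * inv_sq r p x) + \<psi> p * (indicator (A \<eta>) x * inv_sq r p x)))"
      unfolding set_lebesgue_integral_def
      by (intro integral_cong_AE) (use rhs_i \<psi>m jm im in \<open>auto intro!: borel_measurable_times borel_measurable_scaleR borel_measurable_power borel_measurable_norm\<close>)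
    also have "\<dots> = (LINT x|lebesgue. indicator (A \<eta>) x * (\<psi> x * g x)) +
      (\<Sum>p\<in>F. (LINT x|lebesgue. indicator (A \<eta>) x * ((\<psi> x - \<psi> p) * inv_sq r p x)) + (LINT x|lebesgue. \<psi> p * (indicator (A \<eta>) x * inv_sq r p x)))"
      using i1 i2 i3 by (simp add: Bochner_Integration.integral_add Bochner_Integration.integral_sum)
    finally show ?thesis by simp
  qed
  have inf: "(\<Sum>\<^sub>\<infinity>p\<in>\<Lambda>. \<psi> p) = (\<Sum>p\<in>F. \<psi> p)"
    by (rule infsum_finite_support[OF finF]) (use \<psi>(2) r in \<open>auto simp: F_def\<close>)
  have "((\<lambda>\<eta>. 1/2 * (LINT x|lebesgue. indicator (A \<eta>) x * (\<psi> x * g x)) +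
      (\<Sum>p\<in>F. 1/2 * (LINT x|lebesgue. indicator (A \<eta>) x * ((\<psi> x - \<psi> p) * inv_sq r p x)) + \<psi> p / 2 * ((LINT x|lebesgue. indicator (A \<eta>) x * inv_sq r p x) + 2 * pi * ln \<eta>)))
    \<longlongrightarrow> 1/2 * (LINT x|lebesgue. \<psi> x * g x) + (\<Sum>p\<in>F. 1/2 * (LINT x|lebesgue. (\<psi> x - \<psi> p) * inv_sq r p x) + \<psi> p / 2 * (2 * pi * ln r))) (at_right 0)"
    by (intro tendsto_add tendsto_mult tendsto_const tendsto_sum T1 T2 T3) (auto simp: F_def)
  then have "((\<lambda>\<eta>. 1/2 * (LINT x:A \<eta>|lebesgue. \<psi> x * (norm (j x))\<^sup>2) + pi * ln \<eta> * (\<Sum>\<^sub>\<infinity>p\<in>\<Lambda>. \<psi> p))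
    \<longlongrightarrow> 1/2 * (LINT x|lebesgue. \<psi> x * g x) + (\<Sum>p\<in>F. 1/2 * (LINT x|lebesgue. (\<psi> x - \<psi> p) * inv_sq r p x) + \<psi> p / 2 * (2 * pi * ln r))) (at_right 0)"
  proof (rule Lim_transform_eventually)
    show "\<forall>\<^sub>F \<eta> in at_right 0. 1/2 * (LINT x|lebesgue. indicator (A \<eta>) x * (\<psi> x * g x)) +
      (\<Sum>p\<in>F. 1/2 * (LINT x|lebesgue. indicator (A \<eta>) x * ((\<psi> x - \<psi> p) * inv_sq r p x)) + \<psi> p / 2 * ((LINT x|lebesgue. indicator (A \<eta>) x * inv_sq r p x) + 2 * pi * ln \<eta>)) =
      1/2 * (LINT x:A \<eta>|lebesgue. \<psi> x * (norm (j x))\<^sup>2) + pi * ln \<eta> * (\<Sum>\<^sub>\<infinity>p\<in>\<Lambda>. \<psi> p)"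
      using eventually_at_right_real[OF r]
    proof eventually_elim
      case (elim \<eta>)
      then have \<eta>: "0 < \<eta>" "\<eta> \<le> r" by auto
      show ?case unfolding split[OF \<eta>] inf
        by (simp add: sum.distrib sum_distrib_left distrib_left sum_divide_distrib add_divide_distrib mult_ac)
    qed
  qed
  then have "W_cutoff \<Lambda> j \<psi> = 1/2 * (LINT x|lebesgue. \<psi> x * g x) + (\<Sum>p\<in>F. 1/2 * (LINT x|lebesgue. (\<psi> x - \<psi> p) * inv_sq r p x) + \<psi> p / 2 * (2 * pi * ln r))"
    unfolding W_cutoff_def A_def by (rule tendsto_Lim[rotated]) simp
  then show ?thesis unfolding F_def by (simp add: algebra_simps)
qed

lemma near_count_locally_integrable:
  assumes "locally_finite_set \<Lambda>"
  shows "locally_integrable (near_count \<Lambda> r)"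
proof (rule locally_integrableI)
  fix R :: real
  have "integrable lebesgue (\<lambda>x. indicat_real (ball 0 R) x *\<^sub>R (\<Sum>p\<in>\<Lambda> \<inter> cball 0 (R + r). indicat_real (cball p r) x))"
    by (intro integrable_mult_indicator Bochner_Integration.integrable_sum integrable_indicator_bounded) auto
  moreover have "indicat_real (ball 0 R) x *\<^sub>R (\<Sum>p\<in>\<Lambda> \<inter> cball 0 (R + r). indicat_real (cball p r) x) = indicat_real (ball 0 R) x *\<^sub>R near_count \<Lambda> r x" for x
    using near_count_eq[OF assms, of x R r] by (auto simp: indicator_def)
  ultimately show "set_integrable lebesgue (ball 0 R) (near_count \<Lambda> r)"
    unfolding set_integrable_def by (simp only:)
qed

section \<open>Cutoff families and the limit defining the energy\<close>

lemma cutoff_familyD: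
  assumes "cutoff_family \<psi>"
  obtains C where "\<And>R. R \<ge> 1 \<Longrightarrow> C-lipschitz_on UNIV (\<psi> R)" "\<And>R x. R \<ge> 1 \<Longrightarrow> norm x \<ge> R \<Longrightarrow> \<psi> R x = 0"
    "\<And>R x. R \<ge> 1 \<Longrightarrow> norm x \<le> R - 1 \<Longrightarrow> \<psi> R x = 1" "\<And>R x. R \<ge> 1 \<Longrightarrow> \<bar>\<psi> R x\<bar> \<le> C + 1" "C \<ge> 0"
proof -
  obtain C where C: "\<And>R. R > 0 \<Longrightarrow> C-lipschitz_on UNIV (\<psi> R)" "\<And>R. R > 0 \<Longrightarrow> closure {x. \<psi> R x \<noteq> 0} \<subseteq> ball 0 R"
    "\<And>R x. R > 0 \<Longrightarrow> infdist x (- ball 0 R) \<ge> 1 \<Longrightarrow> \<psi> R x = 1"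
    using assms unfolding cutoff_family_def by blast
  have C0: "C \<ge> 0" using lipschitz_on_nonneg[OF C(1)[of 1]] by simp
  have zero: "\<psi> R x = 0" if "R \<ge> 1" "norm x \<ge> R" for R x
    using C(2)[of R] closure_subset[of "{x. \<psi> R x \<noteq> 0}"] that by force
  have one: "\<psi> R x = 1" if R: "R \<ge> 1" "norm x \<le> R - 1" for R and x :: "real^2"
  proof (rule C(3))
    have ne: "- ball (0::real^2) R \<noteq> {}"
    proof -
      have "R *\<^sub>R axis 1 1 \<in> - ball (0::real^2) R" using R by (simp add: norm_axis_1)
      then show ?thesis by blast
    qed
    show "infdist x (- ball 0 R) \<ge> 1"
      unfolding infdist_notempty[OF ne]
    proof (rule cINF_greatest[OF ne])
      fix y :: "real^2" assume "y \<in> - ball 0 R"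
      then show "1 \<le> dist x y" using R norm_triangle_ineq2[of y x] by (simp add: dist_norm norm_minus_commute)
    qed
  qed (use R in auto)
  have bd: "\<bar>\<psi> R x\<bar> \<le> C + 1" if R: "R \<ge> 1" for R x
  proof -
    consider "norm x \<le> R - 1" | "norm x \<ge> R" | "R - 1 < norm x" "norm x < R" by linarith
    then show ?thesis
    proof cases
      case 3
      then have n: "norm x > 0" using R by linarith
      \<comment> \<open>The radial projection to the circle of radius R, where the cutoff vanishes.
        It is at distance at most 1, so the Lipschitz bound also bounds the cutoff itself in the
        transition layer.\<close>
      define y where "y = (R / norm x) *\<^sub>R x"
      have "norm y = R" using n R by (simp add: y_def)
      then have y0: "\<psi> R y = 0" using zero[OF R] by simp
      have "x - y = (1 - R / norm x) *\<^sub>R x" by (simp add: y_def scaleR_left_diff_distrib)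
      then have "norm (x - y) = \<bar>1 - R / norm x\<bar> * norm x" by simp
      also have "\<dots> = R - norm x" using n 3 by (simp add: abs_if field_simps)
      finally have "norm (x - y) \<le> 1" using 3 by simp
      then have "C * norm (x - y) \<le> C * 1" using C0 by (intro mult_left_mono)
      then show ?thesis using lipschitz_onD[OF C(1), of R x y] R y0 by (simp add: dist_norm)
    qed (use one[OF R] zero[OF R] C0 in auto)
  qed
  show ?thesis
    by (rule that[of C]) (use C(1) zero one bd C0 in auto)
qed

lemma integral_indicator_cball_plane:
  "r > 0 \<Longrightarrow> (LINT x|lebesgue. indicat_real (cball p r) x) = pi * r\<^sup>2" for p :: "real^2"
  using content_cball[of r p] by (simp add: unit_ball_vol_2)

context plane_lattice begin

text \<open>Only points near the boundary circle contribute. Each adds pi r^2 to the integral of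
  \<open>near_count\<close> over a slightly thicker shell, and that integral is o(R^2) by
  \<open>average_shell\<close>.\<close>

lemma sum_over_points_shell:
  fixes \<rho> :: "real \<Rightarrow> real^2 \<Rightarrow> real"
  assumes \<Lambda>: "locally_finite_set \<Lambda>" and r: "r > 0" and per: "torus_periodic u v (near_count \<Lambda> r)"
    and \<rho>: "\<And>R p. R \<ge> 1 \<Longrightarrow> \<bar>\<rho> R p\<bar> \<le> B" "\<And>R p. R \<ge> 1 \<Longrightarrow> norm p \<le> R - 1 - r \<Longrightarrow> \<rho> R p = 0"
  shows "((\<lambda>R. (\<Sum>p\<in>\<Lambda> \<inter> cball 0 (R + r). \<rho> R p) / R\<^sup>2) \<longlongrightarrow> 0) at_top"
proof -
  \<comment> \<open>The relevant points have norm between R - 1 - r and R + r; this shell contains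
    their discs of radius r.\<close>
  define h where "h R x = indicat_real (cball 0 (R + 2 * r) - ball 0 (R - 1 - 2 * r)) x" for R and x :: "real^2"
  have "((\<lambda>R. (LINT x|lebesgue. h R x * near_count \<Lambda> r x) / R\<^sup>2) \<longlongrightarrow> 0) at_top"
    by (rule average_shell[OF near_count_locally_integrable[OF \<Lambda>] per, where Ra = 1 and C = 1 and b = "2 * r + 2"])
       (use r in \<open>auto simp: h_def intro!: borel_measurable_indicator split: split_indicator\<close>)
  then have lim: "((\<lambda>R. (B / (pi * r\<^sup>2)) * ((LINT x|lebesgue. h R x * near_count \<Lambda> r x) / R\<^sup>2)) \<longlongrightarrow> (B / (pi * r\<^sup>2)) * 0) at_top"
    by (intro tendsto_mult tendsto_const)
  show ?thesis
  proof (rule Lim_null_comparison)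
    show "((\<lambda>R. (B / (pi * r\<^sup>2)) * ((LINT x|lebesgue. h R x * near_count \<Lambda> r x) / R\<^sup>2)) \<longlongrightarrow> 0) at_top" using lim by simp
    show "\<forall>\<^sub>F R in at_top. norm ((\<Sum>p\<in>\<Lambda> \<inter> cball 0 (R + r). \<rho> R p) / R\<^sup>2) \<le> (B / (pi * r\<^sup>2)) * ((LINT x|lebesgue. h R x * near_count \<Lambda> r x) / R\<^sup>2)"
      using eventually_ge_at_top[of 1]
    proof eventually_elim
      case (elim R)
      define F where "F = \<Lambda> \<inter> cball 0 (R + r)"
      define F' where "F' = {p\<in>F. norm p > R - 1 - r}"
      have fin: "finite F" using \<Lambda> by (auto simp: F_def locally_finite_set_def)
      have "F' \<subseteq> F" by (auto simp: F'_def)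
      have B: "B \<ge> 0" using \<rho>(1)[of 1 0] by simp
      have "\<bar>\<Sum>p\<in>F. \<rho> R p\<bar> = \<bar>\<Sum>p\<in>F'. \<rho> R p\<bar>"
        using \<rho>(2)[OF elim] fin by (intro arg_cong[where f = abs] sum.mono_neutral_right) (auto simp: F'_def not_less)
      also have "\<dots> \<le> (\<Sum>p\<in>F'. B)" by (rule order_trans[OF sum_abs sum_mono[OF \<rho>(1)[OF elim]]])
      also have "\<dots> = B * card F'" by simp
      finally have 1: "\<bar>\<Sum>p\<in>F. \<rho> R p\<bar> \<le> B * card F'" .
      have ind: "integrable lebesgue (indicat_real (cball p r))" for p :: "real^2"
        by (rule integrable_indicator_bounded) auto
      have "pi * r\<^sup>2 * card F' = (\<Sum>p\<in>F'. (LINT x|lebesgue. indicat_real (cball p r) x))"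
        by (simp only: integral_indicator_cball_plane[OF r] sum_constant) simp
      also have "\<dots> = (LINT x|lebesgue. (\<Sum>p\<in>F'. indicat_real (cball p r) x))"
        by (rule Bochner_Integration.integral_sum[symmetric]) (rule ind)
      also have "\<dots> \<le> (LINT x|lebesgue. h R x * near_count \<Lambda> r x)"
      proof (rule integral_mono)
        show "integrable lebesgue (\<lambda>x. \<Sum>p\<in>F'. indicat_real (cball p r) x)"
          by (intro Bochner_Integration.integrable_sum ind)
        show "integrable lebesgue (\<lambda>x. h R x * near_count \<Lambda> r x)"
          by (rule locally_integrable_bounded_mult[OF near_count_locally_integrable[OF \<Lambda>], of _ 1 "R + 2 * r"])
             (auto simp: h_def intro!: borel_measurable_indicator split: split_indicator)
        fix x :: "real^2"
        have "(\<Sum>p\<in>F'. indicat_real (cball p r) x) \<le> h R x * (\<Sum>p\<in>\<Lambda> \<inter> cball 0 ((R + 2 * r) + r). indicat_real (cball p r) x)"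
        proof (cases "\<exists>p\<in>F'. x \<in> cball p r")
          case True
          then obtain p where p: "p \<in> F'" "x \<in> cball p r" by blast
          then have "norm x \<le> R + 2 * r" "norm x \<ge> R - 1 - 2 * r"
            using norm_triangle_ineq2[of x p] norm_triangle_ineq2[of p x] by (auto simp: F'_def F_def dist_norm norm_minus_commute)
          then have "h R x = 1" by (simp add: h_def)
          moreover have "(\<Sum>p\<in>F'. indicat_real (cball p r) x) \<le> (\<Sum>p\<in>\<Lambda> \<inter> cball 0 ((R + 2 * r) + r). indicat_real (cball p r) x)"
            using \<Lambda> r by (intro sum_mono2) (auto simp: F'_def F_def locally_finite_set_def)
          ultimately show ?thesis by simp
        next
          case False
          then have "(\<Sum>p\<in>F'. indicat_real (cball p r) x) = 0" by (intro sum.neutral) auto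
          then show ?thesis by (simp add: h_def sum_nonneg)
        qed
        also have "\<dots> = h R x * near_count \<Lambda> r x"
        proof (cases "norm x \<le> R + 2 * r")
          case True
          then show ?thesis using near_count_eq[OF \<Lambda> True, of r] by simp
        next
          case False
          then show ?thesis by (simp add: h_def)
        qed
        finally show "(\<Sum>p\<in>F'. indicat_real (cball p r) x) \<le> h R x * near_count \<Lambda> r x" .
      qed
      finally have "pi * r\<^sup>2 * card F' \<le> (LINT x|lebesgue. h R x * near_count \<Lambda> r x)" .
      then have "B / (pi * r\<^sup>2) * (pi * r\<^sup>2 * card F') \<le> B / (pi * r\<^sup>2) * (LINT x|lebesgue. h R x * near_count \<Lambda> r x)"
        using B by (intro mult_left_mono) auto
      then have "\<bar>\<Sum>p\<in>F. \<rho> R p\<bar> \<le> B / (pi * r\<^sup>2) * (LINT x|lebesgue. h R x * near_count \<Lambda> r x)"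
        using 1 r by simp
      then have "\<bar>\<Sum>p\<in>F. \<rho> R p\<bar> / R\<^sup>2 \<le> B / (pi * r\<^sup>2) * (LINT x|lebesgue. h R x * near_count \<Lambda> r x) / R\<^sup>2"
        by (rule divide_right_mono) simp
      then show ?case unfolding F_def[symmetric] by simp
    qed
  qed
qed

text \<open>The upper limit is an actual limit, with the same value for every cutoff family. The sum
  over points left by \<open>W_cutoff_eq\<close> is replaced by an integral against
  \<open>near_count\<close>, to which \<open>average_cutoff\<close> applies, at the price of local
  errors.\<close>

theorem W_eq:
  fixes j :: "real^2 \<Rightarrow> real^2"
  assumes \<Lambda>: "locally_finite_set \<Lambda>" and r: "r > 0" and g: "locally_integrable g" "torus_periodic u v g"
    and per: "torus_periodic u v (near_count \<Lambda> r)"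
    and j: "AE x in lebesgue. (norm (j x))\<^sup>2 = g x + sing_part \<Lambda> r x" and jm: "j \<in> borel_measurable lebesgue"
    and \<psi>: "cutoff_family \<psi>"
  shows "W \<psi> \<Lambda> j = ereal (mean g / 2 + ln r / r\<^sup>2 * mean (near_count \<Lambda> r))"
proof -
  obtain C where C: "\<And>R. R \<ge> 1 \<Longrightarrow> C-lipschitz_on UNIV (\<psi> R)" "\<And>R x. R \<ge> 1 \<Longrightarrow> norm x \<ge> R \<Longrightarrow> \<psi> R x = 0"
    "\<And>R x. R \<ge> 1 \<Longrightarrow> norm x \<le> R - 1 \<Longrightarrow> \<psi> R x = 1" "\<And>R x. R \<ge> 1 \<Longrightarrow> \<bar>\<psi> R x\<bar> \<le> C + 1" "C \<ge> 0"
    using cutoff_familyD[OF \<psi>] by metis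
  have \<psi>m: "\<psi> R \<in> borel_measurable lebesgue" if "R \<ge> 1" for R
    by (intro measurable_completion) (use borel_measurable_continuous_onI[OF lipschitz_on_continuous_on[OF C(1)[OF that]]] in simp)
  have avg: "((\<lambda>R. (LINT x|lebesgue. \<psi> R x * f x) / R\<^sup>2) \<longlongrightarrow> pi * mean f) at_top"
    if "locally_integrable f" "torus_periodic u v f" for f
    by (rule average_cutoff[OF that, where Ra = 1 and C = "C + 1"]) (use \<psi>m C in auto)
  define N where "N = near_count \<Lambda> r"
  have N: "locally_integrable N" "torus_periodic u v N"
    unfolding N_def using near_count_locally_integrable[OF \<Lambda>] per by auto
  define I1 where "I1 R p = (LINT x|lebesgue. (\<psi> R x - \<psi> R p) * inv_sq r p x)" for R p
  define I2 where "I2 R p = (LINT x|lebesgue. (\<psi> R x - \<psi> R p) * indicator (cball p r) x)" for R p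
  \<comment> \<open>The local error at a point: the tamed inverse square minus the correction from
    replacing the sum by an integral. It vanishes when the cutoff is constant on the disc around the
    point, hence away from the boundary.\<close>
  define \<rho> where "\<rho> R p = 1/2 * I1 R p - ln r / r\<^sup>2 * I2 R p" for R p
  have indi: "integrable lebesgue (indicat_real (cball p r))" for p :: "real^2"
    by (rule integrable_indicator_bounded) auto
  have vol: "(LINT x|lebesgue. indicat_real (cball p r) x) = pi * r\<^sup>2" for p :: "real^2"
    by (rule integral_indicator_cball_plane[OF r])
  have I2i: "integrable lebesgue (\<lambda>x. (\<psi> R x - \<psi> R p) * indicator (cball p r) x)" 
    and I2b: "\<bar>(\<psi> R x - \<psi> R p) * indicator (cball p r) x\<bar> \<le> (2 * (C + 1)) * indicator (cball p r) x"
    if "R \<ge> 1" for R p x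
  proof -
    show b: "\<bar>(\<psi> R x - \<psi> R p) * indicator (cball p r) x\<bar> \<le> (2 * (C + 1)) * indicator (cball p r) x" for x
      using C(4)[OF that, of x] C(4)[OF that, of p] by (auto simp: abs_mult indicator_def)
    show "integrable lebesgue (\<lambda>x. (\<psi> R x - \<psi> R p) * indicator (cball p r) x)"
    proof (rule Bochner_Integration.integrable_bound)
      show "integrable lebesgue (\<lambda>x. (2 * (C + 1)) * indicat_real (cball p r) x)" by (intro integrable_mult_right indi)
      show "(\<lambda>x. (\<psi> R x - \<psi> R p) * indicator (cball p r) x) \<in> borel_measurable lebesgue"
        using \<psi>m[OF that] by (intro borel_measurable_times borel_measurable_diff borel_measurable_indicator) auto
      show "AE x in lebesgue. norm ((\<psi> R x - \<psi> R p) * indicator (cball p r) x) \<le> norm ((2 * (C + 1)) * indicat_real (cball p r) x)"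
        using b unfolding real_norm_def by (intro AE_I2) (rule order_trans[OF b abs_ge_self])
    qed
  qed
  \<comment> \<open>By translation invariance the bound from the Lipschitz estimate is the same at
    every point; this is its value for the point 0.\<close>
  define B1 where "B1 = (LINT x|lebesgue. C * (indicator (cball 0 r) x *\<^sub>R (1 / norm (x::real^2))))"
  have I1b: "\<bar>I1 R p\<bar> \<le> B1" if "R \<ge> 1" for R p
  proof -
    have "\<bar>I1 R p\<bar> \<le> (LINT x|lebesgue. C * (indicator (cball p r) x *\<^sub>R (1 / norm (x - p))))"
      unfolding I1_def by (rule lipschitz_inv_sq(4)[OF C(1)[OF that] r])
    also have "\<dots> = (LINT x|lebesgue. C * (indicator (cball p r) (x + p) *\<^sub>R (1 / norm (x + p - p))))"
      by (rule integral_shift[symmetric])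
    also have "\<dots> = B1" unfolding B1_def
      by (intro Bochner_Integration.integral_cong) (auto simp: indicator_def dist_norm)
    finally show ?thesis .
  qed
  have I2b': "\<bar>I2 R p\<bar> \<le> 2 * (C + 1) * (pi * r\<^sup>2)" if "R \<ge> 1" for R p
  proof -
    have "\<bar>I2 R p\<bar> \<le> (LINT x|lebesgue. \<bar>(\<psi> R x - \<psi> R p) * indicator (cball p r) x\<bar>)"
      unfolding I2_def by (rule integral_abs_bound)
    also have "\<dots> \<le> (LINT x|lebesgue. (2 * (C + 1)) * indicator (cball p r) x)"
      by (intro integral_mono integrable_abs I2i[OF that] I2b[OF that] integrable_mult_right indi)
    also have "\<dots> = 2 * (C + 1) * (pi * r\<^sup>2)" using vol[of p] by simp
    finally show ?thesis .
  qed
  have \<rho>b: "\<bar>\<rho> R p\<bar> \<le> 1/2 * B1 + \<bar>ln r / r\<^sup>2\<bar> * (2 * (C + 1) * (pi * r\<^sup>2))" if "R \<ge> 1" for R p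
  proof -
    have "\<bar>\<rho> R p\<bar> \<le> 1/2 * \<bar>I1 R p\<bar> + \<bar>ln r / r\<^sup>2\<bar> * \<bar>I2 R p\<bar>"
      unfolding \<rho>_def using abs_triangle_ineq4[of "1/2 * I1 R p" "ln r / r\<^sup>2 * I2 R p"] by (simp add: abs_mult)
    also have "\<dots> \<le> 1/2 * B1 + \<bar>ln r / r\<^sup>2\<bar> * (2 * (C + 1) * (pi * r\<^sup>2))"
      by (intro add_mono mult_left_mono I1b I2b' that) auto
    finally show ?thesis .
  qed
  have \<rho>0: "\<rho> R p = 0" if R: "R \<ge> 1" and p: "norm p \<le> R - 1 - r" for R p
  proof -
    have "\<psi> R x - \<psi> R p = 0" if "x \<in> cball p r" for x
    proof -
      have "norm x \<le> R - 1" using that p norm_triangle_ineq2[of x p] by (simp add: dist_norm norm_minus_commute)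
      moreover have "norm p \<le> R - 1" using p r by linarith
      ultimately show ?thesis using C(3)[OF R] by simp
    qed
    then have "(\<psi> R x - \<psi> R p) * inv_sq r p x = 0" "(\<psi> R x - \<psi> R p) * indicator (cball p r) x = 0" for x
      by (auto simp: inv_sq_def indicator_def)
    then show ?thesis unfolding \<rho>_def I1_def I2_def by (simp only: Bochner_Integration.integral_zero mult_zero_right diff_self)
  qed
  have NI: "(LINT x|lebesgue. \<psi> R x * N x) = (\<Sum>p\<in>\<Lambda> \<inter> cball 0 (R + r). \<psi> R p * (pi * r\<^sup>2) + I2 R p)" if R: "R \<ge> 1" for R
  proof -
    have "(LINT x|lebesgue. \<psi> R x * N x) = (LINT x|lebesgue. (\<Sum>p\<in>\<Lambda> \<inter> cball 0 (R + r). \<psi> R p * indicator (cball p r) x + (\<psi> R x - \<psi> R p) * indicator (cball p r) x))"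
    proof (intro Bochner_Integration.integral_cong refl)
      fix x :: "real^2"
      have s: "(\<Sum>p\<in>\<Lambda> \<inter> cball 0 (R + r). \<psi> R p * indicator (cball p r) x + (\<psi> R x - \<psi> R p) * indicator (cball p r) x)
         = \<psi> R x * (\<Sum>p\<in>\<Lambda> \<inter> cball 0 (R + r). indicator (cball p r) x)"
        unfolding sum_distrib_left by (intro sum.cong) (auto simp: algebra_simps)
      show "\<psi> R x * N x = (\<Sum>p\<in>\<Lambda> \<inter> cball 0 (R + r). \<psi> R p * indicator (cball p r) x + (\<psi> R x - \<psi> R p) * indicator (cball p r) x)"
        unfolding s N_def using near_count_eq[OF \<Lambda>, of x R r] C(2)[OF R, of x] by (cases "norm x \<le> R") auto
    qed
    also have "\<dots> = (\<Sum>p\<in>\<Lambda> \<inter> cball 0 (R + r). (LINT x|lebesgue. \<psi> R p * indicator (cball p r) x) + I2 R p)"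
    proof -
      have a: "integrable lebesgue (\<lambda>x. \<psi> R p * indicator (cball p r) x)" for p by (intro integrable_mult_right indi)
      have "(LINT x|lebesgue. (\<Sum>p\<in>\<Lambda> \<inter> cball 0 (R + r). \<psi> R p * indicator (cball p r) x + (\<psi> R x - \<psi> R p) * indicator (cball p r) x))
        = (\<Sum>p\<in>\<Lambda> \<inter> cball 0 (R + r). (LINT x|lebesgue. \<psi> R p * indicator (cball p r) x + (\<psi> R x - \<psi> R p) * indicator (cball p r) x))"
        by (intro Bochner_Integration.integral_sum Bochner_Integration.integrable_add a I2i R)
      then show ?thesis unfolding I2_def Bochner_Integration.integral_add[OF a I2i[OF R]] .
    qed
    also have "\<dots> = (\<Sum>p\<in>\<Lambda> \<inter> cball 0 (R + r). \<psi> R p * (pi * r\<^sup>2) + I2 R p)"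
      using vol by simp
    finally show ?thesis .
  qed
  have eq: "W_cutoff \<Lambda> j (\<psi> R) = 1/2 * (LINT x|lebesgue. \<psi> R x * g x) + ln r / r\<^sup>2 * (LINT x|lebesgue. \<psi> R x * N x) + (\<Sum>p\<in>\<Lambda> \<inter> cball 0 (R + r). \<rho> R p)"
    if R: "R \<ge> 1" for R
  proof -
    have "pi * ln r * \<psi> R p + 1/2 * I1 R p = ln r / r\<^sup>2 * (\<psi> R p * (pi * r\<^sup>2) + I2 R p) + \<rho> R p" for p
      using r by (simp add: \<rho>_def field_simps)
    then have "(\<Sum>p\<in>\<Lambda> \<inter> cball 0 (R + r). pi * ln r * \<psi> R p + 1/2 * I1 R p) = ln r / r\<^sup>2 * (LINT x|lebesgue. \<psi> R x * N x) + (\<Sum>p\<in>\<Lambda> \<inter> cball 0 (R + r). \<rho> R p)"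
      unfolding NI[OF R] by (simp only: sum.distrib sum_distrib_left distrib_left)
    then show ?thesis
      using W_cutoff_eq[OF \<Lambda> r g(1) j jm C(1)[OF R] C(2)[OF R]] unfolding I1_def by simp
  qed
  have "((\<lambda>R. (1/2 * ((LINT x|lebesgue. \<psi> R x * g x) / R\<^sup>2) + ln r / r\<^sup>2 * ((LINT x|lebesgue. \<psi> R x * N x) / R\<^sup>2) + (\<Sum>p\<in>\<Lambda> \<inter> cball 0 (R + r). \<rho> R p) / R\<^sup>2) / pi)
    \<longlongrightarrow> (1/2 * (pi * mean g) + ln r / r\<^sup>2 * (pi * mean N) + 0) / pi) at_top"
    by (intro tendsto_divide tendsto_add tendsto_mult tendsto_const avg g N sum_over_points_shell[OF \<Lambda> r per \<rho>b \<rho>0]) auto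
  then have "((\<lambda>R. W_cutoff \<Lambda> j (\<psi> R) / measure lebesgue (ball (0::real^2) R)) \<longlongrightarrow> mean g / 2 + ln r / r\<^sup>2 * mean N) at_top"
  proof (rule Lim_transform_eventually[OF tendsto_eq_rhs])
    show "(1/2 * (pi * mean g) + ln r / r\<^sup>2 * (pi * mean N) + 0) / pi = mean g / 2 + ln r / r\<^sup>2 * mean N"
      by (simp add: add_divide_distrib)
    show "\<forall>\<^sub>F R in at_top. (1/2 * ((LINT x|lebesgue. \<psi> R x * g x) / R\<^sup>2) + ln r / r\<^sup>2 * ((LINT x|lebesgue. \<psi> R x * N x) / R\<^sup>2) + (\<Sum>p\<in>\<Lambda> \<inter> cball 0 (R + r). \<rho> R p) / R\<^sup>2) / pi
      = W_cutoff \<Lambda> j (\<psi> R) / measure lebesgue (ball (0::real^2) R)"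
      using eventually_ge_at_top[of 1]
    proof eventually_elim
      case (elim R)
      show ?case unfolding eq[OF elim] measure_ball_plane[of R, OF order_trans[OF zero_le_one elim]]
        by (simp add: add_divide_distrib mult.commute[of pi])
    qed
  qed
  then have "((\<lambda>R. ereal (W_cutoff \<Lambda> j (\<psi> R) / measure lebesgue (ball (0::real^2) R))) \<longlongrightarrow> ereal (mean g / 2 + ln r / r\<^sup>2 * mean N)) at_top"
    by (rule tendsto_ereal)
  then show ?thesis unfolding W_def N_def by (intro lim_imp_Limsup) auto
qed

end

section \<open>Uniqueness of the Green function and of periodic fields\<close>

lemma C1c_partial: "test_function \<phi> \<Longrightarrow> C1c R \<phi> \<Longrightarrow> C1c R (partial i \<phi>)"
proof -
  assume t: "test_function \<phi>" and c: "C1c R \<phi>"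
  have "times_cont_differentiable (Suc 0) (partial i \<phi>)"
    using test_function_partial[OF t, of i] unfolding test_function_def by blast
  then show "C1c R (partial i \<phi>)" using C1cD(5)[OF c] by (auto simp: C1c_def)
qed

lemma locally_integrable_mult_compact:
  fixes f \<phi> :: "real^2 \<Rightarrow> real"
  assumes f: "locally_integrable f" and \<phi>: "continuous_on UNIV \<phi>" "\<And>x. norm x > R \<Longrightarrow> \<phi> x = 0"
  shows "integrable lebesgue (\<lambda>x. f x * \<phi> x)"
proof -
  obtain C where C: "C > 0" "\<And>x. norm (\<phi> x) \<le> C" using continuous_compact_support_bounded[OF \<phi>] by metis
  have "integrable lebesgue (\<lambda>x. \<phi> x * f x)"
    by (rule locally_integrable_bounded_mult[OF f, of _ C R])
       (use C \<phi>(2) borel_measurable_continuous_onI[OF \<phi>(1)] in \<open>auto intro!: measurable_completion\<close>)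
  then show ?thesis by (simp add: mult.commute)
qed

lemma locally_integrable_mult_test:
  fixes f :: "real^2 \<Rightarrow> real"
  assumes f: "locally_integrable f" and \<phi>: "test_function \<phi>"
  shows "integrable lebesgue (\<lambda>x. f x * \<phi> x)" "integrable lebesgue (\<lambda>x. f x * partial i \<phi> x)"
    "integrable lebesgue (\<lambda>x. f x * partial i (partial k \<phi>) x)"
proof -
  have *: "integrable lebesgue (\<lambda>x. f x * \<phi> x)" if t: "test_function \<phi>" for \<phi>
  proof -
    obtain R where R: "C1c R \<phi>" using test_function_C1c[OF t] by blast
    show ?thesis by (rule locally_integrable_mult_compact[OF f C1cD(2)[OF R] C1cD(4)[OF R]])
  qed
  show "integrable lebesgue (\<lambda>x. f x * \<phi> x)" "integrable lebesgue (\<lambda>x. f x * partial i \<phi> x)"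
    "integrable lebesgue (\<lambda>x. f x * partial i (partial k \<phi>) x)"
    by (intro * test_function_partial \<phi>)+
qed

lemma integral_partial_eq_0:
  assumes "C1c R \<phi>"
  shows "(LINT x|lebesgue. partial i \<phi> x) = 0"
  using integral_by_parts(3)[OF assms, of "R + 1" "\<lambda>x. 1::real" "\<lambda>x h. 0" i] by simp

lemma distr_laplacian_diff:
  assumes "locally_integrable f" "locally_integrable g" "test_function \<phi>"
  shows "distr_laplacian (\<lambda>x. f x - g x) \<phi> = distr_laplacian f \<phi> - distr_laplacian g \<phi>"
  using locally_integrable_mult_test(3)[OF assms(1,3)] locally_integrable_mult_test(3)[OF assms(2,3)]
  unfolding distr_laplacian_def distrib_left left_diff_distrib by simp

lemma locally_integrable_nth:
  "locally_integrable (j :: real^2 \<Rightarrow> real^2) \<Longrightarrow> locally_integrable (\<lambda>x. j x $ i)"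
  using locally_integrable_inner[of j "axis i 1"] by (simp add: inner_axis' )

lemma solves_curl_div_diff:
  assumes "solves_curl_div \<Lambda> m j" "solves_curl_div \<Lambda> m j'" and \<phi>: "test_function \<phi>"
  shows "(LINT x|lebesgue. (j' x - j x) $ 1 * partial 2 \<phi> x - (j' x - j x) $ 2 * partial 1 \<phi> x) = 0"
    "(LINT x|lebesgue. (j' x - j x) $ 1 * partial 1 \<phi> x + (j' x - j x) $ 2 * partial 2 \<phi> x) = 0"
proof -
  have jl: "locally_integrable j" "locally_integrable j'" using assms by (auto simp: solves_curl_div_def)
  have i: "integrable lebesgue (\<lambda>x. j x $ k * partial l \<phi> x)" "integrable lebesgue (\<lambda>x. j' x $ k * partial l \<phi> x)" for k l
    by (rule locally_integrable_mult_test(2)[OF locally_integrable_nth[OF jl(1)] \<phi>],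
        rule locally_integrable_mult_test(2)[OF locally_integrable_nth[OF jl(2)] \<phi>])
  have "distr_curl j' \<phi> - distr_curl j \<phi> = 0" "distr_div j' \<phi> - distr_div j \<phi> = 0"
    using assms by (auto simp: solves_curl_div_def)
  then show "(LINT x|lebesgue. (j' x - j x) $ 1 * partial 2 \<phi> x - (j' x - j x) $ 2 * partial 1 \<phi> x) = 0"
    "(LINT x|lebesgue. (j' x - j x) $ 1 * partial 1 \<phi> x + (j' x - j x) $ 2 * partial 2 \<phi> x) = 0"
    using i unfolding distr_curl_def distr_div_def vector_minus_component left_diff_distrib by simp_all
qed

context plane_lattice begin

lemma set_integrable_T: "locally_integrable f \<Longrightarrow> set_integrable lebesgue T f"
  by (rule locally_integrable_bounded[OF _ bounded_T sets_T_lebesgue])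

lemma mean_add: "locally_integrable f \<Longrightarrow> locally_integrable g \<Longrightarrow> mean (\<lambda>x. f x + g x) = mean f + mean g"
  unfolding mean_def by (simp add: set_integral_add(2)[OF set_integrable_T set_integrable_T] add_divide_distrib)

lemma mean_diff: "locally_integrable f \<Longrightarrow> locally_integrable g \<Longrightarrow> mean (\<lambda>x. f x - g x) = mean f - mean g"
  unfolding mean_def by (simp add: set_integral_diff(2)[OF set_integrable_T set_integrable_T] diff_divide_distrib)

lemma mean_const: "mean (\<lambda>x. c) = c"
  using volume by (simp add: mean_def set_lebesgue_integral_def)

lemma mean_cmult: "mean (\<lambda>x. c * f x) = c * mean f"
  unfolding mean_def by simp

lemma mean_sum:
  "finite I \<Longrightarrow> (\<And>i. i \<in> I \<Longrightarrow> locally_integrable (f i)) \<Longrightarrow> mean (\<lambda>x. \<Sum>i\<in>I. f i x) = (\<Sum>i\<in>I. mean (f i))"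
  by (induction I rule: finite_induct) (auto simp: mean_const mean_add locally_integrable_sum)

lemma mean_AE_cong:
  assumes "locally_integrable f" "locally_integrable g" "AE x in lebesgue. f x = g x"
  shows "mean f = mean g"
proof -
  have "(LINT x:T|lebesgue. f x) = (LINT x:T|lebesgue. g x)"
    unfolding set_lebesgue_integral_def
  proof (rule integral_cong_AE)
    show "(\<lambda>x. indicat_real T x *\<^sub>R f x) \<in> borel_measurable lebesgue" "(\<lambda>x. indicat_real T x *\<^sub>R g x) \<in> borel_measurable lebesgue"
      using set_integrable_T[OF assms(1)] set_integrable_T[OF assms(2)] unfolding set_integrable_def by auto
    show "AE x in lebesgue. indicat_real T x *\<^sub>R f x = indicat_real T x *\<^sub>R g x"
      using assms(3) by eventually_elim simp
  qed
  then show ?thesis by (simp add: mean_def)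
qed

lemma torus_mean_zero_real: "torus_mean_zero u v (f :: real^2 \<Rightarrow> real) \<longleftrightarrow> mean f = 0"
  by (simp add: torus_mean_zero_def mean_def)

lemma torus_mean_zero_vec:
  fixes j :: "real^2 \<Rightarrow> real^2"
  assumes "locally_integrable j"
  shows "torus_mean_zero u v j \<longleftrightarrow> (\<forall>c. mean (\<lambda>x. c \<bullet> j x) = 0)"
proof -
  have i: "integrable lebesgue (\<lambda>x. indicat_real T x *\<^sub>R j x)"
    using set_integrable_T[OF assms] by (simp add: set_integrable_def)
  have "mean (\<lambda>x. c \<bullet> j x) = (c \<bullet> (LINT x:T|lebesgue. j x)) / (2 * pi)" for c
  proof -
    have "(LINT x|lebesgue. c \<bullet> (indicat_real T x *\<^sub>R j x)) = c \<bullet> (LINT x|lebesgue. indicat_real T x *\<^sub>R j x)"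
      by (rule integral_inner_right) (use i in simp)
    then show ?thesis by (simp add: mean_def set_lebesgue_integral_def)
  qed
  then have "(\<forall>c. mean (\<lambda>x. c \<bullet> j x) = 0) \<longleftrightarrow> (\<forall>c. c \<bullet> (LINT x:T|lebesgue. j x) = 0)" by simp
  also have "\<dots> \<longleftrightarrow> (LINT x:T|lebesgue. j x) = 0" by (auto dest: spec[of _ "LINT x:T|lebesgue. j x"])
  finally show ?thesis unfolding torus_mean_zero_def by simp
qed

text \<open>The Laplacian of each component is a combination of first derivatives of the divergence
  and the curl. Weakly this means testing the two equations with first partials of a bump, whose
  mixed second partials are symmetric by the explicit formula.\<close>

lemma periodic_curl_div_free_diff_const:
  assumes j: "solves_curl_div \<Lambda> m j" "torus_periodic u v j" and j': "solves_curl_div \<Lambda> m j'" "torus_periodic u v j'"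
  shows "\<exists>c. AE x in lebesgue. j' x = j x + c"
proof -
  define d where "d x = j' x - j x" for x
  have d: "locally_integrable d" "torus_periodic u v d"
    unfolding d_def[abs_def] using j j' by (auto simp: solves_curl_div_def intro: locally_integrable_diff torus_periodic_comp2)
  have di: "locally_integrable (\<lambda>x. d x $ i)" "torus_periodic u v (\<lambda>x. d x $ i)" for i
    by (rule locally_integrable_nth[OF d(1)], rule torus_periodic_comp[OF d(2)])
  have sym: "partial 1 (partial 2 (test_bump 1 t y)) x = partial 2 (partial 1 (test_bump 1 t y)) x" for t y x
    unfolding partial_partial_test_bump by (simp add: mult_ac)
  have tb: "test_function (partial i (test_bump 1 t y))" if "t > 0" for t y i
    by (intro test_function_partial test_function_bump that)
  note curl = solves_curl_div_diff(1)[OF j(1) j'(1), folded d_def]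
  note div = solves_curl_div_diff(2)[OF j(1) j'(1), folded d_def]
  have int: "integrable lebesgue (\<lambda>x. d x $ i * partial k (partial l (test_bump 1 t y)) x)" if "t > 0" for t y i k l
    by (rule locally_integrable_mult_test(2)[OF di(1) tb[OF that]])
  have "\<exists>c. AE x in lebesgue. d x $ 1 = c"
  proof (rule periodic_weakly_harmonic_const[OF di])
    fix t :: real and y assume t: "t > 0"
    show "distr_laplacian (\<lambda>x. d x $ 1) (test_bump 1 t y) = 0"
      using curl[OF tb[OF t, of 2 y]] div[OF tb[OF t, of 1 y]] int[OF t, of _ _ _ y] sym[of t y]
      unfolding distr_laplacian_def distrib_left by simp
  qed
  moreover have "\<exists>c. AE x in lebesgue. d x $ 2 = c"
  proof (rule periodic_weakly_harmonic_const[OF di])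
    fix t :: real and y assume t: "t > 0"
    show "distr_laplacian (\<lambda>x. d x $ 2) (test_bump 1 t y) = 0"
      using curl[OF tb[OF t, of 1 y]] div[OF tb[OF t, of 2 y]] int[OF t, of _ _ _ y] sym[of t y]
      unfolding distr_laplacian_def distrib_left by simp
  qed
  ultimately obtain c1 c2 where "AE x in lebesgue. d x $ 1 = c1" "AE x in lebesgue. d x $ 2 = c2" by blast
  then have "AE x in lebesgue. j' x = j x + vector [c1, c2]"
    by eventually_elim (auto simp: d_def vec_eq_iff forall_2)
  then show ?thesis by blast
qed

end

context quasiperiodic begin

section \<open>The Green function obtained from the potential\<close>

definition "green x = pot x - mean pot"

lemma green_locally_integrable: "locally_integrable green"
  unfolding green_def[abs_def] by (intro locally_integrable_diff pot_locally_integrable locally_integrable_const)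

text \<open>The two derivatives are moved one at a time: \<open>pot_by_parts\<close>, applied to
  first partials of the test function, reduces the Laplacian to the first-order equation
  \<open>dbar_fld\<close>.\<close>

lemma torus_green_green: "torus_green u v green"
  unfolding torus_green_def
proof (intro conjI allI impI)
  show "locally_integrable green" by (rule green_locally_integrable)
  show "continuous_on (- L) green" unfolding green_def[abs_def] by (intro continuous_intros pot_continuous)
  show "torus_periodic u v green" unfolding green_def[abs_def] by (rule torus_periodic_comp[OF torus_periodic_pot])
  show "torus_mean_zero u v green"
    unfolding torus_mean_zero_real green_def[abs_def]
    by (simp add: mean_diff[OF pot_locally_integrable locally_integrable_const] mean_const)
  fix \<phi> assume \<phi>: "test_function \<phi>"
  obtain R where R: "C1c R \<phi>" using test_function_C1c[OF \<phi>] by blast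
  have R': "C1c R (partial i \<phi>)" for i by (rule C1c_partial[OF \<phi> R])
  note gi = locally_integrable_mult_test(3)[OF green_locally_integrable \<phi>]
  have s: "(LINT x|lebesgue. green x * partial i (partial i \<phi>) x) = - (LINT x|lebesgue. partial i \<phi> x * Re (fld x * to_complex (axis i 1)))" for i
  proof -
    have pi: "integrable lebesgue (\<lambda>x. partial i (partial i \<phi>) x * pot x)"
      using locally_integrable_mult_test(3)[OF pot_locally_integrable \<phi>, of i i] by (simp add: mult.commute)
    have ci: "integrable lebesgue (\<lambda>x. partial i (partial i \<phi>) x * mean pot)"
      using locally_integrable_mult_test(3)[OF locally_integrable_const[of "mean pot"] \<phi>, of i i] by (simp add: mult.commute)
    have "(LINT x|lebesgue. green x * partial i (partial i \<phi>) x) = (LINT x|lebesgue. partial i (partial i \<phi>) x * pot x - partial i (partial i \<phi>) x * mean pot)"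
      by (simp add: green_def algebra_simps)
    also have "\<dots> = (LINT x|lebesgue. partial i (partial i \<phi>) x * pot x) - (LINT x|lebesgue. partial i (partial i \<phi>) x * mean pot)"
      by (rule Bochner_Integration.integral_diff[OF pi ci])
    also have "(LINT x|lebesgue. partial i (partial i \<phi>) x * mean pot) = 0"
      using integral_partial_eq_0[OF R', of i i] by simp
    finally show ?thesis using pot_by_parts[OF R', of i i] by simp
  qed
  have fi: "integrable lebesgue (\<lambda>x. partial i \<phi> x * Re (fld x * to_complex (axis k 1)))" for i k
  proof -
    have "locally_integrable (\<lambda>x. cnj (to_complex (axis k 1)) \<bullet> fld x)"
      by (rule locally_integrable_inner[OF fld_locally_integrable])
    moreover have "cnj (to_complex (axis k 1)) \<bullet> z = Re (z * to_complex (axis k 1))" for z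
      by (simp add: inner_complex_def algebra_simps)
    ultimately have "locally_integrable (\<lambda>x. Re (fld x * to_complex (axis k 1)))" by simp
    from locally_integrable_mult_test(2)[OF this \<phi>, of i] show ?thesis by (simp only: mult.commute)
  qed
  have "distr_laplacian green \<phi> = (LINT x|lebesgue. green x * partial 1 (partial 1 \<phi>) x) + (LINT x|lebesgue. green x * partial 2 (partial 2 \<phi>) x)"
    unfolding distr_laplacian_def distrib_left by (rule Bochner_Integration.integral_add[OF gi gi])
  also have "\<dots> = - ((LINT x|lebesgue. partial 1 \<phi> x * Re (fld x * to_complex (axis 1 1))) + (LINT x|lebesgue. partial 2 \<phi> x * Re (fld x * to_complex (axis 2 1))))"
    unfolding s by simp
  also have "(LINT x|lebesgue. partial 1 \<phi> x * Re (fld x * to_complex (axis 1 1))) + (LINT x|lebesgue. partial 2 \<phi> x * Re (fld x * to_complex (axis 2 1)))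
    = (LINT x|lebesgue. Re (dbar \<phi> x * fld x))"
    unfolding Bochner_Integration.integral_add[OF fi fi, symmetric] Re_dbar_mult by simp
  also have "\<dots> = Re (LINT x|lebesgue. dbar \<phi> x * fld x)"
    by (rule integral_Re[OF dbar_fld(1)[OF R]])
  also have "\<dots> = point_charges L 1 \<phi>"
    unfolding dbar_fld(2)[OF R] point_charges_def by simp
  finally show "- distr_laplacian green \<phi> = point_charges L 1 \<phi>" by simp
qed

text \<open>The difference is weakly harmonic and periodic, hence constant almost everywhere, and
  the constant is 0 by the mean.\<close>

lemma torus_green_unique:
  assumes G: "torus_green u v G" and x: "x \<notin> L"
  shows "G x = green x"
proof -
  have Gd: "locally_integrable G" "continuous_on (- L) G" "torus_periodic u v G" "mean G = 0"
    and Gl: "\<And>\<phi>. test_function \<phi> \<Longrightarrow> - distr_laplacian G \<phi> = point_charges L 1 \<phi>"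
    using G by (auto simp: torus_green_def torus_mean_zero_real)
  have gd: "continuous_on (- L) green" "torus_periodic u v green" "mean green = 0"
    and gl: "\<And>\<phi>. test_function \<phi> \<Longrightarrow> - distr_laplacian green \<phi> = point_charges L 1 \<phi>"
    using torus_green_green by (auto simp: torus_green_def torus_mean_zero_real)
  have l: "locally_integrable (\<lambda>x. G x - green x)" by (intro locally_integrable_diff Gd green_locally_integrable)
  have "\<exists>c. AE x in lebesgue. G x - green x = c"
  proof (rule periodic_weakly_harmonic_const[OF l])
    show "torus_periodic u v (\<lambda>x. G x - green x)" by (rule torus_periodic_comp2[OF Gd(3) gd(2)])
    fix t :: real and y assume "t > 0"
    then have t: "test_function (test_bump 1 t y)" by (rule test_function_bump)
    show "distr_laplacian (\<lambda>x. G x - green x) (test_bump 1 t y) = 0"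
      unfolding distr_laplacian_diff[OF Gd(1) green_locally_integrable t] using Gl[OF t] gl[OF t] by simp
  qed
  then obtain c where c: "AE x in lebesgue. G x - green x = c" by blast
  have "mean (\<lambda>x. G x - green x) = mean (\<lambda>x. c)" by (rule mean_AE_cong[OF l locally_integrable_const c])
  then have "c = 0" using mean_diff[OF Gd(1) green_locally_integrable] Gd(4) gd(3) by (simp add: mean_const)
  \<comment> \<open>The step from almost every point to every point off the lattice: by continuity
    the set of disagreement is open, and an open null set is empty.\<close>
  define S where "S = {x \<in> - L. G x - green x \<noteq> 0}"
  have "AE x in lebesgue. x \<notin> S" using c by eventually_elim (simp add: S_def \<open>c = 0\<close>)
  moreover have "open S"
  proof -
    have "open ((\<lambda>x. G x - green x) -` (- {0}) \<inter> - L)"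
      by (rule continuous_on_open_vimage[THEN iffD1, rule_format, OF open_compl_L])
         (auto intro!: continuous_intros Gd gd)
    moreover have "(\<lambda>x. G x - green x) -` (- {0}) \<inter> - L = S" by (auto simp: S_def)
    ultimately show ?thesis by simp
  qed
  ultimately have "S = {}"
    using open_not_negligible[of S] by (auto simp: negligible_iff_null_sets AE_iff_null_sets)
  then show ?thesis using x by (auto simp: S_def)
qed

text \<open>A weak gradient of a periodic function has mean zero: integrated against a large cutoff,
  the derivative moves to the cutoff and leaves only a shell term.\<close>

lemma mean_fld: "mean (\<lambda>x. Re (fld x * to_complex (axis i 1))) = 0"
proof -
  have eq: "cnj (to_complex (axis i 1)) \<bullet> z = Re (z * to_complex (axis i 1))" for z
    by (simp add: inner_complex_def algebra_simps)
  have l: "locally_integrable (\<lambda>x. Re (fld x * to_complex (axis i 1)))"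
    using locally_integrable_inner[OF fld_locally_integrable, of "cnj (to_complex (axis i 1))"] unfolding eq .
  have p: "torus_periodic u v (\<lambda>x. Re (fld x * to_complex (axis i 1)))"
    by (rule torus_periodic_comp[OF torus_periodic_fld])
  have cm: "cutoff R \<in> borel_measurable lebesgue" if "R \<ge> 1" for R
    by (intro measurable_completion) (use borel_measurable_continuous_onI[OF C1cD(2)[OF cutoff_C1c[OF that]]] in simp)
  have 1: "((\<lambda>R. (LINT x|lebesgue. cutoff R x * Re (fld x * to_complex (axis i 1))) / R\<^sup>2) \<longlongrightarrow> pi * mean (\<lambda>x. Re (fld x * to_complex (axis i 1)))) at_top"
    by (rule average_cutoff[OF l p, where Ra = 1 and C = 1]) (auto intro: cm cutoff_bounds cutoff_0 cutoff_1)
  obtain C where C: "C > 0" "\<And>R x i. R \<ge> 1 \<Longrightarrow> \<bar>partial i (cutoff R) x\<bar> \<le> C"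
    using partial_cutoff_bounded by blast
  have m: "partial i (cutoff R) \<in> borel_measurable lebesgue" if "R \<ge> 1" for R
    by (intro measurable_completion) (use borel_measurable_continuous_onI[OF C1cD(3)[OF cutoff_C1c[OF that]]] in simp)
  have "((\<lambda>R. (LINT x|lebesgue. partial i (cutoff R) x * pot x) / R\<^sup>2) \<longlongrightarrow> 0) at_top"
    by (rule average_shell[OF pot_locally_integrable torus_periodic_pot, where Ra = 1 and C = C and b = 1])
       (use m C partial_cutoff_shell in auto)
  then have "((\<lambda>R. - ((LINT x|lebesgue. partial i (cutoff R) x * pot x) / R\<^sup>2)) \<longlongrightarrow> - 0) at_top"
    by (rule tendsto_minus)
  then have "((\<lambda>R. (LINT x|lebesgue. cutoff R x * Re (fld x * to_complex (axis i 1))) / R\<^sup>2) \<longlongrightarrow> - 0) at_top"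
  proof (rule Lim_transform_eventually)
    show "\<forall>\<^sub>F R in at_top. - ((LINT x|lebesgue. partial i (cutoff R) x * pot x) / R\<^sup>2) = (LINT x|lebesgue. cutoff R x * Re (fld x * to_complex (axis i 1))) / R\<^sup>2"
      using eventually_ge_at_top[of 1] by eventually_elim (simp only: pot_by_parts[OF cutoff_C1c] minus_divide_left minus_minus)
  qed
  from tendsto_unique[OF _ 1 this] show ?thesis by simp
qed

end

lemma C1c_shift:
  assumes \<phi>: "C1c R \<phi>"
  shows "C1c (R + norm c) (\<lambda>x. \<phi> (x + c))" "dbar (\<lambda>x. \<phi> (x + c)) x = dbar \<phi> (x + c)"
proof -
  have d: "((\<lambda>x. \<phi> (x + c)) has_derivative frechet_derivative \<phi> (at (x + c))) (at x)" for x
  proof -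
    have "((\<lambda>x. x + c) has_derivative (\<lambda>h. h)) (at x)" by (auto intro!: derivative_eq_intros)
    from has_derivative_compose[OF this C1cD(1)[OF \<phi>]] show ?thesis by simp
  qed
  show "C1c (R + norm c) (\<lambda>x. \<phi> (x + c))"
  proof (rule C1cI[OF d])
    fix h
    have "continuous_on UNIV (\<lambda>x. frechet_derivative \<phi> (at x) h)" using \<phi> by (auto simp: C1c_def)
    then show "continuous_on UNIV (\<lambda>x. frechet_derivative \<phi> (at (x + c)) h)"
      by (rule continuous_on_compose2) (auto intro!: continuous_intros)
  next
    fix x :: "real^2" assume "norm x > R + norm c"
    then have "norm (x + c) > R" using norm_diff_ineq[of x c] by linarith
    then show "\<phi> (x + c) = 0" by (rule C1cD(4)[OF \<phi>])
  qed
  show "dbar (\<lambda>x. \<phi> (x + c)) x = dbar \<phi> (x + c)"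
    unfolding dbar_def partial_def frechet_derivative_at[OF d, symmetric] by simp
qed

section \<open>The rotated field and the self energy of one charge per cell\<close>

lemma sing_part_measurable:
  assumes "locally_finite_set \<Lambda>"
  shows "sing_part \<Lambda> r \<in> borel_measurable lebesgue"
proof (rule borel_measurable_LIMSEQ_metric)
  show "(\<lambda>x. \<Sum>p\<in>\<Lambda> \<inter> cball 0 (real n + r). inv_sq r p x) \<in> borel_measurable lebesgue" for n
    by (intro borel_measurable_sum inv_sq_measurable)
  show "(\<lambda>n. \<Sum>p\<in>\<Lambda> \<inter> cball 0 (real n + r). inv_sq r p x) \<longlonglongrightarrow> sing_part \<Lambda> r x" for x
  proof (rule tendsto_eventually)
    obtain N where N: "norm x \<le> real N" using real_arch_simple by blast
    show "\<forall>\<^sub>F n in sequentially. (\<Sum>p\<in>\<Lambda> \<inter> cball 0 (real n + r). inv_sq r p x) = sing_part \<Lambda> r x"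
      using eventually_ge_at_top[of N]
    proof eventually_elim
      case (elim n)
      then show ?case using N by (intro sing_part_eq[OF assms, symmetric]) simp
    qed
  qed
qed

text \<open>\<open>vf (fld x) = (\<partial>\<^sub>2 pot x, - \<partial>\<^sub>1 pot x)\<close>.\<close>

definition vf :: "complex \<Rightarrow> real^2" where "vf z = (- Im z) *\<^sub>R axis 1 1 - Re z *\<^sub>R axis 2 1"

lemma vf_nth [simp]: "vf z $ 1 = - Im z" "vf z $ 2 = - Re z"
  by (simp_all add: vf_def axis_def)

lemma vf_inner: "vf z \<bullet> vf w = z \<bullet> w"
  by (simp add: inner_vec_def sum_2 inner_complex_def)

lemma bounded_linear_vf: "bounded_linear vf"
  unfolding vf_def[abs_def]
  by (intro bounded_linear_sub bounded_linear_scaleR_left[THEN bounded_linear_compose] bounded_linear_minus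
      bounded_linear_Im bounded_linear_Re)

lemma inner_diff_self: "(m - S) \<bullet> (m - S) = m \<bullet> m - 2 * (m \<bullet> S) + S \<bullet> (S :: 'a :: real_inner)"
  by (simp add: inner_diff_left inner_diff_right inner_commute)

lemma inner_sum_self:
  fixes b :: "'a \<Rightarrow> 'b :: real_inner"
  assumes "finite F"
  shows "(\<Sum>p\<in>F. b p) \<bullet> (\<Sum>p\<in>F. b p) = (\<Sum>p\<in>F. (norm (b p))\<^sup>2) + (\<Sum>p\<in>F. \<Sum>q\<in>F - {p}. b p \<bullet> b q)"
proof -
  have "(\<Sum>p\<in>F. b p) \<bullet> (\<Sum>p\<in>F. b p) = (\<Sum>p\<in>F. \<Sum>q\<in>F. b p \<bullet> b q)"
    by (subst inner_sum_left) (simp only: inner_sum_right)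
  also have "\<dots> = (\<Sum>p\<in>F. (norm (b p))\<^sup>2 + (\<Sum>q\<in>F - {p}. b p \<bullet> b q))"
    by (intro sum.cong refl) (use assms in \<open>simp add: sum.remove dot_square_norm\<close>)
  finally show ?thesis by (simp add: sum.distrib)
qed

context plane_lattice begin

lemma locally_finite_L: "locally_finite_set L"
  by (simp add: locally_finite_set_def finite_L)

lemma L_cball_shift: "w \<in> L \<Longrightarrow> L \<inter> cball (x + w) r = (+) w ` (L \<inter> cball x r)"
proof -
  assume w: "w \<in> L"
  have "q \<in> (+) w ` (L \<inter> cball x r)" if "q \<in> L" "dist (x + w) q \<le> r" for q
    using that L_diff[OF that(1) w] by (intro image_eqI[of _ _ "q - w"]) (auto simp: dist_norm algebra_simps)
  then show ?thesis using L_add w by (auto simp: dist_norm algebra_simps)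
qed

lemma torus_periodic_sing_part: "torus_periodic u v (sing_part L r)"
  by (rule torus_periodicI) (simp add: sing_part_def L_cball_shift sum.reindex)

lemma torus_periodic_near_count: "torus_periodic u v (near_count L r)"
  by (rule torus_periodicI) (simp add: near_count_def L_cball_shift card_image)

lemma finite_L_shift: "bounded K \<Longrightarrow> finite (L \<inter> {w. a + w \<in> K})"
proof (rule finite_L)
  assume "bounded K"
  moreover have "{w. a + w \<in> K} \<subseteq> (+) (- a) ` K" by (auto intro!: image_eqI[of _ _ "a + _"])
  ultimately show "bounded {w. a + w \<in> K}" using bounded_subset bounded_translation by blast
qed

end

context quasiperiodic begin

text \<open>With radius \<open>1\<close> the logarithmic term in \<open>W_eq\<close> vanishes.\<close>

definition "self_energy x = (cmod (fld x))\<^sup>2 - sing_part L 1 x"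

lemma torus_periodic_self_energy: "torus_periodic u v self_energy"
  unfolding self_energy_def[abs_def] by (rule torus_periodic_comp2[OF torus_periodic_fld torus_periodic_sing_part])

text \<open>With \<open>fld\<close> = m - sum of Cauchy kernels, the square is expanded. Squares of
  single kernels cancel against \<open>sing_part\<close> up to bounded terms, the mixed term with m
  has simple poles, and products of two different kernels do too, by the inequality of
  \<open>product_majorant\<close>.\<close>

lemma self_energy_locally_integrable: "locally_integrable self_energy"
proof (rule locally_integrable_majorant[OF _ null_L])
  have [measurable]: "sing_part L 1 \<in> borel_measurable lebesgue" by (rule sing_part_measurable[OF locally_finite_L])
  have [measurable]: "fld \<in> borel_measurable lebesgue" by (rule measurable_completion) simp
  show "self_energy \<in> borel_measurable lebesgue" unfolding self_energy_def[abs_def] by measurable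
  fix R :: real assume R: "R > 0"
  \<comment> \<open>Lattice points at distance up to 1 from the ball still enter
    \<open>sing_part\<close>, hence the radius R + 1.\<close>
  define F where "F = L \<inter> cball 0 (R + 1)"
  have finF: "finite F" unfolding F_def by (intro finite_L) auto
  obtain m m' h C where m: "\<And>x. norm x \<le> R + 1 \<Longrightarrow> x \<notin> L \<Longrightarrow> fld x = m x - (\<Sum>p\<in>F. 1 / to_complex (x - p))"
    "C > 0" "\<And>x. norm x \<le> R + 1 \<Longrightarrow> cmod (m x) \<le> C"
    using local_structure[of "R + 1"] unfolding F_def by metis
  define K where "K = (\<Sum>p\<in>F. \<Sum>q\<in>F - {p}. 1 / norm (p - q))"
  have K: "1 / norm (p - q) \<le> K" if "p \<in> F" "q \<in> F - {p}" for p q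
  proof -
    have "1 / norm (p - q) \<le> (\<Sum>q\<in>F - {p}. 1 / norm (p - q))"
      by (rule member_le_sum[OF that(2), of "\<lambda>q. 1 / norm (p - q)"]) (use finF in auto)
    also have "\<dots> \<le> K" unfolding K_def
      by (rule member_le_sum[OF that(1), of "\<lambda>p. \<Sum>q\<in>F - {p}. 1 / norm (p - q)"]) (use finF in \<open>auto intro: sum_nonneg\<close>)
    finally show ?thesis .
  qed
  show "\<exists>C D F. finite F \<and> (\<forall>x. norm x \<le> R \<longrightarrow> x \<notin> L \<longrightarrow> norm (self_energy x) \<le> C + D * (\<Sum>p\<in>F. 1 / norm (x - p)))"
  proof (rule exI[of _ "C\<^sup>2 + real (card F)"], rule exI[of _ "2 * C + real (card F) * real (card F) * (2 * K)"], rule exI[of _ F], intro conjI finF allI impI)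
    fix x assume x: "norm x \<le> R" "x \<notin> L"
    define b where "b p = 1 / to_complex (x - p)" for p
    define B where "B = (\<Sum>p\<in>F. 1 / norm (x - p))"
    have nb: "norm (b p) = 1 / norm (x - p)" for p by (simp add: b_def norm_divide)
    have bB: "norm (b p) \<le> B" if "p \<in> F" for p
      unfolding nb B_def by (rule member_le_sum[OF that, of "\<lambda>p. 1 / norm (x - p)"]) (use finF in auto)
    define S where "S = (\<Sum>p\<in>F. b p)"
    have nS: "norm S \<le> B" unfolding S_def B_def nb[symmetric] by (rule norm_sum)
    have mC: "norm (m x) \<le> C" using m(3)[of x] x by simp
    have f: "fld x = m x - S" using m(1)[of x] x by (simp add: S_def b_def)
    have "self_energy x = fld x \<bullet> fld x - (\<Sum>p\<in>F. inv_sq 1 p x)"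
      unfolding self_energy_def sing_part_eq[OF locally_finite_L x(1)] F_def by (simp add: dot_square_norm)
    also have "\<dots> = m x \<bullet> m x - 2 * (m x \<bullet> S) + (\<Sum>p\<in>F. (norm (b p))\<^sup>2 - inv_sq 1 p x) + (\<Sum>p\<in>F. \<Sum>q\<in>F - {p}. b p \<bullet> b q)"
      unfolding f inner_diff_self sum_subtractf S_def inner_sum_self[OF finF] by simp
    finally have e: "self_energy x = \<dots>" .
    have 1: "\<bar>m x \<bullet> m x\<bar> \<le> C\<^sup>2" using mC power_mono[OF mC norm_ge_zero, of 2] by (simp add: dot_square_norm)
    have 2: "\<bar>m x \<bullet> S\<bar> \<le> C * B"
      using Cauchy_Schwarz_ineq2[of "m x" S] mult_mono[OF mC nS] m(2) norm_ge_zero[of S] by linarith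
    have 3: "\<bar>\<Sum>p\<in>F. (norm (b p))\<^sup>2 - inv_sq 1 p x\<bar> \<le> card F"
    proof -
      \<comment> \<open>Within distance 1 the two terms are equal; beyond it the second is 0 and the
        first at most 1.\<close>
      have "\<bar>(norm (b p))\<^sup>2 - inv_sq 1 p x\<bar> \<le> 1" for p
      proof (cases "norm (x - p) \<le> 1")
        case True
        then show ?thesis by (simp add: nb inv_sq_def power_divide dist_norm norm_minus_commute)
      next
        case False
        then have "(1 / norm (x - p))\<^sup>2 \<le> 1" by (intro power_le_one) (auto simp: divide_le_eq)
        then show ?thesis using False by (simp add: nb inv_sq_def power_divide dist_norm norm_minus_commute)
      qed
      then have "\<bar>\<Sum>p\<in>F. (norm (b p))\<^sup>2 - inv_sq 1 p x\<bar> \<le> (\<Sum>p\<in>F. 1)"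
        by (intro order_trans[OF sum_abs] sum_mono)
      then show ?thesis by simp
    qed
    have 4: "\<bar>\<Sum>p\<in>F. \<Sum>q\<in>F - {p}. b p \<bullet> b q\<bar> \<le> real (card F) * real (card F) * (2 * K) * B"
    proof -
      have t: "\<bar>b p \<bullet> b q\<bar> \<le> 2 * K * B" if pq: "p \<in> F" "q \<in> F - {p}" for p q
      proof -
        have xp: "x \<noteq> p" "x \<noteq> q" "p \<noteq> q" using x pq by (auto simp: F_def)
        have "norm (p - q) \<le> norm (x - p) + norm (x - q)"
          using norm_triangle_ineq4[of "x - q" "x - p"] by (simp add: algebra_simps)
        then have "1 / norm (x - p) * (1 / norm (x - q)) \<le> 1 / norm (p - q) * (1 / norm (x - p) + 1 / norm (x - q))"
          using xp by (simp add: divide_simps algebra_simps)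
        also have "\<dots> \<le> K * (B + B)"
          using K[OF pq] bB[OF pq(1)] bB[of q] pq(2) unfolding nb
          by (intro mult_mono add_mono) (auto intro: order_trans[OF _ K[OF pq]])
        finally have "norm (b p) * norm (b q) \<le> 2 * K * B" by (simp add: nb)
        then show ?thesis using Cauchy_Schwarz_ineq2[of "b p" "b q"] by linarith
      qed
      have KB: "0 \<le> 2 * K * B"
        unfolding K_def B_def by (intro mult_nonneg_nonneg sum_nonneg) auto
      have "\<bar>\<Sum>p\<in>F. \<Sum>q\<in>F - {p}. b p \<bullet> b q\<bar> \<le> (\<Sum>p\<in>F. \<Sum>q\<in>F - {p}. \<bar>b p \<bullet> b q\<bar>)"
        by (intro order_trans[OF sum_abs] sum_mono sum_abs)
      also have "\<dots> \<le> (\<Sum>p\<in>F. \<Sum>q\<in>F - {p}. 2 * K * B)" by (intro sum_mono t)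
      also have "\<dots> \<le> (\<Sum>p\<in>F. \<Sum>q\<in>F. 2 * K * B)"
        using KB finF by (intro sum_mono sum_mono2) auto
      finally show ?thesis by (simp add: mult_ac)
    qed
    show "norm (self_energy x) \<le> C\<^sup>2 + real (card F) + (2 * C + real (card F) * real (card F) * (2 * K)) * (\<Sum>p\<in>F. 1 / norm (x - p))"
      unfolding B_def[symmetric] distrib_right using e 1 2 3 4 by (simp only: real_norm_def)
  qed
qed

end

section \<open>Periodic configurations of points\<close>

lemma locally_integrable_linear:
  "bounded_linear h \<Longrightarrow> locally_integrable f \<Longrightarrow> locally_integrable (\<lambda>x. h (f x))"
  unfolding locally_integrable_def using absolutely_integrable_linear[where f = f and h = h] by (auto simp: o_def)

locale torus_configuration = quasiperiodic +
  fixes n :: nat and a :: "nat \<Rightarrow> real^2"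
  assumes distinct: "distinct_on_torus u v n a"
begin

abbreviation "\<Lambda> \<equiv> periodic_points u v n a"

lemma diff_notin_L: "i \<in> {1..n} \<Longrightarrow> k \<in> {1..n} \<Longrightarrow> i \<noteq> k \<Longrightarrow> a i - a k \<notin> L"
  using distinct by (simp add: distinct_on_torus_def)

lemma points_Int: "\<Lambda> \<inter> K = (\<Union>i\<in>{1..n}. (+) (a i) ` (L \<inter> {w. a i + w \<in> K}))"
  by (auto simp: periodic_points_def; blast)

lemma finite_points: "bounded K \<Longrightarrow> finite (\<Lambda> \<inter> K)"
  unfolding points_Int by (intro finite_UN_I finite_imageI finite_L_shift) auto

lemma locally_finite_points: "locally_finite_set \<Lambda>"
  by (simp add: locally_finite_set_def finite_points)

text \<open>Distinctness on the torus makes the cosets of the \<open>a i\<close> disjoint, so no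
  point of \<open>\<Lambda>\<close> is counted twice.\<close>

lemma sum_points:
  fixes f :: "real^2 \<Rightarrow> 'b::comm_monoid_add"
  assumes "bounded K"
  shows "(\<Sum>p\<in>\<Lambda> \<inter> K. f p) = (\<Sum>i\<in>{1..n}. \<Sum>w\<in>L \<inter> {w. a i + w \<in> K}. f (a i + w))"
proof -
  have "(\<Sum>p\<in>\<Lambda> \<inter> K. f p) = (\<Sum>i\<in>{1..n}. sum f ((+) (a i) ` (L \<inter> {w. a i + w \<in> K})))"
    unfolding points_Int
  proof (rule sum.UNION_disjoint)
    show "\<forall>i\<in>{1..n}. finite ((+) (a i) ` (L \<inter> {w. a i + w \<in> K}))"
      using finite_L_shift[OF assms] by blast
    show "\<forall>i\<in>{1..n}. \<forall>k\<in>{1..n}. i \<noteq> k \<longrightarrow> (+) (a i) ` (L \<inter> {w. a i + w \<in> K}) \<inter> (+) (a k) ` (L \<inter> {w. a k + w \<in> K}) = {}"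
    proof (intro ballI impI)
      fix i k assume ik: "i \<in> {1..n}" "k \<in> {1..n}" "i \<noteq> k"
      have False if "w \<in> L" "w' \<in> L" "a i + w = a k + w'" for w w'
      proof -
        have "a i - a k = w' - w" using that(3) by (simp add: algebra_simps)
        then show False using diff_notin_L[OF ik] L_diff[OF that(2,1)] by simp
      qed
      then show "(+) (a i) ` (L \<inter> {w. a i + w \<in> K}) \<inter> (+) (a k) ` (L \<inter> {w. a k + w \<in> K}) = {}" by blast
    qed
  qed simp
  then show ?thesis by (simp add: sum.reindex)
qed

lemma shifted_cball: "L \<inter> {w. c + w \<in> cball x r} = L \<inter> cball (x - c) r"
  by (auto simp: dist_norm algebra_simps)

lemma sing_part_points: "sing_part \<Lambda> r x = (\<Sum>i\<in>{1..n}. sing_part L r (x - a i))"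
  unfolding sing_part_def sum_points[OF bounded_cball] shifted_cball by (simp add: algebra_simps)

lemma near_count_points: "near_count \<Lambda> r x = (\<Sum>i\<in>{1..n}. near_count L r (x + - a i))"
  using sum_points[OF bounded_cball, of "\<lambda>p. 1::real" x r] unfolding shifted_cball
  by (simp add: near_count_def)

lemma torus_periodic_near_count_points: "torus_periodic u v (near_count \<Lambda> r)"
  unfolding near_count_points[abs_def] by (intro torus_periodic_sum torus_periodic_shift torus_periodic_near_count)

lemma infsum_points:
  assumes \<phi>: "\<And>x. norm x > R \<Longrightarrow> \<phi> x = (0::real)"
  shows "(\<Sum>\<^sub>\<infinity>p\<in>\<Lambda>. \<phi> p) = (\<Sum>i\<in>{1..n}. \<Sum>\<^sub>\<infinity>w\<in>L. \<phi> (w + a i))"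
proof -
  have "(\<Sum>\<^sub>\<infinity>p\<in>\<Lambda>. \<phi> p) = (\<Sum>p\<in>\<Lambda> \<inter> cball 0 R. \<phi> p)"
    by (rule infsum_finite_support) (use finite_points \<phi> in \<open>auto simp: not_le\<close>)
  also have "\<dots> = (\<Sum>i\<in>{1..n}. \<Sum>w\<in>L \<inter> {w. a i + w \<in> cball 0 R}. \<phi> (a i + w))"
    by (rule sum_points) simp
  also have "\<dots> = (\<Sum>i\<in>{1..n}. \<Sum>\<^sub>\<infinity>w\<in>L. \<phi> (w + a i))"
  proof (rule sum.cong[OF refl])
    fix i
    have "(\<Sum>\<^sub>\<infinity>w\<in>L. \<phi> (w + a i)) = (\<Sum>w\<in>L \<inter> {w. a i + w \<in> cball 0 R}. \<phi> (w + a i))"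
      by (rule infsum_finite_support, rule finite_L_shift) (use \<phi> in \<open>auto simp: not_le add.commute\<close>)
    then show "(\<Sum>w\<in>L \<inter> {w. a i + w \<in> cball 0 R}. \<phi> (a i + w)) = (\<Sum>\<^sub>\<infinity>w\<in>L. \<phi> (w + a i))"
      by (simp add: add.commute)
  qed
  finally show ?thesis .
qed

lemma admissible_if_solves: "solves_curl_div \<Lambda> m j \<Longrightarrow> j \<in> admissible m"
proof -
  assume j: "solves_curl_div \<Lambda> m j"
  \<comment> \<open>For the point \<open>a i\<close> the lattice vectors lie in the ball of radius R
    + |a i| + \<open>dm\<close>, the last summand securing the hypothesis of
    \<open>card_L_ball\<close>. For R > 1 the resulting R + |a i| + 2 \<open>dm\<close> is at most R
    (1 + |a i| + 2 \<open>dm\<close>), so R^2 cancels.\<close>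
  have "2 * pi * real (card (\<Lambda> \<inter> ball 0 R)) / measure lebesgue (ball (0::real^2) R) \<le> (\<Sum>i\<in>{1..n}. (1 + (norm (a i) + 2 * dm))\<^sup>2)"
    if R: "R > 1" for R
  proof -
    have le: "card (L \<inter> {w. a i + w \<in> ball 0 R}) \<le> R\<^sup>2 * (1 + (norm (a i) + 2 * dm))\<^sup>2 / 2" for i
    proof -
      have "card (L \<inter> {w. a i + w \<in> ball 0 R}) \<le> card (L \<inter> ball 0 (R + norm (a i) + dm))"
      proof (rule card_mono)
        show "L \<inter> {w. a i + w \<in> ball 0 R} \<subseteq> L \<inter> ball 0 (R + norm (a i) + dm)"
        proof clarsimp
          fix w assume "norm (a i + w) < R"
          then show "norm w < R + norm (a i) + dm"
            using norm_triangle_ineq4[of "a i + w" "a i"] dm_pos by (simp add: add.commute)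
        qed
      qed (simp add: finite_L)
      moreover have "card (L \<inter> ball 0 (R + norm (a i) + dm)) \<le> (R + norm (a i) + dm + dm)\<^sup>2 / 2"
        by (rule card_L_ball(1)) (use R in simp)
      moreover have "(R + norm (a i) + dm + dm)\<^sup>2 \<le> (R * (1 + (norm (a i) + 2 * dm)))\<^sup>2"
      proof (rule power_mono)
        have "1 * (norm (a i) + 2 * dm) \<le> R * (norm (a i) + 2 * dm)" using R dm_pos by (intro mult_right_mono) auto
        then show "R + norm (a i) + dm + dm \<le> R * (1 + (norm (a i) + 2 * dm))" by (simp add: algebra_simps)
        show "0 \<le> R + norm (a i) + dm + dm" using R dm_pos norm_ge_zero[of "a i"] by linarith
      qed
      ultimately show ?thesis by (simp add: power_mult_distrib)
    qed
    have "2 * real (card (\<Lambda> \<inter> ball 0 R)) = (\<Sum>i\<in>{1..n}. 2 * real (card (L \<inter> {w. a i + w \<in> ball 0 R})))"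
      using sum_points[OF bounded_ball, of "\<lambda>p. 1::real" 0 R] by (simp add: sum_distrib_left)
    also have "\<dots> \<le> (\<Sum>i\<in>{1..n}. R\<^sup>2 * (1 + (norm (a i) + 2 * dm))\<^sup>2)"
      using le by (intro sum_mono) (simp add: field_simps)
    finally show ?thesis
      using R unfolding measure_ball_plane[OF less_imp_le[OF less_trans[OF zero_less_one R]]] sum_distrib_left[symmetric]
      by (simp add: divide_simps mult_ac)
  qed
  then show ?thesis
    unfolding admissible_def using j finite_points[OF compact_imp_bounded] by blast
qed

definition "ffield x = (\<Sum>i\<in>{1..n}. fld (x - a i))"

definition "jfield x = vf (ffield x)"

lemma fld_shift_locally_integrable: "locally_integrable (\<lambda>x. fld (x - c))"
  using locally_integrable_shift[OF fld_locally_integrable, of "- c"] by simp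

lemma fld_shift_periodic: "torus_periodic u v (\<lambda>x. fld (x - c))"
  using torus_periodic_shift[OF torus_periodic_fld, of "- c"] by simp

lemma ffield_locally_integrable: "locally_integrable ffield"
  unfolding ffield_def[abs_def] by (intro locally_integrable_sum fld_shift_locally_integrable) auto

lemma jfield_locally_integrable: "locally_integrable jfield"
  unfolding jfield_def[abs_def] by (rule locally_integrable_linear[OF bounded_linear_vf ffield_locally_integrable])

lemma jfield_periodic: "torus_periodic u v jfield"
  unfolding jfield_def[abs_def] ffield_def[abs_def]
  by (rule torus_periodic_comp, rule torus_periodic_sum, rule fld_shift_periodic)

lemma dbar_fld_shift:
  assumes \<phi>: "C1c R \<phi>"
  shows "integrable lebesgue (\<lambda>x. dbar \<phi> x * fld (x - c))"
    "(LINT x|lebesgue. dbar \<phi> x * fld (x - c)) = of_real (2 * pi * (\<Sum>\<^sub>\<infinity>p\<in>L. \<phi> (p + c)) - (LINT x|lebesgue. \<phi> x))"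
  using dbar_fld[OF C1c_shift(1)[OF \<phi>, of c]] integrable_shift_iff[of "\<lambda>x. dbar \<phi> x * fld (x - c)" c]
    integral_shift[of "\<lambda>x. dbar \<phi> x * fld (x - c)" c] integral_shift[of \<phi> c]
  unfolding C1c_shift(2)[OF \<phi>] by simp_all

lemma dbar_ffield:
  assumes \<phi>: "C1c R \<phi>"
  shows "integrable lebesgue (\<lambda>x. dbar \<phi> x * ffield x)"
    "(LINT x|lebesgue. dbar \<phi> x * ffield x) = of_real (point_charges \<Lambda> n \<phi>)"
proof -
  show "integrable lebesgue (\<lambda>x. dbar \<phi> x * ffield x)"
    unfolding ffield_def sum_distrib_left by (intro Bochner_Integration.integrable_sum dbar_fld_shift[OF \<phi>])
  have "(LINT x|lebesgue. dbar \<phi> x * ffield x) = (\<Sum>i\<in>{1..n}. LINT x|lebesgue. dbar \<phi> x * fld (x - a i))"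
    unfolding ffield_def sum_distrib_left by (intro Bochner_Integration.integral_sum dbar_fld_shift[OF \<phi>])
  also have "\<dots> = of_real (2 * pi * (\<Sum>i\<in>{1..n}. \<Sum>\<^sub>\<infinity>w\<in>L. \<phi> (w + a i)) - n * (LINT x|lebesgue. \<phi> x))"
    unfolding dbar_fld_shift(2)[OF \<phi>] by (simp add: sum_subtractf sum_distrib_left)
  also have "(\<Sum>i\<in>{1..n}. \<Sum>\<^sub>\<infinity>w\<in>L. \<phi> (w + a i)) = (\<Sum>\<^sub>\<infinity>p\<in>\<Lambda>. \<phi> p)"
    by (rule infsum_points[symmetric]) (rule C1cD(4)[OF \<phi>])
  also have "2 * pi * (\<Sum>\<^sub>\<infinity>p\<in>\<Lambda>. \<phi> p) - n * (LINT x|lebesgue. \<phi> x) = point_charges \<Lambda> n \<phi>"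
    by (simp only: point_charges_def)
  finally show "(LINT x|lebesgue. dbar \<phi> x * ffield x) = of_real (point_charges \<Lambda> n \<phi>)" .
qed

text \<open>Real and imaginary part of \<open>dbar_ffield\<close>: for the rotated field the curl
  pairing is the real part and the divergence pairing the imaginary part, and the right-hand side is
  real.\<close>

lemma jfield_solves: "solves_curl_div \<Lambda> n jfield"
  unfolding solves_curl_div_def
proof (intro conjI jfield_locally_integrable allI impI)
  fix \<phi> assume "test_function \<phi>"
  then obtain R where R: "C1c R \<phi>" using test_function_C1c by blast
  have "distr_curl jfield \<phi> = (LINT x|lebesgue. Re (dbar \<phi> x * ffield x))"
    unfolding distr_curl_def jfield_def Re_dbar_mult by (simp add: algebra_simps)
  then show "distr_curl jfield \<phi> = point_charges \<Lambda> n \<phi>"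
    unfolding integral_Re[OF dbar_ffield(1)[OF R]] dbar_ffield(2)[OF R] by simp
  have "distr_div jfield \<phi> = - (LINT x|lebesgue. - Im (dbar \<phi> x * ffield x))"
    unfolding distr_div_def jfield_def dbar_def by (simp add: algebra_simps)
  also have "\<dots> = Im (LINT x|lebesgue. dbar \<phi> x * ffield x)"
    unfolding Bochner_Integration.integral_minus integral_Im[OF dbar_ffield(1)[OF R]] by (rule minus_minus)
  finally show "distr_div jfield \<phi> = 0" unfolding dbar_ffield(2)[OF R] by simp
qed

lemma jfield_field: "torus_field u v n a jfield"
  using jfield_solves jfield_periodic by (simp add: torus_field_def)

lemma jfield_inner_mean: "mean (\<lambda>x. c \<bullet> jfield x) = 0"
proof -
  have li: "locally_integrable (\<lambda>x. Re (fld x * to_complex (axis i 1)))" for i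
    by (rule locally_integrable_linear[OF _ fld_locally_integrable])
       (intro bounded_linear_compose[OF bounded_linear_Re] bounded_linear_mult_left)
  have eq: "c \<bullet> vf (fld x) = c$1 * Re (fld x * to_complex (axis 2 1)) - c$2 * Re (fld x * to_complex (axis 1 1))" for x
    by (simp add: inner_vec_def sum_2)
  have li2: "locally_integrable (\<lambda>x. c$k * Re (fld x * to_complex (axis i 1)))" for i k
    by (rule locally_integrable_linear[OF bounded_linear_mult_right li])
  have "mean (\<lambda>x. c \<bullet> vf (fld x)) = 0"
    unfolding eq mean_diff[OF li2 li2] mean_cmult mean_fld by simp
  moreover have l: "locally_integrable (\<lambda>x. c \<bullet> vf (fld (x - b)))" for b
    by (intro locally_integrable_inner locally_integrable_linear[OF bounded_linear_vf] fld_shift_locally_integrable)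
  moreover have "mean (\<lambda>x. c \<bullet> vf (fld (x - b))) = mean (\<lambda>x. c \<bullet> vf (fld x))" for b
    using mean_shift[of "\<lambda>x. c \<bullet> vf (fld x)" "- b"] l[of 0] torus_periodic_comp[OF torus_periodic_fld, of "\<lambda>z. c \<bullet> vf z"] by simp
  moreover have "c \<bullet> jfield x = (\<Sum>i\<in>{1..n}. c \<bullet> vf (fld (x - a i)))" for x
    by (simp add: jfield_def ffield_def bounded_linear.linear[OF bounded_linear_vf, THEN linear_sum] inner_sum_right)
  ultimately show ?thesis by (simp add: mean_sum)
qed

lemma field_eq_plus_const:
  "torus_field u v n a j \<Longrightarrow> \<exists>c. AE x in lebesgue. j x = jfield x + c"
  using periodic_curl_div_free_diff_const[OF jfield_solves jfield_periodic] by (auto simp: torus_field_def)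

lemma mean_zero_iff:
  assumes j: "locally_integrable j" and c: "AE x in lebesgue. j x = jfield x + c"
  shows "torus_mean_zero u v j \<longleftrightarrow> c = 0"
proof -
  have "mean (\<lambda>x. b \<bullet> j x) = b \<bullet> c" for b
  proof -
    have l: "locally_integrable (\<lambda>x. b \<bullet> jfield x)" by (intro locally_integrable_inner jfield_locally_integrable)
    have "mean (\<lambda>x. b \<bullet> j x) = mean (\<lambda>x. b \<bullet> jfield x + b \<bullet> c)"
      by (rule mean_AE_cong) (use c in \<open>auto intro!: locally_integrable_inner j locally_integrable_add l locally_integrable_const elim!: eventually_mono simp: inner_add_right\<close>)
    also have "\<dots> = b \<bullet> c" by (simp add: mean_add[OF l locally_integrable_const] mean_const jfield_inner_mean)
    finally show ?thesis .
  qed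
  then show ?thesis unfolding torus_mean_zero_vec[OF j] by (metis inner_eq_zero_iff inner_zero_right)
qed

text \<open>The function \<open>g\<close> collects everything in |jfield + c|^2 beyond the inverse
  squares: self energies, mixed products and the terms with \<open>c\<close>. The term linear in
  \<open>c\<close> drops out because \<open>jfield\<close> has mean zero.\<close>

lemma W_field:
  assumes j: "locally_integrable j" and c: "AE x in lebesgue. j x = jfield x + c" and \<psi>: "cutoff_family \<psi>"
  shows "W \<psi> \<Lambda> j = ereal (1/2 * (\<Sum>i\<in>{1..n}. \<Sum>k\<in>{1..n} - {i}. green (a i - a k)) + real n * (mean self_energy / 2) + (norm c)\<^sup>2 / 2)"
proof -
  define X where "X i k x = fld (x - a i) \<bullet> fld (x - a k)" for i k x
  define g where "g x = (\<Sum>i\<in>{1..n}. self_energy (x - a i)) + (\<Sum>i\<in>{1..n}. \<Sum>k\<in>{1..n} - {i}. X i k x) + (2 * (c \<bullet> jfield x) + (norm c)\<^sup>2)" for x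
  have S: "locally_integrable (\<lambda>x. self_energy (x - b))" "torus_periodic u v (\<lambda>x. self_energy (x - b))"
      "mean (\<lambda>x. self_energy (x - b)) = mean self_energy" for b
    using locally_integrable_shift[OF self_energy_locally_integrable, of "- b"]
      torus_periodic_shift[OF torus_periodic_self_energy, of "- b"]
      mean_shift[OF self_energy_locally_integrable torus_periodic_self_energy, of "- b"] by simp_all
  have X: "locally_integrable (X i k)" "torus_periodic u v (X i k)" "mean (X i k) = green (a i - a k)"
    if ik: "i \<in> {1..n}" "k \<in> {1..n} - {i}" for i k
  proof -
    \<comment> \<open>Translation by \<open>a i\<close> moves one charge to 0 and the other to a k -
      a i, the situation of \<open>cross_mean\<close>. The value there is taken at the negative of
      the difference.\<close>
    define h where "h y = fld (y - (a k - a i)) \<bullet> fld y" for y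
    have s: "a k - a i \<notin> L" using diff_notin_L[of k i] ik by auto
    have Xh: "X i k = (\<lambda>x. h (x + - a i))" by (auto simp: X_def h_def inner_commute algebra_simps)
    note h = cross_mean[OF s, folded h_def]
    show "locally_integrable (X i k)" unfolding Xh by (rule locally_integrable_shift[OF h(1)])
    show "torus_periodic u v (X i k)" unfolding Xh by (rule torus_periodic_shift[OF h(2)])
    show "mean (X i k) = green (a i - a k)" unfolding Xh mean_shift[OF h(1,2)] h(3) by (simp add: green_def)
  qed
  have J: "locally_integrable (\<lambda>x. c \<bullet> jfield x)" "torus_periodic u v (\<lambda>x. c \<bullet> jfield x)"
    by (rule locally_integrable_inner[OF jfield_locally_integrable], rule torus_periodic_comp[OF jfield_periodic])
  have J2: "locally_integrable (\<lambda>x. 2 * (c \<bullet> jfield x))"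
    by (rule locally_integrable_linear[OF bounded_linear_mult_right J(1)])
  have l1: "locally_integrable (\<lambda>x. \<Sum>i\<in>{1..n}. self_energy (x - a i))"
    by (intro locally_integrable_sum S) auto
  have l2: "locally_integrable (\<lambda>x. \<Sum>k\<in>{1..n} - {i}. X i k x)" if "i \<in> {1..n}" for i
    by (intro locally_integrable_sum X that) auto
  have l3: "locally_integrable (\<lambda>x. \<Sum>i\<in>{1..n}. \<Sum>k\<in>{1..n} - {i}. X i k x)"
    by (intro locally_integrable_sum l2) auto
  have l4: "locally_integrable (\<lambda>x. 2 * (c \<bullet> jfield x) + (norm c)\<^sup>2)"
    by (intro locally_integrable_add J2 locally_integrable_const)
  have gl: "locally_integrable g" unfolding g_def[abs_def] by (intro locally_integrable_add l1 l3 l4)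
  have gp: "torus_periodic u v g"
    unfolding g_def[abs_def]
  proof (rule torus_periodic_comp2[where g = "(+)"], rule torus_periodic_comp2[where g = "(+)"])
    show "torus_periodic u v (\<lambda>x. \<Sum>i\<in>{1..n}. self_energy (x - a i))" by (rule torus_periodic_sum, rule S)
    show "torus_periodic u v (\<lambda>x. \<Sum>i\<in>{1..n}. \<Sum>k\<in>{1..n} - {i}. X i k x)"
      by (rule torus_periodic_sum, rule torus_periodic_sum, rule X)
    show "torus_periodic u v (\<lambda>x. 2 * (c \<bullet> jfield x) + (norm c)\<^sup>2)" by (rule torus_periodic_comp[OF J(2)])
  qed
  have mg: "mean g = real n * mean self_energy + (\<Sum>i\<in>{1..n}. \<Sum>k\<in>{1..n} - {i}. green (a i - a k)) + (norm c)\<^sup>2"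
  proof -
    have "mean g = (mean (\<lambda>x. \<Sum>i\<in>{1..n}. self_energy (x - a i)) + mean (\<lambda>x. \<Sum>i\<in>{1..n}. \<Sum>k\<in>{1..n} - {i}. X i k x))
      + mean (\<lambda>x. 2 * (c \<bullet> jfield x) + (norm c)\<^sup>2)"
      unfolding g_def[abs_def] mean_add[OF locally_integrable_add[OF l1 l3] l4] mean_add[OF l1 l3] ..
    also have "mean (\<lambda>x. \<Sum>i\<in>{1..n}. self_energy (x - a i)) = real n * mean self_energy"
      by (subst mean_sum) (auto simp: S)
    also have "mean (\<lambda>x. \<Sum>i\<in>{1..n}. \<Sum>k\<in>{1..n} - {i}. X i k x) = (\<Sum>i\<in>{1..n}. mean (\<lambda>x. \<Sum>k\<in>{1..n} - {i}. X i k x))"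
      by (rule mean_sum, simp, rule l2)
    also have "\<dots> = (\<Sum>i\<in>{1..n}. \<Sum>k\<in>{1..n} - {i}. green (a i - a k))"
    proof (rule sum.cong[OF refl])
      fix i assume i: "i \<in> {1..n}"
      have "mean (\<lambda>x. \<Sum>k\<in>{1..n} - {i}. X i k x) = (\<Sum>k\<in>{1..n} - {i}. mean (X i k))"
        by (rule mean_sum) (use X(1)[OF i] in auto)
      also have "\<dots> = (\<Sum>k\<in>{1..n} - {i}. green (a i - a k))" by (rule sum.cong[OF refl X(3)[OF i]])
      finally show "mean (\<lambda>x. \<Sum>k\<in>{1..n} - {i}. X i k x) = (\<Sum>k\<in>{1..n} - {i}. green (a i - a k))" .
    qed
    also have "mean (\<lambda>x. 2 * (c \<bullet> jfield x) + (norm c)\<^sup>2) = (norm c)\<^sup>2"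
      by (simp add: mean_add[OF J2 locally_integrable_const] mean_cmult jfield_inner_mean mean_const)
    finally show ?thesis .
  qed
  have sq: "(norm (jfield x + c))\<^sup>2 = g x + sing_part \<Lambda> 1 x" for x
  proof -
    have "(norm (jfield x + c))\<^sup>2 = ffield x \<bullet> ffield x + (2 * (c \<bullet> jfield x) + (norm c)\<^sup>2)"
      unfolding dot_square_norm[symmetric] inner_add_left inner_add_right by (simp add: jfield_def vf_inner inner_commute)
    also have "ffield x \<bullet> ffield x = (\<Sum>i\<in>{1..n}. (cmod (fld (x - a i)))\<^sup>2) + (\<Sum>i\<in>{1..n}. \<Sum>k\<in>{1..n} - {i}. X i k x)"
      unfolding ffield_def X_def by (rule inner_sum_self) simp
    finally show ?thesis
      by (simp add: g_def sing_part_points self_energy_def sum_subtractf)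
  qed
  have "W \<psi> \<Lambda> j = ereal (mean g / 2 + ln 1 / 1\<^sup>2 * mean (near_count \<Lambda> 1))"
  proof (rule W_eq[OF locally_finite_points _ gl gp torus_periodic_near_count_points _ _ \<psi>])
    show "AE x in lebesgue. (norm (j x))\<^sup>2 = g x + sing_part \<Lambda> 1 x" using c by eventually_elim (simp add: sq)
    show "j \<in> borel_measurable lebesgue" by (rule locally_integrable_measurable[OF j])
  qed simp
  then show ?thesis by (simp add: mg algebra_simps add_divide_distrib)
qed

end

theorem lemma1p3:
  fixes u v :: "real^2"
  assumes basis: "u \<noteq> v" "independent {u, v}" "span {u, v} = UNIV"
    and volume: "measure lebesgue (torus_cell u v) = 2 * pi"
  shows "(\<exists>G. torus_green u v G) \<and>
    (\<exists>c::real. \<forall>(n::nat) (a :: nat \<Rightarrow> real^2). n \<ge> 1 \<and> distinct_on_torus u v n a \<longrightarrow>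
      (\<exists>j. torus_field u v n a j \<and> torus_mean_zero u v j) \<and>
      (\<forall>j. torus_field u v n a j \<and> torus_mean_zero u v j \<longrightarrow>
        (\<forall>j'. torus_field u v n a j' \<and> torus_mean_zero u v j' \<longrightarrow> (AE x in lebesgue. j' x = j x)) \<and>
        j \<in> admissible (real n) \<and>
        (\<forall>\<psi>. cutoff_family \<psi> \<longrightarrow>
          (\<forall>G. torus_green u v G \<longrightarrow>
            W \<psi> (periodic_points u v n a) j =
              ereal (1/2 * (\<Sum>i\<in>{1..n}. \<Sum>k\<in>{1..n} - {i}. G (a i - a k)) + real n * c)) \<and>
          (\<forall>j'. torus_field u v n a j' \<longrightarrow>
            W \<psi> (periodic_points u v n a) j \<le> W \<psi> (periodic_points u v n a) j' \<and>
            (W \<psi> (periodic_points u v n a) j' = W \<psi> (periodic_points u v n a) j \<longrightarrow>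
              (AE x in lebesgue. j' x = j x))))))"
proof -
  interpret plane_lattice u v by unfold_locales (rule volume)
  obtain P where P: "P holomorphic_on UNIV" "\<And>x. P (to_complex x) = 0 \<longleftrightarrow> x \<in> lattice u v"
    "\<And>x. x \<in> lattice u v \<Longrightarrow> deriv P (to_complex x) \<noteq> 0"
    "\<And>w x. w \<in> lattice u v \<Longrightarrow> cmod (P (to_complex (x + w))) * exp (- (norm (x + w))\<^sup>2 / 4) = cmod (P (to_complex x)) * exp (- (norm x)\<^sup>2 / 4)"
    using exists_quasiperiodic_entire by metis
  interpret quasiperiodic u v P by unfold_locales (fact P)+
  show ?thesis
  \<comment> \<open>Both witnesses are fixed before the number of points and the points are
    introduced; \<open>P\<close>, and with it \<open>self_energy\<close>, is chosen from
    \<open>u\<close> and \<open>v\<close> alone.\<close>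
  proof (intro conjI exI[of _ green] torus_green_green exI[of _ "mean self_energy / 2"] allI impI)
    fix n a assume "1 \<le> n \<and> distinct_on_torus u v n a"
    then interpret torus_configuration u v P n a by unfold_locales blast
    have field: "locally_integrable j" if "torus_field u v n a j" for j
      using that by (simp add: torus_field_def solves_curl_div_def)
    have mean_zero: "AE x in lebesgue. j x = jfield x" if j: "torus_field u v n a j" "torus_mean_zero u v j" for j
    proof -
      obtain c where c: "AE x in lebesgue. j x = jfield x + c" using field_eq_plus_const[OF j(1)] by blast
      then show ?thesis using mean_zero_iff[OF field[OF j(1)] c] j(2) by simp
    qed
    have "torus_mean_zero u v jfield"
      using mean_zero_iff[OF jfield_locally_integrable, of 0] by simp
    then show "\<exists>j. torus_field u v n a j \<and> torus_mean_zero u v j" using jfield_field by blast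
    fix j assume j: "torus_field u v n a j \<and> torus_mean_zero u v j"
    then have j0: "AE x in lebesgue. j x = jfield x" by (intro mean_zero) auto
    show "AE x in lebesgue. j' x = j x" if "torus_field u v n a j' \<and> torus_mean_zero u v j'" for j'
      using mean_zero[of j'] that j0 by (auto elim: eventually_elim2)
    show "j \<in> admissible (real n)" using j by (intro admissible_if_solves) (simp add: torus_field_def)
    fix \<psi> assume \<psi>: "cutoff_family \<psi>"
    have Wj: "W \<psi> \<Lambda> j = ereal (1/2 * (\<Sum>i\<in>{1..n}. \<Sum>k\<in>{1..n} - {i}. green (a i - a k)) + real n * (mean self_energy / 2))"
      using W_field[of j 0, OF _ _ \<psi>] field j j0 by simp
    show "W \<psi> \<Lambda> j = ereal (1/2 * (\<Sum>i\<in>{1..n}. \<Sum>k\<in>{1..n} - {i}. G (a i - a k)) + real n * (mean self_energy / 2))"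
      if G: "torus_green u v G" for G
    proof -
      have "(\<Sum>k\<in>{1..n} - {i}. G (a i - a k)) = (\<Sum>k\<in>{1..n} - {i}. green (a i - a k))" if "i \<in> {1..n}" for i
        by (intro sum.cong refl torus_green_unique[OF G] diff_notin_L that) auto
      then show ?thesis unfolding Wj by simp
    qed
    fix j' assume j': "torus_field u v n a j'"
    obtain c where c: "AE x in lebesgue. j' x = jfield x + c" using field_eq_plus_const[OF j'] by blast
    note Wj' = W_field[OF field[OF j'] c \<psi>]
    show "W \<psi> \<Lambda> j \<le> W \<psi> \<Lambda> j'" unfolding Wj Wj' by simp
    assume "W \<psi> \<Lambda> j' = W \<psi> \<Lambda> j"
    \<comment> \<open>The two values differ by |c|^2/2, and both are finite.\<close>
    then have "c = 0" unfolding Wj Wj' by simp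
    then show "AE x in lebesgue. j' x = j x" using c j0 by (auto elim: eventually_elim2)
  qed
qed

end
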